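(* Assume that $A,\hat A,A_1,\hat A_1\in L^\infty(0,T;\mathbb R^{n\times n})$, $B,\hat B,B_1,\hat B_1\in L^\infty(0,T;\mathbb R^{n\times m})$, $Q,\hat Q\in L^\infty(0,T;\mathcal S^n)$, $R,\hat R\in L^\infty(0,T;\mathcal S^m)$, $G,\hat G\in\mathcal S^n$, and that for some $\delta>0$, $$Q(s)\ge0,\quad Q(s)+\hat Q(s)\ge0,\quad R(s)\ge\delta I,\quad R(s)+\hat R(s)\ge\delta I,\quad s\in[0,T];\qquad G\ge0,\quad G+\hat G\ge0.$$ Let $P(\cdot)$ and $\Pi(\cdot)$ be the solutions of the Riccati equations $$\begin{cases}P'+PA+A^TP+A_1^TPA_1+Q-(PB+A_1^TPB_1)K_0^{-1}(B^TP+B_1^TPA_1)=0,\quad s\in[0,T],\\ P(T)=G,\end{cases}$$ and $$\begin{cases}\Pi'+\Pi\big[(A+\hat A)-(B+\hat B)K_1^{-1}(B_1+\hat B_1)^TP(A_1+\hat A_1)\big]\\ \quad+\big[(A+\hat A)^T-(A_1+\hat A_1)^TP(B_1+\hat B_1)K_1^{-1}(B+\hat B)^T\big]\Pi-\Pi(B+\hat B)K_1^{-1}(B+\hat B)^T\Pi\\ \quad+(A_1+\hat A_1)^T\big[P-P(B_1+\hat B_1)K_1^{-1}(B_1+\hat B_1)^TP\big](A_1+\hat A_1)+Q+\hat Q=0,\quad s\in[0,T],\\ \Pi(T)=G+\hat G,\end{cases}$$ respectively, where $K_0=R+B_1^TPB_1$ and $K_1=R+\hat R+(B_1+\hat B_1)^TP(B_1+\hat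 B_1)$. Then, for every $x\in\mathbb R^n$, the state feedback control $$\bar u=-K_0^{-1}(B^TP+B_1^TPA_1)\big(\bar X-\mathbb E[\bar X]\big)-K_1^{-1}\big[(B+\hat B)^T\Pi+(B_1+\hat B_1)^TP(A_1+\hat A_1)\big]\mathbb E[\bar X],$$ where $\bar X=X(\cdot\,;x,\bar u)$ is the corresponding state process (i.e. the solution of the state equation closed by this feedback), is the optimal control of Problem (MF) with initial state $x$. Moreover, the optimal value of the cost is $$\inf_{u(\cdot)\in\mathcal U[0,T]}J(x;u(\cdot))=\langle\Pi(0)x,x\rangle,\qquad\forall x\in\mathbb R^n.$$
   Context: Let $T>0$ and let $(\Omega,\mathcal F,\mathbb P,\mathbb F)$ be a complete filtered probability space carrying a one-dimensional standard Brownian motion $W$, where $\mathbb F=\{\mathcal F_t\}_{t\ge0}$ is the natural filtration of $W$ augmented by all $\mathbb P$-null sets. $\mathcal S^k$ is the set of symmetric $k\times k$ real matrices, and inequalities between symmetric matrices are in the positive semidefinite order. The set of admissible controls is $\mathcal U[0,T]=L^2_{\mathbb F}(0,T;\mathbb R^m)$, the set of $\mathbb F$-adapted $\mathbb R^m$-valued processes $u$ with $\mathbb E\int_0^T|u(s)|^2ds<\infty$. $\hat{\mathcal X}[0,T]$ is the set of $\mathbb F$-adapted $\mathbb R^n$-valued processes $X$ with continuous paths and $\mathbb E[\sup_{s\in[0,T]}|X(s)|^2]<\infty$. All coefficients $A,\hat A,A_1,\hat A_1,B,\hat B,B_1,\hat B_1,Q,\hat Q,R,\hat R,G,\hat G$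 are deterministic; the time variable $s$ is suppressed in formulas. For $x\in\mathbb R^n$ and $u\in\mathcal U[0,T]$, the state process $X=X(\cdot\,;x,u)\in\hat{\mathcal X}[0,T]$ is the unique solution of $$\begin{cases} dX=\{AX+Bu+\hat A\,\mathbb E[X]+\hat B\,\mathbb E[u]\}ds+\{A_1X+B_1u+\hat A_1\mathbb E[X]+\hat B_1\mathbb E[u]\}dW(s),\quad s\in[0,T],\\ X(0)=x,\end{cases}$$ and the cost functional is $$J(x;u)=\mathbb E\Big\{\int_0^T\big[\langle QX,X\rangle+\langle\hat Q\,\mathbb E[X],\mathbb E[X]\rangle+\langle Ru,u\rangle+\langle\hat R\,\mathbb E[u],\mathbb E[u]\rangle\big]ds+\langle GX(T),X(T)\rangle+\langle\hat G\,\mathbb E[X(T)],\mathbb E[X(T)]\rangle\Big\}.$$ Problem (MF): given $x\in\mathbb R^n$, find $\bar u\in\mathcal U[0,T]$ (an optimal control) with $J(x;\bar u)=\inf_{u\in\mathcal U[0,T]}J(x;u)$. A solution of a Riccati equation is an absolutely continuous $\mathcal S^n$-valued function on $[0,T]$ satisfying the equation for almost every $s$ and the terminal condition (the matrices $K_0,K_1$ occurring in it being invertible). The prime denotes $d/ds$. *)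

theory Defs
  imports "HOL-Probability.Probability"
begin

section \<open>Brownian motion and its augmented filtration\<close>

definition brownian_motion :: "'w measure \<Rightarrow> (real \<Rightarrow> 'w \<Rightarrow> real) \<Rightarrow> bool" where
  "brownian_motion M W \<longleftrightarrow>
     (\<forall>t\<ge>0. W t \<in> borel_measurable M) \<and>
     (AE \<omega> in M. W 0 \<omega> = 0) \<and>
     (AE \<omega> in M. continuous_on {0..} (\<lambda>t. W t \<omega>)) \<and>
     (\<forall>s t. 0 \<le> s \<longrightarrow> s < t \<longrightarrow>
        distributed M lborel (\<lambda>\<omega>. W t \<omega> - W s \<omega>) (normal_density 0 (sqrt (t - s)))) \<and>
     (\<forall>(k::nat) (\<tau> :: nat \<Rightarrow> real). 0 \<le> \<tau> 0 \<longrightarrow> (\<forall>i<k. \<tau> i \<le> \<tau> (Suc i)) \<longrightarrow>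
        prob_space.indep_vars M (\<lambda>_. borel) (\<lambda>i \<omega>. W (\<tau> (Suc i)) \<omega> - W (\<tau> i) \<omega>) {..<k})"

definition aug_filtration :: "'w measure \<Rightarrow> (real \<Rightarrow> 'w \<Rightarrow> real) \<Rightarrow> real \<Rightarrow> 'w measure" where
  "aug_filtration M W t =
     sigma (space M)
       ({W s -` B \<inter> space M | s B. 0 \<le> s \<and> s \<le> t \<and> B \<in> sets borel} \<union> null_sets M)"

section \<open>Spaces of processes and the Ito integral\<close>

text \<open>
  The space \<open>L\<^sup>2\<close> of adapted processes on \<open>[0,T]\<close>. Joint measurability in time and scenario, without
  which the integral over both is meaningless, is part of the definition; time carries the
  Lebesgue (not only the Borel) sigma-algebra because the deterministic coefficients are only
  Lebesgue measurable.
\<close>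

definition L2_adapted ::
  "'w measure \<Rightarrow> (real \<Rightarrow> 'w \<Rightarrow> real) \<Rightarrow> real \<Rightarrow> (real \<Rightarrow> 'w \<Rightarrow> 'b::euclidean_space) set" where
  "L2_adapted M W T =
     {u. (\<lambda>(s, \<omega>). u s \<omega>) \<in> borel_measurable (lebesgue_on {0..T} \<Otimes>\<^sub>M M) \<and>
         (\<forall>s\<in>{0..T}. u s \<in> borel_measurable (aug_filtration M W s)) \<and>
         (\<integral>\<^sup>+\<omega>. (\<integral>\<^sup>+s. ennreal ((norm (u s \<omega>))\<^sup>2) \<partial>(lebesgue_on {0..T})) \<partial>M) < \<infinity>}"

definition cont_adapted ::
  "'w measure \<Rightarrow> (real \<Rightarrow> 'w \<Rightarrow> real) \<Rightarrow> real \<Rightarrow> (real \<Rightarrow> 'w \<Rightarrow> 'b::euclidean_space) set" where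
  "cont_adapted M W T =
     {X. (\<forall>s\<in>{0..T}. X s \<in> borel_measurable (aug_filtration M W s)) \<and>
         (\<forall>\<omega>\<in>space M. continuous_on {0..T} (\<lambda>s. X s \<omega>)) \<and>
         (\<integral>\<^sup>+\<omega>. (SUP s\<in>{0..T}. ennreal ((norm (X s \<omega>))\<^sup>2)) \<partial>M) < \<infinity>}"

text \<open>
  \<open>\<phi>\<close> is the simple process with value \<open>\<xi> i\<close> on \<open>]\<tau> i, \<tau> (i + 1)]\<close>, where \<open>\<xi> i\<close> is known at time
  \<open>\<tau> i\<close>, and \<open>S\<close> is its elementary stochastic integral over \<open>[0,t]\<close>.
\<close>

definition simple_ito_integral ::
  "'w measure \<Rightarrow> (real \<Rightarrow> 'w \<Rightarrow> real) \<Rightarrow> real \<Rightarrow>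
   (real \<Rightarrow> 'w \<Rightarrow> 'b::euclidean_space) \<Rightarrow> ('w \<Rightarrow> 'b) \<Rightarrow> bool" where
  "simple_ito_integral M W t \<phi> S \<longleftrightarrow>
     (\<exists>(k::nat) (\<tau> :: nat \<Rightarrow> real) (\<xi> :: nat \<Rightarrow> 'w \<Rightarrow> 'b).
        0 \<le> \<tau> 0 \<and> (\<forall>i<k. \<tau> i \<le> \<tau> (Suc i)) \<and> \<tau> k \<le> t \<and>
        (\<forall>i<k. \<xi> i \<in> borel_measurable (aug_filtration M W (\<tau> i)) \<and>
               integrable M (\<lambda>\<omega>. (norm (\<xi> i \<omega>))\<^sup>2)) \<and>
        \<phi> = (\<lambda>s \<omega>. \<Sum>i<k. indicator {\<tau> i<..\<tau> (Suc i)} s *\<^sub>R \<xi> i \<omega>) \<and>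
        S = (\<lambda>\<omega>. \<Sum>i<k. (W (\<tau> (Suc i)) \<omega> - W (\<tau> i) \<omega>) *\<^sub>R \<xi> i \<omega>))"

text \<open>
  The random variable \<open>Y\<close> is a version of the Ito integral of \<open>f\<close> over \<open>[0,t]\<close>: the
  \<open>L\<^sup>2\<close>-limit of elementary integrals of simple processes converging to \<open>f\<close> in \<open>L\<^sup>2\<close>.
\<close>

definition has_ito_integral ::
  "'w measure \<Rightarrow> (real \<Rightarrow> 'w \<Rightarrow> real) \<Rightarrow> real \<Rightarrow>
   (real \<Rightarrow> 'w \<Rightarrow> 'b::euclidean_space) \<Rightarrow> ('w \<Rightarrow> 'b) \<Rightarrow> bool" where
  "has_ito_integral M W t f Y \<longleftrightarrow>
     f \<in> L2_adapted M W t \<and> Y \<in> borel_measurable M \<and>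
     (\<exists>(\<phi> :: nat \<Rightarrow> real \<Rightarrow> 'w \<Rightarrow> 'b) (S :: nat \<Rightarrow> 'w \<Rightarrow> 'b).
        (\<forall>j. simple_ito_integral M W t (\<phi> j) (S j)) \<and>
        (\<lambda>j. \<integral>\<^sup>+\<omega>. (\<integral>\<^sup>+s. ennreal ((norm (\<phi> j s \<omega> - f s \<omega>))\<^sup>2) \<partial>(lebesgue_on {0..t})) \<partial>M)
          \<longlonglongrightarrow> 0 \<and>
        (\<lambda>j. \<integral>\<^sup>+\<omega>. ennreal ((norm (S j \<omega> - Y \<omega>))\<^sup>2) \<partial>M) \<longlonglongrightarrow> 0)"

section \<open>Matrix-valued functions\<close>

definition symmetric_matrices :: "(real ^ 'n ^ 'n) set" where
  "symmetric_matrices = {S. transpose S = S}"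

text \<open>The positive semidefinite order; it is only used between symmetric matrices.\<close>

definition psd_le :: "real ^ 'n ^ 'n \<Rightarrow> real ^ 'n ^ 'n \<Rightarrow> bool" (infix \<open>\<preceq>\<close> 50) where
  "S \<preceq> S' \<longleftrightarrow> (\<forall>y. 0 \<le> ((S' - S) *v y) \<bullet> y)"

definition Linf :: "real \<Rightarrow> 'b::euclidean_space set \<Rightarrow> (real \<Rightarrow> 'b) set" where
  "Linf T V =
     {f. f \<in> borel_measurable (lebesgue_on {0..T}) \<and>
         (AE s in lebesgue_on {0..T}. f s \<in> V) \<and>
         (\<exists>C. AE s in lebesgue_on {0..T}. norm (f s) \<le> C)}"

definition abs_continuous_on :: "real \<Rightarrow> real \<Rightarrow> (real \<Rightarrow> 'b::real_normed_vector) \<Rightarrow> bool" where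
  "abs_continuous_on a b f \<longleftrightarrow>
     (\<forall>\<epsilon>>0. \<exists>\<delta>>0. \<forall>(k::nat) (l :: nat \<Rightarrow> real) (r :: nat \<Rightarrow> real).
        (\<forall>i<k. a \<le> l i \<and> l i \<le> r i \<and> r i \<le> b) \<longrightarrow>
        disjoint_family_on (\<lambda>i. {l i<..<r i}) {..<k} \<longrightarrow>
        (\<Sum>i<k. r i - l i) < \<delta> \<longrightarrow>
        (\<Sum>i<k. norm (f (r i) - f (l i))) < \<epsilon>)"

section \<open>The controlled mean-field equation and the cost\<close>

text \<open>Both the drift and the diffusion of the state equation are of this form.\<close>

definition mf_coeff ::
  "'w measure \<Rightarrow> (real \<Rightarrow> real ^ 'n ^ 'n) \<Rightarrow> (real \<Rightarrow> real ^ 'n ^ 'n) \<Rightarrow>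
   (real \<Rightarrow> real ^ 'm ^ 'n) \<Rightarrow> (real \<Rightarrow> real ^ 'm ^ 'n) \<Rightarrow>
   (real \<Rightarrow> 'w \<Rightarrow> real ^ 'n) \<Rightarrow> (real \<Rightarrow> 'w \<Rightarrow> real ^ 'm) \<Rightarrow> real \<Rightarrow> 'w \<Rightarrow> real ^ 'n" where
  "mf_coeff M A Ah B Bh X u s \<omega> =
     A s *v X s \<omega> + B s *v u s \<omega> + Ah s *v integral\<^sup>L M (X s) + Bh s *v integral\<^sup>L M (u s)"

text \<open>
  The state equation in integral form; \<open>t = 0\<close> gives the initial condition. As the paths of \<open>X\<close>
  and of the drift integral are continuous, an exceptional null set for each \<open>t\<close> amounts to a
  common one for the continuous version of the stochastic integral.
\<close>

definition mf_state_solution ::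
  "'w measure \<Rightarrow> (real \<Rightarrow> 'w \<Rightarrow> real) \<Rightarrow> real \<Rightarrow>
   (real \<Rightarrow> real ^ 'n ^ 'n) \<Rightarrow> (real \<Rightarrow> real ^ 'n ^ 'n) \<Rightarrow>
   (real \<Rightarrow> real ^ 'm ^ 'n) \<Rightarrow> (real \<Rightarrow> real ^ 'm ^ 'n) \<Rightarrow>
   (real \<Rightarrow> real ^ 'n ^ 'n) \<Rightarrow> (real \<Rightarrow> real ^ 'n ^ 'n) \<Rightarrow>
   (real \<Rightarrow> real ^ 'm ^ 'n) \<Rightarrow> (real \<Rightarrow> real ^ 'm ^ 'n) \<Rightarrow>
   real ^ 'n \<Rightarrow> (real \<Rightarrow> 'w \<Rightarrow> real ^ 'm) \<Rightarrow> (real \<Rightarrow> 'w \<Rightarrow> real ^ 'n) \<Rightarrow> bool" where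
  "mf_state_solution M W T A Ah B Bh A1 A1h B1 B1h x u X \<longleftrightarrow>
     X \<in> cont_adapted M W T \<and>
     (\<forall>t\<in>{0..T}. \<exists>Y. has_ito_integral M W t (mf_coeff M A1 A1h B1 B1h X u) Y \<and>
        (AE \<omega> in M. X t \<omega> =
           x + (\<integral>s. mf_coeff M A Ah B Bh X u s \<omega> \<partial>(lebesgue_on {0..t})) + Y \<omega>))"

text \<open>The state process \<open>X(\<cdot>; x, u)\<close>; solutions are unique only up to indistinguishability.\<close>

definition mf_state ::
  "'w measure \<Rightarrow> (real \<Rightarrow> 'w \<Rightarrow> real) \<Rightarrow> real \<Rightarrow>
   (real \<Rightarrow> real ^ 'n ^ 'n) \<Rightarrow> (real \<Rightarrow> real ^ 'n ^ 'n) \<Rightarrow>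
   (real \<Rightarrow> real ^ 'm ^ 'n) \<Rightarrow> (real \<Rightarrow> real ^ 'm ^ 'n) \<Rightarrow>
   (real \<Rightarrow> real ^ 'n ^ 'n) \<Rightarrow> (real \<Rightarrow> real ^ 'n ^ 'n) \<Rightarrow>
   (real \<Rightarrow> real ^ 'm ^ 'n) \<Rightarrow> (real \<Rightarrow> real ^ 'm ^ 'n) \<Rightarrow>
   real ^ 'n \<Rightarrow> (real \<Rightarrow> 'w \<Rightarrow> real ^ 'm) \<Rightarrow> real \<Rightarrow> 'w \<Rightarrow> real ^ 'n" where
  "mf_state M W T A Ah B Bh A1 A1h B1 B1h x u =
     (SOME X. mf_state_solution M W T A Ah B Bh A1 A1h B1 B1h x u X)"

definition mf_cost ::
  "'w measure \<Rightarrow> real \<Rightarrow>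
   (real \<Rightarrow> real ^ 'n ^ 'n) \<Rightarrow> (real \<Rightarrow> real ^ 'n ^ 'n) \<Rightarrow>
   (real \<Rightarrow> real ^ 'm ^ 'm) \<Rightarrow> (real \<Rightarrow> real ^ 'm ^ 'm) \<Rightarrow>
   real ^ 'n ^ 'n \<Rightarrow> real ^ 'n ^ 'n \<Rightarrow>
   (real \<Rightarrow> 'w \<Rightarrow> real ^ 'n) \<Rightarrow> (real \<Rightarrow> 'w \<Rightarrow> real ^ 'm) \<Rightarrow> real" where
  "mf_cost M T Q Qh R Rh G Gh X u =
     (\<integral>\<omega>.
        (\<integral>s. (Q s *v X s \<omega>) \<bullet> X s \<omega>
             + (Qh s *v integral\<^sup>L M (X s)) \<bullet> integral\<^sup>L M (X s)
             + (R s *v u s \<omega>) \<bullet> u s \<omega>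
             + (Rh s *v integral\<^sup>L M (u s)) \<bullet> integral\<^sup>L M (u s) \<partial>(lebesgue_on {0..T}))
        + (G *v X T \<omega>) \<bullet> X T \<omega>
        + (Gh *v integral\<^sup>L M (X T)) \<bullet> integral\<^sup>L M (X T) \<partial>M)"

section \<open>Riccati equations and the feedback\<close>

text \<open>\<open>K\<^sub>0\<close> is \<open>riccati_K R B1 P\<close> and \<open>K\<^sub>1\<close> is \<open>riccati_K (R + Rh) (B1 + B1h) P\<close>.\<close>

definition riccati_K ::
  "(real \<Rightarrow> real ^ 'm ^ 'm) \<Rightarrow> (real \<Rightarrow> real ^ 'm ^ 'n) \<Rightarrow> (real \<Rightarrow> real ^ 'n ^ 'n) \<Rightarrow>
   real \<Rightarrow> real ^ 'm ^ 'm" where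
  "riccati_K R B1 P s = R s + transpose (B1 s) ** P s ** B1 s"

definition riccati_P ::
  "real \<Rightarrow> (real \<Rightarrow> real ^ 'n ^ 'n) \<Rightarrow> (real \<Rightarrow> real ^ 'm ^ 'n) \<Rightarrow>
   (real \<Rightarrow> real ^ 'n ^ 'n) \<Rightarrow> (real \<Rightarrow> real ^ 'm ^ 'n) \<Rightarrow>
   (real \<Rightarrow> real ^ 'n ^ 'n) \<Rightarrow> (real \<Rightarrow> real ^ 'm ^ 'm) \<Rightarrow> real ^ 'n ^ 'n \<Rightarrow>
   (real \<Rightarrow> real ^ 'n ^ 'n) \<Rightarrow> bool" where
  "riccati_P T A B A1 B1 Q R G P \<longleftrightarrow>
     abs_continuous_on 0 T P \<and>
     (\<forall>s\<in>{0..T}. P s \<in> symmetric_matrices) \<and>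
     (AE s in lebesgue_on {0..T}.
        invertible (riccati_K R B1 P s) \<and>
        (\<exists>P'. (P has_vector_derivative P') (at s within {0..T}) \<and>
           P' + P s ** A s + transpose (A s) ** P s + transpose (A1 s) ** P s ** A1 s + Q s
           - (P s ** B s + transpose (A1 s) ** P s ** B1 s) ** matrix_inv (riccati_K R B1 P s)
             ** (transpose (B s) ** P s + transpose (B1 s) ** P s ** A1 s) = 0)) \<and>
     P T = G"

text \<open>
  The second Riccati equation involves its coefficients only through the sums
  \<open>A + Ah\<close>, \<open>B + Bh\<close>, \<dots>, which are the arguments here.
\<close>

definition riccati_Pi ::
  "real \<Rightarrow> (real \<Rightarrow> real ^ 'n ^ 'n) \<Rightarrow> (real \<Rightarrow> real ^ 'm ^ 'n) \<Rightarrow>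
   (real \<Rightarrow> real ^ 'n ^ 'n) \<Rightarrow> (real \<Rightarrow> real ^ 'm ^ 'n) \<Rightarrow>
   (real \<Rightarrow> real ^ 'n ^ 'n) \<Rightarrow> (real \<Rightarrow> real ^ 'm ^ 'm) \<Rightarrow> real ^ 'n ^ 'n \<Rightarrow>
   (real \<Rightarrow> real ^ 'n ^ 'n) \<Rightarrow> (real \<Rightarrow> real ^ 'n ^ 'n) \<Rightarrow> bool" where
  "riccati_Pi T A B A1 B1 Q R G P Pii \<longleftrightarrow>
     abs_continuous_on 0 T Pii \<and>
     (\<forall>s\<in>{0..T}. Pii s \<in> symmetric_matrices) \<and>
     (AE s in lebesgue_on {0..T}.
        invertible (riccati_K R B1 P s) \<and>
        (\<exists>Pii'. (Pii has_vector_derivative Pii') (at s within {0..T}) \<and>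
           Pii' + Pii s ** (A s - B s ** matrix_inv (riccati_K R B1 P s)
                              ** transpose (B1 s) ** P s ** A1 s)
           + (transpose (A s) - transpose (A1 s) ** P s ** B1 s
                ** matrix_inv (riccati_K R B1 P s) ** transpose (B s)) ** Pii s
           - Pii s ** B s ** matrix_inv (riccati_K R B1 P s) ** transpose (B s) ** Pii s
           + transpose (A1 s) ** (P s - P s ** B1 s ** matrix_inv (riccati_K R B1 P s)
                                    ** transpose (B1 s) ** P s) ** A1 s
           + Q s = 0)) \<and>
     Pii T = G"

definition mf_feedback ::
  "'w measure \<Rightarrow>
   (real \<Rightarrow> real ^ 'n ^ 'n) \<Rightarrow> (real \<Rightarrow> real ^ 'n ^ 'n) \<Rightarrow>
   (real \<Rightarrow> real ^ 'm ^ 'n) \<Rightarrow> (real \<Rightarrow> real ^ 'm ^ 'n) \<Rightarrow>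
   (real \<Rightarrow> real ^ 'm ^ 'n) \<Rightarrow> (real \<Rightarrow> real ^ 'm ^ 'n) \<Rightarrow>
   (real \<Rightarrow> real ^ 'm ^ 'm) \<Rightarrow> (real \<Rightarrow> real ^ 'm ^ 'm) \<Rightarrow>
   (real \<Rightarrow> real ^ 'n ^ 'n) \<Rightarrow> (real \<Rightarrow> real ^ 'n ^ 'n) \<Rightarrow>
   (real \<Rightarrow> 'w \<Rightarrow> real ^ 'n) \<Rightarrow> real \<Rightarrow> 'w \<Rightarrow> real ^ 'm" where
  "mf_feedback M A1 A1h B Bh B1 B1h R Rh P Pii X s \<omega> =
     - ((matrix_inv (riccati_K R B1 P s)
           ** (transpose (B s) ** P s + transpose (B1 s) ** P s ** A1 s))
         *v (X s \<omega> - integral\<^sup>L M (X s)))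
     - (matrix_inv (riccati_K (\<lambda>s. R s + Rh s) (\<lambda>s. B1 s + B1h s) P s)
           ** (transpose (B s + Bh s) ** Pii s
               + transpose (B1 s + B1h s) ** P s ** (A1 s + A1h s)))
         *v integral\<^sup>L M (X s)"

end

theory Submission imports Defs begin

text \<open>
  The optimal cost is found by completing squares separately for the mean and for the fluctuation.
Put \<open>m = E[X]\<close>, \<open>Z = X - m\<close>, and split the control likewise into \<open>E[u]\<close> and \<open>u - E[u]\<close>. The mean
solves an ordinary differential equation driven by \<open>E[u]\<close>; the drift of \<open>Z\<close> involves only \<open>Z\<close> and
\<open>u - E[u]\<close>, and its diffusion is \<open>A1 Z + B1 (u - E[u])\<close> plus a deterministic term coming from \<open>m\<close> and
\<open>E[u]\<close>. Differentiating \<open>E\<langle>P Z, Z\<rangle>\<close> by Ito's product rule and \<open>\<langle>\<Pi> m, m\<rangle>\<close> by the ordinary one, the second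
Riccati equation absorbs the deterministic part of the diffusion, and the two equations turn the
integrands into squares. The result (\<open>cost_identity\<close>) is
\<open>J(x;u) = \<langle>\<Pi>(0)x, x\<rangle> + \<integral> (E\<langle>K0 (d - E[d]), d - E[d]\<rangle> + \<langle>K1 E[d], E[d]\<rangle>) ds\<close>, where \<open>d\<close> is the deviation of \<open>u\<close>
from the feedback evaluated along the state of \<open>u\<close>. As \<open>K0\<close> and \<open>K1\<close> are bounded below by \<open>\<delta>\<close>, the
cost exceeds \<open>\<langle>\<Pi>(0)x, x\<rangle>\<close> by at least \<open>\<delta>\<close> times the squared \<open>L\<^sup>2\<close> norm of \<open>d\<close> (\<open>cost_lower_bound\<close>). Hence the
feedback is optimal, and an optimal control has \<open>d = 0\<close>, so that its state solves the closed-loop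
equation, whose solution is unique (\<open>optimal_unique\<close>).

The lower bounds on \<open>K0\<close> and \<open>K1\<close> require \<open>P \<ge> 0\<close>, which is not part of being a solution of the Riccati
equation. It is proved by a touching argument (\<open>riccati_P_psd\<close>): run backwards from \<open>T\<close> to the last
time at which \<open>P\<close>, perturbed by a small positive multiple of the identity, is not strictly positive; just after
that time the form would have to decrease in a null direction, which is a contradiction.

The stochastic part is built on the definition of the Ito integral as an \<open>L\<^sup>2\<close> limit of elementary
integrals. The isometry comes from the independence of Brownian increments of the augmented past;
simple processes are dense because averages over the preceding time cell converge
(\<open>simple_dense\<close>); Doob's inequality yields continuous versions (\<open>ito_integral_process\<close>). Existence and
uniqueness for linear mean-field equations, for an open-loop control as well as for the closed
loop, follow by Picard iteration (\<open>mean_field_exists\<close>, \<open>mean_field_unique\<close>).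
\<close>

abbreviation at_pair :: "('a => 'b => 'c) => 'a \<times> 'b => 'c" (infixl \<open>@@\<close> 100) where
  "f @@ z \<equiv> f (fst z) (snd z)"

abbreviation LT :: "real => real measure" where
  "LT t \<equiv> lebesgue_on {0..t}"

section \<open>Square-integrable functions\<close>

lemmas bint_cong = Bochner_Integration.integral_cong
lemmas bint_add_int = Bochner_Integration.integrable_add
lemmas bint_bound = Bochner_Integration.integrable_bound
lemmas bint_sum_int = Bochner_Integration.integrable_sum
lemmas bint_sum = Bochner_Integration.integral_sum
lemmas bint_add = Bochner_Integration.integral_add
lemmas bint_diff = Bochner_Integration.integral_diff

text \<open>
  Square integrability and the mean square are kept on functions, without passing to equivalence
classes: the processes below are compared at each time, where a class modulo null sets of the
product space carries no information.
\<close>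

definition sq_int :: "'a measure => ('a => 'b::euclidean_space) => bool" where
  "sq_int N f \<longleftrightarrow> f \<in> borel_measurable N \<and> integrable N (\<lambda>x. (norm (f x))^2)"

definition msq :: "'a measure => ('a => 'b::euclidean_space) => real" where
  "msq N f = (\<integral>x. (norm (f x))^2 \<partial>N)"

lemma sq_int_measurable: "sq_int N f ==> f \<in> borel_measurable N"
  and sq_int_integrable: "sq_int N f ==> integrable N (\<lambda>x. (norm (f x))^2)"
  by (auto simp: sq_int_def)

lemma msq_nonneg: "0 <= msq N f"
  by (simp add: msq_def)

lemma two_mult_le_squares: "2 * (a * b) <= a^2 + (b::real)^2"
  using sum_squares_bound[of a b] by (simp add: mult.assoc)

lemma norm_add_sq_le: "(norm (a + b))^2 <= 2 * (norm a)^2 + 2 * (norm (b::'b::real_normed_vector))^2"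
proof -
  have "(norm (a + b))^2 <= (norm a + norm b)^2"
    by (intro power_mono norm_triangle_ineq) auto
  also have "... <= 2 * (norm a)^2 + 2 * (norm b)^2"
    using two_mult_le_squares[of "norm a" "norm b"] by (simp add: power2_sum)
  finally show ?thesis .
qed

lemma sq_int_dominated:
  assumes "f \<in> borel_measurable N" "sq_int N g" "AE x in N. norm (f x) <= C * norm (g x)"
  shows "sq_int N f"
proof -
  have "integrable N (\<lambda>x. (norm (f x))^2)"
  proof (rule bint_bound)
    show "integrable N (\<lambda>x. C^2 * (norm (g x))^2)"
      using assms(2) by (auto simp: sq_int_def)
    show "(\<lambda>x. (norm (f x))^2) \<in> borel_measurable N" using assms(1) by measurable
    show "AE x in N. norm ((norm (f x))^2) <= norm (C^2 * (norm (g x))^2)"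
      using assms(3) by eventually_elim (auto simp flip: power_mult_distrib intro!: power_mono)
  qed
  then show ?thesis using assms by (auto simp: sq_int_def)
qed

lemma sq_int_add:
  assumes "sq_int N f" "sq_int N g" shows "sq_int N (\<lambda>x. f x + g x)"
proof -
  note [measurable] = sq_int_measurable[OF assms(1)] sq_int_measurable[OF assms(2)]
  have "integrable N (\<lambda>x. (norm (f x + g x))^2)"
  proof (rule bint_bound)
    show "integrable N (\<lambda>x. 2 * (norm (f x))^2 + 2 * (norm (g x))^2)"
      using assms by (auto simp: sq_int_def)
    show "AE x in N. norm ((norm (f x + g x))^2) <= norm (2 * (norm (f x))^2 + 2 * (norm (g x))^2)"
      using norm_add_sq_le by (auto intro!: AE_I2)
  qed measurable
  then show ?thesis by (auto simp: sq_int_def)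
qed

lemma sq_int_zero [simp]: "sq_int N (\<lambda>x. 0)"
  by (auto simp: sq_int_def)

lemma sq_int_scaleR: "sq_int N f ==> sq_int N (\<lambda>x. c *\<^sub>R f x)"
  by (auto simp: sq_int_def power_mult_distrib)

lemma sq_int_minus: "sq_int N f ==> sq_int N (\<lambda>x. - f x)"
  by (auto simp: sq_int_def)

lemma sq_int_diff: "sq_int N f ==> sq_int N g ==> sq_int N (\<lambda>x. f x - g x)"
  using sq_int_add[OF _ sq_int_minus, of N f g] by simp

lemma sq_int_sum: "(\<And>i. i \<in> I ==> sq_int N (f i)) ==> sq_int N (\<lambda>x. \<Sum>i\<in>I. f i x)"
  by (induction I rule: infinite_finite_induct) (auto intro: sq_int_add)

lemma sq_int_cong_AE:
  assumes "sq_int N f" "AE x in N. f x = g x" "g \<in> borel_measurable N"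
  shows "sq_int N g"
  by (rule sq_int_dominated[OF assms(3,1), of 1]) (use assms(2) in auto)

lemma msq_cong_AE:
  assumes "AE x in N. f x = g x" "f \<in> borel_measurable N" "g \<in> borel_measurable N"
  shows "msq N f = msq N g"
  unfolding msq_def using assms by (intro integral_cong_AE) auto

lemma sq_int_inner:
  assumes "sq_int N f" "sq_int N g" shows "integrable N (\<lambda>x. f x \<bullet> g x)"
proof (rule bint_bound)
  note [measurable] = sq_int_measurable[OF assms(1)] sq_int_measurable[OF assms(2)]
  show "integrable N (\<lambda>x. (norm (f x))^2 + (norm (g x))^2)"
    using assms by (auto simp: sq_int_def)
  show "(\<lambda>x. f x \<bullet> g x) \<in> borel_measurable N" by measurable
  show "AE x in N. norm (f x \<bullet> g x) <= norm ((norm (f x))^2 + (norm (g x))^2)"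
  proof (rule AE_I2)
    fix x
    have "\<bar>f x \<bullet> g x\<bar> <= norm (f x) * norm (g x)" by (rule Cauchy_Schwarz_ineq2)
    moreover have "2 * (norm (f x) * norm (g x)) <= (norm (f x))^2 + (norm (g x))^2"
      by (rule two_mult_le_squares)
    moreover have "0 <= (norm (f x))^2 + (norm (g x))^2" "0 <= norm (f x) * norm (g x)" by auto
    ultimately show "norm (f x \<bullet> g x) <= norm ((norm (f x))^2 + (norm (g x))^2)"
      unfolding real_norm_def by linarith
  qed
qed

lemma sq_int_inner_const:
  "sq_int N f ==> sq_int N (\<lambda>x. f x \<bullet> c)"
  by (rule sq_int_dominated[of _ _ f "norm c"])
     (auto intro!: borel_measurable_inner AE_I2 simp: sq_int_def mult.commute[of "norm c"] Cauchy_Schwarz_ineq2)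

lemma (in finite_measure) sq_int_const: "sq_int M (\<lambda>x. c)"
  by (auto simp: sq_int_def)

lemma (in finite_measure) sq_int_imp_integrable:
  assumes "sq_int M f" shows "integrable M f"
proof (rule bint_bound)
  show "integrable M (\<lambda>x. 1 + (norm (f x))^2)" using assms by (auto simp: sq_int_def)
  show "AE x in M. norm (f x) <= norm (1 + (norm (f x))^2)"
  proof (rule AE_I2)
    fix x
    have "2 * (norm (f x) * 1) <= (norm (f x))^2 + 1^2" by (rule two_mult_le_squares)
    moreover have "0 <= (norm (f x))^2" "0 <= norm (f x)" by auto
    ultimately show "norm (f x) <= norm (1 + (norm (f x))^2)"
      unfolding real_norm_def power_one by linarith
  qed
qed (use assms in \<open>auto simp: sq_int_def\<close>)

lemma msq_add_le:
  assumes "sq_int N f" "sq_int N g"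
  shows "msq N (\<lambda>x. f x + g x) <= 2 * msq N f + 2 * msq N g"
proof -
  have "msq N (\<lambda>x. f x + g x) <= (\<integral>x. 2 * (norm (f x))^2 + 2 * (norm (g x))^2 \<partial>N)"
    unfolding msq_def using assms sq_int_add[OF assms]
    by (intro integral_mono norm_add_sq_le) (auto simp: sq_int_def)
  also have "... = 2 * msq N f + 2 * msq N g"
    unfolding msq_def using assms by (auto simp: sq_int_def)
  finally show ?thesis .
qed

lemma msq_scaleR: "msq N (\<lambda>x. c *\<^sub>R f x) = c^2 * msq N f"
  by (simp add: msq_def power_mult_distrib)

lemma msq_commute: "msq N (\<lambda>x. f x - g x) = msq N (\<lambda>x. g x - f x)"
  by (simp add: msq_def norm_minus_commute)

lemma msq_triangle:
  assumes "sq_int N f" "sq_int N g" "sq_int N h"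
  shows "msq N (\<lambda>x. f x - h x) <= 2 * msq N (\<lambda>x. f x - g x) + 2 * msq N (\<lambda>x. g x - h x)"
  using msq_add_le[OF sq_int_diff[OF assms(1,2)] sq_int_diff[OF assms(2,3)]] by simp

lemma msq_mono_AE:
  assumes "AE x in N. norm (f x) <= C * norm (g x)" "f \<in> borel_measurable N" "sq_int N g"
  shows "msq N f <= C^2 * msq N g"
proof -
  have "msq N f <= (\<integral>x. C^2 * (norm (g x))^2 \<partial>N)"
    unfolding msq_def
  proof (rule integral_mono_AE)
    show "integrable N (\<lambda>x. (norm (f x))^2)" using sq_int_dominated[OF assms(2,3,1)] by (rule sq_int_integrable)
    show "integrable N (\<lambda>x. C^2 * (norm (g x))^2)" using assms(3) by (simp add: sq_int_def)
    show "AE x in N. (norm (f x))^2 <= C^2 * (norm (g x))^2"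
      using assms(1) by eventually_elim (auto simp flip: power_mult_distrib intro!: power_mono)
  qed
  then show ?thesis by (simp add: msq_def)
qed

lemma msq_diff_expand:
  assumes "sq_int N f" "sq_int N g"
  shows "msq N (\<lambda>x. f x - g x) = msq N f - 2 * (\<integral>x. f x \<bullet> g x \<partial>N) + msq N g"
proof -
  have "msq N (\<lambda>x. f x - g x) = (\<integral>x. (norm (f x))^2 - 2 * (f x \<bullet> g x) + (norm (g x))^2 \<partial>N)"
    unfolding msq_def
    by (intro bint_cong refl)
       (simp add: power2_norm_eq_inner inner_diff_left inner_diff_right inner_commute)
  also have "... = msq N f - 2 * (\<integral>x. f x \<bullet> g x \<partial>N) + msq N g"
    using assms sq_int_inner[OF assms] by (simp add: sq_int_def msq_def)
  finally show ?thesis .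
qed

lemma msq_eq_0_AE: "sq_int N f ==> msq N f = 0 ==> AE x in N. f x = 0"
  unfolding msq_def sq_int_def by (subst (asm) integral_nonneg_eq_0_iff_AE) auto

lemma l2_Cauchy_Schwarz:
  assumes "sq_int N f" "sq_int N g"
  shows "\<bar>\<integral>x. f x \<bullet> g x \<partial>N\<bar> <= sqrt (msq N f) * sqrt (msq N g)"
proof -
  let ?I = "\<integral>x. f x \<bullet> g x \<partial>N"
  have *: "0 <= msq N f - 2 * (t * ?I) + t^2 * msq N g" for t
    using msq_diff_expand[OF assms(1) sq_int_scaleR[OF assms(2), of t]] msq_nonneg[of N "\<lambda>x. f x - t *\<^sub>R g x"]
    by (simp add: msq_scaleR)
  have "?I^2 <= msq N f * msq N g"
  proof (cases "msq N g = 0")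
    case True
    then have "AE x in N. f x \<bullet> g x = 0"
      using msq_eq_0_AE[OF assms(2)] by auto
    then have "?I = 0" by (rule integral_eq_zero_AE)
    with True show ?thesis by simp
  next
    case False
    then have pos: "0 < msq N g" using msq_nonneg[of N g] by simp
    have "0 <= msq N f - 2 * (?I / msq N g * ?I) + (?I / msq N g)^2 * msq N g" by (rule *)
    also have "... = msq N f - ?I^2 / msq N g"
      using pos by (simp add: field_simps power2_eq_square)
    finally show ?thesis using pos by (simp add: field_simps)
  qed
  then have "sqrt (?I^2) <= sqrt (msq N f * msq N g)" by (rule real_sqrt_le_mono)
  then show ?thesis by (simp add: real_sqrt_mult)
qed

text \<open>
  Mean-square limits commute with the inner product; this carries isometry and orthogonality from elementary integrals to their limits.
\<close>

lemma l2_tendsto_inner: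
  assumes f: "\<And>j. sq_int N (f j)" "sq_int N f'" "(\<lambda>j. msq N (\<lambda>x. f j x - f' x)) \<longlonglongrightarrow> 0"
    and g: "\<And>j. sq_int N (g j)" "sq_int N g'" "(\<lambda>j. msq N (\<lambda>x. g j x - g' x)) \<longlonglongrightarrow> 0"
  shows "(\<lambda>j. \<integral>x. f j x \<bullet> g j x \<partial>N) \<longlonglongrightarrow> (\<integral>x. f' x \<bullet> g' x \<partial>N)"
proof -
  let ?df = "\<lambda>j x. f j x - f' x" and ?dg = "\<lambda>j x. g j x - g' x"
  have df: "sq_int N (?df j)" and dg: "sq_int N (?dg j)" for j
    using f g by (auto intro: sq_int_diff)
  have sf: "(\<lambda>j. sqrt (msq N (?df j))) \<longlonglongrightarrow> 0" and sg: "(\<lambda>j. sqrt (msq N (?dg j))) \<longlonglongrightarrow> 0"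
    using tendsto_real_sqrt[OF f(3)] tendsto_real_sqrt[OF g(3)] by auto
  have eq: "(\<integral>x. f j x \<bullet> g j x \<partial>N) - (\<integral>x. f' x \<bullet> g' x \<partial>N)
      = (\<integral>x. ?df j x \<bullet> ?dg j x \<partial>N) + (\<integral>x. ?df j x \<bullet> g' x \<partial>N) + (\<integral>x. f' x \<bullet> ?dg j x \<partial>N)" for j
  proof -
    have "(\<integral>x. ?df j x \<bullet> ?dg j x \<partial>N) + (\<integral>x. ?df j x \<bullet> g' x \<partial>N) + (\<integral>x. f' x \<bullet> ?dg j x \<partial>N)
      = (\<integral>x. ?df j x \<bullet> ?dg j x + ?df j x \<bullet> g' x + f' x \<bullet> ?dg j x \<partial>N)"
      using sq_int_inner[OF df[of j] dg[of j]] sq_int_inner[OF df[of j] g(2)] sq_int_inner[OF f(2) dg[of j]]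
      by (subst bint_add bint_add_int, simp, simp)+ simp
    also have "... = (\<integral>x. f j x \<bullet> g j x - f' x \<bullet> g' x \<partial>N)"
      by (intro bint_cong refl) (simp add: inner_diff_left inner_diff_right)
    also have "... = (\<integral>x. f j x \<bullet> g j x \<partial>N) - (\<integral>x. f' x \<bullet> g' x \<partial>N)"
      using f g by (intro bint_diff sq_int_inner)
    finally show ?thesis by simp
  qed
  have "(\<lambda>j. (\<integral>x. f j x \<bullet> g j x \<partial>N) - (\<integral>x. f' x \<bullet> g' x \<partial>N)) \<longlonglongrightarrow> 0"
  proof (rule Lim_null_comparison)
    show "\<forall>\<^sub>F j in sequentially. norm ((\<integral>x. f j x \<bullet> g j x \<partial>N) - (\<integral>x. f' x \<bullet> g' x \<partial>N))
      <= sqrt (msq N (?df j)) * sqrt (msq N (?dg j)) + sqrt (msq N (?df j)) * sqrt (msq N g')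
         + sqrt (msq N f') * sqrt (msq N (?dg j))"
      unfolding eq real_norm_def
      using l2_Cauchy_Schwarz[OF df dg] l2_Cauchy_Schwarz[OF df g(2)] l2_Cauchy_Schwarz[OF f(2) dg]
      by (intro always_eventually allI order_trans[OF abs_triangle_ineq] add_mono)
    show "(\<lambda>j. sqrt (msq N (?df j)) * sqrt (msq N (?dg j)) + sqrt (msq N (?df j)) * sqrt (msq N g')
         + sqrt (msq N f') * sqrt (msq N (?dg j))) \<longlonglongrightarrow> 0"
      by (rule tendsto_eq_rhs[OF tendsto_add[OF tendsto_add[OF tendsto_mult[OF sf sg]
            tendsto_mult[OF sf tendsto_const]] tendsto_mult[OF tendsto_const sg]]]) simp
  qed
  then show ?thesis by (simp add: LIM_zero_iff)
qed

lemma nn_integral_norm_sq: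
  "sq_int N f ==> (\<integral>\<^sup>+x. ennreal ((norm (f x))^2) \<partial>N) = ennreal (msq N f)"
  unfolding msq_def by (rule nn_integral_eq_integral) (auto simp: sq_int_def)

lemma sq_int_iff_nn_integral:
  "sq_int N f \<longleftrightarrow> f \<in> borel_measurable N \<and> (\<integral>\<^sup>+x. ennreal ((norm (f x))^2) \<partial>N) < \<infinity>"
  unfolding sq_int_def by (auto simp: integrable_iff_bounded)

lemma l2_null_unique:
  assumes "sq_int N f" "sq_int N g" "\<And>j. sq_int N (h j)"
    "(\<lambda>j. msq N (\<lambda>x. h j x - f x)) \<longlonglongrightarrow> 0" "(\<lambda>j. msq N (\<lambda>x. h j x - g x)) \<longlonglongrightarrow> 0"
  shows "AE x in N. f x = g x"
proof -
  have "msq N (\<lambda>x. f x - g x) <= 2 * msq N (\<lambda>x. h j x - f x) + 2 * msq N (\<lambda>x. h j x - g x)" for j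
    using msq_triangle[OF assms(1,3,2), of j] by (simp add: msq_commute[of N f])
  then have "msq N (\<lambda>x. f x - g x) <= 0"
    by (intro LIMSEQ_le_const[of "\<lambda>j. 2 * msq N (\<lambda>x. h j x - f x) + 2 * msq N (\<lambda>x. h j x - g x)"])
       (use assms in \<open>auto intro!: tendsto_eq_intros\<close>)
  then have "msq N (\<lambda>x. f x - g x) = 0" using msq_nonneg[of N "\<lambda>x. f x - g x"] by linarith
  from msq_eq_0_AE[OF sq_int_diff[OF assms(1,2)] this] show ?thesis by simp
qed

section \<open>Absolutely continuous functions\<close>

text \<open>
  The intervals of a tagged partial division that lie in a set of small measure are, after enumeration,
an admissible family for the definition of absolute continuity.
\<close>

lemma sum_increments_small:
  fixes f :: "real => 'b::real_normed_vector" and p :: "(real \<times> real set) set"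
  assumes d: "\<And>k l r. (\<forall>i<(k::nat). a <= l i \<and> l i <= r i \<and> r i <= b) ==>
        disjoint_family_on (\<lambda>i. {l i<..<r i}) {..<k} ==>
        (\<Sum>i<k. r i - l i) < d ==> (\<Sum>i<k. norm (f (r i) - f (l i))) < \<epsilon>"
    and p: "p tagged_partial_division_of {a..b}"
    and U: "\<And>x K. (x, K) \<in> p ==> K \<subseteq> U" "U \<in> lmeasurable" "measure lebesgue U < d"
  shows "(\<Sum>(x,K)\<in>p. norm (f (Sup K) - f (Inf K))) < \<epsilon>"
proof -
  note pd = tagged_partial_division_ofD[OF p]
  have fin: "finite p" by (rule pd(1))
  obtain e :: "nat => real \<times> real set" where e: "bij_betw e {..<card p} p"
    using ex_bij_betw_nat_finite[OF fin] by (auto simp: lessThan_atLeast0)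
  define l where "l i = Inf (snd (e i))" for i
  define r where "r i = Sup (snd (e i))" for i
  have ep: "e i \<in> p" if "i < card p" for i using e that by (auto simp: bij_betw_def)
  have K: "snd (e i) = {l i..r i} \<and> a <= l i \<and> l i <= r i \<and> r i <= b" if i: "i < card p" for i
  proof -
    obtain x K where xK: "e i = (x, K)" by force
    then have xp: "(x, K) \<in> p" using ep[OF i] by simp
    obtain u v where uv: "K = cbox u v" using pd(4)[OF xp] by blast
    have "x \<in> K" "K \<subseteq> {a..b}" using pd(2,3)[OF xp] by auto
    then have "u <= v" "a <= u" "v <= b" using uv by (auto simp: subset_iff)
    then show ?thesis using xK uv by (simp add: l_def r_def)
  qed
  have disj: "disjoint_family_on (\<lambda>i. {l i<..<r i}) {..<card p}"
  proof (unfold disjoint_family_on_def, intro ballI impI)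
    fix i j assume ij: "i \<in> {..<card p}" "j \<in> {..<card p}" "i \<noteq> j"
    then have "e i \<noteq> e j" using e by (auto simp: bij_betw_def inj_on_def)
    then have "interior (snd (e i)) \<inter> interior (snd (e j)) = {}"
      using pd(5)[of "fst (e i)" "snd (e i)" "fst (e j)" "snd (e j)"] ep ij by (auto simp: prod_eq_iff)
    then show "{l i<..<r i} \<inter> {l j<..<r j} = {}"
      using K[of i] K[of j] ij by auto
  qed
  have "(\<Sum>i<card p. r i - l i) = (\<Sum>i<card p. measure lebesgue {l i<..<r i})"
    using K by (intro sum.cong refl) auto
  also have "... = measure lebesgue (\<Union>i<card p. {l i<..<r i})"
    by (rule measure_finite_Union[symmetric]) (use disj K in auto)
  also have "... <= measure lebesgue U"
  proof (rule measure_mono_fmeasurable)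
    show "(\<Union>i<card p. {l i<..<r i}) \<subseteq> U"
    proof (rule UN_least)
      fix i assume "i \<in> {..<card p}"
      then show "{l i<..<r i} \<subseteq> U"
        using K[of i] U(1)[of "fst (e i)" "snd (e i)"] ep[of i] greaterThanLessThan_subseteq_atLeastAtMost_iff
        by (metis (no_types) lessThan_iff order.refl order.trans prod.collapse)
    qed
  qed (use U in auto)
  finally have "(\<Sum>i<card p. r i - l i) < d" using U by simp
  then have "(\<Sum>i<card p. norm (f (r i) - f (l i))) < \<epsilon>"
    by (intro d disj) (use K in auto)
  also have "(\<Sum>i<card p. norm (f (r i) - f (l i))) = (\<Sum>(x,K)\<in>p. norm (f (Sup K) - f (Inf K)))"
    using sum.reindex_bij_betw[OF e, of "\<lambda>z. norm (f (Sup (snd z)) - f (Inf (snd z)))"]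
    by (simp add: l_def r_def case_prod_beta)
  finally show ?thesis .
qed

lemma norm_add_bound:
  fixes x :: "'b::real_normed_vector"
  assumes "a < e" "norm y <= a" "norm z <= b" "b <= c" "c = d" "x = y + z"
  shows "norm x <= e + d"
  using assms norm_triangle_ineq[of y z] by simp

text \<open>
  The gauge of Henstock and Kurzweil proves the fundamental theorem for an absolutely continuous
function directly. At tags outside the null set the increment is close to the derivative times the
length; the intervals tagged in the null set lie in an open set of small measure, so that their
increments are small in total by absolute continuity.
\<close>

theorem abs_continuous_has_integral:
  fixes f :: "real => 'b::banach"
  assumes ab: "a < b" and ac: "abs_continuous_on a b f" and N: "negligible N"
    and der: "\<And>x. x \<in> {a..b} - N ==> (f has_vector_derivative g x) (at x within {a..b})"
  shows "((\<lambda>x. if x \<in> N then 0 else g x) has_integral (f b - f a)) {a..b}"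
  unfolding has_integral_factor_content_real
proof (intro allI impI)
  fix e :: real assume e: "e > 0"
  define e' where "e' = e * (b - a) / 2"
  have e': "e' > 0" using e ab by (simp add: e'_def)
  from ac[unfolded abs_continuous_on_def, rule_format, OF e']
  obtain \<delta> where \<delta>: "\<delta> > 0" and H: "\<forall>(k::nat) l r. (\<forall>i<k. a <= l i \<and> l i <= r i \<and> r i <= b) \<longrightarrow>
        disjoint_family_on (\<lambda>i. {l i<..<r i}) {..<k} \<longrightarrow>
        (\<Sum>i<k. r i - l i) < \<delta> \<longrightarrow> (\<Sum>i<k. norm (f (r i) - f (l i))) < e'" by (elim exE conjE)
  note \<delta>' = H[THEN spec, THEN spec, THEN spec, THEN mp, THEN mp, THEN mp]
  have N0: "N \<in> sets lebesgue" "emeasure lebesgue N = 0"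
    using N by (auto simp: negligible_iff_null_sets null_sets_def)
  obtain U where U: "open U" "N \<subseteq> U" "U - N \<in> lmeasurable" "emeasure lebesgue (U - N) < ennreal \<delta>"
    using sets_lebesgue_outer_open[OF N0(1) \<delta>] by metis
  have UN: "U = (U - N) \<union> N" using U by auto
  have Ul: "U \<in> lmeasurable"
    by (subst UN) (rule fmeasurable.Un[OF U(3) negligible_imp_measurable[OF N]])
  have "measure lebesgue U <= measure lebesgue (U - N) + measure lebesgue N"
    by (subst UN, rule measure_Un_le) (use U(3) N0 in auto)
  also have "measure lebesgue N = 0" using N by (simp add: negligible_imp_measure0)
  also have "measure lebesgue (U - N) < \<delta>"
    using U(3,4) \<delta> by (simp add: emeasure_eq_measure2 ennreal_less_iff)
  finally have Um: "measure lebesgue U < \<delta>" by simp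
  \<comment> \<open>Half of the error budget goes to the tags outside N, the other half to the intervals tagged in N.\<close>
  have "\<forall>x. \<exists>d>0. (x \<in> {a..b} - N \<longrightarrow>
         (\<forall>y\<in>{a..b}. norm (y-x) < d \<longrightarrow> norm (f y - f x - (y-x) *\<^sub>R g x) <= e/2 * norm (y-x)))
         \<and> (x \<in> N \<longrightarrow> ball x d \<subseteq> U)"
  proof
    fix x show "\<exists>d>0. (x \<in> {a..b} - N \<longrightarrow>
         (\<forall>y\<in>{a..b}. norm (y-x) < d \<longrightarrow> norm (f y - f x - (y-x) *\<^sub>R g x) <= e/2 * norm (y-x)))
         \<and> (x \<in> N \<longrightarrow> ball x d \<subseteq> U)"
    proof (cases "x \<in> N")
      case True
      then obtain d where "d > 0" "ball x d \<subseteq> U" using U(1,2) openE[of U x] by blast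
      with True show ?thesis by blast
    next
      case False
      show ?thesis
      proof (cases "x \<in> {a..b}")
        case True
        with False have "x \<in> {a..b} - N" by blast
        from der[OF this, unfolded has_vector_derivative_def has_derivative_within_alt, THEN conjunct2, rule_format, of "e/2"] e
        obtain d where "d > 0" "\<forall>y\<in>{a..b}. norm (y-x) < d \<longrightarrow> norm (f y - f x - (y-x) *\<^sub>R g x) <= e/2 * norm (y-x)"
          by auto
        with False show ?thesis by blast
      next
        case outside: False
        with False have "x \<notin> {a..b} - N" "x \<notin> N" by blast+
        then show ?thesis by (intro exI[of _ 1]) (simp del: DiffI Diff_iff atLeastAtMost_iff)
      qed
    qed
  qed
  then obtain d where d0: "\<And>x. d x > 0" and d1: "\<And>x y. x \<in> {a..b} - N ==> y \<in> {a..b} ==> norm (y-x) < d x ==>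
      norm (f y - f x - (y-x) *\<^sub>R g x) <= e/2 * norm (y-x)" and d2: "\<And>x. x \<in> N ==> ball x (d x) \<subseteq> U"
    by metis
  show "\<exists>d. gauge d \<and> (\<forall>p. p tagged_division_of {a..b} \<and> d fine p \<longrightarrow>
      norm ((\<Sum>(x,k)\<in>p. measure lborel k *\<^sub>R (if x \<in> N then 0 else g x)) - (f b - f a)) <= e * measure lborel {a..b})"
  proof (rule exI, safe)
    show "gauge (\<lambda>x. ball x (d x))" using d0 gauge_ball_dependent by blast
  next
    fix p assume p: "p tagged_division_of {a..b}" and fine: "(\<lambda>x. ball x (d x)) fine p"
    have fin: "finite p" using p by blast
    define p1 where "p1 = p \<inter> {z. fst z \<in> N}"
    define p2 where "p2 = p - {z. fst z \<in> N}"
    have p12: "p = p1 \<union> p2" "p1 \<inter> p2 = {}" "finite p1" "finite p2"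
      using fin by (auto simp: p1_def p2_def)
    have ba: "b - a = (\<Sum>(x,K)\<in>p. Sup K - Inf K)" "f b - f a = (\<Sum>(x,K)\<in>p. f(Sup K) - f(Inf K))"
      using additive_tagged_division_1[OF less_imp_le[OF ab] p, of "\<lambda>x. x"]
        additive_tagged_division_1[OF less_imp_le[OF ab] p, of f] by simp_all
    have iv: "\<exists>u v. K = {u..v} \<and> u <= x \<and> x <= v \<and> a <= u \<and> v <= b" if "(x,K) \<in> p" for x K
    proof -
      obtain u v where uv: "K = cbox u v" using p \<open>(x,K) \<in> p\<close> by blast
      moreover have "x \<in> K" "K \<subseteq> {a..b}" using p that by blast+
      ultimately show ?thesis by (intro exI[of _ u] exI[of _ v]) (auto simp: subset_iff)
    qed
    have "(\<Sum>(x,K)\<in>p1. norm (f (Sup K) - f (Inf K))) < e'"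
    proof (rule sum_increments_small[OF \<delta>' _ _ Ul Um])
      show "p1 tagged_partial_division_of {a..b}"
        using p unfolding tagged_division_of_def p1_def by (auto intro: tagged_partial_division_subset)
      fix x K assume "(x,K) \<in> p1"
      then show "K \<subseteq> U" using fine d2[of x] by (fastforce simp: p1_def fine_def)
    qed
    moreover have "norm ((\<Sum>(x,K)\<in>p1. measure lborel K *\<^sub>R (if x \<in> N then 0 else g x) - (f(Sup K) - f(Inf K))))
        <= (\<Sum>(x,K)\<in>p1. norm (f (Sup K) - f (Inf K)))"
      by (rule order_trans[OF norm_sum], rule sum_mono) (auto simp: p1_def norm_minus_commute)
    moreover have "norm ((\<Sum>(x,K)\<in>p2. measure lborel K *\<^sub>R (if x \<in> N then 0 else g x) - (f(Sup K) - f(Inf K))))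
        <= (\<Sum>z\<in>p2. e/2 * (Sup (snd z) - Inf (snd z)))"
    proof (rule sum_norm_le, safe)
      fix x K assume xK: "(x,K) \<in> p2"
      then have "(x,K) \<in> p" "x \<notin> N" by (auto simp: p2_def)
      from iv[OF this(1)] this(2) obtain u v where uv: "K = {u..v}" "u <= x" "x <= v" "a <= u" "v <= b" "x \<notin> N"
        by blast
      have "K \<subseteq> ball x (d x)" using fine xK by (auto simp: p2_def fine_def)
      moreover have "u \<in> K" "v \<in> K" using uv by auto
      ultimately have "u \<in> ball x (d x)" "v \<in> ball x (d x)" by blast+
      then have *: "norm (f u - f x - (u - x) *\<^sub>R g x) <= e/2 * norm (u-x)" "norm (f v - f x - (v - x) *\<^sub>R g x) <= e/2 * norm (v-x)"
        using uv d1[of x u] d1[of x v] by (auto simp: dist_real_def abs_minus_commute)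
      have "norm ((v - u) *\<^sub>R g x - (f v - f u)) = norm (f u - f x - (u - x) *\<^sub>R g x - (f v - f x - (v - x) *\<^sub>R g x))"
        by (auto simp: algebra_simps)
      also have "... <= norm (f u - f x - (u - x) *\<^sub>R g x) + norm (f v - f x - (v - x) *\<^sub>R g x)"
        by (rule norm_triangle_ineq4)
      also have "... <= e/2 * norm (u-x) + e/2 * norm (v-x)" using * by (rule add_mono)
      also have "... = e/2 * (v - u)"
        using uv by (simp add: distrib_left[symmetric])
      finally show "norm (measure lborel K *\<^sub>R (if x \<in> N then 0 else g x) - (f(Sup K) - f(Inf K))) <= e/2 * (Sup (snd (x,K)) - Inf (snd (x,K)))"
        using uv by simp
    qed
    moreover have "(\<Sum>z\<in>p2. e/2 * (Sup (snd z) - Inf (snd z))) <= (\<Sum>z\<in>p. e/2 * (Sup (snd z) - Inf (snd z)))"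
    proof (rule sum_mono2[OF fin])
      show "p2 \<subseteq> p" using p12 by blast
      fix z assume "z \<in> p - p2"
      then have "(fst z, snd z) \<in> p" by simp
      from iv[OF this] show "0 <= e/2 * (Sup (snd z) - Inf (snd z))" using e by force
    qed
    moreover have "(\<Sum>z\<in>p. e/2 * (Sup (snd z) - Inf (snd z))) = e/2 * (b - a)"
      by (simp add: ba(1) sum_distrib_left case_prod_beta)
    moreover have "(\<Sum>(x,k)\<in>p. measure lborel k *\<^sub>R (if x \<in> N then 0 else g x)) - (f b - f a) =
       (\<Sum>(x,K)\<in>p1. measure lborel K *\<^sub>R (if x \<in> N then 0 else g x) - (f(Sup K) - f(Inf K)))
       + (\<Sum>(x,K)\<in>p2. measure lborel K *\<^sub>R (if x \<in> N then 0 else g x) - (f(Sup K) - f(Inf K)))"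
      unfolding ba(2)
      by (simp add: case_prod_beta sum_subtractf p12(1) sum.union_disjoint[OF p12(3,4,2)])
    ultimately have "norm ((\<Sum>(x,k)\<in>p. measure lborel k *\<^sub>R (if x \<in> N then 0 else g x)) - (f b - f a)) <= e' + e/2 * (b - a)"
      by (rule norm_add_bound)
    also have "... = e * measure lborel {a..b}" using ab by (simp add: e'_def)
    finally show "norm ((\<Sum>(x,k)\<in>p. measure lborel k *\<^sub>R (if x \<in> N then 0 else g x)) - (f b - f a)) <= e * measure lborel {a..b}" .
  qed
qed

lemma abs_continuous_on_subset:
  assumes "abs_continuous_on a b f" "a <= a'" "b' <= b"
  shows "abs_continuous_on a' b' f"
  unfolding abs_continuous_on_def
proof (intro allI impI)
  fix e :: real assume "e > 0"
  then obtain \<delta> where d: "\<delta> > 0" "\<forall>(k::nat) l r.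
        (\<forall>i<k. a <= l i \<and> l i <= r i \<and> r i <= b) \<longrightarrow>
        disjoint_family_on (\<lambda>i. {l i<..<r i}) {..<k} \<longrightarrow>
        (\<Sum>i<k. r i - l i) < \<delta> \<longrightarrow> (\<Sum>i<k. norm (f (r i) - f (l i))) < e"
    using assms(1) unfolding abs_continuous_on_def by blast
  show "\<exists>\<delta>>0. \<forall>(k::nat) l r.
        (\<forall>i<k. a' <= l i \<and> l i <= r i \<and> r i <= b') \<longrightarrow>
        disjoint_family_on (\<lambda>i. {l i<..<r i}) {..<k} \<longrightarrow>
        (\<Sum>i<k. r i - l i) < \<delta> \<longrightarrow> (\<Sum>i<k. norm (f (r i) - f (l i))) < e"
    using d assms(2,3) by (intro exI[of _ \<delta>]) (meson order_trans)
qed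

lemma abs_continuous_on_imp_continuous_on:
  assumes "abs_continuous_on a b f" shows "continuous_on {a..b} f"
proof (rule continuous_onI)
  fix x e assume x: "x \<in> {a..b}" and e: "(e::real) > 0"
  from assms[unfolded abs_continuous_on_def, rule_format, OF e]
  obtain \<delta> where d: "\<delta> > 0" "\<forall>(k::nat) l r. (\<forall>i<k. a <= l i \<and> l i <= r i \<and> r i <= b) \<longrightarrow>
        disjoint_family_on (\<lambda>i. {l i<..<r i}) {..<k} \<longrightarrow>
        (\<Sum>i<k. r i - l i) < \<delta> \<longrightarrow> (\<Sum>i<k. norm (f (r i) - f (l i))) < e" by (elim exE conjE)
  have *: "norm (f v - f u) < e" if "a <= u" "u <= v" "v <= b" "v - u < \<delta>" for u v
    using d(2)[THEN spec[of _ "Suc 0"], THEN spec[of _ "\<lambda>_. u"], THEN spec[of _ "\<lambda>_. v"]] that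
    by (auto simp: disjoint_family_on_def)
  show "\<exists>d>0. \<forall>x'\<in>{a..b}. dist x' x < d \<longrightarrow> dist (f x') (f x) <= e"
  proof (intro exI[of _ \<delta>] conjI ballI impI d)
    fix x' assume x': "x' \<in> {a..b}" "dist x' x < \<delta>"
    show "dist (f x') (f x) <= e"
      using *[of x x'] *[of x' x] x x' by (cases "x <= x'") (auto simp: dist_norm norm_minus_commute)
  qed
qed

section \<open>Time integrals\<close>

lemma finite_measure_lebesgue_interval: "finite_measure (lebesgue_on {a..b::real})"
  by (rule finite_measure_lebesgue_on) (metis cbox_interval lmeasurable_cbox)

interpretation L: finite_measure "LT t" for t by (rule finite_measure_lebesgue_interval)

lemma restrict_lebesgue_on:
  "t <= T ==> LT t = restrict_space (LT T) {0..t::real}"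
  by (subst restrict_restrict_space) (auto intro!: arg_cong[where f="restrict_space lebesgue"])

lemma integral_time_restrict:
  fixes f :: "real => 'b::euclidean_space"
  assumes "t <= T"
  shows "(\<integral>s. f s \<partial>(LT t)) = (\<integral>s. indicator {0..t} s *\<^sub>R f s \<partial>(LT T))"
  unfolding restrict_lebesgue_on[OF assms]
  by (rule integral_restrict_space) (use assms in \<open>auto simp: sets_restrict_space space_restrict_space\<close>)

lemma integrable_time_restrict:
  fixes f :: "real => 'b::euclidean_space"
  assumes "t <= T"
  shows "integrable (LT t) f \<longleftrightarrow> integrable (LT T) (\<lambda>s. indicator {0..t} s *\<^sub>R f s)"
  unfolding restrict_lebesgue_on[OF assms]
  by (rule integrable_restrict_space) (use assms in \<open>auto simp: sets_restrict_space space_restrict_space\<close>)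

lemma integrable_time_subset:
  fixes f :: "real => 'b::euclidean_space"
  assumes "t <= T" "integrable (LT T) f"
  shows "integrable (LT t) f"
  unfolding integrable_time_restrict[OF assms(1)] using assms
  by (intro integrable_mult_indicator) (auto simp: sets_restrict_space)

lemma AE_time_subset:
  assumes "t <= T" "AE s in lebesgue_on {0..T::real}. Q s" shows "AE s in LT t. Q s"
  using assms by (subst (asm) AE_restrict_space_iff, simp, subst AE_restrict_space_iff) (auto elim: eventually_mono)

lemma AE_lebesgue_on_neq: "AE s in lebesgue_on {a..b::real}. s \<noteq> c"
  by (subst AE_restrict_space_iff) (auto intro!: AE_I'[of "{c}"] simp: negligible_iff_null_sets[symmetric])

lemma measurable_id_lebesgue_on [measurable]: "(\<lambda>s. s) \<in> borel_measurable (lebesgue_on S)" for S :: "real set"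
  by (rule measurable_restrict_space1) (simp add: measurable_completion)

text \<open>
  Integration by parts for two indefinite integrals, by Fubini on the square: the products with the
inner integrals are the integrals over its two triangles.
\<close>

lemma time_product_rule:
  fixes p q :: "real => real" and p0 q0 T
  assumes p: "integrable (LT T) p" and q: "integrable (LT T) q" and T: "0 <= T"
  defines "P \<equiv> \<lambda>t. p0 + (\<integral>s. p s \<partial>(LT t))"
    and "Q \<equiv> \<lambda>t. q0 + (\<integral>s. q s \<partial>(LT t))"
  shows "integrable (LT T) (\<lambda>s. p s * Q s)" (is ?i1)
    and "integrable (LT T) (\<lambda>s. P s * q s)" (is ?i2)
    and "P T * Q T = p0 * q0 + (\<integral>s. p s * Q s + P s * q s \<partial>(LT T))" (is ?eq)
proof -
  let ?L = "LT T"
  interpret LL: pair_sigma_finite ?L ?L ..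
  note [measurable] = borel_measurable_integrable[OF p] borel_measurable_integrable[OF q]
  define H where "H s r = p s * q r" for s r
  define A1 where "A1 s r = (if s <= r then p s * q r else 0)" for s r
  define A2 where "A2 s r = (if r < s then p s * q r else 0)" for s r
  have iH: "integrable (?L \<Otimes>\<^sub>M ?L) (case_prod H)"
  proof (rule LL.Fubini_integrable)
    show "integrable ?L (\<lambda>x. \<integral>y. norm (case (x, y) of (x, xa) => H x xa) \<partial>?L)"
      using p by (auto simp: H_def abs_mult intro!: integrable_mult_left)
    show "AE x in ?L. integrable ?L (\<lambda>y. case (x, y) of (x, xa) => H x xa)"
      using q by (auto simp: H_def)
  qed (simp add: H_def[abs_def] case_prod_beta)
  have iA1: "integrable (?L \<Otimes>\<^sub>M ?L) (case_prod A1)"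
    by (rule bint_bound[OF iH]) (auto simp: H_def A1_def[abs_def] case_prod_beta)
  have iA2: "integrable (?L \<Otimes>\<^sub>M ?L) (case_prod A2)"
    by (rule bint_bound[OF iH]) (auto simp: H_def A2_def[abs_def] case_prod_beta)
  have eP: "(\<integral>s. A1 s r \<partial>?L) = (P r - p0) * q r" if "r \<in> {0..T}" for r
  proof -
    have "(\<integral>s. A1 s r \<partial>?L) = (\<integral>s. (indicator {0..r} s *\<^sub>R p s) * q r \<partial>?L)"
      by (rule bint_cong) (auto simp: A1_def indicator_def)
    also have "... = (P r - p0) * q r"
      using that by (simp add: P_def integral_time_restrict[of r T])
    finally show ?thesis .
  qed
  have eQ: "(\<integral>r. A2 s r \<partial>?L) = p s * (Q s - q0)" if "s \<in> {0..T}" for s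
  proof -
    have "(\<integral>r. A2 s r \<partial>?L) = (\<integral>r. p s * (indicator {0..s} r *\<^sub>R q r) \<partial>?L)"
    proof (rule integral_cong_AE)
      show "AE r in ?L. A2 s r = p s * (indicator {0..s} r *\<^sub>R q r)"
        using AE_lebesgue_on_neq[of s 0 T] AE_space[of ?L] by eventually_elim (auto simp: A2_def indicator_def)
    qed (auto simp: A2_def)
    also have "... = p s * (Q s - q0)"
      using that by (simp add: Q_def integral_time_restrict[of s T])
    finally show ?thesis .
  qed
  have "integrable ?L (\<lambda>s. \<integral>r. A2 s r \<partial>?L)" by (rule LL.integrable_fst[OF iA2])
  then have j2: "integrable ?L (\<lambda>s. p s * (Q s - q0))"
    by (subst (asm) Bochner_Integration.integrable_cong[OF refl, where g="\<lambda>s. p s * (Q s - q0)"]) (auto simp: eQ)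
  have "integrable ?L (\<lambda>r. \<integral>s. A1 s r \<partial>?L)" by (rule LL.integrable_snd[OF iA1])
  then have j1: "integrable ?L (\<lambda>s. (P s - p0) * q s)"
    by (subst (asm) Bochner_Integration.integrable_cong[OF refl, where g="\<lambda>s. (P s - p0) * q s"]) (auto simp: eP)
  have "integrable ?L (\<lambda>s. p s * (Q s - q0) + p s * q0)" using j2 p by auto
  then show i1: ?i1 by (simp add: algebra_simps)
  have "integrable ?L (\<lambda>s. (P s - p0) * q s + p0 * q s)" using j1 q by auto
  then show i2: ?i2 by (simp add: algebra_simps)
  have "(P T - p0) * (Q T - q0) = (\<integral>s. \<integral>r. H s r \<partial>?L \<partial>?L)"
    by (simp add: H_def P_def Q_def)
  also have "... = (\<integral>z. case_prod H z \<partial>(?L \<Otimes>\<^sub>M ?L))"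
    using LL.integral_fst'[OF iH] by simp
  also have "... = (\<integral>z. case_prod A1 z + case_prod A2 z \<partial>(?L \<Otimes>\<^sub>M ?L))"
    by (rule bint_cong) (auto simp: H_def A1_def A2_def)
  also have "... = (\<integral>z. case_prod A1 z \<partial>(?L \<Otimes>\<^sub>M ?L)) + (\<integral>z. case_prod A2 z \<partial>(?L \<Otimes>\<^sub>M ?L))"
    by (rule bint_add[OF iA1 iA2])
  also have "(\<integral>z. case_prod A2 z \<partial>(?L \<Otimes>\<^sub>M ?L)) = (\<integral>s. \<integral>r. A2 s r \<partial>?L \<partial>?L)"
    using LL.integral_fst'[OF iA2] by simp
  also have "... = (\<integral>s. p s * (Q s - q0) \<partial>?L)"
    by (rule bint_cong) (auto simp: eQ)
  also have "(\<integral>z. case_prod A1 z \<partial>(?L \<Otimes>\<^sub>M ?L)) = (\<integral>s. \<integral>r. A1 s r \<partial>?L \<partial>?L)"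
    using LL.integral_fst'[OF iA1] by simp
  also have "... = (\<integral>r. \<integral>s. A1 s r \<partial>?L \<partial>?L)"
    by (rule LL.Fubini_integral[OF iA1, symmetric])
  also have "... = (\<integral>s. (P s - p0) * q s \<partial>?L)"
    by (rule bint_cong) (auto simp: eP)
  finally have "(P T - p0) * (Q T - q0) = (\<integral>s. (P s - p0) * q s \<partial>?L) + (\<integral>s. p s * (Q s - q0) \<partial>?L)" .
  also have "(\<integral>s. (P s - p0) * q s \<partial>?L) = (\<integral>s. P s * q s \<partial>?L) - p0 * (Q T - q0)"
  proof -
    have "(\<integral>s. (P s - p0) * q s \<partial>?L) = (\<integral>s. P s * q s - p0 * q s \<partial>?L)"
      by (simp only: left_diff_distrib)
    also have "... = (\<integral>s. P s * q s \<partial>?L) - (\<integral>s. p0 * q s \<partial>?L)"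
      by (rule bint_diff[OF i2]) (use q in auto)
    finally show ?thesis by (simp add: Q_def)
  qed
  also have "(\<integral>s. p s * (Q s - q0) \<partial>?L) = (\<integral>s. p s * Q s \<partial>?L) - (P T - p0) * q0"
  proof -
    have "(\<integral>s. p s * (Q s - q0) \<partial>?L) = (\<integral>s. p s * Q s - p s * q0 \<partial>?L)"
      by (simp only: right_diff_distrib)
    also have "... = (\<integral>s. p s * Q s \<partial>?L) - (\<integral>s. p s * q0 \<partial>?L)"
      by (rule bint_diff[OF i1]) (use p in auto)
    finally show ?thesis by (simp add: P_def)
  qed
  finally show ?eq using i1 i2 by (simp add: algebra_simps)
qed

section \<open>A weighted Gronwall iteration\<close>

lemma exp_integral:
  fixes c t :: real assumes "c > 0" "0 <= t"
  shows "(\<integral>s. exp (c * s) \<partial>(LT t)) <= exp (c * t) / c"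
proof -
  have "((\<lambda>s. exp (c * s)) has_integral (exp (c * t) / c - exp (c * 0) / c)) {0..t}"
    by (rule fundamental_theorem_of_calculus)
       (use assms in \<open>auto intro!: derivative_eq_intros simp flip: has_real_derivative_iff_has_vector_derivative\<close>)
  moreover have "continuous_on {0..t} (\<lambda>s. exp (c * s))" by (intro continuous_intros)
  then have "integrable (LT t) (\<lambda>s. exp (c * s))"
    by (metis continuous_imp_integrable_real)
  then have "(\<integral>s. exp (c * s) \<partial>(LT t)) = integral {0..t} (\<lambda>s. exp (c * s))"
    by (rule lebesgue_integral_eq_integral) auto
  ultimately have "(\<integral>s. exp (c * s) \<partial>(LT t)) = exp (c * t) / c - 1 / c"
    by (simp add: integral_unique)
  then show ?thesis using assms by simp
qed

text \<open>
  The weight \<open>exp (\<theta> C t)\<close> gains a factor \<open>1 / \<theta>\<close> at each integration, so that a geometric rate of any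
ratio is available. Picard's iteration uses \<open>\<theta> = 8\<close> to match \<open>cont_adapted_limit\<close> below.
\<close>

lemma gronwall_iterate:
  fixes e :: "nat => real => real"
  assumes C: "C > 0" and \<theta>: "\<theta> > 0"
    and e0: "\<And>t. t \<in> {0..T} ==> e 0 t <= K"
    and int: "\<And>k. integrable (LT T) (e k)"
    and step: "\<And>k t. t \<in> {0..T} ==> e (Suc k) t <= C * (\<integral>s. e k s \<partial>(LT t))"
    and K: "K \<ge> 0" and t: "t \<in> {0..T}"
  shows "e k t <= K * exp (\<theta> * C * t) / \<theta> ^ k"
  using t
proof (induction k arbitrary: t)
  case 0
  have "1 <= exp (\<theta> * C * t)" using C \<theta> 0 by simp
  then have "K * 1 <= K * exp (\<theta> * C * t)" using K by (rule mult_left_mono)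
  then show ?case using e0[OF 0] by simp
next
  case (Suc k)
  have "continuous_on {0..t} (\<lambda>s. K * exp (\<theta> * C * s) / \<theta> ^ k)"
    using \<theta> by (intro continuous_intros) auto
  then have i: "integrable (LT t) (\<lambda>s. K * exp (\<theta> * C * s) / \<theta> ^ k)"
    by (metis continuous_imp_integrable_real)
  have "e (Suc k) t <= C * (\<integral>s. e k s \<partial>(LT t))" by (rule step[OF Suc.prems])
  also have "... <= C * (\<integral>s. K * exp (\<theta> * C * s) / \<theta> ^ k \<partial>(LT t))"
    by (intro mult_left_mono integral_mono i integrable_time_subset[OF _ int])
       (use Suc C in auto)
  also have "... = C * K / \<theta> ^ k * (\<integral>s. exp (\<theta> * C * s) \<partial>(LT t))"
    by (simp add: mult.commute mult.left_commute)
  also have "... <= C * K / \<theta> ^ k * (exp (\<theta> * C * t) / (\<theta> * C))"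
    using C K \<theta> Suc.prems by (intro mult_left_mono exp_integral) auto
  also have "... = K * exp (\<theta> * C * t) / \<theta> ^ Suc k" using C \<theta> by simp
  finally show ?case .
qed

lemma gronwall_zero:
  fixes g :: "real => real"
  assumes C: "C > 0" and int: "integrable (LT T) g"
    and bound: "\<And>t. t \<in> {0..T} ==> g t <= K" "K \<ge> 0"
    and step: "\<And>t. t \<in> {0..T} ==> g t <= C * (\<integral>s. g s \<partial>(LT t))"
    and t: "t \<in> {0..T}"
  shows "g t <= 0"
proof -
  have "g t <= K * exp (2 * C * t) * (1 / 2) ^ k" for k
    using gronwall_iterate[of C 2 T "\<lambda>_. g" K t k] assms by (simp add: power_divide)
  moreover have "(\<lambda>k. K * exp (2 * C * t) * (1 / 2) ^ k) \<longlonglongrightarrow> K * exp (2 * C * t) * 0"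
    by (intro tendsto_mult_left LIMSEQ_power_zero) auto
  ultimately show ?thesis by (intro LIMSEQ_le_const[where X="\<lambda>k. K * exp (2 * C * t) * (1 / 2) ^ k"]) auto
qed

section \<open>A pathwise form of Doob's inequality\<close>

primrec runmax :: "(nat => real) => nat => real" where
  "runmax s 0 = s 0"
| "runmax s (Suc n) = max (runmax s n) (s (Suc n))"

lemma runmax_ge: "k <= n ==> s k <= runmax s n"
  by (induction n) (auto simp: le_Suc_eq max_def)

lemma runmax_attained: "\<exists>k\<le>n. runmax s n = s k"
  by (induction n) (auto simp: max_def intro: le_SucI)

text \<open>
  Summation by parts for the running maximum. Integrated against a nonnegative submartingale, the sum has
nonnegative expectation, and Doob's \<open>L\<^sup>2\<close> maximal inequality follows without level sets.
\<close>

lemma pathwise_doob_sum: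
  "(\<Sum>k<n. runmax s k * (s (Suc k) - s k)) <= runmax s n * s n - (runmax s n)^2 / 2 - (s 0)^2 / 2"
proof (induction n)
  case (Suc n)
  let ?a = "runmax s n"
  have "?a * s (Suc n) - ?a^2 / 2 <= max ?a (s (Suc n)) * s (Suc n) - (max ?a (s (Suc n)))^2 / 2"
    using two_mult_le_squares[of ?a "s (Suc n)"] by (auto simp: max_def power2_eq_square field_simps)
  with Suc show ?case by (simp add: algebra_simps)
qed (simp add: power2_eq_square)

lemma pathwise_doob:
  "(runmax s n)^2 <= 4 * (s n)^2 - 4 * (\<Sum>k<n. runmax s k * (s (Suc k) - s k))"
proof -
  have "2 * (runmax s n / 2 * s n) <= (runmax s n / 2)^2 + (s n)^2" by (rule two_mult_le_squares)
  then have "runmax s n * s n <= (runmax s n)^2 / 4 + (s n)^2" by (simp add: power_divide)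
  moreover have "0 <= (s 0)^2" by simp
  ultimately show ?thesis using pathwise_doob_sum[of s n] by linarith
qed

section \<open>The augmented Brownian filtration\<close>

lemma sigma_sets_subsetI: "A \<subseteq> sigma_sets \<Omega> B ==> sigma_sets \<Omega> A \<subseteq> sigma_sets \<Omega> B"
  using sigma_sets_mono by blast

locale brownian = prob_space M for M :: "'w measure" +
  fixes W :: "real => 'w => real"
  assumes complete: "complete_measure M" and bm: "brownian_motion M W"
begin

text \<open>
  The binder \<open>\<E> w.\<close> is the expectation on the fixed space, \<open>L2p T\<close> and \<open>Cp T\<close> are the \<open>L\<^sup>2\<close> adapted and the continuous adapted processes on \<open>[0,T]\<close>.
\<close>

abbreviation Mean :: "('w => 'b::{banach,second_countable_topology}) => 'b" (binder \<open>\<E>\<close> 10) where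
  "Mean f \<equiv> integral\<^sup>L M f"

abbreviation L2p :: "real => (real => 'w => 'b::euclidean_space) set" where "L2p \<equiv> L2_adapted M W"

abbreviation Cp :: "real => (real => 'w => 'b::euclidean_space) set" where "Cp \<equiv> cont_adapted M W"

abbreviation F :: "real => 'w measure" where "F t \<equiv> aug_filtration M W t"

definition F_gen :: "real => 'w set set" where
  "F_gen t = {W s -` B \<inter> space M | s B. 0 <= s \<and> s <= t \<and> B \<in> sets borel} \<union> null_sets M"

lemma W_measurable: "0 <= t ==> W t \<in> borel_measurable M"
  and W_zero: "AE w in M. W 0 w = 0"
  and W_continuous: "AE w in M. continuous_on {0..} (\<lambda>t. W t w)"
  and W_normal: "0 <= s ==> s < t ==>
        distributed M lborel (\<lambda>w. W t w - W s w) (normal_density 0 (sqrt (t - s)))"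
  and W_indep_vars: "0 <= \<tau> 0 ==> (\<forall>i<k. \<tau> i <= \<tau> (Suc i)) ==>
        indep_vars (\<lambda>_. borel) (\<lambda>i w. W (\<tau> (Suc i)) w - W (\<tau> i) w) {..<k::nat}"
  using bm by (auto simp: brownian_motion_def)

lemma F_gen_subset: "F_gen t \<subseteq> sets M"
  using W_measurable by (auto simp: F_gen_def intro: measurable_sets)

lemma space_F [simp]: "space (F t) = space M"
  by (simp add: aug_filtration_def space_measure_of_conv)

lemma sets_F: "sets (F t) = sigma_sets (space M) (F_gen t)"
  unfolding aug_filtration_def F_gen_def[symmetric]
  by (rule sets_measure_of) (use F_gen_subset sets.sets_into_space in blast)

lemma F_subalgebra: "subalgebra M (F t)"
  unfolding subalgebra_def sets_F using sets.sigma_sets_subset[OF F_gen_subset] by auto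

lemma F_sets_mono: "s <= t ==> sets (F s) \<subseteq> sets (F t)"
  unfolding sets_F by (rule sigma_sets_mono') (unfold F_gen_def, blast intro: order_trans)

lemma F_measurable_M: "f \<in> measurable (F t) N ==> f \<in> measurable M N"
  by (rule measurable_from_subalg[OF F_subalgebra])

lemma F_measurable_mono: "s <= t ==> f \<in> measurable (F s) N ==> f \<in> measurable (F t) N"
  using measurable_mono[of N N "F s" "F t"] F_sets_mono[of s t] by auto

lemma W_adapted: "0 <= s ==> s <= t ==> W s \<in> borel_measurable (F t)"
  by (rule measurableI) (auto simp: sets_F F_gen_def)

lemma null_subset: "A \<subseteq> N ==> N \<in> null_sets M ==> A \<in> null_sets M"
  using complete_measure.complete[OF complete] null_sets_subset by blast

lemma null_F: "N \<in> null_sets M ==> N \<in> sets (F t)"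
  by (auto simp: sets_F F_gen_def)

text \<open>
  As every \<open>F t\<close> contains the null sets, adaptedness survives changes on null sets; this is what completing the filtration is for.
\<close>

lemma F_measurable_AE:
  assumes f: "f \<in> measurable (F t) N" and ae: "AE w in M. f w = g w" and g: "g \<in> space M \<rightarrow> space N"
  shows "g \<in> measurable (F t) N"
proof (rule measurableI)
  fix B assume B: "B \<in> sets N"
  obtain Z where Z: "Z \<in> null_sets M" "{w \<in> space M. f w \<noteq> g w} \<subseteq> Z"
    using ae by (auto elim: AE_E3 simp: eventually_ae_filter)
  have eq: "g -` B \<inter> space M = (f -` B \<inter> space M - Z) \<union> (g -` B \<inter> space M \<inter> Z)"
    using Z(2) by auto
  have 1: "f -` B \<inter> space M \<in> sets (F t)" using measurable_sets[OF f B] by simp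
  have 2: "g -` B \<inter> space M \<inter> Z \<in> sets (F t)"
    by (rule null_F, rule null_subset[OF _ Z(1)]) auto
  show "g -` B \<inter> space (F t) \<in> sets (F t)"
    unfolding space_F by (subst eq) (intro sets.Un sets.Diff 1 2 null_F Z(1))
qed (use g in auto)

lemma F_measurable_AE': 
  fixes f g :: "'w => 'b::topological_space"
  shows "f \<in> borel_measurable (F t) ==> AE w in M. f w = g w ==> g \<in> borel_measurable (F t)"
  by (rule F_measurable_AE) auto

lemma M_measurable_AE:
  fixes f g :: "'w => 'b::topological_space"
  assumes f: "f \<in> borel_measurable M" and ae: "AE w in M. f w = g w"
  shows "g \<in> borel_measurable M"
proof (rule measurableI)
  fix B assume B: "B \<in> sets (borel :: 'b measure)"
  obtain Z where Z: "Z \<in> null_sets M" "{w \<in> space M. f w \<noteq> g w} \<subseteq> Z"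
    using ae by (auto elim: AE_E3 simp: eventually_ae_filter)
  have eq: "g -` B \<inter> space M = (f -` B \<inter> space M - Z) \<union> (g -` B \<inter> space M \<inter> Z)"
    using Z(2) by auto
  have 1: "f -` B \<inter> space M \<in> sets M" using measurable_sets[OF f B] by simp
  have 2: "g -` B \<inter> space M \<inter> Z \<in> sets M"
    using null_subset[OF _ Z(1), of "g -` B \<inter> space M \<inter> Z"] by auto
  show "g -` B \<inter> space M \<in> sets M"
    by (subst eq) (intro sets.Un sets.Diff 1 2 null_setsD2[OF Z(1)])
qed auto

subsection \<open>Increments are independent of the past\<close>

text \<open>
  Finite intersections of the generators of \<open>F s\<close>; together with the null sets they form an
intersection-stable generator, which independence can be checked on.
\<close>

definition cylinders :: "real => 'w set set" where
  "cylinders s = {{w \<in> space M. \<forall>r\<in>I. W r w \<in> B r} | I B. finite I \<and> I \<subseteq> {0..s} \<and> (\<forall>r. B r \<in> sets borel)}"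

lemma cylinders_Int_stable: "Int_stable (cylinders s \<union> null_sets M)"
proof (rule Int_stableI)
  fix a b assume a: "a \<in> cylinders s \<union> null_sets M" and b: "b \<in> cylinders s \<union> null_sets M"
  show "a \<inter> b \<in> cylinders s \<union> null_sets M"
  proof (cases "a \<in> null_sets M \<or> b \<in> null_sets M")
    case True
    then have "a \<inter> b \<in> null_sets M" using null_subset[of "a \<inter> b"] by blast
    then show ?thesis ..
  next
    case False
    with a b have "a \<in> cylinders s" "b \<in> cylinders s" by blast+
    from this(1) obtain I B where I: "a = {w \<in> space M. \<forall>r\<in>I. W r w \<in> B r}" "finite I" "I \<subseteq> {0..s}" "\<forall>r. B r \<in> sets borel"
      unfolding cylinders_def by blast
    from \<open>b \<in> cylinders s\<close> obtain I' B' where I': "b = {w \<in> space M. \<forall>r\<in>I'. W r w \<in> B' r}" "finite I'" "I' \<subseteq> {0..s}" "\<forall>r. B' r \<in> sets borel"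
      unfolding cylinders_def by blast
    have "a \<inter> b = {w \<in> space M. \<forall>r\<in>I \<union> I'. W r w \<in> (if r \<in> I then B r else UNIV) \<inter> (if r \<in> I' then B' r else UNIV)}"
      unfolding I(1) I'(1) by auto
    moreover have "finite (I \<union> I')" "I \<union> I' \<subseteq> {0..s}"
      "\<forall>r. (if r \<in> I then B r else UNIV) \<inter> (if r \<in> I' then B' r else UNIV) \<in> sets borel"
      using I I' by auto
    ultimately have "a \<inter> b \<in> cylinders s"
      unfolding cylinders_def mem_Collect_eq
      by (intro exI[of _ "I \<union> I'"] exI[of _ "\<lambda>r. (if r \<in> I then B r else UNIV) \<inter> (if r \<in> I' then B' r else UNIV)"]) auto
    then show ?thesis ..
  qed
qed

lemma cylinders_sets: "cylinders s \<subseteq> sets M"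
proof
  fix a assume "a \<in> cylinders s"
  then obtain I B where I: "a = {w \<in> space M. \<forall>r\<in>I. W r w \<in> B r}" "finite I" "I \<subseteq> {0..s}" "\<forall>r. B r \<in> sets borel"
    unfolding cylinders_def by blast
  show "a \<in> sets M" unfolding I(1)
  proof (rule sets.sets_Collect_finite_All[OF _ I(2)])
    fix r assume "r \<in> I"
    then have "W r -` B r \<inter> space M \<in> sets M"
      by (intro measurable_sets[OF W_measurable]) (use I in auto)
    moreover have "W r -` B r \<inter> space M = {w \<in> space M. W r w \<in> B r}" by auto
    ultimately show "{w \<in> space M. W r w \<in> B r} \<in> sets M" by simp
  qed
qed

lemma F_gen_subset_cylinders: "F_gen s \<subseteq> cylinders s \<union> null_sets M"
proof
  fix a assume "a \<in> F_gen s"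
  then consider "a \<in> null_sets M" | r B where "a = W r -` B \<inter> space M" "0 <= r" "r <= s" "B \<in> sets borel"
    unfolding F_gen_def by blast
  then show "a \<in> cylinders s \<union> null_sets M"
  proof cases
    case 2
    then have "a \<in> cylinders s" unfolding cylinders_def mem_Collect_eq
      by (intro exI[of _ "{r}"] exI[of _ "\<lambda>_. B"]) auto
    then show ?thesis ..
  qed auto
qed

text \<open>
  A cylinder event up to time \<open>s\<close> is, up to the null set where \<open>W 0 \<noteq> 0\<close>, an event about finitely many increments of \<open>W\<close> up to \<open>s\<close>,
which are independent of the increment after \<open>s\<close>.
\<close>

lemma cylinder_indep_increment:
  assumes st: "0 <= s" "s <= t" and a: "a \<in> cylinders s" and C: "C \<in> sets borel"
  shows "prob (a \<inter> ((\<lambda>w. W t w - W s w) -` C \<inter> space M)) = prob a * prob ((\<lambda>w. W t w - W s w) -` C \<inter> space M)"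
proof -
  obtain I B where I: "a = {w \<in> space M. \<forall>r\<in>I. W r w \<in> B r}" "finite I" "I \<subseteq> {0..s}" "\<forall>r. B r \<in> sets borel"
    using a unfolding cylinders_def by blast
  \<comment> \<open>The grid contains 0 and s: the partial sums of increments then give back every W r, and the last increment is the one from s to t.\<close>
  define xs where "xs = sorted_list_of_set (I \<union> {0, s})"
  define n where "n = length xs - 1"
  have set_xs: "set xs = I \<union> {0, s}" unfolding xs_def by (rule set_sorted_list_of_set) (use I(2) in simp)
  have sorted: "sorted xs" by (simp add: xs_def)
  have ne: "xs \<noteq> []" using set_xs by auto
  then have len: "length xs = Suc n" by (simp add: n_def)
  have idx: "\<exists>j\<le>n. xs ! j = r" if "r \<in> I \<union> {0, s}" for r
    using that unfolding set_xs[symmetric] in_set_conv_nth len by (auto simp: less_Suc_eq_le)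
  have range: "xs ! j \<in> {0..s}" if "j <= n" for j
    using nth_mem[of j xs] that set_xs I(3) st len by auto
  have x0: "xs ! 0 = 0"
  proof -
    obtain j where "j <= n" "xs ! j = 0" using idx[of 0] by auto
    then have "xs ! 0 <= 0" using sorted_nth_mono[OF sorted, of 0 j] len by auto
    with range[of 0] show ?thesis by auto
  qed
  have xn: "xs ! n = s"
  proof -
    obtain j where "j <= n" "xs ! j = s" using idx[of s] by auto
    then have "s <= xs ! n" using sorted_nth_mono[OF sorted, of j n] len by auto
    with range[of n] show ?thesis by auto
  qed
  define \<tau> where "\<tau> i = (if i <= n then xs ! i else t)" for i
  define X where "X i w = W (\<tau> (Suc i)) w - W (\<tau> i) w" for i w
  have mono: "\<forall>i<Suc n. \<tau> i <= \<tau> (Suc i)"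
  proof (intro allI impI)
    fix i assume "i < Suc n"
    then show "\<tau> i <= \<tau> (Suc i)"
      using sorted_nth_mono[OF sorted, of i "Suc i"] range[of i] st len by (auto simp: \<tau>_def)
  qed
  have iv: "indep_vars (\<lambda>_. borel) X {..<Suc n}"
    unfolding X_def[abs_def] by (rule W_indep_vars) (use mono range[of 0] in \<open>auto simp: \<tau>_def\<close>)
  have ind: "indep_var (PiM {..<n} (\<lambda>_. borel)) (\<lambda>w. restrict (\<lambda>i. X i w) {..<n})
      (PiM {n} (\<lambda>_. borel)) (\<lambda>w. restrict (\<lambda>i. X i w) {n})"
    by (rule indep_var_restrict[OF iv]) auto
  have Xn: "X n w = W t w - W s w" for w by (simp add: X_def \<tau>_def xn)
  obtain j where j: "\<And>r. r \<in> I ==> j r <= n \<and> xs ! (j r) = r" using idx by (metis UnI1)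
  define E where "E = {f \<in> space (PiM {..<n} (\<lambda>_. borel :: real measure)). \<forall>r\<in>I. (\<Sum>i<j r. f i) \<in> B r}"
  define E2 where "E2 = {f \<in> space (PiM {n} (\<lambda>_. borel :: real measure)). f n \<in> C}"
  have E: "E \<in> sets (PiM {..<n} (\<lambda>_. borel))"
    unfolding E_def
  proof (rule sets.sets_Collect_finite_All[OF _ I(2)])
    fix r assume "r \<in> I"
    then have "(\<lambda>f. \<Sum>i<j r. f i) \<in> borel_measurable (PiM {..<n} (\<lambda>_. borel :: real measure))"
      using j[OF \<open>r \<in> I\<close>] by (intro borel_measurable_sum measurable_component_singleton) auto
    from measurable_sets_Collect[OF this, of "\<lambda>x. x \<in> B r"]
    show "{f \<in> space (PiM {..<n} (\<lambda>_. borel :: real measure)). (\<Sum>i<j r. f i) \<in> B r} \<in> sets (PiM {..<n} (\<lambda>_. borel))"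
      using I(4) by simp
  qed
  have E2: "E2 \<in> sets (PiM {n} (\<lambda>_. borel))"
  proof -
    have "(\<lambda>f. f n) \<in> borel_measurable (PiM {n} (\<lambda>_. borel :: real measure))"
      by (rule measurable_component_singleton) auto
    from measurable_sets_Collect[OF this, of "\<lambda>x. x \<in> C"] show ?thesis using C by (simp add: E2_def)
  qed
  let ?A = "(\<lambda>w. restrict (\<lambda>i. X i w) {..<n}) -` E \<inter> space M"
  let ?D = "(\<lambda>w. W t w - W s w) -` C \<inter> space M"
  have D: "(\<lambda>w. restrict (\<lambda>i. X i w) {n}) -` E2 \<inter> space M = ?D"
    by (auto simp: E2_def Xn space_PiM)
  have A_sets: "?A \<in> sets M" by (rule measurable_sets[OF indep_var_rv1[OF ind] E])
  have D_sets: "?D \<in> sets M" unfolding D[symmetric] by (rule measurable_sets[OF indep_var_rv2[OF ind] E2])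
  have a_sets: "a \<in> sets M" using a cylinders_sets by blast
  have AE: "AE w in M. w \<in> a \<longleftrightarrow> w \<in> ?A"
    using W_zero AE_space[of M]
  proof eventually_elim
    case (elim w)
    have "(\<Sum>i<j r. (restrict (\<lambda>i. X i w) {..<n}) i) = W r w" if "r \<in> I" for r
    proof -
      have "(\<Sum>i<j r. (restrict (\<lambda>i. X i w) {..<n}) i) = (\<Sum>i<j r. W (\<tau> (Suc i)) w - W (\<tau> i) w)"
        using j[OF that] by (intro sum.cong refl) (auto simp: X_def)
      also have "... = W (\<tau> (j r)) w - W (\<tau> 0) w" by (rule sum_lessThan_telescope)
      also have "... = W r w" using j[OF that] elim x0 by (simp add: \<tau>_def)
      finally show ?thesis .
    qed
    then show ?case using elim unfolding I(1) E_def by (auto simp: space_PiM)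
  qed
  have "prob (a \<inter> ?D) = prob (?A \<inter> ?D)"
    by (rule finite_measure_eq_AE) (use AE a_sets A_sets D_sets in \<open>auto elim: eventually_mono\<close>)
  also have "?A \<inter> ?D = (\<lambda>x. ((\<lambda>i\<in>{..<n}. X i x), (\<lambda>i\<in>{n}. X i x))) -` (E \<times> E2) \<inter> space M"
    unfolding D[symmetric] by auto
  also have "prob ... = prob ?A * prob ?D"
    unfolding D[symmetric] by (rule indep_varD[OF ind E E2])
  also have "prob ?A = prob a"
    by (rule finite_measure_eq_AE) (use AE a_sets A_sets in \<open>auto elim: eventually_mono\<close>)
  finally show ?thesis .
qed

lemma F_indep_increment:
  assumes st: "0 <= s" "s <= t" and f: "f \<in> borel_measurable (F s)"
  shows "indep_var borel f borel (\<lambda>w. W t w - W s w)"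
proof -
  let ?D = "{(\<lambda>w. W t w - W s w) -` C \<inter> space M | C. C \<in> sets borel}"
  have Wm: "(\<lambda>w. W t w - W s w) \<in> borel_measurable M"
    using W_measurable st by (intro borel_measurable_diff) auto
  have "indep_set (cylinders s \<union> null_sets M) ?D"
  proof (rule indep_setI)
    show "cylinders s \<union> null_sets M \<subseteq> events" using cylinders_sets by auto
    show "?D \<subseteq> events" using measurable_sets[OF Wm] by auto
    fix a b assume a: "a \<in> cylinders s \<union> null_sets M" and b: "b \<in> ?D"
    from a show "prob (a \<inter> b) = prob a * prob b"
    proof
      assume "a \<in> cylinders s"
      with b cylinder_indep_increment[OF st] show ?thesis by blast
    next
      assume a0: "a \<in> null_sets M"
      then have "a \<inter> b \<in> null_sets M" by (rule null_subset[OF Int_lower1])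
      with a0 show ?thesis by (simp add: measure_eq_0_null_sets)
    qed
  qed
  then have "indep_set (sigma_sets (space M) (cylinders s \<union> null_sets M)) (sigma_sets (space M) ?D)"
  proof (rule indep_set_sigma_sets[OF _ cylinders_Int_stable Int_stableI])
    fix a b assume ab: "a \<in> ?D" "b \<in> ?D"
    from ab(1) obtain C1 where C1: "a = (\<lambda>w. W t w - W s w) -` C1 \<inter> space M" "C1 \<in> sets borel"
      by (elim CollectE exE conjE)
    from ab(2) obtain C2 where C2: "b = (\<lambda>w. W t w - W s w) -` C2 \<inter> space M" "C2 \<in> sets borel"
      by (elim CollectE exE conjE)
    have "a \<inter> b = (\<lambda>w. W t w - W s w) -` (C1 \<inter> C2) \<inter> space M"
      unfolding C1(1) C2(1) by (simp only: vimage_Int) (simp only: Int_ac Int_left_absorb)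
    moreover have "C1 \<inter> C2 \<in> sets borel" using C1(2) C2(2) by (rule sets.Int)
    ultimately show "a \<inter> b \<in> ?D" by (intro CollectI exI conjI)
  qed
  moreover have "sigma_sets (space M) {f -` A \<inter> space M |A. A \<in> sets borel} \<subseteq> sigma_sets (space M) (cylinders s \<union> null_sets M)"
  proof (rule sigma_sets_subsetI)
    have "{f -` A \<inter> space M |A. A \<in> sets borel} \<subseteq> sets (F s)"
      using measurable_sets[OF f] by auto
    also have "... \<subseteq> sigma_sets (space M) (cylinders s \<union> null_sets M)"
      unfolding sets_F by (rule sigma_sets_mono'[OF F_gen_subset_cylinders])
    finally show "{f -` A \<inter> space M |A. A \<in> sets borel} \<subseteq> sigma_sets (space M) (cylinders s \<union> null_sets M)" .
  qed
  ultimately have "indep_set (sigma_sets (space M) {f -` A \<inter> space M |A. A \<in> sets borel}) (sigma_sets (space M) ?D)"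
    unfolding indep_sets2_eq by blast
  then show ?thesis
    unfolding indep_var_eq using Wm F_measurable_M[OF f] by simp
qed

lemma increment_moments:
  assumes "0 <= s" "s < t"
  shows "integrable M (\<lambda>w. W t w - W s w)" "(\<E> w. W t w - W s w) = 0"
    and "integrable M (\<lambda>w. (W t w - W s w)^2)" "(\<E> w. (W t w - W s w)^2) = t - s"
proof -
  note D = W_normal[OF assms]
  have \<sigma>: "0 < sqrt (t - s)" using assms by simp
  show 1: "integrable M (\<lambda>w. W t w - W s w)"
    using distributed_integrable[OF D, of "\<lambda>x. x"] integrable_normal_moment[OF \<sigma>, of 0 1] by simp
  show 2: "(\<E> w. W t w - W s w) = 0"
    using normal_distributed_expectation[OF \<sigma> D] by simp
  show "integrable M (\<lambda>w. (W t w - W s w)^2)"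
    using distributed_integrable[OF D, of "\<lambda>x. x^2"] integrable_normal_moment[OF \<sigma>, of 0 2] by simp
  show "(\<E> w. (W t w - W s w)^2) = t - s"
    using normal_distributed_variance[OF \<sigma> D] 2 assms by simp
qed

text \<open>
  The two martingale identities behind the isometry: an increment is centred, and its square has the conditional mean \<open>t - s\<close>, given the past.
\<close>

lemma increment_times_past:
  assumes st: "0 <= s" "s <= t" and f: "f \<in> borel_measurable (F s)" "integrable M f"
  shows "integrable M (\<lambda>w. f w * (W t w - W s w))" "(\<E> w. f w * (W t w - W s w)) = 0"
    and "integrable M (\<lambda>w. f w * (W t w - W s w)^2)"
      "(\<E> w. f w * (W t w - W s w)^2) = (t - s) * (\<E> w. f w)"
proof -
  have "integrable M (\<lambda>w. f w * (W t w - W s w)) \<and> (\<E> w. f w * (W t w - W s w)) = 0 \<and>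
    integrable M (\<lambda>w. f w * (W t w - W s w)^2) \<and>
      (\<E> w. f w * (W t w - W s w)^2) = (t - s) * (\<E> w. f w)"
  proof (cases "s < t")
    case True
    note m = increment_moments[OF st(1) True]
    note i1 = F_indep_increment[OF st f(1)]
    have i2: "indep_var borel f borel (\<lambda>w. (W t w - W s w)^2)"
      using indep_var_compose[OF i1, of "\<lambda>x. x" borel "\<lambda>x. x^2" borel] by (simp add: comp_def)
    show ?thesis
      using indep_var_lebesgue_integral[OF i1 f(2) m(1)] indep_var_integrable[OF i1 f(2) m(1)]
        indep_var_lebesgue_integral[OF i2 f(2) m(3)] indep_var_integrable[OF i2 f(2) m(3)] m by simp
  next
    case False
    with st have "s = t" by simp
    then show ?thesis by simp
  qed
  then show "integrable M (\<lambda>w. f w * (W t w - W s w))" "(\<E> w. f w * (W t w - W s w)) = 0"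
    "integrable M (\<lambda>w. f w * (W t w - W s w)^2)"
    "(\<E> w. f w * (W t w - W s w)^2) = (t - s) * (\<E> w. f w)" by auto
qed

subsection \<open>Time integrals of adapted processes are adapted\<close>

lemma pair_sigma_finite_time: "pair_sigma_finite (lebesgue_on {0..T::real}) M"
proof -
  show ?thesis ..
qed

text \<open>
  The time integral need not be a limit of Riemann sums, so its measurability with respect to the past
is shown by duality: its conditional expectation \<open>c\<close> satisfies \<open>E|G - c| = E[(G - c) \<eta>]\<close> with \<open>\<eta>\<close> the sign of \<open>G - c\<close>, and by Fubini
\<open>\<eta>\<close> may be replaced by its own conditional expectation, which annihilates \<open>G - c\<close>.
\<close>

lemma time_integral_adapted_real:
  fixes g :: "real => 'w => real"
  assumes int: "integrable (LT T \<Otimes>\<^sub>M M) (\<lambda>(s, w). g s w)"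
    and g: "\<And>s. s \<in> {0..T} ==> g s \<in> borel_measurable (F b)"
  shows "(\<lambda>w. \<integral>s. g s w \<partial>(LT T)) \<in> borel_measurable (F b)"
proof -
  let ?L = "LT T"
  interpret P: pair_sigma_finite ?L M by (rule pair_sigma_finite_time)
  interpret Fb: finite_measure_subalgebra M "F b"
    by unfold_locales (rule F_subalgebra)
  define G where "G w = (\<integral>s. g s w \<partial>?L)" for w
  have G: "integrable M G" unfolding G_def by (rule P.integrable_snd[OF int])
  define c where "c = real_cond_exp M (F b) G"
  have c: "integrable M c" "c \<in> borel_measurable (F b)" using G by (auto simp: c_def)
  note [measurable] = borel_measurable_integrable[OF G] F_measurable_M[OF c(2)] borel_measurable_integrable[OF int]
  define \<eta> where "\<eta> w = sgn (G w - c w)" for w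
  have \<eta>m [measurable]: "\<eta> \<in> borel_measurable M" unfolding \<eta>_def by measurable
  have \<eta>b: "\<bar>\<eta> w\<bar> <= 1" for w by (auto simp: \<eta>_def sgn_real_def)
  have \<eta>i: "integrable M \<eta>" by (rule integrable_const_bound[of _ 1]) (use \<eta>b in auto)
  define \<zeta> where "\<zeta> = real_cond_exp M (F b) \<eta>"
  have \<zeta>m: "\<zeta> \<in> borel_measurable (F b)" by (simp add: \<zeta>_def)
  note [measurable] = F_measurable_M[OF \<zeta>m]
  have "AE w in M. \<zeta> w <= 1" unfolding \<zeta>_def
    by (rule Fb.real_cond_exp_le_c[OF \<eta>i]) (use \<eta>b in \<open>auto simp: abs_le_iff\<close>)
  moreover have "AE w in M. \<zeta> w \<ge> -1" unfolding \<zeta>_def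
    by (rule Fb.real_cond_exp_ge_c[OF \<eta>i]) (use \<eta>b in \<open>auto simp: abs_le_iff minus_le_iff\<close>)
  ultimately have \<zeta>b: "AE w in M. \<bar>\<zeta> w\<bar> <= 1" by eventually_elim auto
  have bnd: "integrable M (\<lambda>w. f w * h w)" if "integrable M f" "h \<in> borel_measurable M" "AE w in M. \<bar>h w\<bar> <= 1" for f h :: "'w => real"
  proof (rule bint_bound[OF that(1)])
    show "AE w in M. norm (f w * h w) <= norm (f w)"
      using that(3) by eventually_elim (auto simp: abs_mult intro: mult_left_le)
  qed (use that in auto)
  have swap: "(\<E> w. f w * \<eta> w) = (\<E> w. f w * \<zeta> w)" if "integrable M f" "f \<in> borel_measurable (F b)" for f
    unfolding \<zeta>_def by (rule Fb.real_cond_exp_intg(2)[symmetric]) (use that bnd \<eta>b in auto)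
  have pull: "(\<E> w. G w * h w) = (\<integral>s. \<integral>w. g s w * h w \<partial>M \<partial>?L)"
    if h: "h \<in> borel_measurable M" "AE w in M. \<bar>h w\<bar> <= 1" for h
  proof -
    have "integrable (?L \<Otimes>\<^sub>M M) (\<lambda>(s, w). g s w * h w)"
    proof (rule bint_bound[OF int])
      note h(1)[measurable]
      have "AE z in ?L \<Otimes>\<^sub>M M. \<bar>h (snd z)\<bar> <= 1"
        by (rule P.AE_pair_measure) (measurable, use h in simp)
      then show "AE z in ?L \<Otimes>\<^sub>M M. norm (case z of (s, w) => g s w * h w) <= norm (case z of (s, w) => g s w)"
        by eventually_elim (auto simp: abs_mult case_prod_beta intro: mult_left_le)
    qed (use h(1) in measurable)
    from P.Fubini_integral[OF this] show ?thesis by (simp add: G_def)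
  qed
  have gi: "AE s in ?L. integrable M (g s)" using P.AE_integrable_fst[OF int] by simp
  have "(\<E> w. \<bar>G w - c w\<bar>) = (\<E> w. G w * \<eta> w - c w * \<eta> w)"
    by (rule bint_cong) (auto simp: \<eta>_def abs_sgn left_diff_distrib[symmetric] sgn_real_def)
  also have "... = (\<E> w. G w * \<eta> w) - (\<E> w. c w * \<eta> w)"
    by (rule bint_diff) (use bnd G c \<eta>b in auto)
  also have "(\<E> w. c w * \<eta> w) = (\<E> w. c w * \<zeta> w)" by (rule swap[OF c])
  also have "(\<E> w. G w * \<eta> w) = (\<integral>s. \<integral>w. g s w * \<eta> w \<partial>M \<partial>?L)" by (rule pull) (use \<eta>b in auto)
  also have "... = (\<integral>s. \<integral>w. g s w * \<zeta> w \<partial>M \<partial>?L)"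
  proof (rule integral_cong_AE)
    show "AE s in ?L. (\<E> w. g s w * \<eta> w) = (\<E> w. g s w * \<zeta> w)"
      using gi AE_space[of ?L] by eventually_elim (rule swap, auto intro: g)
  qed measurable
  also have "... = (\<E> w. G w * \<zeta> w)" by (rule pull[symmetric]) (use \<zeta>b in auto)
  also have "... = (\<E> w. \<zeta> w * c w)"
    unfolding c_def using Fb.real_cond_exp_intg(2)[of \<zeta> G] bnd[OF G _ \<zeta>b] \<zeta>m
    by (simp add: mult.commute)
  finally have "(\<E> w. \<bar>G w - c w\<bar>) = 0" by (simp add: mult.commute)
  then have "AE w in M. \<bar>G w - c w\<bar> = 0"
    by (subst (asm) integral_nonneg_eq_0_iff_AE) (use G c in auto)
  then have "AE w in M. c w = G w" by eventually_elim auto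
  from F_measurable_AE'[OF c(2) this] show ?thesis by (simp add: G_def[abs_def])
qed

lemma time_integral_adapted:
  fixes g :: "real => 'w => 'b::euclidean_space"
  assumes int: "integrable (LT T \<Otimes>\<^sub>M M) (\<lambda>(s, w). g s w)"
    and g: "\<And>s. s \<in> {0..T} ==> g s \<in> borel_measurable (F b)"
  shows "(\<lambda>w. \<integral>s. g s w \<partial>(LT T)) \<in> borel_measurable (F b)"
proof -
  let ?L = "LT T"
  interpret P: pair_sigma_finite ?L M by (rule pair_sigma_finite_time)
  have "(\<lambda>w. (\<integral>s. g s w \<partial>?L) \<bullet> i) \<in> borel_measurable (F b)" for i
  proof (rule F_measurable_AE')
    have "(\<lambda>(s,w). g s w \<bullet> i) = (\<lambda>z. (case z of (s, w) => g s w) \<bullet> i)" by auto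
    then have "integrable (?L \<Otimes>\<^sub>M M) (\<lambda>(s, w). g s w \<bullet> i)"
      using integrable_inner_left[OF int] by simp
    then show "(\<lambda>w. \<integral>s. g s w \<bullet> i \<partial>?L) \<in> borel_measurable (F b)"
      by (rule time_integral_adapted_real) (use g in \<open>auto intro!: borel_measurable_inner\<close>)
    show "AE w in M. (\<integral>s. g s w \<bullet> i \<partial>?L) = (\<integral>s. g s w \<partial>?L) \<bullet> i"
      using P.AE_integrable_snd[OF int] by eventually_elim (rule integral_inner_left, simp)
  qed
  then show ?thesis by (subst borel_measurable_euclidean_space) auto
qed

end

section \<open>The Ito isometry\<close>

lemma integral_inner_sums:
  assumes f: "\<And>i. i \<in> I ==> sq_int N (f i)" and g: "\<And>j. j \<in> J ==> sq_int N (g j)"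
  shows "(\<integral>x. (\<Sum>i\<in>I. f i x) \<bullet> (\<Sum>j\<in>J. g j x) \<partial>N) = (\<Sum>i\<in>I. \<Sum>j\<in>J. \<integral>x. f i x \<bullet> g j x \<partial>N)"
proof -
  have "(\<integral>x. (\<Sum>i\<in>I. f i x) \<bullet> (\<Sum>j\<in>J. g j x) \<partial>N) = (\<integral>x. (\<Sum>i\<in>I. \<Sum>j\<in>J. f i x \<bullet> g j x) \<partial>N)"
    by (simp only: inner_sum_left) (simp only: inner_sum_right)
  also have "... = (\<Sum>i\<in>I. \<integral>x. (\<Sum>j\<in>J. f i x \<bullet> g j x) \<partial>N)"
    by (intro bint_sum bint_sum_int sq_int_inner f g)
  also have "... = (\<Sum>i\<in>I. \<Sum>j\<in>J. \<integral>x. f i x \<bullet> g j x \<partial>N)"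
    by (intro sum.cong refl bint_sum sq_int_inner f g)
  finally show ?thesis .
qed

context brownian
begin

abbreviation NT :: "real => (real \<times> 'w) measure" where
  "NT T \<equiv> LT T \<Otimes>\<^sub>M M"

text \<open>
  Integrands on different horizons are compared after extension by zero to a common one.
\<close>

definition cut :: "real => (real => 'w => 'b::euclidean_space) => real \<times> 'w => 'b" where
  "cut t f z = indicator {0..t} (fst z) *\<^sub>R f @@ z"

lemma finite_NT: "finite_measure (NT T)"
proof -
  show ?thesis by (rule finite_measure_pair_measure) unfold_locales
qed

lemma fst_NT [measurable]: "fst \<in> borel_measurable (NT T)"
  by (rule measurable_compose[OF measurable_fst measurable_id_lebesgue_on])

lemma indicator_fst_NT [measurable]:
  "A \<in> sets borel ==> (\<lambda>z. indicator A (fst z) :: real) \<in> borel_measurable (NT T)"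
  by (rule measurable_compose[OF fst_NT]) simp

lemma M_measurable_NT: "f \<in> measurable M K ==> (\<lambda>z. f (snd z)) \<in> measurable (NT T) K"
  by (rule measurable_compose[OF measurable_snd])

lemma time_measurable_NT: "f \<in> measurable (LT T) K ==> (\<lambda>z. f (fst z)) \<in> measurable (NT T) K"
  by (rule measurable_compose[OF measurable_fst])

lemma nn_integral_NT:
  "g \<in> borel_measurable (NT T) ==>
    (\<integral>\<^sup>+w. (\<integral>\<^sup>+s. g (s, w) \<partial>(LT T)) \<partial>M) = (\<integral>\<^sup>+z. g z \<partial>NT T)"
  by (rule pair_sigma_finite.nn_integral_snd[OF pair_sigma_finite_time])

lemma L2_adapted_iff:
  "f \<in> L2p T \<longleftrightarrow>
     sq_int (NT T) (\<lambda>z. f @@ z) \<and> (\<forall>s\<in>{0..T}. f s \<in> borel_measurable (F s))"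
  using nn_integral_NT[of "\<lambda>z. ennreal ((norm (f @@ z))^2)" T]
  unfolding L2_adapted_def sq_int_iff_nn_integral case_prod_beta' by auto

lemma min_measurable_time:
  fixes t T :: real
  assumes "0 <= t" "t <= T"
  shows "(\<lambda>s. min s t) \<in> measurable (LT T) (LT t)"
proof (rule measurable_restrict_space2)
  show "(\<lambda>s. min s t) \<in> space (LT T) \<rightarrow> {0..t}" using assms by (auto simp: min_def)
  show "(\<lambda>s. min s t) \<in> measurable (LT T) lebesgue"
  proof (rule measurableI)
    fix A :: "real set" assume A: "A \<in> sets lebesgue"
    have "(\<lambda>s. min s t) -` A \<inter> space (LT T) = (A \<inter> {0..t} \<union> (if t \<in> A then {t..T} else {})) \<inter> {0..T}"
      using assms by (auto simp: min_def split: if_splits)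
    also have "... \<in> sets (LT T)"
      unfolding Int_commute[of _ "{0..T}"] sets_restrict_space
      by (intro imageI sets.Un sets.Int A) auto
    finally show "(\<lambda>s. min s t) -` A \<inter> space (LT T) \<in> sets (LT T)" .
  qed auto
qed

lemma measurable_cut:
  assumes t: "0 <= t" "t <= T" and f: "(\<lambda>z. f @@ z) \<in> borel_measurable (NT t)"
  shows "cut t f \<in> borel_measurable (NT T)"
proof -
  have "(\<lambda>z. (min (fst z) t, snd z)) \<in> measurable (NT T) (NT t)"
    by (rule measurable_Pair[OF measurable_compose[OF measurable_fst min_measurable_time[OF t]] measurable_snd])
  from measurable_compose[OF this f]
  have [measurable]: "(\<lambda>z. f (min (fst z) t) (snd z)) \<in> borel_measurable (NT T)" by simp
  have "cut t f = (\<lambda>z. indicator {0..t} (fst z) *\<^sub>R f (min (fst z) t) (snd z))"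
    by (auto simp: cut_def indicator_def fun_eq_iff)
  also have "... \<in> borel_measurable (NT T)" by measurable
  finally show ?thesis .
qed

lemma measurable_NT_subset:
  assumes "t <= T" and f: "f \<in> measurable (NT T) K" shows "f \<in> measurable (NT t) K"
proof -
  have "(\<lambda>s. s) \<in> measurable (LT t) (LT T)"
    by (rule measurable_restrict_space2) (use assms in \<open>auto intro!: measurable_restrict_space1\<close>)
  then have "(\<lambda>z. (fst z, snd z)) \<in> measurable (NT t) (NT T)"
    by (intro measurable_Pair measurable_snd measurable_compose[OF measurable_fst])
  from measurable_compose[OF this f] show ?thesis by simp
qed

lemma nn_integral_cut:
  assumes t: "0 <= t" "t <= T" and f: "(\<lambda>z. f @@ z) \<in> borel_measurable (NT t)"
  shows "(\<integral>\<^sup>+w. (\<integral>\<^sup>+s. ennreal ((norm (f s w))^2) \<partial>(LT t)) \<partial>M)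
    = (\<integral>\<^sup>+z. ennreal ((norm (cut t f z))^2) \<partial>NT T)"
proof -
  note [measurable] = measurable_cut[OF t f]
  have "(\<integral>\<^sup>+s. ennreal ((norm (f s w))^2) \<partial>(LT t))
      = (\<integral>\<^sup>+s. ennreal ((norm (cut t f (s, w)))^2) \<partial>(LT T))" for w
    unfolding restrict_lebesgue_on[OF t(2)]
    by (subst nn_integral_restrict_space)
       (use t in \<open>auto simp: sets_restrict_space cut_def indicator_def intro!: nn_integral_cong\<close>)
  then show ?thesis by (simp add: nn_integral_NT[symmetric])
qed

lemma L2_adapted_cut:
  assumes t: "0 <= t" "t <= T" and f: "f \<in> L2p t"
  shows "sq_int (NT T) (cut t f)"
proof -
  have m: "(\<lambda>z. f @@ z) \<in> borel_measurable (NT t)"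
    using f by (auto simp: L2_adapted_iff sq_int_def)
  then show ?thesis
    using f nn_integral_cut[OF t m] measurable_cut[OF t m]
    by (auto simp: sq_int_iff_nn_integral L2_adapted_def)
qed

lemma L2_adapted_subset:
  assumes t: "0 <= t" "t <= T" and f: "f \<in> L2p T"
  shows "f \<in> L2p t"
proof -
  have sq: "sq_int (NT T) (\<lambda>z. f @@ z)" using f by (simp add: L2_adapted_iff)
  have m: "(\<lambda>z. f @@ z) \<in> borel_measurable (NT t)"
    by (rule measurable_NT_subset[OF t(2) sq_int_measurable[OF sq]])
  have "sq_int (NT T) (cut t f)"
    by (rule sq_int_dominated[OF measurable_cut[OF t m] sq, of 1]) (auto simp: cut_def indicator_def)
  then show ?thesis
    using f t m nn_integral_cut[OF t m]
    by (auto simp: L2_adapted_def sq_int_iff_nn_integral case_prod_beta')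
qed

lemma cut_AE:
  assumes t: "t <= T" and "AE z in NT T. f @@ z = g @@ z"
  shows "AE z in NT T. cut t f z = cut t g z"
  using assms(2) by eventually_elim (simp add: cut_def)

lemma cut_self: "AE z in NT T. cut T f z = f @@ z"
  by (rule AE_I2) (auto simp: cut_def indicator_def space_pair_measure)

lemma sq_int_NT_product:
  assumes "A \<in> sets borel" "sq_int M \<xi>"
  shows "sq_int (NT T) (\<lambda>z. indicator A (fst z) *\<^sub>R \<xi> (snd z))"
proof -
  interpret P: pair_sigma_finite "LT T" M by (rule pair_sigma_finite_time)
  have [measurable]: "\<xi> \<in> borel_measurable M" using assms by (simp add: sq_int_def)
  have m [measurable]: "(\<lambda>z. \<xi> (snd z)) \<in> borel_measurable (NT T)" by (rule M_measurable_NT) measurable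
  have "integrable (NT T) (\<lambda>z. (norm (\<xi> (snd z)))^2)"
  proof (rule P.Fubini_integrable)
    show "AE s in LT T. integrable M (\<lambda>y. (norm (\<xi> (snd (s, y))))^2)"
      using assms by (simp add: sq_int_def)
  qed (simp_all)
  then have "sq_int (NT T) (\<lambda>z. \<xi> (snd z))" by (simp add: sq_int_def)
  then show ?thesis
    by (rule sq_int_dominated[rotated, of _ _ _ 1]) (use assms(1) in \<open>auto simp: indicator_def\<close>)
qed

lemma integral_NT_product:
  fixes h :: "real => real" and k :: "'w => real"
  assumes h: "integrable (LT T) h" and k: "integrable M k"
  shows "integrable (NT T) (\<lambda>z. h (fst z) * k (snd z))"
    and "(\<integral>z. h (fst z) * k (snd z) \<partial>NT T) = (\<integral>s. h s \<partial>(LT T)) * (\<E> w. k w)"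
proof -
  interpret P: pair_sigma_finite "LT T" M by (rule pair_sigma_finite_time)
  note [measurable] = borel_measurable_integrable[OF h] borel_measurable_integrable[OF k]
  have [measurable]: "(\<lambda>z. h (fst z)) \<in> borel_measurable (NT T)" "(\<lambda>z. k (snd z)) \<in> borel_measurable (NT T)"
    by (auto intro: M_measurable_NT time_measurable_NT)
  show i: "integrable (NT T) (\<lambda>z. h (fst z) * k (snd z))"
  proof (rule P.Fubini_integrable)
    show "integrable (LT T) (\<lambda>s. \<integral>y. norm (h (fst (s, y)) * k (snd (s, y))) \<partial>M)"
      using h by (auto simp: abs_mult)
    show "AE s in LT T. integrable M (\<lambda>y. h (fst (s, y)) * k (snd (s, y)))"
      using k by simp
  qed measurable
  show "(\<integral>z. h (fst z) * k (snd z) \<partial>NT T) = (\<integral>s. h s \<partial>(LT T)) * (\<E> w. k w)"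
    using P.integral_fst'[OF i] by simp
qed

subsection \<open>Elementary integrals\<close>

lemma sq_int_increment:
  assumes ab: "0 <= a" "a <= b" and \<xi>: "\<xi> \<in> borel_measurable (F a)" "sq_int M \<xi>"
  shows "sq_int M (\<lambda>w. (W b w - W a w) *\<^sub>R \<xi> w)"
proof -
  have [measurable]: "\<xi> \<in> borel_measurable M" "W b \<in> borel_measurable M" "W a \<in> borel_measurable M"
    using \<xi> W_measurable ab by (auto simp: sq_int_def)
  have "(\<lambda>w. (norm (\<xi> w))^2) \<in> borel_measurable (F a)" using \<xi>(1) by measurable
  from increment_times_past(3)[OF ab this] \<xi>(2)
  have "integrable M (\<lambda>w. (norm (\<xi> w))^2 * (W b w - W a w)^2)" by (simp add: sq_int_def)
  then have "integrable M (\<lambda>w. (norm ((W b w - W a w) *\<^sub>R \<xi> w))^2)"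
    by (simp add: power_mult_distrib mult.commute)
  moreover have "(\<lambda>w. (W b w - W a w) *\<^sub>R \<xi> w) \<in> borel_measurable M" by measurable
  ultimately show ?thesis unfolding sq_int_def by blast
qed

lemma F_measurable_increment:
  fixes \<xi> :: "'w => 'b::euclidean_space"
  assumes ab: "0 <= a" "a <= b" "b <= c" and \<xi>: "\<xi> \<in> borel_measurable (F a)"
  shows "(\<lambda>w. (W b w - W a w) *\<^sub>R \<xi> w) \<in> borel_measurable (F c)"
  using W_adapted[of b c] W_adapted[of a c] F_measurable_mono[OF _ \<xi>, of c] ab
  by (intro borel_measurable_scaleR borel_measurable_diff) auto

lemma increment_cross:
  fixes f :: "'w => real"
  assumes c: "0 <= c" "c <= b" "c <= d" and f: "f \<in> borel_measurable (F c)" "integrable M f"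
  shows "integrable M (\<lambda>w. f w * (W b w - W c w) * (W d w - W c w))"
    and "(\<E> w. f w * (W b w - W c w) * (W d w - W c w)) = (min b d - c) * (\<E> w. f w)"
proof -
  have main: "integrable M (\<lambda>w. f w * (W b w - W c w) * (W d w - W c w)) \<and>
    (\<E> w. f w * (W b w - W c w) * (W d w - W c w)) = (b - c) * (\<E> w. f w)"
    if bd: "c <= b" "b <= d" for b d
  proof -
    have g: "(\<lambda>w. f w * (W b w - W c w)) \<in> borel_measurable (F b)"
      using F_measurable_increment[of c b b f] f c bd by (simp add: mult.commute)
    note i1 = increment_times_past[OF c(1) bd(1) f]
    have b0: "0 <= b" using c bd by simp
    note i2 = increment_times_past[OF b0 bd(2) g i1(1)]
    have eq: "f w * (W b w - W c w) * (W d w - W c w)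
      = f w * (W b w - W c w)^2 + f w * (W b w - W c w) * (W d w - W b w)" for w
      by (simp add: algebra_simps power2_eq_square)
    show ?thesis unfolding eq using i1 i2 by simp
  qed
  have "integrable M (\<lambda>w. f w * (W b w - W c w) * (W d w - W c w)) \<and>
    (\<E> w. f w * (W b w - W c w) * (W d w - W c w)) = (min b d - c) * (\<E> w. f w)"
  proof (cases "b <= d")
    case True then show ?thesis using main[of b d] c by simp
  next
    case False
    have "f w * (W b w - W c w) * (W d w - W c w) = f w * (W d w - W c w) * (W b w - W c w)" for w
      by simp
    then have eq: "(\<lambda>w. f w * (W b w - W c w) * (W d w - W c w)) = (\<lambda>w. f w * (W d w - W c w) * (W b w - W c w))"
      by (rule ext)
    show ?thesis unfolding eq using main[of d b] c False by (simp only: min_def) simp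
  qed
  then show "integrable M (\<lambda>w. f w * (W b w - W c w) * (W d w - W c w))"
    "(\<E> w. f w * (W b w - W c w) * (W d w - W c w)) = (min b d - c) * (\<E> w. f w)"
    by auto
qed

text \<open>
  The integral of the later atom over the part beyond the earlier one is centred given the past; the
overlap contributes its length.
\<close>

lemma atom_inner:
  assumes ab: "0 <= a" "a <= b" and cd: "0 <= c" "c <= d" and ac: "a <= c"
    and \<xi>: "\<xi> \<in> borel_measurable (F a)" "sq_int M \<xi>"
    and \<eta>: "\<eta> \<in> borel_measurable (F c)" "sq_int M \<eta>"
  shows "(\<E> w. ((W b w - W a w) *\<^sub>R \<xi> w) \<bullet> ((W d w - W c w) *\<^sub>R \<eta> w))
    = max 0 (min b d - c) * (\<E> w. \<xi> w \<bullet> \<eta> w)"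
proof -
  have past: "(\<E> w. ((W e w - W a w) *\<^sub>R \<xi> w) \<bullet> \<eta> w * (W d w - W c w)) = 0"
    "integrable M (\<lambda>w. ((W e w - W a w) *\<^sub>R \<xi> w) \<bullet> \<eta> w * (W d w - W c w))"
    if e: "a <= e" "e <= c" for e
  proof -
    have "(\<lambda>w. ((W e w - W a w) *\<^sub>R \<xi> w) \<bullet> \<eta> w) \<in> borel_measurable (F c)"
      by (intro borel_measurable_inner F_measurable_increment[OF ab(1) e \<xi>(1)] \<eta>(1))
    moreover have "integrable M (\<lambda>w. ((W e w - W a w) *\<^sub>R \<xi> w) \<bullet> \<eta> w)"
      by (intro sq_int_inner sq_int_increment ab e \<xi> \<eta>)
    ultimately show "(\<E> w. ((W e w - W a w) *\<^sub>R \<xi> w) \<bullet> \<eta> w * (W d w - W c w)) = 0"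
      "integrable M (\<lambda>w. ((W e w - W a w) *\<^sub>R \<xi> w) \<bullet> \<eta> w * (W d w - W c w))"
      using increment_times_past[OF cd] by blast+
  qed
  show ?thesis
  proof (cases "b <= c")
    case True
    have "((W b w - W a w) *\<^sub>R \<xi> w) \<bullet> ((W d w - W c w) *\<^sub>R \<eta> w)
        = ((W b w - W a w) *\<^sub>R \<xi> w) \<bullet> \<eta> w * (W d w - W c w)" for w by simp
    then show ?thesis using past(1)[OF ab(2) True] True by (simp only:) simp
  next
    case False
    then have cb: "c <= b" by simp
    have z: "(\<lambda>w. \<xi> w \<bullet> \<eta> w) \<in> borel_measurable (F c)" "integrable M (\<lambda>w. \<xi> w \<bullet> \<eta> w)"
      using F_measurable_mono[OF ac \<xi>(1)] \<eta>(1) sq_int_inner[OF \<xi>(2) \<eta>(2)] by auto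
    have "((W b w - W a w) *\<^sub>R \<xi> w) \<bullet> ((W d w - W c w) *\<^sub>R \<eta> w)
        = ((W c w - W a w) *\<^sub>R \<xi> w) \<bullet> \<eta> w * (W d w - W c w)
          + (\<xi> w \<bullet> \<eta> w) * (W b w - W c w) * (W d w - W c w)" for w
      by (simp add: algebra_simps)
    then have "(\<E> w. ((W b w - W a w) *\<^sub>R \<xi> w) \<bullet> ((W d w - W c w) *\<^sub>R \<eta> w))
      = (\<E> w. ((W c w - W a w) *\<^sub>R \<xi> w) \<bullet> \<eta> w * (W d w - W c w)
          + (\<xi> w \<bullet> \<eta> w) * (W b w - W c w) * (W d w - W c w))" by (simp only:)
    also have "... = 0 + (min b d - c) * (\<E> w. \<xi> w \<bullet> \<eta> w)"
      using past[OF ac order_refl] increment_cross[OF cd(1) cb cd(2) z]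
      by (subst bint_add) auto
    finally show ?thesis using cb cd by simp
  qed
qed

lemma integral_indicator_interval:
  assumes "0 <= a" "b <= T"
  shows "(\<integral>s. indicat_real {a<..b} s * indicator {c<..d} s \<partial>(LT T)) = max 0 (min b d - max a c)"
proof -
  have "(\<integral>s. indicat_real {a<..b} s * indicator {c<..d} s \<partial>(LT T))
      = (\<integral>s. indicator {0..T} s *\<^sub>R (indicator {a<..b} s * indicator {c<..d} s) \<partial>lebesgue)"
    by (subst integral_restrict_space) auto
  also have "... = (\<integral>s. indicator {max a c<..min b d} s \<partial>lebesgue)"
    using assms by (intro bint_cong) (auto simp: indicator_def)
  also have "... = measure lebesgue {max a c<..min b d}" by simp
  also have "... = max 0 (min b d - max a c)"
    by (cases "max a c <= min b d") auto
  finally show ?thesis .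
qed

text \<open>
  Polar form of the isometry for two atoms; on the right the overlap of the two time intervals appears as an integral of indicators.
\<close>

lemma atom_polar:
  assumes ab: "0 <= a" "a <= b" "b <= T" and cd: "0 <= c" "c <= d" "d <= T"
    and \<xi>: "\<xi> \<in> borel_measurable (F a)" "sq_int M \<xi>"
    and \<eta>: "\<eta> \<in> borel_measurable (F c)" "sq_int M \<eta>"
  shows "(\<E> w. ((W b w - W a w) *\<^sub>R \<xi> w) \<bullet> ((W d w - W c w) *\<^sub>R \<eta> w))
    = (\<integral>z. (indicator {a<..b} (fst z) *\<^sub>R \<xi> (snd z)) \<bullet> (indicator {c<..d} (fst z) *\<^sub>R \<eta> (snd z)) \<partial>NT T)"
proof -
  have "(\<integral>z. (indicator {a<..b} (fst z) *\<^sub>R \<xi> (snd z)) \<bullet> (indicator {c<..d} (fst z) *\<^sub>R \<eta> (snd z)) \<partial>NT T)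
    = (\<integral>z. (indicator {a<..b} (fst z) * indicator {c<..d} (fst z)) * (\<xi> (snd z) \<bullet> \<eta> (snd z)) \<partial>NT T)"
    by (simp add: mult_ac)
  also have "... = (\<integral>s. indicator {a<..b} s * indicator {c<..d} s \<partial>(LT T)) * (\<E> w. \<xi> w \<bullet> \<eta> w)"
  proof (rule integral_NT_product(2)[OF _ sq_int_inner[OF \<xi>(2) \<eta>(2)]])
    have "(\<lambda>s. indicator {a<..b} s * indicator {c<..d} s :: real) \<in> borel_measurable (LT T)"
      by (intro borel_measurable_times) (auto intro!: measurable_compose[OF measurable_id_lebesgue_on])
    then show "integrable (LT T) (\<lambda>s. indicator {a<..b} s * indicator {c<..d} s :: real)"
      by (intro L.integrable_const_bound[of _ 1]) (auto simp: indicator_def)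
  qed
  also have "... = max 0 (min b d - max a c) * (\<E> w. \<xi> w \<bullet> \<eta> w)"
    by (simp add: integral_indicator_interval[OF ab(1,3)])
  also have "... = (\<E> w. ((W b w - W a w) *\<^sub>R \<xi> w) \<bullet> ((W d w - W c w) *\<^sub>R \<eta> w))"
  proof (cases "a <= c")
    case True
    then show ?thesis using atom_inner[OF ab(1,2) cd(1,2) True \<xi> \<eta>] by simp
  next
    case False
    then have "c <= a" by simp
    from atom_inner[OF cd(1,2) ab(1,2) this \<eta> \<xi>] False show ?thesis
      by (simp add: min.commute inner_commute mult.commute mult.left_commute max_def)
  qed
  finally show ?thesis by simp
qed

subsection \<open>Integrals of simple processes\<close>

lemma simple_ito_cases:
  assumes "simple_ito_integral M W t \<phi> S" "t <= T"
  obtains k \<tau> \<xi> where "\<And>i. i < k ==> 0 <= \<tau> i \<and> \<tau> i <= \<tau> (Suc i) \<and> \<tau> (Suc i) <= t"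
    "\<And>i. i < k ==> \<xi> i \<in> borel_measurable (F (\<tau> i))" "\<And>i. i < k ==> sq_int M (\<xi> i)"
    "\<phi> = (\<lambda>s w. \<Sum>i<(k::nat). indicator {\<tau> i<..\<tau> (Suc i)} s *\<^sub>R \<xi> i w)"
    "S = (\<lambda>w. \<Sum>i<k. (W (\<tau> (Suc i)) w - W (\<tau> i) w) *\<^sub>R \<xi> i w)"
proof -
  from assms(1)[unfolded simple_ito_integral_def] obtain k \<tau> \<xi> where
    *: "0 <= \<tau> 0" "\<forall>i<k. \<tau> i <= \<tau> (Suc i)" "\<tau> k <= t"
      "\<forall>i<k. \<xi> i \<in> borel_measurable (F (\<tau> i)) \<and> integrable M (\<lambda>w. (norm (\<xi> i w))^2)"
      "\<phi> = (\<lambda>s w. \<Sum>i<k. indicator {\<tau> i<..\<tau> (Suc i)} s *\<^sub>R \<xi> i w)"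
      "S = (\<lambda>w. \<Sum>i<k. (W (\<tau> (Suc i)) w - W (\<tau> i) w) *\<^sub>R \<xi> i w)"
    by (elim exE conjE)
  have mono: "\<tau> i <= \<tau> j" if "i <= j" "j <= k" for i j
    using that
  proof (induction j)
    case (Suc j)
    then show ?case using *(2) by (cases "i = Suc j") (auto intro: order_trans)
  qed auto
  show thesis
  proof (rule that[of k \<tau> \<xi>])
    fix i assume i: "i < k"
    show "0 <= \<tau> i \<and> \<tau> i <= \<tau> (Suc i) \<and> \<tau> (Suc i) <= t"
      using mono[of 0 i] mono[of "Suc i" k] *(1,2,3) i by auto
    show "\<xi> i \<in> borel_measurable (F (\<tau> i))" using * i by blast
    show "sq_int M (\<xi> i)" using *(4)[rule_format, OF i] by (auto simp: sq_int_def intro: F_measurable_M)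
  qed (fact *)+
qed

lemma simple_ito_sq_int:
  assumes "simple_ito_integral M W t \<phi> S" "t <= T"
  shows "sq_int (NT T) (\<lambda>z. \<phi> @@ z)" "sq_int M S"
  by (rule simple_ito_cases[OF assms], simp only:, intro sq_int_sum sq_int_NT_product, auto)
     (rule simple_ito_cases[OF assms], simp only:, intro sq_int_sum sq_int_increment, auto)

lemma simple_ito_polar:
  assumes 1: "simple_ito_integral M W t \<phi> S" "t <= T" and 2: "simple_ito_integral M W t' \<phi>' S'" "t' <= T"
  shows "(\<E> w. S w \<bullet> S' w) = (\<integral>z. \<phi> @@ z \<bullet> \<phi>' @@ z \<partial>NT T)"
proof -
  obtain k \<tau> \<xi> where a: "\<And>i. i < k ==> 0 <= \<tau> i \<and> \<tau> i <= \<tau> (Suc i) \<and> \<tau> (Suc i) <= t"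
    "\<And>i. i < k ==> \<xi> i \<in> borel_measurable (F (\<tau> i))" "\<And>i. i < k ==> sq_int M (\<xi> i)"
    "\<phi> = (\<lambda>s w. \<Sum>i<(k::nat). indicator {\<tau> i<..\<tau> (Suc i)} s *\<^sub>R \<xi> i w)"
    "S = (\<lambda>w. \<Sum>i<k. (W (\<tau> (Suc i)) w - W (\<tau> i) w) *\<^sub>R \<xi> i w)"
    using that by (rule simple_ito_cases[OF 1])
  obtain k' \<tau>' \<xi>' where b: "\<And>i. i < k' ==> 0 <= \<tau>' i \<and> \<tau>' i <= \<tau>' (Suc i) \<and> \<tau>' (Suc i) <= t'"
    "\<And>i. i < k' ==> \<xi>' i \<in> borel_measurable (F (\<tau>' i))" "\<And>i. i < k' ==> sq_int M (\<xi>' i)"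
    "\<phi>' = (\<lambda>s w. \<Sum>i<(k'::nat). indicator {\<tau>' i<..\<tau>' (Suc i)} s *\<^sub>R \<xi>' i w)"
    "S' = (\<lambda>w. \<Sum>i<k'. (W (\<tau>' (Suc i)) w - W (\<tau>' i) w) *\<^sub>R \<xi>' i w)"
    using that by (rule simple_ito_cases[OF 2])
  have si: "sq_int M (\<lambda>w. (W (\<tau> (Suc i)) w - W (\<tau> i) w) *\<^sub>R \<xi> i w)"
    "sq_int (NT T) (\<lambda>z. indicator {\<tau> i<..\<tau> (Suc i)} (fst z) *\<^sub>R \<xi> i (snd z))" if "i < k" for i
    using a that by (auto intro: sq_int_increment sq_int_NT_product)
  have si': "sq_int M (\<lambda>w. (W (\<tau>' (Suc i)) w - W (\<tau>' i) w) *\<^sub>R \<xi>' i w)"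
    "sq_int (NT T) (\<lambda>z. indicator {\<tau>' i<..\<tau>' (Suc i)} (fst z) *\<^sub>R \<xi>' i (snd z))" if "i < k'" for i
    using b that by (auto intro: sq_int_increment sq_int_NT_product)
  have "(\<E> w. S w \<bullet> S' w) = (\<Sum>i<k. \<Sum>j<k'. \<integral>w. ((W (\<tau> (Suc i)) w - W (\<tau> i) w) *\<^sub>R \<xi> i w)
      \<bullet> ((W (\<tau>' (Suc j)) w - W (\<tau>' j) w) *\<^sub>R \<xi>' j w) \<partial>M)"
    unfolding a(5) b(5) by (rule integral_inner_sums) (use si si' in auto)
  also have "... = (\<Sum>i<k. \<Sum>j<k'. \<integral>z. (indicator {\<tau> i<..\<tau> (Suc i)} (fst z) *\<^sub>R \<xi> i (snd z))
      \<bullet> (indicator {\<tau>' j<..\<tau>' (Suc j)} (fst z) *\<^sub>R \<xi>' j (snd z)) \<partial>NT T)"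
  proof (intro sum.cong refl atom_polar)
    fix i j assume "i \<in> {..<k}" "j \<in> {..<k'}"
    with a(1)[of i] b(1)[of j] 1(2) 2(2) show "0 <= \<tau> i" "\<tau> i <= \<tau> (Suc i)" "\<tau> (Suc i) <= T"
      "0 <= \<tau>' j" "\<tau>' j <= \<tau>' (Suc j)" "\<tau>' (Suc j) <= T" by auto
  qed (use a b in auto)
  also have "... = (\<integral>z. \<phi> @@ z \<bullet> \<phi>' @@ z \<partial>NT T)"
    unfolding a(4) b(4) by (rule integral_inner_sums[symmetric]) (use si si' in auto)
  finally show ?thesis .
qed

lemma simple_ito_cut:
  assumes "simple_ito_integral M W t \<phi> S" "t <= T" "t <= t'"
  shows "cut t' \<phi> = (\<lambda>z. \<phi> @@ z)"
proof -
  obtain k \<tau> \<xi> where a: "\<And>i. i < k ==> 0 <= \<tau> i \<and> \<tau> i <= \<tau> (Suc i) \<and> \<tau> (Suc i) <= t"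
    and "\<And>i. i < k ==> \<xi> i \<in> borel_measurable (F (\<tau> i))" "\<And>i. i < k ==> sq_int M (\<xi> i)"
    and a2: "\<phi> = (\<lambda>s w. \<Sum>i<(k::nat). indicator {\<tau> i<..\<tau> (Suc i)} s *\<^sub>R \<xi> i w)"
    and "S = (\<lambda>w. \<Sum>i<k. (W (\<tau> (Suc i)) w - W (\<tau> i) w) *\<^sub>R \<xi> i w)"
    using that by (rule simple_ito_cases[OF assms(1,2)])
  show ?thesis
  proof
    fix z
    show "cut t' \<phi> z = \<phi> @@ z"
    proof (cases "fst z \<in> {0..t'}")
      case False
      then have "\<phi> @@ z = 0"
        unfolding a2
      proof (intro sum.neutral ballI)
        fix i assume "i \<in> {..<k}"
        with a[of i] assms(3) False show "indicator {\<tau> i<..\<tau> (Suc i)} (fst z) *\<^sub>R \<xi> i (snd z) = 0"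
          by (auto simp: indicator_def)
      qed
      then show ?thesis by (simp add: cut_def)
    qed (simp add: cut_def)
  qed
qed

lemma simple_ito_adapted:
  assumes "simple_ito_integral M W t \<phi> S" "t <= T"
  shows "\<phi> s \<in> borel_measurable (F s)"
proof -
  obtain k \<tau> \<xi> where "\<And>i. i < k ==> 0 <= \<tau> i \<and> \<tau> i <= \<tau> (Suc i) \<and> \<tau> (Suc i) <= t"
    and a: "\<And>i. i < k ==> \<xi> i \<in> borel_measurable (F (\<tau> i))" and "\<And>i. i < k ==> sq_int M (\<xi> i)"
    and a2: "\<phi> = (\<lambda>s w. \<Sum>i<(k::nat). indicator {\<tau> i<..\<tau> (Suc i)} s *\<^sub>R \<xi> i w)"
    and "S = (\<lambda>w. \<Sum>i<k. (W (\<tau> (Suc i)) w - W (\<tau> i) w) *\<^sub>R \<xi> i w)"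
    using that by (rule simple_ito_cases[OF assms])
  have "(\<lambda>w. indicator {\<tau> i<..\<tau> (Suc i)} s *\<^sub>R \<xi> i w) \<in> borel_measurable (F s)" if "i < k" for i
    using F_measurable_mono[OF _ a[OF that], of s] by (cases "\<tau> i <= s") auto
  then show ?thesis unfolding a2 by (intro borel_measurable_sum) auto
qed

subsection \<open>The Ito integral as a limit\<close>

text \<open>
  The double integral in the definition is the squared norm on the product space over the larger horizon, after cutting the integrand.
\<close>

lemma has_ito_limit:
  assumes Y: "has_ito_integral M W t f Y" and t: "0 <= t" "t <= T"
  obtains \<phi> S where "sq_int (NT T) (cut t f)" "sq_int M Y"
    "\<And>j. simple_ito_integral M W t (\<phi> j) (S j)"
    "(\<lambda>j::nat. msq (NT T) (\<lambda>z. \<phi> j @@ z - cut t f z)) \<longlonglongrightarrow> 0"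
    "(\<lambda>j. msq M (\<lambda>w. S j w - Y w)) \<longlonglongrightarrow> 0"
proof -
  from Y[unfolded has_ito_integral_def] obtain \<phi> S where
    f: "f \<in> L2p t" "Y \<in> borel_measurable M" and S: "\<And>j::nat. simple_ito_integral M W t (\<phi> j) (S j)"
    and l1: "(\<lambda>j. \<integral>\<^sup>+w. (\<integral>\<^sup>+s. ennreal ((norm (\<phi> j s w - f s w))^2) \<partial>(LT t)) \<partial>M) \<longlonglongrightarrow> 0"
    and l2: "(\<lambda>j. \<integral>\<^sup>+w. ennreal ((norm (S j w - Y w))^2) \<partial>M) \<longlonglongrightarrow> 0"
    by blast
  have sf: "sq_int (NT T) (cut t f)" by (rule L2_adapted_cut[OF t f(1)])
  have ft: "(\<lambda>z. f @@ z) \<in> borel_measurable (NT t)"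
    using f by (auto simp: L2_adapted_iff sq_int_def)
  note s\<phi> = simple_ito_sq_int(1)[OF S t(2)] and sS = simple_ito_sq_int(2)[OF S t(2)]
  have "(\<lambda>z. \<phi> j @@ z - f @@ z) \<in> borel_measurable (NT t)" for j
    by (intro borel_measurable_diff ft sq_int_measurable[OF simple_ito_sq_int(1)[OF S order_refl]])
  note n = nn_integral_cut[OF t this]
  have c: "cut t (\<lambda>s w. \<phi> j s w - f s w) z = \<phi> j @@ z - cut t f z" for j z
    using simple_ito_cut[OF S t(2) order_refl, of j] by (simp add: cut_def fun_eq_iff scaleR_diff_right)
  have "(\<lambda>j. ennreal (msq (NT T) (\<lambda>z. \<phi> j @@ z - cut t f z))) \<longlonglongrightarrow> 0"
    using l1 unfolding n c nn_integral_norm_sq[OF sq_int_diff[OF s\<phi> sf]] .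
  then have L1: "(\<lambda>j. msq (NT T) (\<lambda>z. \<phi> j @@ z - cut t f z)) \<longlonglongrightarrow> 0"
    by (subst (asm) ennreal_tendsto_0_iff) (auto simp: msq_nonneg)
  have "\<exists>j. (\<integral>\<^sup>+w. ennreal ((norm (S j w - Y w))^2) \<partial>M) < 1"
    using order_tendstoD(2)[OF l2, of 1] by (auto simp: eventually_sequentially)
  then obtain j where "(\<integral>\<^sup>+w. ennreal ((norm (S j w - Y w))^2) \<partial>M) < 1" by blast
  then have "(\<integral>\<^sup>+w. ennreal ((norm (S j w - Y w))^2) \<partial>M) < \<infinity>"
    by (rule order.strict_trans) simp
  then have "sq_int M (\<lambda>w. S j w - Y w)"
    using f(2) sq_int_measurable[OF sS] by (simp add: sq_int_iff_nn_integral)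
  from sq_int_diff[OF sS[of j] this] have sY: "sq_int M Y" by simp
  have "(\<lambda>j. ennreal (msq M (\<lambda>w. S j w - Y w))) \<longlonglongrightarrow> 0"
    using l2 unfolding nn_integral_norm_sq[OF sq_int_diff[OF sS sY]] .
  then have L2: "(\<lambda>j. msq M (\<lambda>w. S j w - Y w)) \<longlonglongrightarrow> 0"
    by (subst (asm) ennreal_tendsto_0_iff) (auto simp: msq_nonneg)
  from that[OF sf sY S L1 L2] show thesis .
qed

lemma has_ito_integralI:
  assumes t: "0 <= t" and f: "f \<in> L2p t" and Y: "sq_int M Y"
    and S: "\<And>j::nat. simple_ito_integral M W t (\<phi> j) (S j)"
    and l1: "(\<lambda>j. msq (NT t) (\<lambda>z. \<phi> j @@ z - f @@ z)) \<longlonglongrightarrow> 0"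
    and l2: "(\<lambda>j. msq M (\<lambda>w. S j w - Y w)) \<longlonglongrightarrow> 0"
  shows "has_ito_integral M W t f Y"
  unfolding has_ito_integral_def
proof (intro conjI exI[of _ \<phi>] exI[of _ S] allI S f)
  show "Y \<in> borel_measurable M" using Y by (simp add: sq_int_def)
  have sf: "sq_int (NT t) (\<lambda>z. f @@ z)" using f by (simp add: L2_adapted_iff)
  note s\<phi> = simple_ito_sq_int(1)[OF S order_refl] and sS = simple_ito_sq_int(2)[OF S order_refl]
  have "(\<integral>\<^sup>+w. (\<integral>\<^sup>+s. ennreal ((norm (\<phi> j s w - f s w))^2) \<partial>(LT t)) \<partial>M)
     = ennreal (msq (NT t) (\<lambda>z. \<phi> j @@ z - f @@ z))" for j
    using nn_integral_NT[of "\<lambda>z. ennreal ((norm (\<phi> j @@ z - f @@ z))^2)" t]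
      nn_integral_norm_sq[OF sq_int_diff[OF s\<phi>[of j] sf]] sq_int_measurable[OF sq_int_diff[OF s\<phi>[of j] sf]]
    by simp
  then show "(\<lambda>j. \<integral>\<^sup>+w. (\<integral>\<^sup>+s. ennreal ((norm (\<phi> j s w - f s w))^2) \<partial>(LT t)) \<partial>M) \<longlonglongrightarrow> 0"
    using l1 by (simp add: ennreal_tendsto_0_iff msq_nonneg)
  show "(\<lambda>j. \<integral>\<^sup>+w. ennreal ((norm (S j w - Y w))^2) \<partial>M) \<longlonglongrightarrow> 0"
    unfolding nn_integral_norm_sq[OF sq_int_diff[OF sS Y]] using l2 by (simp add: ennreal_tendsto_0_iff msq_nonneg)
qed

lemma ito_sq_int:
  assumes "has_ito_integral M W t f Y" "0 <= t" "t <= T"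
  shows "sq_int (NT T) (cut t f)" "sq_int M Y"
  by (rule has_ito_limit[OF assms], assumption)+

theorem ito_polar:
  assumes Y: "has_ito_integral M W t f Y" "0 <= t" "t <= T" and Z: "has_ito_integral M W t' g Z" "0 <= t'" "t' <= T"
  shows "(\<E> w. Y w \<bullet> Z w) = (\<integral>z. cut t f z \<bullet> cut t' g z \<partial>NT T)"
proof -
  obtain \<phi> S where a: "sq_int (NT T) (cut t f)" "sq_int M Y"
    "\<And>j::nat. simple_ito_integral M W t (\<phi> j) (S j)"
    "(\<lambda>j. msq (NT T) (\<lambda>z. \<phi> j @@ z - cut t f z)) \<longlonglongrightarrow> 0"
    "(\<lambda>j. msq M (\<lambda>w. S j w - Y w)) \<longlonglongrightarrow> 0"
    using that by (rule has_ito_limit[OF Y])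
  obtain \<psi> R where b: "sq_int (NT T) (cut t' g)" "sq_int M Z"
    "\<And>j::nat. simple_ito_integral M W t' (\<psi> j) (R j)"
    "(\<lambda>j. msq (NT T) (\<lambda>z. \<psi> j @@ z - cut t' g z)) \<longlonglongrightarrow> 0"
    "(\<lambda>j. msq M (\<lambda>w. R j w - Z w)) \<longlonglongrightarrow> 0"
    using that by (rule has_ito_limit[OF Z])
  have "(\<lambda>j. \<integral>w. S j w \<bullet> R j w \<partial>M) \<longlonglongrightarrow> (\<E> w. Y w \<bullet> Z w)"
    by (rule l2_tendsto_inner) (use a b simple_ito_sq_int(2)[OF a(3) Y(3)] simple_ito_sq_int(2)[OF b(3) Z(3)] in auto)
  moreover have "(\<lambda>j. \<integral>z. \<phi> j @@ z \<bullet> \<psi> j @@ z \<partial>NT T) \<longlonglongrightarrow> (\<integral>z. cut t f z \<bullet> cut t' g z \<partial>NT T)"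
    by (rule l2_tendsto_inner) (use a b simple_ito_sq_int(1)[OF a(3) Y(3)] simple_ito_sq_int(1)[OF b(3) Z(3)] in auto)
  moreover have "(\<E> w. S j w \<bullet> R j w) = (\<integral>z. \<phi> j @@ z \<bullet> \<psi> j @@ z \<partial>NT T)" for j
    by (rule simple_ito_polar[OF a(3) Y(3) b(3) Z(3)])
  ultimately show ?thesis by (simp add: LIMSEQ_unique)
qed

corollary ito_isometry_diff:
  assumes Y: "has_ito_integral M W t f Y" "0 <= t" "t <= T" and Z: "has_ito_integral M W t' g Z" "0 <= t'" "t' <= T"
  shows "msq M (\<lambda>w. Y w - Z w) = msq (NT T) (\<lambda>z. cut t f z - cut t' g z)"
  using ito_polar[OF Y Z] ito_polar[OF Y Y] ito_polar[OF Z Z]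
  unfolding msq_diff_expand[OF ito_sq_int(2)[OF Y] ito_sq_int(2)[OF Z]]
    msq_diff_expand[OF ito_sq_int(1)[OF Y] ito_sq_int(1)[OF Z]]
  by (simp add: msq_def power2_norm_eq_inner)

corollary ito_isometry:
  assumes Y: "has_ito_integral M W t f Y" "0 <= t" "t <= T"
  shows "msq M Y = msq (NT T) (cut t f)"
  using ito_polar[OF Y Y] by (simp add: msq_def power2_norm_eq_inner)

lemma ito_unique_AE:
  assumes Y: "has_ito_integral M W t f Y" and Z: "has_ito_integral M W t g Z" and t: "0 <= t" "t <= T"
    and eq: "AE z in NT T. cut t f z = cut t g z"
  shows "AE w in M. Y w = Z w"
proof -
  have "msq (NT T) (\<lambda>z. cut t f z - cut t g z) = (\<integral>z. 0 \<partial>NT T)"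
    unfolding msq_def
    using eq sq_int_measurable[OF ito_sq_int(1)[OF Y t]] sq_int_measurable[OF ito_sq_int(1)[OF Z t]]
    by (intro integral_cong_AE) auto
  then have "msq M (\<lambda>w. Y w - Z w) = 0" by (simp add: ito_isometry_diff[OF Y t Z t])
  from msq_eq_0_AE[OF sq_int_diff[OF ito_sq_int(2)[OF Y t] ito_sq_int(2)[OF Z t]] this] show ?thesis by auto
qed

lemma has_ito_integral_AE:
  assumes Y: "has_ito_integral M W t f Y" and eq: "AE w in M. Y w = Y' w"
  shows "has_ito_integral M W t f Y'"
proof -
  have "(\<integral>\<^sup>+w. ennreal ((norm (S w - Y w))^2) \<partial>M) = (\<integral>\<^sup>+w. ennreal ((norm (S w - Y' w))^2) \<partial>M)" for S
    by (rule nn_integral_cong_AE) (use eq in auto)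
  then show ?thesis using Y M_measurable_AE[OF _ eq] unfolding has_ito_integral_def by auto
qed

subsection \<open>Simple integrals as processes\<close>

text \<open>
  Stopping the grid of a simple process at \<open>r\<close> gives its integral up to \<open>r\<close>, for all \<open>r\<close> at once: the paths
are continuous because \<open>W\<close> is, and increments in \<open>r\<close> are orthogonal to the past.
\<close>

lemma simple_ito_process:
  fixes \<phi> :: "real => 'w => 'b::euclidean_space"
  assumes S: "simple_ito_integral M W T \<phi> S"
  obtains I where "\<And>r. r \<in> {0..T} ==> simple_ito_integral M W r (\<lambda>s w. indicator {0..r} s *\<^sub>R \<phi> s w) (I r)"
    and "\<And>r. r \<in> {0..T} ==> I r \<in> borel_measurable (F r)"
    and "AE w in M. continuous_on {0..T} (\<lambda>r. I r w)"
    and "\<And>s r \<eta>. 0 <= s ==> s <= r ==> r <= T ==> \<eta> \<in> borel_measurable (F s) ==> sq_int M \<eta> ==>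
        (\<E> w. (I r w - I s w) \<bullet> \<eta> w) = 0"
proof -
  from S[unfolded simple_ito_integral_def] obtain k \<tau> \<xi> where
    *: "0 <= \<tau> 0" "\<forall>i<(k::nat). \<tau> i <= \<tau> (Suc i)" "\<tau> k <= T"
      "\<forall>i<k. \<xi> i \<in> borel_measurable (F (\<tau> i)) \<and> integrable M (\<lambda>w. (norm (\<xi> i w))^2)"
      "\<phi> = (\<lambda>s w. \<Sum>i<k. indicator {\<tau> i<..\<tau> (Suc i)} s *\<^sub>R \<xi> i w)"
    by (elim exE conjE)
  have \<tau>0: "0 <= \<tau> i" if "i <= k" for i
    using that by (induction i) (use * in \<open>auto intro: order_trans\<close>)
  define I where "I r w = (\<Sum>i<k. (W (min (\<tau> (Suc i)) r) w - W (min (\<tau> i) r) w) *\<^sub>R \<xi> i w)" for r w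
  have sI: "simple_ito_integral M W r (\<lambda>s w. indicator {0..r} s *\<^sub>R \<phi> s w) (I r)" if r: "r \<in> {0..T}" for r
    unfolding simple_ito_integral_def
  proof (intro exI[of _ k] exI[of _ "\<lambda>i. min (\<tau> i) r"] exI[of _ "\<lambda>i w. if \<tau> i < r then \<xi> i w else 0"] conjI allI impI)
    show "0 <= min (\<tau> 0) r" "min (\<tau> k) r <= r" using * r by auto
    fix i assume i: "i < k"
    show "min (\<tau> i) r <= min (\<tau> (Suc i)) r" using * i by (auto simp: min_le_iff_disj)
    show "(\<lambda>w. if \<tau> i < r then \<xi> i w else 0) \<in> borel_measurable (F (min (\<tau> i) r))"
      using * i by (cases "\<tau> i < r") auto
    show "integrable M (\<lambda>w. (norm (if \<tau> i < r then \<xi> i w else 0))^2)"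
      using * i by (cases "\<tau> i < r") auto
  next
    show "(\<lambda>s w. indicator {0..r} s *\<^sub>R \<phi> s w) = (\<lambda>s w. \<Sum>i<k. indicator {min (\<tau> i) r<..min (\<tau> (Suc i)) r} s *\<^sub>R
        (if \<tau> i < r then \<xi> i w else 0))"
      unfolding *(5) scaleR_sum_right fun_eq_iff
    proof (intro allI sum.cong refl)
      fix s w i assume "i \<in> {..<k}"
      then have "0 <= \<tau> i" "\<tau> i <= \<tau> (Suc i)" using \<tau>0 * by auto
      then show "indicat_real {0..r} s *\<^sub>R indicat_real {\<tau> i<..\<tau> (Suc i)} s *\<^sub>R \<xi> i w =
         indicat_real {min (\<tau> i) r<..min (\<tau> (Suc i)) r} s *\<^sub>R (if \<tau> i < r then \<xi> i w else 0)"
        by (auto simp: indicator_def)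
    qed
    show "I r = (\<lambda>w. \<Sum>i<k. (W (min (\<tau> (Suc i)) r) w - W (min (\<tau> i) r) w) *\<^sub>R (if \<tau> i < r then \<xi> i w else 0))"
      unfolding I_def fun_eq_iff
    proof (intro allI sum.cong refl)
      fix w i assume "i \<in> {..<k}"
      then have "\<tau> i <= \<tau> (Suc i)" using * by auto
      then show "(W (min (\<tau> (Suc i)) r) w - W (min (\<tau> i) r) w) *\<^sub>R \<xi> i w =
        (W (min (\<tau> (Suc i)) r) w - W (min (\<tau> i) r) w) *\<^sub>R (if \<tau> i < r then \<xi> i w else 0)"
        by (auto simp: min_def)
    qed
  qed
  have Fi: "(\<lambda>w. (W (min (\<tau> (Suc i)) r) w - W (min (\<tau> i) r) w) *\<^sub>R \<xi> i w) \<in> borel_measurable (F r)"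
    if "i < k" "r \<in> {0..T}" for i r
  proof (cases "\<tau> i < r")
    case True
    then show ?thesis using that * \<tau>0[of i] by (simp add: min_absorb1 F_measurable_increment)
  next
    case False
    moreover have "\<tau> i <= \<tau> (Suc i)" using * that by auto
    ultimately show ?thesis by (simp add: min_absorb2)
  qed
  show thesis
  proof (rule that[of I])
    fix r assume "r \<in> {0..T}"
    then show "simple_ito_integral M W r (\<lambda>s w. indicator {0..r} s *\<^sub>R \<phi> s w) (I r)" by (rule sI)
    from \<open>r \<in> {0..T}\<close> show "I r \<in> borel_measurable (F r)"
      unfolding I_def[abs_def] by (intro borel_measurable_sum Fi) auto
  next
    show "AE w in M. continuous_on {0..T} (\<lambda>r. I r w)"
      using W_continuous
    proof eventually_elim
      case (elim w)
      have "continuous_on {0..T} (\<lambda>r. W (min (\<tau> i) r) w)" if "i <= k" for i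
        by (rule continuous_on_compose2[OF elim]) (use \<tau>0[OF that] in \<open>auto intro!: continuous_intros\<close>)
      then show ?case unfolding I_def by (intro continuous_intros) auto
    qed
  next
    fix s r and \<eta> :: "'w => 'b" assume sr: "0 <= s" "s <= r" "r <= T" and \<eta>: "\<eta> \<in> borel_measurable (F s)" "sq_int M \<eta>"
    have summand: "integrable M (\<lambda>w. ((W (min (\<tau> (Suc i)) r) w - W (min (\<tau> i) r) w) *\<^sub>R \<xi> i w
          - (W (min (\<tau> (Suc i)) s) w - W (min (\<tau> i) s) w) *\<^sub>R \<xi> i w) \<bullet> \<eta> w) \<and>
        (\<E> w. ((W (min (\<tau> (Suc i)) r) w - W (min (\<tau> i) r) w) *\<^sub>R \<xi> i w
          - (W (min (\<tau> (Suc i)) s) w - W (min (\<tau> i) s) w) *\<^sub>R \<xi> i w) \<bullet> \<eta> w) = 0" if i: "i < k" for i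
    proof -
      define a where "a = min (max (\<tau> i) s) r"
      define b where "b = min (max (\<tau> (Suc i)) s) r"
      have ab: "0 <= a" "a <= b" "\<tau> i <= \<tau> (Suc i)" using sr * i by (auto simp: a_def b_def min_le_iff_disj le_max_iff_disj max_def)
      have eq: "((W (min (\<tau> (Suc i)) r) w - W (min (\<tau> i) r) w) *\<^sub>R \<xi> i w
          - (W (min (\<tau> (Suc i)) s) w - W (min (\<tau> i) s) w) *\<^sub>R \<xi> i w) \<bullet> \<eta> w = (\<xi> i w \<bullet> \<eta> w) * (W b w - W a w)" for w
      proof -
        have "W (min (\<tau> (Suc i)) r) w - W (min (\<tau> i) r) w - (W (min (\<tau> (Suc i)) s) w - W (min (\<tau> i) s) w) = W b w - W a w"
          using sr ab(3) by (auto simp: a_def b_def min_def max_def)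
        then show ?thesis by (simp add: scaleR_diff_left[symmetric] del: scaleR_diff_left)
      qed
      show ?thesis
      proof (cases "a < r")
        case True
        then have "a = max (\<tau> i) s" by (auto simp: a_def)
        then have "\<tau> i <= a" "s <= a" by auto
        then have "(\<lambda>w. \<xi> i w \<bullet> \<eta> w) \<in> borel_measurable (F a)"
          by (intro borel_measurable_inner F_measurable_mono[OF \<open>s <= a\<close> \<eta>(1)]
              F_measurable_mono[OF \<open>\<tau> i <= a\<close>]) (use *(4) i in blast)
        moreover have "integrable M (\<lambda>w. \<xi> i w \<bullet> \<eta> w)"
          using *(4)[rule_format, OF i] \<eta> by (intro sq_int_inner) (auto simp: sq_int_def intro: F_measurable_M)
        ultimately show ?thesis unfolding eq using increment_times_past[OF ab(1,2)] by blast
      next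
        case False
        then have "a = b" using ab by (auto simp: a_def b_def)
        then show ?thesis unfolding eq by simp
      qed
    qed
    have "(\<lambda>w. (I r w - I s w) \<bullet> \<eta> w) = (\<lambda>w. \<Sum>i<k. ((W (min (\<tau> (Suc i)) r) w - W (min (\<tau> i) r) w) *\<^sub>R \<xi> i w
          - (W (min (\<tau> (Suc i)) s) w - W (min (\<tau> i) s) w) *\<^sub>R \<xi> i w) \<bullet> \<eta> w)"
      unfolding I_def by (simp add: sum_subtractf inner_sum_left[symmetric] fun_eq_iff del: inner_scaleR_left)
    then show "(\<E> w. (I r w - I s w) \<bullet> \<eta> w) = 0"
      using summand by (simp only:) (subst bint_sum, auto)
  qed
qed

end

section \<open>Density of simple processes\<close>

lemma msq_components: "msq N f = (\<Sum>b\<in>Basis. msq N (\<lambda>x. f x \<bullet> b))" if "sq_int N f"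
proof -
  have "msq N f = (\<integral>x. (\<Sum>b\<in>Basis. (norm (f x \<bullet> b))^2) \<partial>N)"
    unfolding msq_def
    by (intro bint_cong refl, subst power2_norm_eq_inner, subst euclidean_inner)
       (simp add: power2_eq_square)
  also have "... = (\<Sum>b\<in>Basis. msq N (\<lambda>x. f x \<bullet> b))"
    unfolding msq_def by (rule bint_sum) (use sq_int_inner_const[OF that] in \<open>auto simp: sq_int_def\<close>)
  finally show ?thesis .
qed

context brownian
begin

text \<open>
  The averages over a cell are shifted to the next one: \<open>avg T h f i\<close> uses the values of \<open>f\<close> on the cell before the \<open>i\<close>-th, hence only the past of \<open>i h\<close>. On the first cell it averages over times up to zero and vanishes.
\<close>

definition cell :: "real => real => real set" where
  "cell h i = {i * h<..(i + 1) * h}"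

definition avg :: "real => real => (real \<times> 'w => 'b::euclidean_space) => nat => 'w => 'b" where
  "avg T h f i w = (\<integral>s. (indicator (cell h (real i - 1)) s / h) *\<^sub>R f (s, w) \<partial>(LT T))"

definition stepavg :: "real => nat => (real \<times> 'w => 'b::euclidean_space) => real \<times> 'w => 'b" where
  "stepavg T n f z = (\<Sum>i<n. indicator (cell (T / n) (real i)) (fst z) *\<^sub>R avg T (T / n) f i (snd z))"

lemma cell_sets [measurable, simp]: "cell h i \<in> sets borel"
  by (simp add: cell_def)

lemma cell_disjoint:
  assumes "h > 0" "i \<noteq> j" shows "cell h (real_of_int i) \<inter> cell h (real_of_int j) = {}"
proof -
  have *: "cell h (real_of_int i) \<inter> cell h (real_of_int j) = {}" if "i < j" for i j
  proof -
    have "real_of_int i + 1 <= real_of_int j" using that by linarith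
    then have "(real_of_int i + 1) * h <= real_of_int j * h" using \<open>h > 0\<close> by (intro mult_right_mono) auto
    then show ?thesis by (auto simp: cell_def)
  qed
  from *[of i j] *[of j i] assms(2) show ?thesis by (auto simp: neq_iff)
qed

lemma sum_cells_le_1:
  assumes "h > 0" shows "(\<Sum>i<n. indicat_real (cell h (real i - 1)) s) <= 1"
proof -
  have "disjoint_family_on (\<lambda>i. cell h (real i - 1)) {..<n}"
    unfolding disjoint_family_on_def
    using cell_disjoint[OF assms, of "int i - 1" "int j - 1" for i j] by auto
  then have "(\<Sum>i<n. indicat_real (cell h (real i - 1)) s) = indicator (\<Union>i<n. cell h (real i - 1)) s"
    by (intro indicator_UN_disjoint[symmetric]) auto
  also have "... <= 1" by (auto simp: indicator_def)
  finally show ?thesis .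
qed

lemma integral_cell_le:
  assumes h: "h > 0"
  shows "integrable (LT T) (indicat_real (cell h x))"
    "(\<integral>s. indicator (cell h x) s \<partial>(LT T)) <= h"
    "0 <= x ==> (x + 1) * h <= T ==> (\<integral>s. indicator (cell h x) s \<partial>(LT T)) = h"
proof -
  have m: "indicat_real (cell h x) \<in> borel_measurable (LT T)"
    by (rule measurable_compose[OF measurable_id_lebesgue_on]) simp
  then show "integrable (LT T) (indicat_real (cell h x))"
    by (intro L.integrable_const_bound[of _ 1]) (auto simp: indicator_def)
  have eq: "(\<integral>s. indicator (cell h x) s \<partial>(LT T)) = measure lebesgue ({0..T} \<inter> cell h x)"
    by (subst integral_restrict_space) (auto simp: indicator_inter_arith[symmetric])
  have mc: "measure lebesgue (cell h x) = h"
    using h by (simp add: cell_def algebra_simps)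
  have "x * h <= (x + 1) * h" using h by (simp add: algebra_simps)
  then have "cell h x \<in> lmeasurable" by (simp add: cell_def fmeasurable_def)
  then have "measure lebesgue ({0..T} \<inter> cell h x) <= measure lebesgue (cell h x)"
    by (intro measure_mono_fmeasurable) auto
  then show "(\<integral>s. indicator (cell h x) s \<partial>(LT T)) <= h" using eq mc by simp
  assume x: "0 <= x" "(x + 1) * h <= T"
  have "0 <= x * h" using x h by simp
  then have "{0..T} \<inter> cell h x = cell h x" using x by (auto simp: cell_def)
  then show "(\<integral>s. indicator (cell h x) s \<partial>(LT T)) = h" using eq mc by simp
qed

lemma sq_int_slices:
  assumes "sq_int (NT T) f"
  shows "AE w in M. sq_int (LT T) (\<lambda>s. f (s, w))"
proof -
  interpret P: pair_sigma_finite "LT T" M by (rule pair_sigma_finite_time)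
  have i: "integrable (NT T) (\<lambda>(s,w). (norm (f (s, w)))^2)" using assms by (simp add: sq_int_def case_prod_beta')
  show ?thesis
    using P.AE_integrable_snd[OF i] AE_space[of M]
  proof eventually_elim
    case (elim w)
    have "(\<lambda>s. f (s, w)) \<in> borel_measurable (LT T)"
      by (rule measurable_compose[OF measurable_Pair2' sq_int_measurable[OF assms]]) (use elim in simp)
    with elim show ?case by (simp add: sq_int_def)
  qed
qed

lemma sq_int_indicator_time:
  assumes "sq_int (NT T) f" "A \<in> sets borel"
  shows "sq_int (NT T) (\<lambda>z. (indicator A (fst z) * c) *\<^sub>R f z)"
  by (rule sq_int_dominated[OF _ assms(1), of _ "\<bar>c\<bar>"])
     (use sq_int_measurable[OF assms(1)] assms(2) in \<open>auto simp: indicator_def intro!: AE_I2\<close>)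

lemma avg_measurable [measurable]:
  assumes "f \<in> borel_measurable (NT T)" shows "avg T h f i \<in> borel_measurable M"
proof -
  have "(\<lambda>z. (indicator (cell h (real i - 1)) (fst z) / h) *\<^sub>R f z) \<in> borel_measurable (NT T)"
    using assms by measurable
  then have "(\<lambda>(w, s). (indicator (cell h (real i - 1)) s / h) *\<^sub>R f (s, w)) \<in> borel_measurable (M \<Otimes>\<^sub>M LT T)"
    by (subst measurable_pair_swap_iff) (simp add: case_prod_beta')
  then show ?thesis unfolding avg_def[abs_def] by (rule L.borel_measurable_lebesgue_integral)
qed

lemma avg_bound:
  assumes h: "h > 0" and f: "sq_int (NT T) f"
  shows "sq_int M (avg T h f i)"
    and "h * msq M (avg T h f i) <= (\<integral>z. indicator (cell h (real i - 1)) (fst z) * (norm (f z))^2 \<partial>NT T)"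
proof -
  let ?L = "LT T"
  let ?c = "cell h (real i - 1)"
  interpret P: pair_sigma_finite ?L M by (rule pair_sigma_finite_time)
  note [measurable] = sq_int_measurable[OF f]
  have int: "integrable (NT T) (\<lambda>z. indicator ?c (fst z) * (norm (f z))^2)"
    by (rule bint_bound[OF sq_int_integrable[OF f]]) (auto simp: indicator_def)
  define R where "R w = (\<integral>s. indicator ?c s * (norm (f (s, w)))^2 \<partial>?L)" for w
  have iR: "integrable M R" and eR: "(\<E> w. R w) = (\<integral>z. indicator ?c (fst z) * (norm (f z))^2 \<partial>NT T)"
  proof -
    have i: "integrable (NT T) (\<lambda>(s,w). indicator ?c s * (norm (f (s, w)))^2)" using int by (simp add: case_prod_beta')
    show "integrable M R" unfolding R_def by (rule P.integrable_snd[OF i])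
    show "(\<E> w. R w) = (\<integral>z. indicator ?c (fst z) * (norm (f z))^2 \<partial>NT T)"
      unfolding R_def P.Fubini_integral[OF i] using P.integral_fst'[OF i] by (simp add: case_prod_beta')
  qed
  have bound: "AE w in M. h * (norm (avg T h f i w))^2 <= R w"
    using sq_int_slices[OF f]
  proof eventually_elim
    case (elim w)
    have c_m [measurable]: "indicat_real ?c \<in> borel_measurable ?L"
      by (rule measurable_compose[OF measurable_id_lebesgue_on]) simp
    note [measurable] = sq_int_measurable[OF elim]
    have s1: "sq_int ?L (indicat_real ?c)"
    proof -
      have "(\<lambda>s. (norm (indicat_real ?c s))^2) = indicat_real ?c" by (auto simp: fun_eq_iff indicator_def)
      then show ?thesis
        unfolding sq_int_def using integral_cell_le(1)[OF h, of T "real i - 1"] c_m by simp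
    qed
    have s2: "sq_int ?L (\<lambda>s. indicator ?c s * norm (f (s, w)))"
      by (rule sq_int_dominated[OF _ elim, of _ 1]) (auto simp: indicator_def)
    have R: "msq ?L (\<lambda>s. indicator ?c s * norm (f (s, w))) = R w"
      unfolding msq_def R_def by (intro bint_cong) (auto simp: indicator_def)
    have "msq ?L (indicat_real ?c) = (\<integral>s. indicator ?c s \<partial>?L)"
      unfolding msq_def by (intro bint_cong) (auto simp: indicator_def)
    then have m1: "msq ?L (indicat_real ?c) <= h" using integral_cell_le(2)[OF h, where x="real i - 1" and T=T] by simp
    have "norm (avg T h f i w) <= (\<integral>s. norm ((indicator ?c s / h) *\<^sub>R f (s, w)) \<partial>?L)"
      unfolding avg_def by (rule integral_norm_bound)
    also have "... = (\<integral>s. (indicator ?c s \<bullet> (indicator ?c s * norm (f (s, w)))) / h \<partial>?L)"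
      using h by (intro bint_cong) (auto simp: indicator_def)
    also have "... = (\<integral>s. indicator ?c s \<bullet> (indicator ?c s * norm (f (s, w))) \<partial>?L) / h" by simp
    also have "... <= (sqrt h * sqrt (R w)) / h"
    proof (rule divide_right_mono)
      have "(\<integral>s. indicator ?c s \<bullet> (indicator ?c s * norm (f (s, w))) \<partial>?L) <= sqrt (msq ?L (indicat_real ?c)) * sqrt (R w)"
        using l2_Cauchy_Schwarz[OF s1 s2] R by simp
      also have "... <= sqrt h * sqrt (R w)"
        using m1 R msq_nonneg[of ?L "\<lambda>s. indicator ?c s * norm (f (s, w))"] by (intro mult_right_mono) auto
      finally show "(\<integral>s. indicator ?c s \<bullet> (indicator ?c s * norm (f (s, w))) \<partial>?L) <= sqrt h * sqrt (R w)" .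
    qed (use h in simp)
    finally have "(norm (avg T h f i w))^2 <= ((sqrt h * sqrt (R w)) / h)^2" by (rule power_mono) simp
    also have "... = R w / h"
      using h R msq_nonneg[of ?L "\<lambda>s. indicator ?c s * norm (f (s, w))"]
      by (simp add: power_divide power_mult_distrib) (simp add: power2_eq_square)
    finally show ?case using h by (simp add: field_simps)
  qed
  have i: "integrable M (\<lambda>w. h * (norm (avg T h f i w))^2)"
    by (rule bint_bound[OF iR])
       (use bound h in \<open>auto elim!: eventually_mono intro: order_trans[OF _ abs_ge_self]\<close>)
  then have "integrable M (\<lambda>w. (1/h) * (h * (norm (avg T h f i w))^2))" by (rule integrable_mult_right)
  then show "sq_int M (avg T h f i)" using h by (simp add: sq_int_def)
  have "(\<E> w. h * (norm (avg T h f i w))^2) <= (\<E> w. R w)"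
    by (rule integral_mono_AE[OF i iR bound])
  then show "h * msq M (avg T h f i) <= (\<integral>z. indicator ?c (fst z) * (norm (f z))^2 \<partial>NT T)"
    using eR by (simp add: msq_def)
qed

lemma stepavg_sq_int:
  assumes "T > 0" "n > 0" "sq_int (NT T) f" shows "sq_int (NT T) (stepavg T n f)"
  unfolding stepavg_def[abs_def] using assms
  by (intro sq_int_sum sq_int_NT_product avg_bound) auto

text \<open>
  By Cauchy-Schwarz on each cell, the mean square of an average is at most the average of the mean square, and the cells are disjoint.
\<close>

lemma stepavg_contraction:
  fixes f :: "real \<times> 'w => 'b::euclidean_space"
  assumes T: "T > 0" "n > 0" and f: "sq_int (NT T) f"
  shows "msq (NT T) (stepavg T n f) <= msq (NT T) f"
proof -
  define h where "h = T / n"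
  have h: "h > 0" using T by (simp add: h_def)
  let ?g = "\<lambda>i z. indicator (cell h (real i)) (fst z) *\<^sub>R avg T h f i (snd z)"
  have sg: "sq_int (NT T) (?g i)" for i by (intro sq_int_NT_product avg_bound h f) auto
  have "msq (NT T) (stepavg T n f) = (\<integral>z. (\<Sum>i<n. ?g i z) \<bullet> (\<Sum>j<n. ?g j z) \<partial>NT T)"
    by (simp add: msq_def power2_norm_eq_inner stepavg_def h_def)
  also have "... = (\<Sum>i<n. \<Sum>j<n. \<integral>z. ?g i z \<bullet> ?g j z \<partial>NT T)"
    by (rule integral_inner_sums) (rule sg)+
  also have "... = (\<Sum>i<n. \<integral>z. ?g i z \<bullet> ?g i z \<partial>NT T)"
  proof (rule sum.cong[OF refl])
    fix i assume i: "i \<in> {..<n}"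
    have "(\<integral>z. ?g i z \<bullet> ?g j z \<partial>NT T) = 0" if "j \<noteq> i" for j
    proof -
      have "cell h (real i) \<inter> cell h (real j) = {}" using cell_disjoint[OF h, of "int i" "int j"] that by simp
      then have "?g i z \<bullet> ?g j z = 0" for z by (auto simp: indicator_def)
      then show ?thesis by (simp only:) simp
    qed
    then have "(\<Sum>j<n. \<integral>z. ?g i z \<bullet> ?g j z \<partial>NT T) = (\<Sum>j<n. if j = i then \<integral>z. ?g i z \<bullet> ?g i z \<partial>NT T else 0)"
      by (intro sum.cong) auto
    also have "... = (\<integral>z. ?g i z \<bullet> ?g i z \<partial>NT T)" using i by (subst sum.delta) auto
    finally show "(\<Sum>j<n. \<integral>z. ?g i z \<bullet> ?g j z \<partial>NT T) = (\<integral>z. ?g i z \<bullet> ?g i z \<partial>NT T)" .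
  qed
  also have "... <= (\<Sum>i<n. \<integral>z. indicator (cell h (real i - 1)) (fst z) * (norm (f z))^2 \<partial>NT T)"
  proof (rule sum_mono)
    fix i
    have "(\<integral>z. ?g i z \<bullet> ?g i z \<partial>NT T) = (\<integral>z. indicator (cell h (real i)) (fst z) * (norm (avg T h f i (snd z)))^2 \<partial>NT T)"
      by (intro bint_cong) (auto simp: indicator_def power2_norm_eq_inner)
    also have "... = (\<integral>s. indicator (cell h (real i)) s \<partial>(LT T)) * (\<E> w. (norm (avg T h f i w))^2)"
      by (rule integral_NT_product(2)[OF integral_cell_le(1)[OF h] sq_int_integrable[OF avg_bound(1)[OF h f]]])
    also have "... <= h * msq M (avg T h f i)"
      unfolding msq_def[symmetric] by (intro mult_right_mono integral_cell_le(2) h msq_nonneg)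
    also have "... <= (\<integral>z. indicator (cell h (real i - 1)) (fst z) * (norm (f z))^2 \<partial>NT T)"
      by (rule avg_bound(2)[OF h f])
    finally show "(\<integral>z. ?g i z \<bullet> ?g i z \<partial>NT T) <= (\<integral>z. indicator (cell h (real i - 1)) (fst z) * (norm (f z))^2 \<partial>NT T)" .
  qed
  also have "... = (\<integral>z. (\<Sum>i<n. indicator (cell h (real i - 1)) (fst z) * (norm (f z))^2) \<partial>NT T)"
    using f by (intro bint_sum[symmetric] bint_bound[OF sq_int_integrable[OF f]])
      (auto simp: indicator_def sq_int_def)
  also have "... <= msq (NT T) f"
    unfolding msq_def
  proof (rule integral_mono)
    show "integrable (NT T) (\<lambda>z. \<Sum>i<n. indicator (cell h (real i - 1)) (fst z) * (norm (f z))^2)"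
      using f by (intro bint_sum_int bint_bound[OF sq_int_integrable[OF f]])
        (auto simp: indicator_def sq_int_def)
    show "integrable (NT T) (\<lambda>z. (norm (f z))^2)" using f by (simp add: sq_int_def)
    fix z
    have "(\<Sum>i<n. indicator (cell h (real i - 1)) (fst z)) * (norm (f z))^2 <= 1 * (norm (f z))^2"
      by (intro mult_right_mono sum_cells_le_1 h) auto
    then show "(\<Sum>i<n. indicator (cell h (real i - 1)) (fst z) * (norm (f z))^2) <= (norm (f z))^2"
      by (simp add: sum_distrib_right)
  qed
  finally show ?thesis .
qed

lemma stepavg_linear:
  fixes f g :: "real \<times> 'w => 'b::euclidean_space"
  assumes T: "T > 0" and f: "sq_int (NT T) f" and g: "sq_int (NT T) g"
  shows "AE z in NT T. stepavg T n (\<lambda>z. a *\<^sub>R f z + b *\<^sub>R g z) z = a *\<^sub>R stepavg T n f z + b *\<^sub>R stepavg T n g z"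
proof -
  let ?L = "LT T"
  interpret P: pair_sigma_finite ?L M by (rule pair_sigma_finite_time)
  have "AE w in M. \<forall>i. avg T (T/n) (\<lambda>z. a *\<^sub>R f z + b *\<^sub>R g z) i w = a *\<^sub>R avg T (T/n) f i w + b *\<^sub>R avg T (T/n) g i w"
    using sq_int_slices[OF f] sq_int_slices[OF g]
  proof eventually_elim
    case (elim w)
    have i: "integrable ?L (\<lambda>s. (indicator A s / c) *\<^sub>R k s)"
      if "sq_int ?L k" "A \<in> sets borel" for c A and k :: "real => 'b"
    proof -
      have "indicat_real A \<in> borel_measurable ?L"
        by (rule measurable_compose[OF measurable_id_lebesgue_on]) (use that in simp)
      note [measurable] = this sq_int_measurable[OF that(1)]
      have "(\<lambda>s. (indicator A s / c) *\<^sub>R k s) \<in> borel_measurable ?L" by measurable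
      then have "sq_int ?L (\<lambda>s. (indicator A s / c) *\<^sub>R k s)"
        by (rule sq_int_dominated[OF _ that(1), of _ "\<bar>1/c\<bar>"]) (auto simp: indicator_def)
      then show ?thesis by (rule L.sq_int_imp_integrable)
    qed
    show ?case unfolding avg_def
    proof
      fix j
      have "(\<integral>s. (indicator (cell (T/n) (real j - 1)) s / (T/n)) *\<^sub>R (a *\<^sub>R f (s, w) + b *\<^sub>R g (s, w)) \<partial>?L)
         = (\<integral>s. a *\<^sub>R ((indicator (cell (T/n) (real j - 1)) s / (T/n)) *\<^sub>R f (s, w)) + b *\<^sub>R ((indicator (cell (T/n) (real j - 1)) s / (T/n)) *\<^sub>R g (s, w)) \<partial>?L)"
        by (intro bint_cong refl) (simp add: scaleR_add_right mult_ac)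
      also have "... = a *\<^sub>R (\<integral>s. (indicator (cell (T/n) (real j - 1)) s / (T/n)) *\<^sub>R f (s, w) \<partial>?L) + b *\<^sub>R (\<integral>s. (indicator (cell (T/n) (real j - 1)) s / (T/n)) *\<^sub>R g (s, w) \<partial>?L)"
      proof -
        note i1 = i[OF elim(1) cell_sets] and i2 = i[OF elim(2) cell_sets]
        show ?thesis
          unfolding integral_scaleR_right[symmetric]
          by (intro bint_add integrable_scaleR_right i1 i2)
      qed
      finally show "(\<integral>s. (indicator (cell (T/n) (real j - 1)) s / (T/n)) *\<^sub>R (a *\<^sub>R f (s, w) + b *\<^sub>R g (s, w)) \<partial>?L)
         = a *\<^sub>R (\<integral>s. (indicator (cell (T/n) (real j - 1)) s / (T/n)) *\<^sub>R f (s, w) \<partial>?L) + b *\<^sub>R (\<integral>s. (indicator (cell (T/n) (real j - 1)) s / (T/n)) *\<^sub>R g (s, w) \<partial>?L)" .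
    qed
  qed
  then obtain Z where Z: "Z \<in> null_sets M" "{w\<in>space M. \<not> (\<forall>i. avg T (T/n) (\<lambda>z. a *\<^sub>R f z + b *\<^sub>R g z) i w = a *\<^sub>R avg T (T/n) f i w + b *\<^sub>R avg T (T/n) g i w)} \<subseteq> Z"
    by (auto simp: eventually_ae_filter)
  have "AE z in NT T. snd z \<in> space M - Z"
    by (rule P.AE_pair_measure) (use Z AE_not_in[OF Z(1)] in \<open>auto intro!: measurable_sets_Collect[OF measurable_snd] simp: sets.sets_into_space\<close>)
  then show ?thesis
  proof eventually_elim
    case (elim z)
    with Z have "avg T (T/n) (\<lambda>z. a *\<^sub>R f z + b *\<^sub>R g z) i (snd z) = a *\<^sub>R avg T (T/n) f i (snd z) + b *\<^sub>R avg T (T/n) g i (snd z)" for i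
      by blast
    then show ?case
      unfolding stepavg_def scaleR_sum_right sum.distrib[symmetric]
      by (intro sum.cong refl) (simp only: scaleR_add_right scaleR_scaleR mult.commute)
  qed
qed

text \<open>
  The class of integrands for which the averages converge. It is linear and closed in \<open>L\<^sup>2\<close>, so that it is enough to find the indicators of rectangles in it.
\<close>

definition apx :: "real => (real \<times> 'w => 'b::euclidean_space) => bool" where
  "apx T f \<longleftrightarrow> sq_int (NT T) f \<and> (\<lambda>n. msq (NT T) (\<lambda>z. stepavg T (Suc n) f z - f z)) \<longlonglongrightarrow> 0"

lemma apx_lincomb:
  fixes f g :: "real \<times> 'w => 'b::euclidean_space"
  assumes T: "T > 0" and f: "apx T f" and g: "apx T g"
  shows "apx T (\<lambda>z. a *\<^sub>R f z + b *\<^sub>R g z)"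
proof -
  let ?k = "\<lambda>z. a *\<^sub>R f z + b *\<^sub>R g z"
  have sf: "sq_int (NT T) f" "sq_int (NT T) g" using f g by (auto simp: apx_def)
  have sk: "sq_int (NT T) ?k" by (intro sq_int_add sq_int_scaleR sf)
  have st: "sq_int (NT T) (stepavg T (Suc n) k)" if "sq_int (NT T) k" for n and k :: "real \<times> 'w => 'b"
    by (rule stepavg_sq_int[OF T _ that]) simp
  let ?df = "\<lambda>n z. stepavg T (Suc n) f z - f z" and ?dg = "\<lambda>n z. stepavg T (Suc n) g z - g z"
  have s: "sq_int (NT T) (?df n)" "sq_int (NT T) (?dg n)" for n by (intro sq_int_diff st sf)+
  have le: "msq (NT T) (\<lambda>z. stepavg T (Suc n) ?k z - ?k z) <= 2 * (a^2 * msq (NT T) (?df n)) + 2 * (b^2 * msq (NT T) (?dg n))" for n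
  proof -
    have "msq (NT T) (\<lambda>z. stepavg T (Suc n) ?k z - ?k z) = msq (NT T) (\<lambda>z. a *\<^sub>R ?df n z + b *\<^sub>R ?dg n z)"
    proof (rule msq_cong_AE)
      show "AE z in NT T. stepavg T (Suc n) ?k z - ?k z = a *\<^sub>R ?df n z + b *\<^sub>R ?dg n z"
        using stepavg_linear[OF T sf, of "Suc n" a b] by eventually_elim (simp add: algebra_simps)
      show "(\<lambda>z. stepavg T (Suc n) ?k z - ?k z) \<in> borel_measurable (NT T)"
        by (rule sq_int_measurable[OF sq_int_diff[OF st[OF sk] sk]])
      show "(\<lambda>z. a *\<^sub>R ?df n z + b *\<^sub>R ?dg n z) \<in> borel_measurable (NT T)"
        by (rule sq_int_measurable) (intro sq_int_add sq_int_scaleR s)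
    qed
    also have "... <= 2 * msq (NT T) (\<lambda>z. a *\<^sub>R ?df n z) + 2 * msq (NT T) (\<lambda>z. b *\<^sub>R ?dg n z)"
      by (rule msq_add_le) (intro sq_int_scaleR s)+
    finally show ?thesis by (simp add: msq_scaleR)
  qed
  have "(\<lambda>n. msq (NT T) (\<lambda>z. stepavg T (Suc n) ?k z - ?k z)) \<longlonglongrightarrow> 0"
  proof (rule tendsto_sandwich[OF _ _ tendsto_const])
    show "\<forall>\<^sub>F n in sequentially. msq (NT T) (\<lambda>z. stepavg T (Suc n) ?k z - ?k z) <= 2 * (a^2 * msq (NT T) (?df n)) + 2 * (b^2 * msq (NT T) (?dg n))"
      using le by simp
    show "(\<lambda>n. 2 * (a^2 * msq (NT T) (?df n)) + 2 * (b^2 * msq (NT T) (?dg n))) \<longlonglongrightarrow> 0"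
      using f g unfolding apx_def by (auto intro!: tendsto_eq_intros)
  qed (simp add: msq_nonneg)
  then show ?thesis using sk by (simp add: apx_def)
qed

text \<open>
  The contraction makes the averaging operators uniformly bounded, so that convergence passes to limits.
\<close>

lemma apx_limit:
  fixes f :: "real \<times> 'w => 'b::euclidean_space"
  assumes T: "T > 0" and g: "\<And>m. apx T (g m)" and f: "sq_int (NT T) f"
    and lim: "(\<lambda>m. msq (NT T) (\<lambda>z. g m z - f z)) \<longlonglongrightarrow> 0"
  shows "apx T f"
proof -
  have sg: "sq_int (NT T) (g m)" for m using g by (auto simp: apx_def)
  have st: "sq_int (NT T) (stepavg T (Suc n) k)" if "sq_int (NT T) k" for n and k :: "real \<times> 'w => 'b"
    by (rule stepavg_sq_int[OF T _ that]) simp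
  have le: "msq (NT T) (\<lambda>z. stepavg T (Suc n) f z - f z)
      <= 6 * msq (NT T) (\<lambda>z. g m z - f z) + 4 * msq (NT T) (\<lambda>z. stepavg T (Suc n) (g m) z - g m z)" for n m
  proof -
    have "msq (NT T) (\<lambda>z. stepavg T (Suc n) f z - f z)
      <= 2 * msq (NT T) (\<lambda>z. stepavg T (Suc n) f z - stepavg T (Suc n) (g m) z) + 2 * msq (NT T) (\<lambda>z. stepavg T (Suc n) (g m) z - f z)"
      by (intro msq_triangle st f sg)
    also have "msq (NT T) (\<lambda>z. stepavg T (Suc n) f z - stepavg T (Suc n) (g m) z) = msq (NT T) (stepavg T (Suc n) (\<lambda>z. f z - g m z))"
    proof (rule msq_cong_AE)
      show "AE z in NT T. stepavg T (Suc n) f z - stepavg T (Suc n) (g m) z = stepavg T (Suc n) (\<lambda>z. f z - g m z) z"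
        using stepavg_linear[OF T f sg[of m], of "Suc n" 1 "-1"] by eventually_elim simp
    qed (intro sq_int_measurable sq_int_diff st f sg)+
    also have "... <= msq (NT T) (\<lambda>z. f z - g m z)"
      by (rule stepavg_contraction[OF T _ sq_int_diff[OF f sg]]) simp
    also have "... = msq (NT T) (\<lambda>z. g m z - f z)" by (rule msq_commute)
    also have "msq (NT T) (\<lambda>z. stepavg T (Suc n) (g m) z - f z)
      <= 2 * msq (NT T) (\<lambda>z. stepavg T (Suc n) (g m) z - g m z) + 2 * msq (NT T) (\<lambda>z. g m z - f z)"
      by (intro msq_triangle st f sg)
    finally show ?thesis by simp
  qed
  have "(\<lambda>n. msq (NT T) (\<lambda>z. stepavg T (Suc n) f z - f z)) \<longlonglongrightarrow> 0"
  proof (rule LIMSEQ_I)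
    fix e :: real assume e: "e > 0"
    obtain m where m: "msq (NT T) (\<lambda>z. g m z - f z) < e / 12"
      using order_tendstoD(2)[OF lim, of "e / 12"] e by (auto simp: eventually_sequentially)
    have "(\<lambda>n. msq (NT T) (\<lambda>z. stepavg T (Suc n) (g m) z - g m z)) \<longlonglongrightarrow> 0" using g[of m] by (simp add: apx_def)
    then obtain n0 where n0: "\<And>n. n \<ge> n0 ==> msq (NT T) (\<lambda>z. stepavg T (Suc n) (g m) z - g m z) < e / 8"
      using order_tendstoD(2)[of _ 0 sequentially "e / 8"] e by (auto simp: eventually_sequentially)
    have "msq (NT T) (\<lambda>z. stepavg T (Suc n) f z - f z) < e" if "n \<ge> n0" for n
      using le[of n m] m n0[OF that] by linarith
    then show "\<exists>n0. \<forall>n\<ge>n0. norm (msq (NT T) (\<lambda>z. stepavg T (Suc n) f z - f z) - 0) < e"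
      by (intro exI[of _ n0]) (auto simp: msq_nonneg)
  qed
  then show ?thesis using f by (simp add: apx_def)
qed

lemma apx_AE:
  fixes f :: "real \<times> 'w => 'b::euclidean_space"
  assumes T: "T > 0" and g: "apx T g" and f: "f \<in> borel_measurable (NT T)" and eq: "AE z in NT T. g z = f z"
  shows "apx T f"
proof (rule apx_limit[OF T g])
  have sg: "sq_int (NT T) g" using g by (simp add: apx_def)
  show sf: "sq_int (NT T) f" by (rule sq_int_cong_AE[OF sg eq f])
  have "msq (NT T) (\<lambda>z. g z - f z) = msq (NT T) (\<lambda>z. 0 :: 'b)"
    by (rule msq_cong_AE) (use eq sq_int_measurable[OF sq_int_diff[OF sg sf]] in auto)
  then show "(\<lambda>m. msq (NT T) (\<lambda>z. g z - f z)) \<longlonglongrightarrow> 0" by (simp add: msq_def)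
qed

lemma apx_sum:
  fixes f :: "'i => real \<times> 'w => 'b::euclidean_space"
  assumes T: "T > 0" and f: "\<And>i. i \<in> I ==> apx T (f i)"
  shows "apx T (\<lambda>z. \<Sum>i\<in>I. c i *\<^sub>R f i z)"
  using f
proof (induction I rule: infinite_finite_induct)
  case (insert i I)
  then show ?case using apx_lincomb[OF T, of "f i" "\<lambda>z. \<Sum>i\<in>I. c i *\<^sub>R f i z" "c i" 1] by simp
qed (simp_all add: apx_def stepavg_def avg_def msq_def)

lemma apx_scale: "T > 0 ==> apx T f ==> apx T (\<lambda>z. c *\<^sub>R f z)"
  using apx_sum[of T "{()}" "\<lambda>_. f" "\<lambda>_. c"] by simp

lemma sq_int_indicator_NT: "A \<in> sets (NT T) ==> sq_int (NT T) (indicat_real A)"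
proof -
  interpret N: finite_measure "NT T" by (rule finite_NT)
  assume A: "A \<in> sets (NT T)"
  then have "indicat_real A \<in> borel_measurable (NT T)" by simp
  then show ?thesis
    by (rule sq_int_dominated[OF _ N.sq_int_const[of "1::real"], of _ 1]) (auto simp: indicator_def)
qed

lemma stepavg_at:
  assumes T: "T > 0" "n > 0" and z: "fst z \<in> cell (T/n) (real i)" "i < n"
  shows "stepavg T n f z = avg T (T/n) f i (snd z)"
proof -
  have "stepavg T n f z = (\<Sum>j<n. if j = i then avg T (T/n) f i (snd z) else 0)"
    unfolding stepavg_def
  proof (rule sum.cong[OF refl])
    fix j
    have "cell (T/n) (real i) \<inter> cell (T/n) (real j) = {}" if "j \<noteq> i"
      using cell_disjoint[of "T/n" "int i" "int j"] T that by simp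
    then show "indicat_real (cell (T/n) (real j)) (fst z) *\<^sub>R avg T (T/n) f j (snd z) =
         (if j = i then avg T (T/n) f i (snd z) else 0)"
      using z by (auto simp: indicator_def)
  qed
  also have "... = avg T (T/n) f i (snd z)" using z by (subst sum.delta) auto
  finally show ?thesis .
qed

lemma cell_exists:
  assumes "T > 0" "n > 0" "s \<in> {0<..T}"
  shows "\<exists>i<n. s \<in> cell (T / real n) (real i)"
proof -
  define h where "h = T / real n"
  have h: "h > 0" using assms by (simp add: h_def)
  define i where "i = nat (\<lceil>s / h\<rceil> - 1)"
  have "s / h > 0" using assms h by simp
  then have c: "\<lceil>s / h\<rceil> \<ge> 1" by linarith
  then have i: "real i = of_int \<lceil>s / h\<rceil> - 1" by (simp add: i_def)
  have "real i < s / h" "s / h <= real i + 1" unfolding i by linarith+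
  then have "real i * h < s" "s <= (real i + 1) * h" using h by (simp_all add: field_simps)
  moreover have "i < n"
  proof -
    have "s / h <= T / h" using assms h by (intro divide_right_mono) auto
    also have "T / h = real n" using assms by (simp add: h_def)
    finally have "\<lceil>s / h\<rceil> <= int n" by linarith
    with i show ?thesis by linarith
  qed
  ultimately show ?thesis by (auto simp: cell_def h_def)
qed

text \<open>
  For the indicator of \<open>{..a}\<close> in time, the shifted average differs from the function only on the first
cell and within two cells of \<open>a\<close>, and there by at most one.
\<close>

lemma apx_halfline:
  assumes T: "T > 0" and B: "B \<in> sets M"
  shows "apx T (indicat_real (({..a} \<inter> {0..T}) \<times> B))"
proof -
  let ?L = "LT T"
  let ?f = "indicat_real (({..a} \<inter> {0..T}) \<times> B)"
  have "{..a} \<inter> {0..T} \<in> sets ?L" by (auto simp: sets_restrict_space)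
  then have sf: "sq_int (NT T) ?f" by (intro sq_int_indicator_NT pair_measureI B)
  have bound: "msq (NT T) (\<lambda>z. stepavg T (Suc n) ?f z - ?f z) <= 5 * (T / real (Suc n))" for n
  proof -
    define h where "h = T / real (Suc n)"
    have h: "h > 0" using T by (simp add: h_def)
    let ?E = "{0..h} \<union> {a - 2*h..a + 2*h}"
    have pt: "\<bar>stepavg T (Suc n) ?f z - ?f z\<bar> <= indicator ?E (fst z)" if z: "z \<in> space (NT T)" for z
    proof (cases "fst z = 0")
      case True
      then have "stepavg T (Suc n) ?f z = 0"
        unfolding stepavg_def h_def[symmetric]
      proof (intro sum.neutral ballI)
        fix i
        have "0 \<notin> cell h (real i)" using h by (simp add: cell_def not_less)
        with True show "indicat_real (cell h (real i)) (fst z) *\<^sub>R avg T h ?f i (snd z) = 0" by simp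
      qed
      with True h show ?thesis by (auto simp: indicator_def)
    next
      case False
      have sz: "fst z \<in> {0<..T}" "snd z \<in> space M" using z False by (auto simp: space_pair_measure)
      obtain i where i: "i < Suc n" "fst z \<in> cell h (real i)" using cell_exists[OF T _ sz(1), of "Suc n"] by (auto simp: h_def)
      have st: "stepavg T (Suc n) ?f z = avg T h ?f i (snd z)"
        using stepavg_at[OF T _ _ i(1)] i(2) by (simp add: h_def)
      have av: "avg T h ?f i (snd z) = indicator B (snd z) * (\<integral>s. indicator (cell h (real i - 1) \<inter> {..a}) s \<partial>?L) / h"
      proof -
        have "avg T h ?f i (snd z) = (\<integral>s. (indicator B (snd z) / h) * indicator (cell h (real i - 1) \<inter> {..a}) s \<partial>?L)"
          unfolding avg_def by (intro bint_cong) (auto simp: indicator_def)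
        then show ?thesis by simp
      qed
      have m: "indicat_real (cell h (real i - 1) \<inter> {..a}) \<in> borel_measurable ?L"
        by (rule measurable_compose[OF measurable_id_lebesgue_on]) simp
      have le: "(\<integral>s. indicator (cell h (real i - 1) \<inter> {..a}) s \<partial>?L) <= h"
        by (rule order_trans[OF integral_mono integral_cell_le(2)[OF h, where x="real i - 1"]])
           (use integral_cell_le(1)[OF h] m in \<open>auto intro!: L.integrable_const_bound[of _ 1] simp: indicator_def\<close>)
      have ge: "0 <= (\<integral>s. indicat_real (cell h (real i - 1) \<inter> {..a}) s \<partial>?L)" by simp
      have av01: "0 <= avg T h ?f i (snd z)" "avg T h ?f i (snd z) <= 1"
      proof -
        define c where "c = (\<integral>s. indicat_real (cell h (real i - 1) \<inter> {..a}) s \<partial>?L)"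
        have "avg T h ?f i (snd z) = indicator B (snd z) * c / h" "0 <= c" "c <= h"
          using av le ge by (simp_all only: c_def)
        then show "0 <= avg T h ?f i (snd z)" "avg T h ?f i (snd z) <= 1"
          using h by (auto simp: indicator_def)
      qed
      have f01: "0 <= ?f z" "?f z <= 1" by (auto simp: indicator_def)
      show ?thesis
      proof (cases "fst z \<in> ?E")
        case True
        then have "indicat_real ?E (fst z) = 1" by simp
        with av01 f01 show ?thesis unfolding st abs_le_iff by linarith
      next
        case no: False
        have i1: "i \<noteq> 0"
        proof
          assume "i = 0"
          with i(2) have "fst z \<in> {0..h}" by (simp add: cell_def)
          with no show False by blast
        qed
        then have ri: "real i \<ge> 1" by simp
        have cl: "real i * h < fst z" "fst z <= real i * h + h" using i(2) by (auto simp: cell_def algebra_simps)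
        have cprev: "cell h (real i - 1) = {real i * h - h<..real i * h}" by (simp add: cell_def algebra_simps)
        consider "a < fst z - 2*h" | "fst z + 2*h < a" using no by fastforce
        then have "avg T h ?f i (snd z) = ?f z"
        proof cases
          case 1
          then have "cell h (real i - 1) \<inter> {..a} = {}" unfolding cprev using cl by auto
          moreover have "?f z = 0" using 1 h by (auto simp: indicator_def)
          ultimately show ?thesis unfolding av by simp
        next
          case 2
          then have "cell h (real i - 1) \<inter> {..a} = cell h (real i - 1)" unfolding cprev using cl h by auto
          moreover have "(\<integral>s. indicator (cell h (real i - 1)) s \<partial>?L) = h"
          proof (rule integral_cell_le(3)[OF h])
            have "real i * h <= real (Suc n) * h" using i(1) h by (intro mult_right_mono) auto
            also have "... = T" by (simp add: h_def)
            finally show "(real i - 1 + 1) * h <= T" by simp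
          qed (use ri in simp)
          moreover have "?f z = indicator B (snd z)" using 2 h sz(1) by (cases z) (auto simp: indicator_def)
          ultimately show ?thesis unfolding av using h by simp
        qed
        then show ?thesis unfolding st by simp
      qed
    qed
    have sE: "{0..h} \<in> sets borel" "{a - 2*h..a + 2*h} \<in> sets borel" by auto
    have iI: "integrable ?L (indicat_real A)" "(\<integral>s. indicator A s \<partial>?L) = measure lebesgue ({0..T} \<inter> A)"
      if "A \<in> sets borel" for A
    proof -
      have "indicat_real A \<in> borel_measurable ?L" by (rule measurable_compose[OF measurable_id_lebesgue_on]) (use that in simp)
      then show "integrable ?L (indicat_real A)" by (intro L.integrable_const_bound[of _ 1]) (auto simp: indicator_def)
      show "(\<integral>s. indicator A s \<partial>?L) = measure lebesgue ({0..T} \<inter> A)"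
        by (subst integral_restrict_space) (use that in \<open>auto simp: indicator_inter_arith[symmetric]\<close>)
    qed
    have l1: "(\<integral>s. indicator {0..h} s \<partial>?L) <= h"
    proof -
      have "measure lebesgue ({0..T} \<inter> {0..h}) <= measure lebesgue {0..h}" by (rule measure_mono_fmeasurable) auto
      also have "measure lebesgue {0..h} = h" using h by simp
      finally show ?thesis unfolding iI(2)[OF sE(1)] .
    qed
    have l2: "(\<integral>s. indicator {a - 2*h..a + 2*h} s \<partial>?L) <= 4 * h"
    proof -
      have "measure lebesgue ({0..T} \<inter> {a - 2*h..a + 2*h}) <= measure lebesgue {a - 2*h..a + 2*h}" by (rule measure_mono_fmeasurable) auto
      also have "measure lebesgue {a - 2*h..a + 2*h} = 4 * h" using h by simp
      finally show ?thesis unfolding iI(2)[OF sE(2)] .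
    qed
    have one: "integrable M (\<lambda>_. 1::real)" by simp
    have iE: "integrable (NT T) (\<lambda>z. indicator {0..h} (fst z) * 1 + indicator {a - 2*h..a + 2*h} (fst z) * (1::real))"
      by (intro bint_add_int integral_NT_product(1) iI(1) sE one)
    have "msq (NT T) (\<lambda>z. stepavg T (Suc n) ?f z - ?f z) <= (\<integral>z. indicator {0..h} (fst z) * 1 + indicator {a - 2*h..a + 2*h} (fst z) * 1 \<partial>NT T)"
      unfolding msq_def
    proof (rule integral_mono[OF _ iE])
      show "integrable (NT T) (\<lambda>z. (norm (stepavg T (Suc n) ?f z - ?f z))^2)"
        by (intro sq_int_integrable sq_int_diff stepavg_sq_int sf T) simp
      fix z assume "z \<in> space (NT T)"
      then have "\<bar>stepavg T (Suc n) ?f z - ?f z\<bar>^2 <= (indicator ?E (fst z))^2" by (intro power_mono pt) auto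
      also have "... <= indicator {0..h} (fst z) * 1 + indicator {a - 2*h..a + 2*h} (fst z) * 1" by (auto simp: indicator_def)
      finally show "(norm (stepavg T (Suc n) ?f z - ?f z))^2 <= indicator {0..h} (fst z) * 1 + indicator {a - 2*h..a + 2*h} (fst z) * 1" by simp
    qed
    also have "... = (\<integral>s. indicator {0..h} s \<partial>?L) + (\<integral>s. indicator {a - 2*h..a + 2*h} s \<partial>?L)"
      by (subst bint_add)
         (simp_all only: integral_NT_product[OF iI(1)[OF sE(1)] one] integral_NT_product[OF iI(1)[OF sE(2)] one] prob_space lebesgue_integral_const, simp add: prob_space)
    also have "... <= 5 * h" using l1 l2 by simp
    finally show ?thesis by (simp add: h_def)
  qed
  have "(\<lambda>n. msq (NT T) (\<lambda>z. stepavg T (Suc n) ?f z - ?f z)) \<longlonglongrightarrow> 0"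
  proof (rule tendsto_sandwich[OF _ _ tendsto_const])
    show "\<forall>\<^sub>F n in sequentially. msq (NT T) (\<lambda>z. stepavg T (Suc n) ?f z - ?f z) <= 5 * (T * inverse (real (Suc n)))"
      using bound by (simp add: divide_inverse)
    show "(\<lambda>n. 5 * (T * inverse (real (Suc n)))) \<longlonglongrightarrow> 0"
      by (intro tendsto_mult_right_zero LIMSEQ_inverse_real_of_nat)
  qed (simp add: msq_nonneg)
  then show ?thesis using sf by (simp add: apx_def)
qed

lemma apx_disjoint_UN:
  assumes T: "T > 0" and A: "\<And>i::nat. apx T (indicat_real (A i))" "\<And>i. A i \<in> sets (NT T)" and d: "disjoint_family A"
  shows "apx T (indicat_real (\<Union>i. A i))"
proof (rule apx_limit[OF T])
  interpret N: finite_measure "NT T" by (rule finite_NT)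
  let ?g = "\<lambda>m z. \<Sum>i<m. 1 *\<^sub>R indicat_real (A i) z"
  show "apx T (?g m)" for m by (rule apx_sum[OF T A(1)])
  have U: "(\<Union>i. A i) \<in> sets (NT T)" using A(2) by auto
  show "sq_int (NT T) (indicat_real (\<Union>i. A i))" by (rule sq_int_indicator_NT[OF U])
  have g: "?g m z = indicator (\<Union>i<m. A i) z" for m z
  proof -
    have "indicat_real (\<Union>i<m. A i) z = (\<Sum>i<m. indicator (A i) z)"
      by (rule indicator_UN_disjoint) (use d in \<open>auto simp: disjoint_family_on_def\<close>)
    then show ?thesis by simp
  qed
  have "(\<lambda>m. \<integral>z. (norm (?g m z - indicator (\<Union>i. A i) z))^2 \<partial>NT T) \<longlonglongrightarrow> (\<integral>z. 0 \<partial>NT T)"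
  proof (rule integral_dominated_convergence[where w="\<lambda>_. 1"])
    show "AE z in NT T. (\<lambda>m. (norm (?g m z - indicator (\<Union>i. A i) z))^2) \<longlonglongrightarrow> 0"
    proof (rule AE_I2)
      fix z
      have "\<forall>\<^sub>F m in sequentially. (norm (?g m z - indicator (\<Union>i. A i) z))^2 = 0"
      proof (cases "\<exists>i. z \<in> A i")
        case True
        then obtain i where "z \<in> A i" by blast
        then show ?thesis unfolding g
          by (intro eventually_sequentiallyI[of "Suc i"]) (auto simp: indicator_def)
      next
        case False
        then show ?thesis unfolding g by (auto simp: indicator_def)
      qed
      then show "(\<lambda>m. (norm (?g m z - indicator (\<Union>i. A i) z))^2) \<longlonglongrightarrow> 0" by (rule tendsto_eventually)
    qed
    show "AE z in NT T. norm ((norm (?g m z - indicator (\<Union>i. A i) z))^2) <= 1" for m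
      unfolding g by (auto simp: indicator_def)
    show "(\<lambda>z. (norm (?g m z - indicator (\<Union>i. A i) z))^2) \<in> borel_measurable (NT T)" for m
      using A(2) U by measurable
  qed auto
  then show "(\<lambda>m. msq (NT T) (\<lambda>z. ?g m z - indicator (\<Union>i. A i) z)) \<longlonglongrightarrow> 0" by (simp add: msq_def)
qed

lemma apx_compl:
  assumes T: "T > 0" and "apx T (indicat_real A)" "apx T (indicat_real B)" "A \<subseteq> B"
  shows "apx T (indicat_real (B - A))"
proof -
  have "(\<lambda>z. 1 *\<^sub>R indicat_real B z + (-1) *\<^sub>R indicat_real A z) = indicat_real (B - A)"
    using assms(4) by (auto simp: fun_eq_iff indicator_def)
  then show ?thesis using apx_lincomb[OF T assms(3,2), of 1 "-1"] by simp
qed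

text \<open>
  Half-lines generate the Borel sets, and the class is closed under proper differences and disjoint unions.
\<close>

lemma apx_borel_rectangle:
  assumes T: "T > 0" and B: "B \<in> sets M" and A: "A \<in> sets (borel :: real measure)"
  shows "apx T (indicat_real ((A \<inter> {0..T}) \<times> B))"
proof -
  have rect: "(A \<inter> {0..T}) \<times> B \<in> sets (NT T)" if "A \<in> sets borel" for A
    unfolding Int_commute[of A] by (rule pair_measureI[OF _ B]) (use that in \<open>simp add: sets_restrict_space\<close>)
  have bs: "sets (borel :: real measure) = sigma_sets UNIV (range (\<lambda>a. {..a}))"
    by (subst borel_eq_atMost) simp
  have "Int_stable (range (\<lambda>a::real. {..a}))" by (auto simp: Int_stable_def)
  moreover have "range (\<lambda>a::real. {..a}) \<subseteq> Pow UNIV" by simp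
  moreover have "A \<in> sigma_sets UNIV (range (\<lambda>a. {..a}))" using A unfolding bs .
  ultimately show ?thesis
  proof (induction rule: sigma_sets_induct_disjoint)
    case (basic A) then show ?case using apx_halfline[OF T B] by auto
  next
    case empty
    show ?case using apx_scale[OF T apx_halfline[OF T B], of 0] by simp
  next
    case (compl A)
    have "((UNIV - A) \<inter> {0..T}) \<times> B = (({..T} \<inter> {0..T}) \<times> B) - ((A \<inter> {0..T}) \<times> B)" by auto
    then show ?case using apx_compl[OF T compl(2) apx_halfline[OF T B, of T]] by auto
  next
    case (union A)
    have "((\<Union>i. A i) \<inter> {0..T}) \<times> B = (\<Union>i. (A i \<inter> {0..T}) \<times> B)" by auto
    moreover have "A i \<in> sets borel" for i using union(2) unfolding bs by auto
    moreover have "disjoint_family (\<lambda>i. (A i \<inter> {0..T}) \<times> B)"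
      using union(1) unfolding disjoint_family_on_def by blast
    ultimately show ?case
      using union by (simp only:) (intro apx_disjoint_UN[OF T] rect, auto)
  qed
qed

text \<open>
  A Lebesgue set differs from a Borel set by a null set, which the class ignores.
\<close>

lemma apx_rectangle:
  assumes T: "T > 0" and B: "B \<in> sets M" and A: "A \<in> sets (LT T)"
  shows "apx T (indicat_real (A \<times> B))"
proof -
  interpret P: pair_sigma_finite "LT T" M by (rule pair_sigma_finite_time)
  have Al: "A \<in> sets lebesgue" "A \<subseteq> {0..T}" using A by (auto simp: sets_restrict_space_iff)
  from sets_completionE[OF Al(1)] obtain S N N' where S: "A = S \<union> N" "N \<subseteq> N'" "N' \<in> null_sets lborel" "S \<in> sets lborel" by metis
  have "AE s in lebesgue. s \<in> S \<longleftrightarrow> s \<in> A"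
    by (rule AE_I'[of N']) (use S in \<open>auto intro: null_sets_completionI\<close>)
  then have AE1: "AE s in LT T. s \<in> S \<longleftrightarrow> s \<in> A" by (subst AE_restrict_space_iff) auto
  have m: "A \<times> B \<in> sets (NT T)" by (rule pair_measureI[OF A B])
  show ?thesis
  proof (rule apx_AE[OF T apx_borel_rectangle[OF T B, of S]])
    show "S \<in> sets borel" using S by simp
    have "AE z in NT T. fst z \<in> S \<longleftrightarrow> fst z \<in> A"
    proof (rule P.AE_pair_measure)
      have [measurable]: "S \<in> sets borel" using S by simp
      have "{z \<in> space (NT T). fst z \<in> A} = A \<times> space M" using Al by (auto simp: space_pair_measure)
      then have "{z \<in> space (NT T). fst z \<in> A} \<in> sets (NT T)" using A by auto
      moreover have "{z \<in> space (NT T). fst z \<in> S} \<in> sets (NT T)" by measurable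
      ultimately have [measurable]: "Measurable.pred (NT T) (\<lambda>z. fst z \<in> S)" "Measurable.pred (NT T) (\<lambda>z. fst z \<in> A)"
        by (auto simp: pred_def)
      show "{z \<in> space (NT T). (fst z \<in> S) = (fst z \<in> A)} \<in> sets (NT T)" by measurable
      show "AE x in LT T. AE y in M. (fst (x, y) \<in> S) = (fst (x, y) \<in> A)"
        using AE1 by eventually_elim simp
    qed
    then show "AE z in NT T. indicat_real ((S \<inter> {0..T}) \<times> B) z = indicat_real (A \<times> B) z"
      using AE_space[of "NT T"] by eventually_elim (auto simp: indicator_def space_pair_measure mem_Times_iff)
    show "indicat_real (A \<times> B) \<in> borel_measurable (NT T)" using m by simp
  qed
qed

lemma apx_set:
  assumes T: "T > 0" and A: "A \<in> sets (NT T)" shows "apx T (indicat_real A)"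
proof -
  let ?L = "LT T"
  have sp: "space (NT T) \<in> {a \<times> b |a b. a \<in> sets ?L \<and> b \<in> sets M}"
    unfolding space_pair_measure by blast
  note Int_stable_pair_measure_generator[of ?L M]
  moreover have "{a \<times> b |a b. a \<in> sets ?L \<and> b \<in> sets M} \<subseteq> Pow (space ?L \<times> space M)"
    by (rule pair_measure_closed)
  moreover have "A \<in> sigma_sets (space ?L \<times> space M) {a \<times> b |a b. a \<in> sets ?L \<and> b \<in> sets M}"
    using A unfolding sets_pair_measure .
  ultimately show ?thesis
  proof (induction rule: sigma_sets_induct_disjoint)
    case (basic A) then show ?case using apx_rectangle[OF T] by auto
  next
    case empty
    show ?case using apx_scale[OF T apx_rectangle[OF T sets.empty_sets sets.empty_sets], of 0] by simp
  next
    case (compl A)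
    have "A \<in> sets (NT T)" unfolding sets_pair_measure by (rule compl(1))
    then have "A \<subseteq> space ?L \<times> space M" using sets.sets_into_space[of A "NT T"] by (simp add: space_pair_measure)
    then show ?case by (intro apx_compl[OF T compl(2)] apx_rectangle[OF T]) auto
  next
    case (union A)
    have "A i \<in> sets (NT T)" for i unfolding sets_pair_measure using union(2) by auto
    then show ?case using union by (intro apx_disjoint_UN[OF T]) auto
  qed
qed

lemma apx_real:
  fixes f :: "real \<times> 'w => real"
  assumes T: "T > 0" and f: "sq_int (NT T) f" shows "apx T f"
proof -
  obtain G where G: "\<And>i. simple_function (NT T) (G i)" "\<And>x. x \<in> space (NT T) ==> (\<lambda>i. G i x) \<longlonglongrightarrow> f x"
    "\<And>i x. x \<in> space (NT T) ==> dist (G i x) 0 <= 2 * dist (f x) 0"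
    using borel_measurable_implies_sequence_metric[OF sq_int_measurable[OF f], of 0] by metis
  have Gm: "G i \<in> borel_measurable (NT T)" for i by (rule borel_measurable_simple_function[OF G(1)])
  have sG: "sq_int (NT T) (G i)" for i
    by (rule sq_int_dominated[OF Gm f, of _ 2]) (use G(3) in \<open>auto intro!: AE_I2\<close>)
  show ?thesis
  proof (rule apx_limit[OF T _ f])
    fix i
    let ?h = "\<lambda>x. \<Sum>y\<in>G i ` space (NT T). y *\<^sub>R indicat_real (G i -` {y} \<inter> space (NT T)) x"
    have fin: "finite (G i ` space (NT T))" using G(1)[of i] by (simp add: simple_function_def)
    have "apx T ?h"
      by (intro apx_sum[OF T] apx_set[OF T]) (use G(1)[of i] in \<open>auto simp: simple_function_def\<close>)
    then show "apx T (G i)"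
    proof (rule apx_AE[OF T _ Gm], intro AE_I2)
      fix x assume x: "x \<in> space (NT T)"
      have "?h x = (\<Sum>y\<in>G i ` space (NT T). if y = G i x then G i x else 0)"
        by (intro sum.cong) (use x in \<open>auto simp: indicator_def\<close>)
      also have "... = G i x" using fin x by (subst sum.delta) auto
      finally show "?h x = G i x" .
    qed
  next
    have "(\<lambda>m. \<integral>z. (norm (G m z - f z))^2 \<partial>NT T) \<longlonglongrightarrow> (\<integral>z. 0 \<partial>NT T)"
    proof (rule integral_dominated_convergence[where w="\<lambda>z. 9 * (norm (f z))^2"])
      show "integrable (NT T) (\<lambda>z. 9 * (norm (f z))^2)" using f by (simp add: sq_int_def)
      show "AE z in NT T. (\<lambda>m. (norm (G m z - f z))^2) \<longlonglongrightarrow> 0"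
      proof (rule AE_I2)
        fix z assume "z \<in> space (NT T)"
        from tendsto_power[OF tendsto_norm[OF LIM_zero[OF G(2)[OF this]]], of 2]
        show "(\<lambda>m. (norm (G m z - f z))^2) \<longlonglongrightarrow> 0" by simp
      qed
      show "AE z in NT T. norm ((norm (G m z - f z))^2) <= 9 * (norm (f z))^2" for m
      proof (rule AE_I2)
        fix z assume "z \<in> space (NT T)"
        from G(3)[OF this, of m] have "norm (G m z - f z) <= 3 * norm (f z)"
          using norm_triangle_ineq4[of "G m z" "f z"] by simp
        then have "(norm (G m z - f z))^2 <= (3 * norm (f z))^2" by (rule power_mono) simp
        then show "norm ((norm (G m z - f z))^2) <= 9 * (norm (f z))^2" by (simp add: power_mult_distrib)
      qed
      show "(\<lambda>z. (norm (G m z - f z))^2) \<in> borel_measurable (NT T)" for m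
        using Gm[of m] sq_int_measurable[OF f] by measurable
    qed auto
    then show "(\<lambda>m. msq (NT T) (\<lambda>z. G m z - f z)) \<longlonglongrightarrow> 0" by (simp add: msq_def)
  qed
qed

lemma stepavg_inner:
  fixes f :: "real \<times> 'w => 'b::euclidean_space"
  assumes T: "T > 0" and f: "sq_int (NT T) f"
  shows "AE z in NT T. stepavg T n f z \<bullet> b = stepavg T n (\<lambda>z. f z \<bullet> b) z"
proof -
  let ?L = "LT T"
  interpret P: pair_sigma_finite ?L M by (rule pair_sigma_finite_time)
  have "AE w in M. \<forall>i. avg T (T/n) f i w \<bullet> b = avg T (T/n) (\<lambda>z. f z \<bullet> b) i w"
    using sq_int_slices[OF f]
  proof eventually_elim
    case (elim w)
    note [measurable] = sq_int_measurable[OF elim]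
    show ?case unfolding avg_def
    proof
      fix i
      let ?A = "cell (T/n) (real i - 1)"
      have "indicat_real ?A \<in> borel_measurable ?L"
        by (rule measurable_compose[OF measurable_id_lebesgue_on]) simp
      then have "(\<lambda>s. (indicator ?A s / (T/n)) *\<^sub>R f (s, w)) \<in> borel_measurable ?L" by measurable
      then have "sq_int ?L (\<lambda>s. (indicator ?A s / (T/n)) *\<^sub>R f (s, w))"
        by (rule sq_int_dominated[OF _ elim, of _ "\<bar>1/(T/n)\<bar>"]) (auto simp: indicator_def)
      from integral_inner_left[OF L.sq_int_imp_integrable[OF this], of b]
      show "(\<integral>s. (indicator ?A s / (T/n)) *\<^sub>R f (s, w) \<partial>?L) \<bullet> b = (\<integral>s. (indicator ?A s / (T/n)) *\<^sub>R (f (s, w) \<bullet> b) \<partial>?L)"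
        by simp
    qed
  qed
  then obtain Z where Z: "Z \<in> null_sets M" "{w\<in>space M. \<not> (\<forall>i. avg T (T/n) f i w \<bullet> b = avg T (T/n) (\<lambda>z. f z \<bullet> b) i w)} \<subseteq> Z"
    by (auto simp: eventually_ae_filter)
  have "AE z in NT T. snd z \<in> space M - Z"
    by (rule P.AE_pair_measure) (use Z AE_not_in[OF Z(1)] in \<open>auto intro!: measurable_sets_Collect[OF measurable_snd] simp: sets.sets_into_space\<close>)
  then show ?thesis
  proof eventually_elim
    case (elim z)
    with Z have "avg T (T/n) f i (snd z) \<bullet> b = avg T (T/n) (\<lambda>z. f z \<bullet> b) i (snd z)" for i
      by blast
    then show ?case by (simp add: stepavg_def inner_sum_left)
  qed
qed

theorem stepavg_tendsto:
  fixes f :: "real \<times> 'w => 'b::euclidean_space"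
  assumes T: "T > 0" and f: "sq_int (NT T) f"
  shows "(\<lambda>n. msq (NT T) (\<lambda>z. stepavg T (Suc n) f z - f z)) \<longlonglongrightarrow> 0"
proof -
  have st: "sq_int (NT T) (stepavg T (Suc n) f)" for n by (rule stepavg_sq_int[OF T _ f]) simp
  have eq: "msq (NT T) (\<lambda>z. stepavg T (Suc n) f z - f z)
      = (\<Sum>b\<in>Basis. msq (NT T) (\<lambda>z. stepavg T (Suc n) (\<lambda>z. f z \<bullet> b) z - f z \<bullet> b))" for n
  proof -
    have "msq (NT T) (\<lambda>z. stepavg T (Suc n) f z - f z) = (\<Sum>b\<in>Basis. msq (NT T) (\<lambda>z. (stepavg T (Suc n) f z - f z) \<bullet> b))"
      by (rule msq_components[OF sq_int_diff[OF st f]])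
    also have "... = (\<Sum>b\<in>Basis. msq (NT T) (\<lambda>z. stepavg T (Suc n) (\<lambda>z. f z \<bullet> b) z - f z \<bullet> b))"
    proof (intro sum.cong refl msq_cong_AE)
      fix b :: 'b
      show "AE z in NT T. (stepavg T (Suc n) f z - f z) \<bullet> b = stepavg T (Suc n) (\<lambda>z. f z \<bullet> b) z - f z \<bullet> b"
        using stepavg_inner[OF T f, of "Suc n" b] by eventually_elim (simp add: inner_diff_left)
      show "(\<lambda>z. (stepavg T (Suc n) f z - f z) \<bullet> b) \<in> borel_measurable (NT T)"
        by (rule sq_int_measurable[OF sq_int_inner_const[OF sq_int_diff[OF st f]]])
      show "(\<lambda>z. stepavg T (Suc n) (\<lambda>z. f z \<bullet> b) z - f z \<bullet> b) \<in> borel_measurable (NT T)"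
        by (intro sq_int_measurable sq_int_diff stepavg_sq_int T sq_int_inner_const f) simp
    qed
    finally show ?thesis .
  qed
  have "(\<lambda>n. \<Sum>b\<in>Basis. msq (NT T) (\<lambda>z. stepavg T (Suc n) (\<lambda>z. f z \<bullet> b) z - f z \<bullet> b)) \<longlonglongrightarrow> (\<Sum>b\<in>(Basis::'b set). 0)"
    using apx_real[OF T sq_int_inner_const[OF f]] by (intro tendsto_sum) (auto simp: apx_def)
  then show ?thesis by (simp add: eq)
qed

lemma avg_adapted:
  fixes f :: "real => 'w => 'b::euclidean_space"
  assumes h: "h > 0" and f: "f \<in> L2p T"
  shows "avg T h (\<lambda>z. f @@ z) i \<in> borel_measurable (F (real i * h))"
proof -
  interpret N: finite_measure "NT T" by (rule finite_NT)
  have sf: "sq_int (NT T) (\<lambda>z. f @@ z)" and fa: "\<And>s. s \<in> {0..T} ==> f s \<in> borel_measurable (F s)"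
    using f by (auto simp: L2_adapted_iff)
  have "(\<lambda>w. \<integral>s. (indicator (cell h (real i - 1)) s / h) *\<^sub>R f s w \<partial>(LT T)) \<in> borel_measurable (F (real i * h))"
  proof (rule time_integral_adapted)
    have "sq_int (NT T) (\<lambda>z. (indicator (cell h (real i - 1)) (fst z) * (1/h)) *\<^sub>R f @@ z)"
      by (rule sq_int_indicator_time[OF sf]) simp
    from N.sq_int_imp_integrable[OF this]
    show "integrable (NT T) (\<lambda>(s, w). (indicator (cell h (real i - 1)) s / h) *\<^sub>R f s w)"
      by (simp add: case_prod_beta')
    fix s assume s: "s \<in> {0..T}"
    show "(\<lambda>w. (indicator (cell h (real i - 1)) s / h) *\<^sub>R f s w) \<in> borel_measurable (F (real i * h))"
    proof (cases "s \<in> cell h (real i - 1)")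
      case True
      then have "s <= real i * h" by (simp add: cell_def)
      from F_measurable_mono[OF this fa[OF s]] show ?thesis by measurable
    qed simp
  qed
  then show ?thesis by (simp add: avg_def[abs_def])
qed

text \<open>
  The step process of the shifted averages is adapted, hence a simple process; it converges by \<open>stepavg_tendsto\<close>.
\<close>

theorem simple_dense:
  fixes f :: "real => 'w => 'b::euclidean_space"
  assumes T: "T > 0" and f: "f \<in> L2p T"
  obtains \<phi> S where "\<And>n::nat. simple_ito_integral M W T (\<phi> n) (S n)"
    "(\<lambda>n. msq (NT T) (\<lambda>z. \<phi> n @@ z - f @@ z)) \<longlonglongrightarrow> 0"
proof -
  let ?f = "\<lambda>z. f @@ z"
  have sf: "sq_int (NT T) ?f" using f by (auto simp: L2_adapted_iff)
  define \<phi> where "\<phi> n s w = stepavg T (Suc n) ?f (s, w)" for n s w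
  define S where "S n w = (\<Sum>i<Suc n. (W (real (Suc i) * (T / real (Suc n))) w - W (real i * (T / real (Suc n))) w) *\<^sub>R avg T (T / real (Suc n)) ?f i w)" for n w
  show thesis
  proof (rule that[of \<phi> S])
    show "(\<lambda>n. msq (NT T) (\<lambda>z. \<phi> n @@ z - f @@ z)) \<longlonglongrightarrow> 0"
      using stepavg_tendsto[OF T sf] by (simp add: \<phi>_def)
    fix n
    define h where "h = T / real (Suc n)"
    have h: "h > 0" using T by (simp add: h_def)
    show "simple_ito_integral M W T (\<phi> n) (S n)"
      unfolding simple_ito_integral_def
    proof (intro exI[of _ "Suc n"] exI[of _ "\<lambda>i. real i * h"] exI[of _ "avg T h ?f"] conjI allI impI)
      show "0 <= real 0 * h" by simp
      show "real (Suc n) * h <= T" by (simp add: h_def)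
      fix i
      show "real i * h <= real (Suc i) * h" using h by (intro mult_right_mono) auto
      show "avg T h ?f i \<in> borel_measurable (F (real i * h))" by (rule avg_adapted[OF h f])
      show "integrable M (\<lambda>w. (norm (avg T h ?f i w))^2)" by (rule sq_int_integrable[OF avg_bound(1)[OF h sf]])
    next
      show "\<phi> n = (\<lambda>s w. \<Sum>i<Suc n. indicator {real i * h<..real (Suc i) * h} s *\<^sub>R avg T h ?f i w)"
        by (simp only: \<phi>_def[abs_def] stepavg_def cell_def h_def fst_conv snd_conv) (simp add: add.commute)
      show "S n = (\<lambda>w. \<Sum>i<Suc n. (W (real (Suc i) * h) w - W (real i * h) w) *\<^sub>R avg T h ?f i w)"
        by (simp only: S_def[abs_def] h_def)
    qed
  qed
qed

end

section \<open>Continuous versions of the Ito integral\<close>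

text \<open>
  Suprema of continuous paths are suprema over the rational grids \<open>k T / (m + 1)\<close>, which makes them
measurable and reduces Doob's inequality to finitely many times.
\<close>

lemma grid_approximation:
  assumes T: "T > 0" and s: "s \<in> {0..T}"
  obtains k where "\<And>m. k m <= Suc m" "(\<lambda>m. real (k m) * T / real (Suc m)) \<longlonglongrightarrow> s"
proof -
  define k where "k m = nat \<lfloor>s * real (Suc m) / T\<rfloor>" for m
  have nn: "0 <= s * real (Suc m) / T" for m using s T by simp
  have k1: "real (k m) <= s * real (Suc m) / T" "s * real (Suc m) / T < real (k m) + 1" for m
    using nn[of m] unfolding k_def by linarith+
  have "s * real (Suc m) / T <= real (Suc m)" for m
    using s T by (simp add: divide_le_eq mult.commute)
  then have 1: "k m <= Suc m" for m using k1(1)[of m] by (metis of_nat_le_iff order_trans)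
  have 2: "norm (real (k m) * T / real (Suc m) - s) <= T * inverse (real (Suc m))" for m
  proof -
    define N where "N = real (Suc m)"
    have N: "N > 0" by (simp add: N_def)
    have a: "real (k m) * T <= s * N" "s * N <= (real (k m) + 1) * T"
      using k1[of m] T unfolding N_def[symmetric] by (simp_all add: pos_le_divide_eq pos_divide_less_eq less_imp_le)
    have "real (k m) * T / N <= s" using a(1) N by (simp add: pos_divide_le_eq)
    moreover have "s <= real (k m) * T / N + T / N" using a(2) N by (simp add: pos_le_divide_eq add_divide_distrib[symmetric] distrib_right)
    moreover have "0 <= T / N" using T N by simp
    ultimately show ?thesis unfolding N_def[symmetric] real_norm_def abs_le_iff divide_inverse[symmetric]
      by (intro conjI) linarith+
  qed
  have "(\<lambda>m. T * inverse (real (Suc m))) \<longlonglongrightarrow> 0"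
    by (intro tendsto_mult_right_zero LIMSEQ_inverse_real_of_nat)
  then have "(\<lambda>m. real (k m) * T / real (Suc m) - s) \<longlonglongrightarrow> 0"
    by (rule Lim_null_comparison[OF always_eventually[OF allI[OF 2]]])
  then have "(\<lambda>m. real (k m) * T / real (Suc m)) \<longlonglongrightarrow> s" by (simp add: LIM_zero_iff)
  with 1 that show thesis by blast
qed

lemma grid_in_interval:
  assumes "T > 0" "k <= Suc m" shows "real k * T / real (Suc m) \<in> {0..T}"
proof -
  have "real k * T <= T * real (Suc m)" using assms by (subst mult.commute) (intro mult_left_mono, auto)
  then have "real k * T / real (Suc m) <= T" by (subst pos_divide_le_eq) auto
  then show ?thesis using assms by simp
qed

definition supsq :: "real => (real => 'w => 'b::real_normed_vector) => 'w => ennreal" where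
  "supsq T X w = (SUP s\<in>{0..T}. ennreal ((norm (X s w))^2))"

lemma supsq_upper: "s \<in> {0..T} ==> ennreal ((norm (X s w))^2) <= supsq T X w"
  unfolding supsq_def by (rule SUP_upper)

lemma supsq_grid:
  assumes T: "T > 0" and c: "continuous_on {0..T} (\<lambda>s. X s w)"
  shows "supsq T X w = (SUP p\<in>{(k,m). k <= Suc m}. ennreal ((norm (X (real (fst p) * T / real (Suc (snd p))) w))^2))"
    (is "_ = ?R")
proof (rule antisym)
  show "supsq T X w <= ?R"
    unfolding supsq_def
  proof (rule SUP_least)
    fix s assume s: "s \<in> {0..T}"
    obtain k where k: "\<And>m. k m <= Suc m" "(\<lambda>m. real (k m) * T / real (Suc m)) \<longlonglongrightarrow> s"
      using grid_approximation[OF T s] by metis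
    have "(\<lambda>m. X (real (k m) * T / real (Suc m)) w) \<longlonglongrightarrow> X s w"
      by (rule continuous_on_tendsto_compose[OF c k(2) s]) (use grid_in_interval[OF T k(1)] in auto)
    then have "(\<lambda>m. ennreal ((norm (X (real (k m) * T / real (Suc m)) w))^2)) \<longlonglongrightarrow> ennreal ((norm (X s w))^2)"
      by (intro tendsto_ennrealI tendsto_power tendsto_norm)
    then show "ennreal ((norm (X s w))^2) <= ?R"
    proof (rule LIMSEQ_le_const2, intro exI allI impI)
      fix m :: nat
      have "(k m, m) \<in> {(k,m). k <= Suc m}" using k(1) by simp
      from SUP_upper[OF this, of "\<lambda>p. ennreal ((norm (X (real (fst p) * T / real (Suc (snd p))) w))^2)"]
      show "ennreal ((norm (X (real (k m) * T / real (Suc m)) w))^2) <= ?R" by simp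
    qed
  qed
  show "?R <= supsq T X w"
    by (rule SUP_least) (use grid_in_interval[OF T] in \<open>auto intro!: supsq_upper\<close>)
qed

lemma supsq_measurable:
  assumes T: "T > 0" and X: "\<And>s. s \<in> {0..T} ==> X s \<in> borel_measurable M"
    and c: "\<And>w. w \<in> space M ==> continuous_on {0..T} (\<lambda>s. X s w)"
  shows "supsq T X \<in> borel_measurable M"
proof -
  have "(\<lambda>w. SUP p\<in>{(k,m). k <= Suc m}. ennreal ((norm (X (real (fst p) * T / real (Suc (snd p))) w))^2)) \<in> borel_measurable M"
  proof (rule borel_measurable_SUP)
    show "countable {(k,m). k <= Suc m}" by (rule countable_subset[of _ UNIV]) auto
    fix p :: "nat \<times> nat" assume "p \<in> {(k,m). k <= Suc m}"
    then have [measurable]: "X (real (fst p) * T / real (Suc (snd p))) \<in> borel_measurable M"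
      by (intro X grid_in_interval T) auto
    show "(\<lambda>w. ennreal ((norm (X (real (fst p) * T / real (Suc (snd p))) w))^2)) \<in> borel_measurable M" by measurable
  qed
  then show ?thesis by (rule measurable_cong[THEN iffD1, rotated]) (simp add: supsq_grid[OF T c])
qed

lemma supsq_add_le:
  fixes X Y :: "real => 'w => 'b::real_normed_vector"
  shows "supsq T (\<lambda>s w. X s w + Y s w) w <= 2 * supsq T X w + 2 * supsq T Y w"
  unfolding supsq_def[of T "\<lambda>s w. X s w + Y s w"]
proof (rule SUP_least)
  fix s assume s: "s \<in> {0..T}"
  have "ennreal ((norm (X s w + Y s w))^2) <= ennreal (2 * (norm (X s w))^2 + 2 * (norm (Y s w))^2)"
    by (rule ennreal_leI[OF norm_add_sq_le])
  also have "... = 2 * ennreal ((norm (X s w))^2) + 2 * ennreal ((norm (Y s w))^2)"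
    by (simp add: ennreal_plus ennreal_mult')
  also have "... <= 2 * supsq T X w + 2 * supsq T Y w"
    by (intro add_mono mult_left_mono supsq_upper s) auto
  finally show "ennreal ((norm (X s w + Y s w))^2) <= 2 * supsq T X w + 2 * supsq T Y w" .
qed

lemma norm_diff_ge_sgn:
  fixes x y :: "'b::euclidean_space"
  shows "(sgn x) \<bullet> (y - x) <= norm y - norm x"
proof (cases "x = 0")
  case False
  have "(sgn x) \<bullet> y <= norm (sgn x) * norm y" by (rule norm_cauchy_schwarz)
  moreover have "norm (sgn x) = 1" using False by (simp add: norm_sgn)
  moreover have "(sgn x) \<bullet> x = norm x"
    using False by (simp add: sgn_div_norm power2_norm_eq_inner[symmetric] power2_eq_square)
  ultimately show ?thesis by (simp add: inner_diff_right)
qed simp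

context brownian
begin

text \<open>
  The martingale property, tested against square-integrable past variables. It is stable under \<open>L\<^sup>2\<close> limits and avoids conditional expectations.
\<close>

definition orth :: "real => (real => 'w => 'b::euclidean_space) => bool" where
  "orth T Y \<longleftrightarrow> (\<forall>s t \<eta>. 0 <= s \<longrightarrow> s <= t \<longrightarrow> t <= T \<longrightarrow> \<eta> \<in> borel_measurable (F s) \<longrightarrow> sq_int M \<eta> \<longrightarrow>
     (\<E> w. (Y t w - Y s w) \<bullet> \<eta> w) = 0)"

lemma runmax_measurable:
  "(\<And>k. k <= n ==> (\<lambda>w. s k w) \<in> borel_measurable N) ==> (\<lambda>w. runmax (\<lambda>k. s k w) n) \<in> borel_measurable N"
  by (induction n) (auto intro!: borel_measurable_max)

text \<open>
  The norm of a martingale is a submartingale. Orthogonality, tested against the running maximum times the unit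
vector of the current value, makes the sum in \<open>pathwise_doob\<close> nonnegative in mean.
\<close>

lemma doob_discrete:
  fixes Y :: "real => 'w => 'b::euclidean_space" and g :: "nat => real"
  assumes sq: "\<And>t. t \<in> {0..T} ==> sq_int M (Y t)" and ad: "\<And>t. t \<in> {0..T} ==> Y t \<in> borel_measurable (F t)"
    and o: "orth T Y" and g: "\<And>k. k <= n ==> g k \<in> {0..T}" "\<And>k. k < n ==> g k <= g (Suc k)"
  shows "sq_int M (\<lambda>w. runmax (\<lambda>k. norm (Y (g k) w)) n)"
    and "msq M (\<lambda>w. runmax (\<lambda>k. norm (Y (g k) w)) n) <= 4 * msq M (Y (g n))"
proof -
  let ?s = "\<lambda>w k. norm (Y (g k) w)"
  let ?r = "\<lambda>k w. runmax (?s w) k"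
  have sn: "sq_int M (\<lambda>w. ?s w k)" if "k <= n" for k
    using sq[OF g(1)[OF that]] by (auto simp: sq_int_def)
  have r0: "0 <= ?r k w" for k w
    using runmax_ge[of 0 k "?s w"] norm_ge_zero order_trans by blast
  have gm: "g i <= g j" if "i <= j" "j <= n" for i j
    using that
  proof (induction j)
    case (Suc j) then show ?case using g(2)[of j] by (cases "i = Suc j") (auto intro: order_trans)
  qed auto
  have rF: "?r k \<in> borel_measurable (F (g k))" if "k <= n" for k
  proof (rule runmax_measurable[where s="\<lambda>j w. norm (Y (g j) w)"])
    fix j assume j: "j <= k"
    then have "j <= n" using that by simp
    from F_measurable_mono[OF gm[OF j that] ad[OF g(1)[OF this]]]
    show "(\<lambda>w. norm (Y (g j) w)) \<in> borel_measurable (F (g k))" by measurable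
  qed
  have rs: "sq_int M (?r k)" if "k <= n" for k
  proof (rule sq_int_dominated)
    show "sq_int M (\<lambda>w. \<Sum>j\<le>k. ?s w j)" by (rule sq_int_sum) (use sn that in auto)
    show "?r k \<in> borel_measurable M" by (rule F_measurable_M[OF rF[OF that]])
    show "AE w in M. norm (?r k w) <= 1 * norm (\<Sum>j\<le>k. ?s w j)"
    proof (rule AE_I2)
      fix w
      obtain i where i: "i <= k" "?r k w = ?s w i" using runmax_attained[of k "?s w"] by blast
      have "?s w i <= (\<Sum>j\<le>k. ?s w j)" by (rule member_le_sum) (use i in auto)
      then show "norm (?r k w) <= 1 * norm (\<Sum>j\<le>k. ?s w j)" using i(2) by simp
    qed
  qed
  then show "sq_int M (\<lambda>w. runmax (\<lambda>k. norm (Y (g k) w)) n)" by simp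
  have ii: "integrable M (\<lambda>w. ?r k w * (?s w (Suc k) - ?s w k))" if "k < n" for k
    using sq_int_inner[OF rs[of k] sq_int_diff[OF sn[of "Suc k"] sn[of k]]] that by simp
  have nn: "0 <= (\<E> w. ?r k w * (?s w (Suc k) - ?s w k))" if k: "k < n" for k
  proof -
    define \<eta> where "\<eta> w = ?r k w *\<^sub>R sgn (Y (g k) w)" for w
    have \<eta>F: "\<eta> \<in> borel_measurable (F (g k))"
    proof -
      have [measurable]: "Y (g k) \<in> borel_measurable (F (g k))" using ad[OF g(1)[of k]] k by simp
      have "(\<lambda>w. sgn (Y (g k) w)) \<in> borel_measurable (F (g k))"
        unfolding sgn_div_norm by measurable
      then show ?thesis unfolding \<eta>_def using rF[of k] k by (intro borel_measurable_scaleR) auto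
    qed
    have \<eta>s: "sq_int M \<eta>"
      by (rule sq_int_dominated[OF F_measurable_M[OF \<eta>F] rs[of k], of 1])
         (use k r0 in \<open>auto simp: \<eta>_def norm_sgn abs_mult intro!: AE_I2\<close>)
    have "0 = (\<E> w. (Y (g (Suc k)) w - Y (g k) w) \<bullet> \<eta> w)"
      using o[unfolded orth_def, rule_format, of "g k" "g (Suc k)" \<eta>] g k \<eta>F \<eta>s by auto
    also have "... <= (\<E> w. ?r k w * (?s w (Suc k) - ?s w k))"
    proof (rule integral_mono[OF _ ii[OF k]])
      show "integrable M (\<lambda>w. (Y (g (Suc k)) w - Y (g k) w) \<bullet> \<eta> w)"
        by (intro sq_int_inner sq_int_diff sq g \<eta>s) (use k in auto)
      fix w
      have "(Y (g (Suc k)) w - Y (g k) w) \<bullet> \<eta> w = ?r k w * (sgn (Y (g k) w) \<bullet> (Y (g (Suc k)) w - Y (g k) w))"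
        by (simp add: \<eta>_def inner_commute)
      also have "... <= ?r k w * (?s w (Suc k) - ?s w k)"
        by (intro mult_left_mono norm_diff_ge_sgn r0)
      finally show "(Y (g (Suc k)) w - Y (g k) w) \<bullet> \<eta> w <= ?r k w * (?s w (Suc k) - ?s w k)" .
    qed
    finally show ?thesis .
  qed
  have i2: "integrable M (\<lambda>w. 4 * (?s w n)^2 - 4 * (\<Sum>k<n. ?r k w * (?s w (Suc k) - ?s w k)))"
    using sn[of n] ii by (intro Bochner_Integration.integrable_diff integrable_mult_right bint_sum_int) (auto simp: sq_int_def)
  have "msq M (?r n) <= (\<E> w. 4 * (?s w n)^2 - 4 * (\<Sum>k<n. ?r k w * (?s w (Suc k) - ?s w k)))"
    unfolding msq_def
    by (rule integral_mono[OF sq_int_integrable[OF rs[OF order_refl]] i2]) (use pathwise_doob[of "?s _" n] in simp)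
  also have "... = 4 * (\<E> w. (?s w n)^2) - 4 * (\<Sum>k<n. \<integral>w. ?r k w * (?s w (Suc k) - ?s w k) \<partial>M)"
    using sn[of n] ii
    by (subst bint_diff) (auto intro!: bint_sum_int simp: sq_int_def bint_sum)
  also have "... <= 4 * msq M (Y (g n))"
    using sum_nonneg[of "{..<n}" "\<lambda>k. \<integral>w. ?r k w * (?s w (Suc k) - ?s w k) \<partial>M"] nn by (simp add: msq_def)
  finally show "msq M (\<lambda>w. runmax (\<lambda>k. norm (Y (g k) w)) n) <= 4 * msq M (Y (g n))" .
qed

theorem doob_maximal:
  fixes Y :: "real => 'w => 'b::euclidean_space"
  assumes T: "T > 0" and sq: "\<And>t. t \<in> {0..T} ==> sq_int M (Y t)" and ad: "\<And>t. t \<in> {0..T} ==> Y t \<in> borel_measurable (F t)"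
    and c: "\<And>w. w \<in> space M ==> continuous_on {0..T} (\<lambda>t. Y t w)" and o: "orth T Y"
  shows "(\<integral>\<^sup>+w. supsq T Y w \<partial>M) <= ennreal (4 * msq M (Y T))"
proof -
  define R where "R m w = runmax (\<lambda>k. norm (Y (real k * T / real (Suc m)) w)) (Suc m)" for m w
  have g: "real k * T / real (Suc m) <= real (Suc k) * T / real (Suc m)" for k m
    using T by (intro divide_right_mono mult_right_mono) auto
  have R: "sq_int M (R m)" "msq M (R m) <= 4 * msq M (Y T)" for m
  proof -
    have d: "sq_int M (R m)" "msq M (R m) <= 4 * msq M (Y (real (Suc m) * T / real (Suc m)))"
      unfolding R_def[abs_def]
      by (rule doob_discrete[of T Y "Suc m" "\<lambda>k. real k * T / real (Suc m)"]; use sq ad o grid_in_interval[OF T] g in blast)+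
    then show "sq_int M (R m)" "msq M (R m) <= 4 * msq M (Y T)" by (simp_all del: of_nat_Suc)
  qed
  have "(\<integral>\<^sup>+w. supsq T Y w \<partial>M) <= (\<integral>\<^sup>+w. liminf (\<lambda>m. ennreal ((norm (R m w))^2)) \<partial>M)"
  proof (rule nn_integral_mono)
    fix w assume w: "w \<in> space M"
    show "supsq T Y w <= liminf (\<lambda>m. ennreal ((norm (R m w))^2))"
      unfolding supsq_def
    proof (rule SUP_least)
      fix s assume s: "s \<in> {0..T}"
      obtain k where k: "\<And>m. k m <= Suc m" "(\<lambda>m. real (k m) * T / real (Suc m)) \<longlonglongrightarrow> s"
        using grid_approximation[OF T s] by metis
      have "(\<lambda>m. Y (real (k m) * T / real (Suc m)) w) \<longlonglongrightarrow> Y s w"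
        by (rule continuous_on_tendsto_compose[OF c[OF w] k(2) s]) (use grid_in_interval[OF T k(1)] in auto)
      then have l: "(\<lambda>m. ennreal ((norm (Y (real (k m) * T / real (Suc m)) w))^2)) \<longlonglongrightarrow> ennreal ((norm (Y s w))^2)"
        by (intro tendsto_ennrealI tendsto_power tendsto_norm)
      have "ennreal ((norm (Y s w))^2) = liminf (\<lambda>m. ennreal ((norm (Y (real (k m) * T / real (Suc m)) w))^2))"
        by (rule lim_imp_Liminf[OF _ l, symmetric]) simp
      also have "... <= liminf (\<lambda>m. ennreal ((norm (R m w))^2))"
      proof (rule Liminf_mono, rule always_eventually, rule allI, rule ennreal_leI)
        fix m
        have "norm (Y (real (k m) * T / real (Suc m)) w) <= R m w"
          unfolding R_def by (rule runmax_ge[OF k(1)])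
        then show "(norm (Y (real (k m) * T / real (Suc m)) w))^2 <= (norm (R m w))^2"
          by (intro power_mono) auto
      qed
      finally show "ennreal ((norm (Y s w))^2) <= liminf (\<lambda>m. ennreal ((norm (R m w))^2))" .
    qed
  qed
  also have "... <= liminf (\<lambda>m. \<integral>\<^sup>+w. ennreal ((norm (R m w))^2) \<partial>M)"
    by (rule nn_integral_liminf) (use sq_int_measurable[OF R(1)] in measurable)
  also have "... = liminf (\<lambda>m. ennreal (msq M (R m)))" unfolding nn_integral_norm_sq[OF R(1)] ..
  also have "... <= ennreal (4 * msq M (Y T))"
    by (rule Liminf_le) (use R(2) in \<open>auto intro!: always_eventually ennreal_leI\<close>)
  finally show ?thesis .
qed

lemma cont_adapted_iff:
  "X \<in> Cp T \<longleftrightarrow> (\<forall>s\<in>{0..T}. X s \<in> borel_measurable (F s)) \<and>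
     (\<forall>w\<in>space M. continuous_on {0..T} (\<lambda>s. X s w)) \<and> (\<integral>\<^sup>+w. supsq T X w \<partial>M) < \<infinity>"
  by (simp add: cont_adapted_def supsq_def)

lemma cont_adaptedD:
  assumes "X \<in> Cp T"
  shows "s \<in> {0..T} ==> X s \<in> borel_measurable (F s)" "w \<in> space M ==> continuous_on {0..T} (\<lambda>s. X s w)"
    "(\<integral>\<^sup>+w. supsq T X w \<partial>M) < \<infinity>" "s \<in> {0..T} ==> X s \<in> borel_measurable M"
  using assms by (auto simp: cont_adapted_iff intro: F_measurable_M)

lemma cont_adapted_sq_int:
  assumes X: "X \<in> Cp T" and s: "s \<in> {0..T}"
  shows "sq_int M (X s)" "ennreal (msq M (X s)) <= (\<integral>\<^sup>+w. supsq T X w \<partial>M)"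
proof -
  have le: "(\<integral>\<^sup>+w. ennreal ((norm (X s w))^2) \<partial>M) <= (\<integral>\<^sup>+w. supsq T X w \<partial>M)"
    by (intro nn_integral_mono supsq_upper s)
  then show *: "sq_int M (X s)"
    using cont_adaptedD(3,4)[OF X] s by (auto simp: sq_int_iff_nn_integral intro: order.strict_trans1)
  show "ennreal (msq M (X s)) <= (\<integral>\<^sup>+w. supsq T X w \<partial>M)" using le by (simp add: nn_integral_norm_sq[OF *])
qed

lemma cont_adapted_add:
  assumes T: "T > 0" and X: "X \<in> Cp T" and Y: "Y \<in> Cp T"
  shows "(\<lambda>s w. X s w + Y s w) \<in> Cp T"
  unfolding cont_adapted_iff
proof (intro conjI ballI)
  have [measurable]: "supsq T X \<in> borel_measurable M" "supsq T Y \<in> borel_measurable M"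
    using X Y by (auto intro!: supsq_measurable T dest: cont_adaptedD)
  have "(\<integral>\<^sup>+w. supsq T (\<lambda>s w. X s w + Y s w) w \<partial>M) <= (\<integral>\<^sup>+w. 2 * supsq T X w + 2 * supsq T Y w \<partial>M)"
    by (intro nn_integral_mono supsq_add_le)
  also have "... = 2 * (\<integral>\<^sup>+w. supsq T X w \<partial>M) + 2 * (\<integral>\<^sup>+w. supsq T Y w \<partial>M)"
    by (simp add: nn_integral_add nn_integral_cmult)
  also have "... < \<infinity>" using cont_adaptedD(3)[OF X] cont_adaptedD(3)[OF Y] by (simp add: ennreal_mult_less_top)
  finally show "(\<integral>\<^sup>+w. supsq T (\<lambda>s w. X s w + Y s w) w \<partial>M) < \<infinity>" .
qed (use cont_adaptedD[OF X] cont_adaptedD[OF Y] in \<open>auto intro!: continuous_intros\<close>)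

lemma cont_adapted_scaleR:
  assumes T: "T > 0" and X: "X \<in> Cp T"
  shows "(\<lambda>s w. c *\<^sub>R X s w) \<in> Cp T"
  unfolding cont_adapted_iff
proof (intro conjI ballI)
  have [measurable]: "supsq T X \<in> borel_measurable M"
    using X by (auto intro!: supsq_measurable T dest: cont_adaptedD)
  have "(\<integral>\<^sup>+w. supsq T (\<lambda>s w. c *\<^sub>R X s w) w \<partial>M) <= (\<integral>\<^sup>+w. ennreal (c^2) * supsq T X w \<partial>M)"
  proof (rule nn_integral_mono)
    fix w
    show "supsq T (\<lambda>s w. c *\<^sub>R X s w) w <= ennreal (c^2) * supsq T X w"
      unfolding supsq_def[of T "\<lambda>s w. c *\<^sub>R X s w"]
      by (rule SUP_least) (auto simp: power_mult_distrib ennreal_mult intro!: mult_left_mono supsq_upper)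
  qed
  also have "... = ennreal (c^2) * (\<integral>\<^sup>+w. supsq T X w \<partial>M)" by (simp add: nn_integral_cmult)
  also have "... < \<infinity>" using cont_adaptedD(3)[OF X] by (simp add: ennreal_mult_less_top)
  finally show "(\<integral>\<^sup>+w. supsq T (\<lambda>s w. c *\<^sub>R X s w) w \<partial>M) < \<infinity>" .
qed (use cont_adaptedD[OF X] in \<open>auto intro!: continuous_intros\<close>)

lemma cont_adapted_diff:
  assumes T: "T > 0" and X: "X \<in> Cp T" and Y: "Y \<in> Cp T"
  shows "(\<lambda>s w. X s w - Y s w) \<in> Cp T"
  using cont_adapted_add[OF T X cont_adapted_scaleR[OF T Y, of "-1"]] by simp

text \<open>
  A fast Cauchy sequence for the norm of the supremum converges uniformly along almost every path. The rate
\<open>8 ^ -n\<close> leaves room for the weights \<open>4 ^ n\<close>: the weighted sum \<open>B\<close> of the squared increments is integrable, and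
where it is finite the increments are at most \<open>sqrt B / 2 ^ n\<close>.
\<close>

theorem cont_adapted_limit:
  fixes U :: "nat => real => 'w => 'b::euclidean_space"
  assumes T: "T > 0" and U: "\<And>n. U n \<in> Cp T"
    and d: "\<And>n. (\<integral>\<^sup>+w. supsq T (\<lambda>s w. U (Suc n) s w - U n s w) w \<partial>M) <= ennreal (K * (1/8) ^ n)"
    and K: "K \<ge> 0"
  obtains V C where "V \<in> Cp T" "\<And>n t. t \<in> {0..T} ==> msq M (\<lambda>w. U n t w - V t w) <= C * (1/4) ^ n"
    "\<And>t. t \<in> {0..T} ==> (\<lambda>n. msq M (\<lambda>w. U n t w - V t w)) \<longlonglongrightarrow> 0"
proof -
  let ?D = "\<lambda>n. supsq T (\<lambda>s w. U (Suc n) s w - U n s w)"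
  have Dm [measurable]: "?D n \<in> borel_measurable M" for n
    by (rule supsq_measurable[OF T]) (use cont_adaptedD[OF cont_adapted_diff[OF T U U]] in auto)
  define B where "B w = (\<Sum>n. 4 ^ n * ?D n w)" for w
  have Bm [measurable]: "B \<in> borel_measurable M" unfolding B_def by measurable
  have "(\<integral>\<^sup>+w. B w \<partial>M) = (\<Sum>n. 4 ^ n * (\<integral>\<^sup>+w. ?D n w \<partial>M))"
    unfolding B_def by (subst nn_integral_suminf) (auto simp: nn_integral_cmult)
  also have "... <= (\<Sum>n. ennreal (K * (1/2) ^ n))"
  proof (rule suminf_le)
    fix n
    have "4 ^ n * (\<integral>\<^sup>+w. ?D n w \<partial>M) <= 4 ^ n * ennreal (K * (1/8) ^ n)"
      by (intro mult_left_mono d) auto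
    also have "... = ennreal (4 ^ n) * ennreal (K * (1/8) ^ n)" by (simp add: ennreal_power[symmetric])
    also have "... = ennreal (4 ^ n * (K * (1/8) ^ n))" using K by (simp add: ennreal_mult)
    also have "4 ^ n * (K * (1/8) ^ n) = K * (1/2) ^ n"
      by (simp add: mult.left_commute power_mult_distrib[symmetric])
    finally show "4 ^ n * (\<integral>\<^sup>+w. ?D n w \<partial>M) <= ennreal (K * (1/2) ^ n)" .
  qed auto
  also have "... = ennreal (\<Sum>n. K * (1/2) ^ n)"
    by (rule suminf_ennreal2) (use K in \<open>auto intro!: summable_mult summable_geometric\<close>)
  also have "... < \<infinity>" by simp
  finally have B: "(\<integral>\<^sup>+w. B w \<partial>M) < \<infinity>" .
  have AEB: "AE w in M. B w < \<infinity>"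
    using nn_integral_PInf_AE[OF Bm] B by (auto simp: less_top[symmetric])
  define b where "b w = sqrt (enn2real (B w))" for w
  have b0: "0 <= b w" for w by (simp add: b_def)
  have step: "norm (U (Suc n) t w - U n t w) <= b w * (1/2) ^ n" if t: "t \<in> {0..T}" and w: "B w < \<infinity>" for n t w
  proof -
    have "4 ^ n * ennreal ((norm (U (Suc n) t w - U n t w))^2) <= 4 ^ n * ?D n w"
      by (intro mult_left_mono supsq_upper[of t T "\<lambda>s w. U (Suc n) s w - U n s w"] t) auto
    also have "... <= B w" unfolding B_def using sum_le_suminf[of "\<lambda>n. 4 ^ n * ?D n w" "{n}"] by simp
    also have "... = ennreal ((b w)^2)" using w by (simp add: b_def ennreal_enn2real)
    also have "4 ^ n * ennreal ((norm (U (Suc n) t w - U n t w))^2) = ennreal (4 ^ n) * ennreal ((norm (U (Suc n) t w - U n t w))^2)"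
      by (simp add: ennreal_power[symmetric])
    also have "... = ennreal (4 ^ n * (norm (U (Suc n) t w - U n t w))^2)" by (simp add: ennreal_mult)
    finally have "4 ^ n * (norm (U (Suc n) t w - U n t w))^2 <= (b w)^2" by (simp add: ennreal_le_iff)
    also have "4 ^ n * (norm (U (Suc n) t w - U n t w))^2 = (2 ^ n * norm (U (Suc n) t w - U n t w))^2"
      by (simp add: power_mult_distrib power_mult[symmetric] mult.commute[of n 2] power_mult)
    finally have "2 ^ n * norm (U (Suc n) t w - U n t w) <= b w" by (rule power2_le_imp_le[OF _ b0])
    then show ?thesis by (simp add: power_divide field_simps)
  qed
  define V where "V t w = (if B w < \<infinity> then lim (\<lambda>n. U n t w) else 0)" for t w
  have tail: "(\<lambda>n. U n t w) \<longlonglongrightarrow> V t w \<and> (\<forall>n. norm (U n t w - V t w) <= 2 * b w * (1/2) ^ n)"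
    if t: "t \<in> {0..T}" and w: "B w < \<infinity>" for t w
  proof -
    let ?d = "\<lambda>k. U (Suc k) t w - U k t w"
    have sm: "summable (\<lambda>k. b w * (1/2) ^ k)" by (intro summable_mult summable_geometric) auto
    have sd: "summable (\<lambda>k. norm (?d k))" by (rule summable_comparison_test'[OF sm]) (use step[OF t w] in auto)
    have sd': "summable ?d" by (rule summable_norm_cancel[OF sd])
    have l: "(\<lambda>n. U n t w - U 0 t w) \<longlonglongrightarrow> suminf ?d"
      using summable_LIMSEQ[OF sd'] by (simp add: sum_lessThan_telescope[where f="\<lambda>k. U k t w"])
    then have "(\<lambda>n. (U n t w - U 0 t w) + U 0 t w) \<longlonglongrightarrow> suminf ?d + U 0 t w" by (intro tendsto_add tendsto_const)
    then have conv: "(\<lambda>n. U n t w) \<longlonglongrightarrow> suminf ?d + U 0 t w" by simp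
    then have V: "V t w = suminf ?d + U 0 t w" using w by (simp add: V_def limI)
    have "norm (U n t w - V t w) <= 2 * b w * (1/2) ^ n" for n
    proof -
      have "suminf ?d = (\<Sum>k. ?d (k + n)) + (\<Sum>k<n. ?d k)" by (rule suminf_split_initial_segment[OF sd'])
      then have "V t w - U n t w = (\<Sum>k. ?d (k + n))" unfolding V by (simp add: sum_lessThan_telescope[where f="\<lambda>k. U k t w"])
      then have "norm (U n t w - V t w) = norm (\<Sum>k. ?d (k + n))" by (metis norm_minus_commute)
      also have "... <= (\<Sum>k. norm (?d (k + n)))" by (rule summable_norm[OF summable_ignore_initial_segment[OF sd]])
      also have "... <= (\<Sum>k. b w * (1/2) ^ (k + n))"
        by (rule suminf_le[OF step[OF t w] summable_ignore_initial_segment[OF sd] summable_ignore_initial_segment[OF sm]])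
      also have "... = b w * (1/2) ^ n * (\<Sum>k. (1/2) ^ k)"
        by (subst suminf_mult[symmetric]) (auto simp: power_add mult_ac intro!: summable_geometric)
      also have "(\<Sum>k. (1/2::real) ^ k) = 2" by (subst suminf_geometric) auto
      finally show ?thesis by (simp add: mult_ac)
    qed
    with conv V show ?thesis by simp
  qed
  have cV: "continuous_on {0..T} (\<lambda>t. V t w)" if w: "w \<in> space M" for w
  proof (cases "B w < \<infinity>")
    case True
    show ?thesis
    proof (rule uniform_limit_theorem[where F=sequentially and f="\<lambda>n t. U n t w"])
      show "\<forall>\<^sub>F n in sequentially. continuous_on {0..T} (\<lambda>t. U n t w)"
        using cont_adaptedD(2)[OF U w] by simp
      show "uniform_limit {0..T} (\<lambda>n t. U n t w) (\<lambda>t. V t w) sequentially"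
      proof (rule uniform_limitI)
        fix e :: real assume e: "e > 0"
        have "(\<lambda>n. 2 * b w * (1/2) ^ n) \<longlonglongrightarrow> 2 * b w * 0" by (intro tendsto_mult_left LIMSEQ_power_zero) auto
        then have "\<forall>\<^sub>F n in sequentially. 2 * b w * (1/2) ^ n < e" using e by (auto dest: order_tendstoD)
        then show "\<forall>\<^sub>F n in sequentially. \<forall>x\<in>{0..T}. dist (U n x w) (V x w) < e"
        proof eventually_elim
          case (elim n)
          show ?case unfolding dist_norm
          proof
            fix x assume "x \<in> {0..T}"
            from tail[OF this True] have "norm (U n x w - V x w) <= 2 * b w * (1/2) ^ n" by blast
            with elim show "norm (U n x w - V x w) < e" by (rule order.strict_trans1[rotated])
          qed
        qed
      qed
    qed simp
  qed (simp add: V_def)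
  have VF: "V t \<in> borel_measurable (F t)" if t: "t \<in> {0..T}" for t
  proof -
    have "(\<lambda>w. lim (\<lambda>n. U n t w)) \<in> borel_measurable (F t)"
      by (rule borel_measurable_lim_metric) (use cont_adaptedD(1)[OF U t] in auto)
    moreover have "AE w in M. lim (\<lambda>n. U n t w) = V t w" using AEB by eventually_elim (simp add: V_def)
    ultimately show ?thesis by (rule F_measurable_AE')
  qed
  have bound: "ennreal ((norm (U n t w - V t w))^2) <= ennreal (4 * (1/4) ^ n) * B w" if t: "t \<in> {0..T}" and w: "B w < \<infinity>" for n t w
  proof -
    have "(norm (U n t w - V t w))^2 <= (2 * b w * (1/2) ^ n)^2" using tail[OF t w] by (intro power_mono) auto
    also have "... = 4 * (1/4) ^ n * (b w)^2"
      by (simp add: power_mult_distrib power_mult[symmetric] mult.commute[of n 2] power_divide) (simp add: power_mult)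
    finally have "ennreal ((norm (U n t w - V t w))^2) <= ennreal (4 * (1/4) ^ n * (b w)^2)" by (rule ennreal_leI)
    also have "... = ennreal (4 * (1/4) ^ n) * B w" using w by (simp add: ennreal_mult b_def ennreal_enn2real)
    finally show ?thesis .
  qed
  have Vc: "V \<in> Cp T"
    unfolding cont_adapted_iff
  proof (intro conjI ballI VF cV)
    have [measurable]: "supsq T (U 0) \<in> borel_measurable M"
      by (rule supsq_measurable[OF T]) (use cont_adaptedD[OF U] in auto)
    have "(\<integral>\<^sup>+w. supsq T V w \<partial>M) <= (\<integral>\<^sup>+w. 2 * supsq T (U 0) w + 8 * B w \<partial>M)"
    proof (rule nn_integral_mono_AE, use AEB in eventually_elim)
      case (elim w)
      have "supsq T V w = supsq T (\<lambda>s w. U 0 s w + (V s w - U 0 s w)) w" by simp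
      also have "... <= 2 * supsq T (U 0) w + 2 * supsq T (\<lambda>s w. V s w - U 0 s w) w" by (rule supsq_add_le)
      also have "supsq T (\<lambda>s w. V s w - U 0 s w) w <= 4 * B w"
        unfolding supsq_def by (rule SUP_least) (use bound[OF _ elim, of _ 0] in \<open>simp add: norm_minus_commute\<close>)
      finally show ?case by (simp add: mult.assoc[symmetric] mult_left_mono add_left_mono)
    qed
    also have "... = 2 * (\<integral>\<^sup>+w. supsq T (U 0) w \<partial>M) + 8 * (\<integral>\<^sup>+w. B w \<partial>M)"
      by (simp add: nn_integral_add nn_integral_cmult)
    also have "... < \<infinity>" using B cont_adaptedD(3)[OF U[of 0]] by (simp add: ennreal_mult_less_top)
    finally show "(\<integral>\<^sup>+w. supsq T V w \<partial>M) < \<infinity>" .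
  qed
  have le: "msq M (\<lambda>w. U n t w - V t w) <= (4 * enn2real (\<integral>\<^sup>+w. B w \<partial>M)) * (1/4) ^ n" if t: "t \<in> {0..T}" for n t
  proof -
    have sq: "sq_int M (\<lambda>w. U n t w - V t w)"
      by (intro sq_int_diff cont_adapted_sq_int[OF _ t] U Vc)
    have "ennreal (msq M (\<lambda>w. U n t w - V t w)) = (\<integral>\<^sup>+w. ennreal ((norm (U n t w - V t w))^2) \<partial>M)"
      by (rule nn_integral_norm_sq[OF sq, symmetric])
    also have "... <= (\<integral>\<^sup>+w. ennreal (4 * (1/4) ^ n) * B w \<partial>M)"
      by (rule nn_integral_mono_AE) (use AEB in \<open>auto elim!: eventually_mono intro: bound[OF t]\<close>)
    also have "... = ennreal (4 * (1/4) ^ n) * (\<integral>\<^sup>+w. B w \<partial>M)" by (simp add: nn_integral_cmult)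
    also have "... = ennreal (4 * (1/4) ^ n * enn2real (\<integral>\<^sup>+w. B w \<partial>M))"
      using B by (simp add: ennreal_mult ennreal_enn2real)
    finally show ?thesis by (simp add: ennreal_le_iff mult_ac)
  qed
  show thesis
  proof (rule that[OF Vc le])
    fix t assume t: "t \<in> {0..T}"
    let ?C = "4 * enn2real (\<integral>\<^sup>+w. B w \<partial>M)"
    have "(\<lambda>n. ?C * (1/4) ^ n) \<longlonglongrightarrow> ?C * 0"
      by (intro tendsto_mult tendsto_const LIMSEQ_power_zero) auto
    then show "(\<lambda>n. msq M (\<lambda>w. U n t w - V t w)) \<longlonglongrightarrow> 0"
      by (rule tendsto_sandwich[OF _ _ tendsto_const, rotated 2, OF tendsto_eq_rhs]) (use le[OF t] in \<open>auto simp: msq_nonneg\<close>)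
  qed
qed

lemma simple_has_ito:
  assumes S: "simple_ito_integral M W t \<phi> S" and t: "0 <= t"
  shows "has_ito_integral M W t \<phi> S"
proof (rule has_ito_integralI[OF t _ simple_ito_sq_int(2)[OF S order_refl] S])
  show "\<phi> \<in> L2p t"
    unfolding L2_adapted_iff using simple_ito_sq_int(1)[OF S order_refl] simple_ito_adapted[OF S order_refl] by auto
qed (simp_all add: msq_def)

lemma msq_cut:
  assumes t: "0 <= t" "t <= T" and h: "sq_int (NT T) (cut t h)" "(\<lambda>z. h @@ z) \<in> borel_measurable (NT t)"
  shows "sq_int (NT t) (\<lambda>z. h @@ z)" "msq (NT t) (\<lambda>z. h @@ z) = msq (NT T) (cut t h)"
proof -
  have eq: "(\<integral>\<^sup>+z. ennreal ((norm (h @@ z))^2) \<partial>NT t) = (\<integral>\<^sup>+z. ennreal ((norm (cut t h z))^2) \<partial>NT T)"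
    using nn_integral_cut[OF t h(2)] nn_integral_NT[of "\<lambda>z. ennreal ((norm (h @@ z))^2)" t] h(2) by simp
  then show *: "sq_int (NT t) (\<lambda>z. h @@ z)"
    using h by (auto simp: sq_int_iff_nn_integral)
  show "msq (NT t) (\<lambda>z. h @@ z) = msq (NT T) (cut t h)"
    using eq by (simp add: nn_integral_norm_sq[OF *] nn_integral_norm_sq[OF h(1)] msq_nonneg)
qed

text \<open>
  Simple processes approximating the integrand at the rate \<open>8 ^ -n\<close> have continuous integrals, which
by Doob's inequality and the isometry satisfy the hypothesis of \<open>cont_adapted_limit\<close>.
\<close>

theorem ito_integral_process:
  fixes f :: "real => 'w => 'b::euclidean_space"
  assumes T: "T > 0" and f: "f \<in> L2p T"
  obtains Y where "Y \<in> Cp T" "\<And>t. t \<in> {0..T} ==> has_ito_integral M W t f (Y t)" "orth T Y"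
proof -
  let ?f = "\<lambda>z. f @@ z"
  have sf: "sq_int (NT T) ?f" using f by (simp add: L2_adapted_iff)
  obtain \<phi>0 S0 where 0: "\<And>n::nat. simple_ito_integral M W T (\<phi>0 n) (S0 n)"
    "(\<lambda>n. msq (NT T) (\<lambda>z. \<phi>0 n @@ z - ?f z)) \<longlonglongrightarrow> 0"
    using simple_dense[OF T f] by blast
  have "\<forall>n. \<exists>m. msq (NT T) (\<lambda>z. \<phi>0 m @@ z - ?f z) < (1/8) ^ n"
  proof
    fix n :: nat
    have "(1/8::real) ^ n > 0" by simp
    from order_tendstoD(2)[OF 0(2) this] show "\<exists>m. msq (NT T) (\<lambda>z. \<phi>0 m @@ z - ?f z) < (1/8) ^ n"
      by (auto simp: eventually_sequentially)
  qed
  then obtain m where m: "\<And>n. msq (NT T) (\<lambda>z. \<phi>0 (m n) @@ z - ?f z) < (1/8) ^ n" by metis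
  define \<phi> where "\<phi> n = \<phi>0 (m n)" for n
  define S where "S n = S0 (m n)" for n
  have sS: "simple_ito_integral M W T (\<phi> n) (S n)" for n using 0(1) by (simp add: \<phi>_def S_def)
  have near: "msq (NT T) (\<lambda>z. \<phi> n @@ z - ?f z) <= (1/8) ^ n" for n using m[of n] by (simp add: \<phi>_def)
  note s\<phi> = simple_ito_sq_int(1)[OF sS order_refl]
  have "\<forall>n. \<exists>I. (\<forall>r\<in>{0..T}. simple_ito_integral M W r (\<lambda>s w. indicator {0..r} s *\<^sub>R \<phi> n s w) (I r) \<and> I r \<in> borel_measurable (F r))
     \<and> (AE w in M. continuous_on {0..T} (\<lambda>r. I r w)) \<and> orth T I"
  proof
    fix n
    obtain I where I: "\<And>r. r \<in> {0..T} ==> simple_ito_integral M W r (\<lambda>s w. indicator {0..r} s *\<^sub>R \<phi> n s w) (I r)"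
      "\<And>r. r \<in> {0..T} ==> I r \<in> borel_measurable (F r)" "AE w in M. continuous_on {0..T} (\<lambda>r. I r w)"
      "\<And>s r \<eta>. 0 <= s ==> s <= r ==> r <= T ==> \<eta> \<in> borel_measurable (F s) ==> sq_int M \<eta> ==>
        (\<E> w. (I r w - I s w) \<bullet> \<eta> w) = 0"
      using that by (rule simple_ito_process[OF sS])
    then show "\<exists>I. (\<forall>r\<in>{0..T}. simple_ito_integral M W r (\<lambda>s w. indicator {0..r} s *\<^sub>R \<phi> n s w) (I r) \<and> I r \<in> borel_measurable (F r))
     \<and> (AE w in M. continuous_on {0..T} (\<lambda>r. I r w)) \<and> orth T I"
      unfolding orth_def by blast
  qed
  from choice[OF this] obtain I where I0: "\<forall>n. (\<forall>r\<in>{0..T}. simple_ito_integral M W r (\<lambda>s w. indicator {0..r} s *\<^sub>R \<phi> n s w) (I n r) \<and> I n r \<in> borel_measurable (F r))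
     \<and> (AE w in M. continuous_on {0..T} (\<lambda>r. I n r w)) \<and> orth T (I n)" by (rule exE)
  have I: "\<And>n r. r \<in> {0..T} ==> simple_ito_integral M W r (\<lambda>s w. indicator {0..r} s *\<^sub>R \<phi> n s w) (I n r)"
    "\<And>n r. r \<in> {0..T} ==> I n r \<in> borel_measurable (F r)" "\<And>n. AE w in M. continuous_on {0..T} (\<lambda>r. I n r w)" "\<And>n. orth T (I n)"
    using I0[THEN spec] by (simp_all only: conj_assoc ball_simps)
  \<comment> \<open>The paths are modified on a null set so that all of them are continuous, as membership in Cp demands.\<close>
  define J where "J n r w = (if continuous_on {0..T} (\<lambda>r. I n r w) then I n r w else 0)" for n r w
  have IJ: "AE w in M. \<forall>r. I n r w = J n r w" for n
    using I(3)[of n] by eventually_elim (simp add: J_def)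
  have IJr: "AE w in M. I n r w = J n r w" for n r using IJ[of n] by eventually_elim simp
  have JF: "J n r \<in> borel_measurable (F r)" if "r \<in> {0..T}" for n r
    by (rule F_measurable_AE'[OF I(2)[OF that] IJr])
  have Jito: "has_ito_integral M W r (\<lambda>s w. indicator {0..r} s *\<^sub>R \<phi> n s w) (J n r)" if "r \<in> {0..T}" for n r
    by (rule has_ito_integral_AE[OF simple_has_ito[OF I(1)[OF that]] IJr]) (use that in auto)
  have cutcut: "cut r (\<lambda>s w. indicator {0..r} s *\<^sub>R \<phi> n s w) = cut r (\<phi> n)" for r n
    by (auto simp: cut_def fun_eq_iff indicator_def)
  have Jsq: "sq_int M (J n r)" if "r \<in> {0..T}" for n r
    using ito_sq_int(2)[OF Jito[OF that]] that by auto
  have Jc: "continuous_on {0..T} (\<lambda>r. J n r w)" for n w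
    by (cases "continuous_on {0..T} (\<lambda>r. I n r w)") (simp_all add: J_def)
  have Jorth: "(\<E> w. (J n t w - J n s w) \<bullet> \<eta> w) = 0"
    if "0 <= s" "s <= t" "t <= T" "\<eta> \<in> borel_measurable (F s)" "sq_int M \<eta>" for n s t \<eta>
  proof -
    have "(\<E> w. (J n t w - J n s w) \<bullet> \<eta> w) = (\<E> w. (I n t w - I n s w) \<bullet> \<eta> w)"
    proof (rule integral_cong_AE)
      show "AE w in M. (J n t w - J n s w) \<bullet> \<eta> w = (I n t w - I n s w) \<bullet> \<eta> w"
        using IJ[of n] by eventually_elim simp
      have [measurable]: "J n t \<in> borel_measurable M" "J n s \<in> borel_measurable M" "I n t \<in> borel_measurable M" "I n s \<in> borel_measurable M" "\<eta> \<in> borel_measurable M"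
        using JF[of t n] JF[of s n] I(2)[of t n] I(2)[of s n] that by (auto intro!: F_measurable_M)
      show "(\<lambda>w. (J n t w - J n s w) \<bullet> \<eta> w) \<in> borel_measurable M" "(\<lambda>w. (I n t w - I n s w) \<bullet> \<eta> w) \<in> borel_measurable M"
        by measurable
    qed
    also have "... = 0" using I(4)[of n] that unfolding orth_def by blast
    finally show ?thesis .
  qed
  have Jorth': "orth T (J n)" for n using Jorth unfolding orth_def by blast
  have JT: "J n \<in> Cp T" for n
    unfolding cont_adapted_iff
  proof (intro conjI ballI JF Jc)
    have "(\<integral>\<^sup>+w. supsq T (J n) w \<partial>M) <= ennreal (4 * msq M (J n T))"
      by (rule doob_maximal[OF T Jsq JF Jc Jorth'])
    also have "... < \<infinity>" by simp
    finally show "(\<integral>\<^sup>+w. supsq T (J n) w \<partial>M) < \<infinity>" .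
  qed
  have diff: "(\<integral>\<^sup>+w. supsq T (\<lambda>s w. J (Suc n) s w - J n s w) w \<partial>M) <= ennreal (16 * (1/8) ^ n)" for n
  proof -
    have o: "orth T (\<lambda>s w. J (Suc n) s w - J n s w)"
      unfolding orth_def
    proof (intro allI impI)
      fix s t and \<eta> :: "'w => 'b" assume a: "0 <= s" "s <= t" "t <= T" "\<eta> \<in> borel_measurable (F s)" "sq_int M \<eta>"
      have "(\<E> w. (J (Suc n) t w - J n t w - (J (Suc n) s w - J n s w)) \<bullet> \<eta> w)
        = (\<E> w. (J (Suc n) t w - J (Suc n) s w) \<bullet> \<eta> w - (J n t w - J n s w) \<bullet> \<eta> w)"
        by (intro bint_cong refl) (simp add: inner_diff_left)
      also have "... = 0"
        using Jorth[OF a] a by (subst bint_diff) (auto intro!: sq_int_inner sq_int_diff Jsq)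
      finally show "(\<E> w. (J (Suc n) t w - J n t w - (J (Suc n) s w - J n s w)) \<bullet> \<eta> w) = 0" .
    qed
    have TT: "T \<in> {0..T}" "0 <= T" using T by auto
    have "(\<integral>\<^sup>+w. supsq T (\<lambda>s w. J (Suc n) s w - J n s w) w \<partial>M) <= ennreal (4 * msq M (\<lambda>w. J (Suc n) T w - J n T w))"
      by (rule doob_maximal[OF T _ _ _ o]) (auto intro!: sq_int_diff Jsq borel_measurable_diff JF continuous_intros Jc)
    also have "msq M (\<lambda>w. J (Suc n) T w - J n T w) = msq (NT T) (\<lambda>z. cut T (\<phi> (Suc n)) z - cut T (\<phi> n) z)"
      using ito_isometry_diff[OF Jito[OF TT(1)] TT(2) order_refl Jito[OF TT(1)] TT(2) order_refl] by (simp add: cutcut)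
    also have "... = msq (NT T) (\<lambda>z. \<phi> (Suc n) @@ z - \<phi> n @@ z)"
      by (simp add: simple_ito_cut[OF sS order_refl order_refl])
    also have "... <= 2 * msq (NT T) (\<lambda>z. \<phi> (Suc n) @@ z - ?f z) + 2 * msq (NT T) (\<lambda>z. ?f z - \<phi> n @@ z)"
      by (rule msq_triangle[OF s\<phi> sf s\<phi>])
    also have "... <= 2 * (1/8) ^ Suc n + 2 * (1/8) ^ n"
      using near[of "Suc n"] near[of n] by (simp add: msq_commute[of _ ?f])
    also have "... <= 4 * (1/8) ^ n" by simp
    finally show ?thesis by (simp add: ennreal_leI)
  qed
  obtain V C where V: "V \<in> Cp T" "\<And>t. t \<in> {0..T} ==> (\<lambda>n. msq M (\<lambda>w. J n t w - V t w)) \<longlonglongrightarrow> 0"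
    by (rule cont_adapted_limit[OF T JT diff]) auto
  show thesis
  proof (rule that[OF V(1)])
    fix t assume t: "t \<in> {0..T}"
    then have t': "0 <= t" "t <= T" by auto
    let ?\<psi> = "\<lambda>n s w. indicator {0..t} s *\<^sub>R \<phi> n s w"
    have ft: "f \<in> L2p t" by (rule L2_adapted_subset[OF t' f])
    note sI = I(1)[OF t]
    show "has_ito_integral M W t f (V t)"
    proof (rule has_ito_integralI[OF t'(1) ft cont_adapted_sq_int(1)[OF V(1) t] sI])
      have eq: "msq (NT t) (\<lambda>z. ?\<psi> n @@ z - ?f z) = msq (NT T) (\<lambda>z. indicator {0..t} (fst z) *\<^sub>R (\<phi> n @@ z - ?f z))" for n
      proof -
        have c: "cut t (\<lambda>s w. ?\<psi> n s w - f s w) = (\<lambda>z. indicator {0..t} (fst z) *\<^sub>R (\<phi> n @@ z - ?f z))"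
          by (auto simp: cut_def fun_eq_iff indicator_def)
        have "sq_int (NT T) (\<lambda>z. (indicator {0..t} (fst z) * 1) *\<^sub>R (\<phi> n @@ z - ?f z))"
          by (rule sq_int_indicator_time[OF sq_int_diff[OF s\<phi> sf]]) simp
        then have 1: "sq_int (NT T) (cut t (\<lambda>s w. ?\<psi> n s w - f s w))" unfolding c by simp
        have 2: "(\<lambda>z. ?\<psi> n @@ z - f @@ z) \<in> borel_measurable (NT t)"
          using simple_ito_sq_int(1)[OF sI order_refl, of n] ft unfolding L2_adapted_iff
          by (intro borel_measurable_diff sq_int_measurable) auto
        show ?thesis using msq_cut(2)[OF t' 1 2] c by simp
      qed
      have le: "msq (NT t) (\<lambda>z. ?\<psi> n @@ z - ?f z) <= (1/8) ^ n" for n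
      proof -
        have "msq (NT T) (\<lambda>z. indicator {0..t} (fst z) *\<^sub>R (\<phi> n @@ z - ?f z)) <= 1^2 * msq (NT T) (\<lambda>z. \<phi> n @@ z - ?f z)"
        proof (rule msq_mono_AE[OF _ _ sq_int_diff[OF s\<phi> sf]])
          have "sq_int (NT T) (\<lambda>z. (indicator {0..t} (fst z) * 1) *\<^sub>R (\<phi> n @@ z - ?f z))"
            by (rule sq_int_indicator_time[OF sq_int_diff[OF s\<phi> sf]]) simp
          then show "(\<lambda>z. indicator {0..t} (fst z) *\<^sub>R (\<phi> n @@ z - ?f z)) \<in> borel_measurable (NT T)"
            by (simp add: sq_int_def)
        qed (auto simp: indicator_def)
        also have "... <= (1/8) ^ n" using near[of n] by simp
        finally show ?thesis unfolding eq .
      qed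
      have "(\<lambda>n. (1/8::real) ^ n) \<longlonglongrightarrow> 0" by (rule LIMSEQ_power_zero) simp
      then show "(\<lambda>n. msq (NT t) (\<lambda>z. ?\<psi> n @@ z - ?f z)) \<longlonglongrightarrow> 0"
        by (rule tendsto_sandwich[OF _ _ tendsto_const, rotated 2]) (use le in \<open>auto simp: msq_nonneg\<close>)
      have "msq M (\<lambda>w. I n t w - V t w) = msq M (\<lambda>w. J n t w - V t w)" for n
      proof (rule msq_cong_AE)
        show "AE w in M. I n t w - V t w = J n t w - V t w" using IJ[of n] by eventually_elim simp
      qed (auto intro!: borel_measurable_diff F_measurable_M[OF I(2)[OF t]] F_measurable_M[OF JF[OF t]] cont_adaptedD(4)[OF V(1) t])
      then show "(\<lambda>n. msq M (\<lambda>w. I n t w - V t w)) \<longlonglongrightarrow> 0" using V(2)[OF t] by simp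
    qed
  next
    show "orth T V"
      unfolding orth_def
    proof (intro allI impI)
      fix s t and \<eta> :: "'w => 'b" assume a: "0 <= s" "s <= t" "t <= T" "\<eta> \<in> borel_measurable (F s)" "sq_int M \<eta>"
      have st: "s \<in> {0..T}" "t \<in> {0..T}" using a by auto
      note sV = cont_adapted_sq_int(1)[OF V(1)]
      have l: "(\<lambda>n. \<integral>w. J n r w \<bullet> \<eta> w \<partial>M) \<longlonglongrightarrow> (\<E> w. V r w \<bullet> \<eta> w)" if r: "r \<in> {0..T}" for r
        by (rule l2_tendsto_inner[OF Jsq[OF r] sV[OF r] V(2)[OF r], of "\<lambda>_. \<eta>"]) (use a in \<open>auto simp: msq_def\<close>)
      have split: "(\<E> w. (Z t w - Z s w) \<bullet> \<eta> w) = (\<E> w. Z t w \<bullet> \<eta> w) - (\<E> w. Z s w \<bullet> \<eta> w)"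
        if "sq_int M (Z t)" "sq_int M (Z s)" for Z
        unfolding inner_diff_left by (intro bint_diff sq_int_inner that a)
      have "(\<lambda>n. (\<E> w. J n t w \<bullet> \<eta> w) - (\<E> w. J n s w \<bullet> \<eta> w)) \<longlonglongrightarrow> (\<E> w. V t w \<bullet> \<eta> w) - (\<E> w. V s w \<bullet> \<eta> w)"
        by (intro tendsto_diff l st)
      moreover have "(\<E> w. J n t w \<bullet> \<eta> w) - (\<E> w. J n s w \<bullet> \<eta> w) = 0" for n
        using Jorth[OF a] split[of "J n"] Jsq st by simp
      ultimately have "(\<E> w. V t w \<bullet> \<eta> w) - (\<E> w. V s w \<bullet> \<eta> w) = 0"
        by (simp add: LIMSEQ_const_iff)
      then show "(\<E> w. (V t w - V s w) \<bullet> \<eta> w) = 0" using split[of V] sV st by simp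
    qed
  qed
qed

end

section \<open>Ito processes\<close>

lemma integral_time_continuous:
  fixes g :: "real => 'b::euclidean_space"
  assumes "integrable (LT T) g"
  shows "continuous_on {0..T} (\<lambda>t. \<integral>s. g s \<partial>(LT t))"
proof -
  have "g integrable_on {0..T}" by (rule integrable_on_lebesgue_on[OF assms]) simp
  from indefinite_integral_continuous_1[OF this]
  have c: "continuous_on {0..T} (\<lambda>t. integral {0..t} g)" .
  have eq: "(\<integral>s. g s \<partial>(LT t)) = integral {0..t} g" if "t \<in> {0..T}" for t
    by (rule lebesgue_integral_eq_integral[OF integrable_time_subset[OF _ assms]]) (use that in auto)
  show ?thesis by (rule iffD2[OF continuous_on_cong[OF refl eq] c])
qed

lemma integral_time_sq_bound:
  fixes g :: "real => 'b::euclidean_space"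
  assumes g: "sq_int (LT T) g" and t: "t \<in> {0..T}"
  shows "(norm (\<integral>s. g s \<partial>(LT t)))^2 <= T * msq (LT T) g"
proof -
  let ?L = "LT T"
  have T: "0 <= T" using t by simp
  have m: "indicat_real {0..t} \<in> borel_measurable ?L"
    by (rule measurable_compose[OF measurable_id_lebesgue_on]) simp
  note [measurable] = m sq_int_measurable[OF g]
  have s1: "sq_int ?L (indicat_real {0..t})"
    by (rule sq_int_dominated[OF m L.sq_int_const[where c="1::real"], of 1]) (auto simp: indicator_def)
  have s2: "sq_int ?L (\<lambda>s. norm (g s))" using g by (auto simp: sq_int_def)
  have m1: "msq ?L (indicat_real {0..t}) <= T"
  proof -
    have "msq ?L (indicat_real {0..t}) <= 1^2 * msq ?L (\<lambda>s. 1::real)"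
      by (rule msq_mono_AE[OF _ m L.sq_int_const]) (auto simp: indicator_def)
    also have "... = T" using T by (simp add: msq_def measure_restrict_space)
    finally show ?thesis .
  qed
  have "norm (\<integral>s. g s \<partial>(LT t)) = norm (\<integral>s. indicator {0..t} s *\<^sub>R g s \<partial>?L)"
    using t by (subst integral_time_restrict[of t T]) auto
  also have "... <= (\<integral>s. norm (indicator {0..t} s *\<^sub>R g s) \<partial>?L)" by (rule integral_norm_bound)
  also have "... = (\<integral>s. indicat_real {0..t} s \<bullet> norm (g s) \<partial>?L)" by simp
  also have "... <= sqrt (msq ?L (indicat_real {0..t})) * sqrt (msq ?L (\<lambda>s. norm (g s)))"
    using l2_Cauchy_Schwarz[OF s1 s2] by linarith
  also have "... <= sqrt T * sqrt (msq ?L g)"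
    using T by (intro mult_mono real_sqrt_le_mono m1) (auto simp: msq_def)
  finally have "(norm (\<integral>s. g s \<partial>(LT t)))^2 <= (sqrt T * sqrt (msq ?L g))^2" by (rule power_mono) simp
  then show ?thesis using T by (simp add: power_mult_distrib msq_nonneg)
qed

context brownian
begin

lemma cont_adapted_measurable:
  fixes X :: "real => 'w => 'b::euclidean_space"
  assumes T: "T > 0" and X: "X \<in> Cp T"
  shows "(\<lambda>z. X @@ z) \<in> borel_measurable (NT T)"
proof -
  define \<kappa> where "\<kappa> m s = nat \<lfloor>s * real (Suc m) / T\<rfloor>" for m and s :: real
  define Xm where "Xm m z = (if \<kappa> m (fst z) <= Suc m then X (real (\<kappa> m (fst z)) * T / real (Suc m)) (snd z) else 0)" for m and z :: "real \<times> 'w"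
  have Xm: "Xm m \<in> borel_measurable (NT T)" for m
  proof -
    have f: "(\<lambda>s. \<lfloor>s * real (Suc m) / T\<rfloor>) \<in> measurable borel (count_space UNIV)"
      by (rule measurable_compose[OF _ measurable_real_floor]) simp
    have "\<kappa> m \<in> measurable borel (count_space UNIV)" unfolding \<kappa>_def[abs_def]
      by (rule measurable_compose[OF f]) simp
    then have k: "(\<lambda>z. \<kappa> m (fst z)) \<in> measurable (NT T) (count_space UNIV)" by (rule measurable_compose[OF fst_NT])
    have "(\<lambda>z. if k <= Suc m then X (real k * T / real (Suc m)) (snd z) else 0) \<in> borel_measurable (NT T)" for k
    proof (cases "k <= Suc m")
      case True
      from M_measurable_NT[OF cont_adaptedD(4)[OF X grid_in_interval[OF T True]]] True show ?thesis by simp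
    qed simp
    from measurable_compose_countable[OF this k] show ?thesis unfolding Xm_def[abs_def] .
  qed
  show ?thesis
  proof (rule borel_measurable_LIMSEQ_metric[OF Xm])
    fix z assume "z \<in> space (NT T)"
    then have z: "fst z \<in> {0..T}" "snd z \<in> space M" by (auto simp: space_pair_measure)
    let ?s = "fst z"
    have nn: "0 <= ?s * real (Suc m) / T" for m using z T by simp
    have k1: "real (\<kappa> m ?s) <= ?s * real (Suc m) / T" "?s * real (Suc m) / T < real (\<kappa> m ?s) + 1" for m
      using nn[of m] unfolding \<kappa>_def by linarith+
    have "?s * real (Suc m) / T <= real (Suc m)" for m
      using z T by (simp add: divide_le_eq mult.commute)
    then have 1: "\<kappa> m ?s <= Suc m" for m using k1(1)[of m] by (metis of_nat_le_iff order_trans)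
    have 2: "norm (real (\<kappa> m ?s) * T / real (Suc m) - ?s) <= T * inverse (real (Suc m))" for m
    proof -
      define N where "N = real (Suc m)"
      have N: "N > 0" by (simp add: N_def)
      have a: "real (\<kappa> m ?s) * T <= ?s * N" "?s * N <= (real (\<kappa> m ?s) + 1) * T"
        using k1[of m] T unfolding N_def[symmetric] by (simp_all add: pos_le_divide_eq pos_divide_less_eq less_imp_le)
      have "real (\<kappa> m ?s) * T / N <= ?s" using a(1) N by (simp add: pos_divide_le_eq)
      moreover have "?s <= real (\<kappa> m ?s) * T / N + T / N" using a(2) N by (simp add: pos_le_divide_eq add_divide_distrib[symmetric] distrib_right)
      moreover have "0 <= T / N" using T N by simp
      ultimately show ?thesis unfolding N_def[symmetric] real_norm_def abs_le_iff divide_inverse[symmetric]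
        by (intro conjI) linarith+
    qed
    have "(\<lambda>m. T * inverse (real (Suc m))) \<longlonglongrightarrow> 0"
      by (intro tendsto_mult_right_zero LIMSEQ_inverse_real_of_nat)
    then have "(\<lambda>m. real (\<kappa> m ?s) * T / real (Suc m) - ?s) \<longlonglongrightarrow> 0"
      by (rule Lim_null_comparison[OF always_eventually[OF allI[OF 2]]])
    then have l: "(\<lambda>m. real (\<kappa> m ?s) * T / real (Suc m)) \<longlonglongrightarrow> ?s" by (simp only: LIM_zero_iff)
    have "(\<lambda>m. X (real (\<kappa> m ?s) * T / real (Suc m)) (snd z)) \<longlonglongrightarrow> X ?s (snd z)"
      by (rule continuous_on_tendsto_compose[OF cont_adaptedD(2)[OF X z(2)] l z(1)]) (use grid_in_interval[OF T 1] in auto)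
    then show "(\<lambda>m. Xm m z) \<longlonglongrightarrow> X @@ z" using 1 by (simp add: Xm_def del: of_nat_Suc)
  qed
qed

lemma cont_adapted_L2:
  fixes X :: "real => 'w => 'b::euclidean_space"
  assumes T: "T > 0" and X: "X \<in> Cp T" shows "X \<in> L2p T"
proof -
  have m: "(\<lambda>z. X @@ z) \<in> borel_measurable (NT T)" by (rule cont_adapted_measurable[OF T X])
  have [measurable]: "supsq T X \<in> borel_measurable M"
    by (rule supsq_measurable[OF T]) (use cont_adaptedD[OF X] in auto)
  have "(\<integral>\<^sup>+w. (\<integral>\<^sup>+s. ennreal ((norm (X s w))^2) \<partial>(LT T)) \<partial>M)
      <= (\<integral>\<^sup>+w. (\<integral>\<^sup>+s. supsq T X w \<partial>(LT T)) \<partial>M)"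
    by (intro nn_integral_mono supsq_upper) simp
  also have "... = (\<integral>\<^sup>+w. ennreal T * supsq T X w \<partial>M)"
    using T by (simp add: mult.commute emeasure_restrict_space)
  also have "... = ennreal T * (\<integral>\<^sup>+w. supsq T X w \<partial>M)" by (simp add: nn_integral_cmult)
  also have "... < \<infinity>" using cont_adaptedD(3)[OF X] by (simp add: ennreal_mult_less_top)
  finally show ?thesis unfolding L2_adapted_def case_prod_beta' using m cont_adaptedD(1)[OF X] by simp
qed

lemma L2_adapted_sq_int: "f \<in> L2p T ==> sq_int (NT T) (\<lambda>z. f @@ z)"
  and L2_adapted_adapted: "f \<in> L2p T ==> s \<in> {0..T} ==> f s \<in> borel_measurable (F s)"
  by (auto simp: L2_adapted_iff)

lemma L2_adapted_lincomb:
  fixes f g :: "real => 'w => 'b::euclidean_space"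
  assumes "f \<in> L2p T" "g \<in> L2p T"
  shows "(\<lambda>s w. a *\<^sub>R f s w + b *\<^sub>R g s w) \<in> L2p T"
  using assms unfolding L2_adapted_iff
  by (auto intro!: sq_int_add sq_int_scaleR borel_measurable_add borel_measurable_scaleR)

lemma L2_adapted_inner: "f \<in> L2p T ==> (\<lambda>s w. f s w \<bullet> c) \<in> L2p T"
  unfolding L2_adapted_iff by (auto intro!: sq_int_inner_const)

lemma sq_int_space_slices:
  assumes "sq_int (NT T) f" shows "AE s in LT T. sq_int M (\<lambda>w. f (s, w))"
proof -
  interpret P: pair_sigma_finite "LT T" M by (rule pair_sigma_finite_time)
  have i: "integrable (NT T) (\<lambda>(s,w). (norm (f (s, w)))^2)" using assms by (simp add: sq_int_def case_prod_beta')
  show ?thesis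
    using P.AE_integrable_fst[OF i] AE_space[of "LT T"]
  proof eventually_elim
    case (elim s)
    have "(\<lambda>w. f (s, w)) \<in> borel_measurable M"
      by (rule measurable_compose[OF measurable_Pair1' sq_int_measurable[OF assms]]) (use elim in simp)
    with elim show ?case by (simp add: sq_int_def)
  qed
qed

lemma L2_adapted_slices:
  "f \<in> L2p T ==> AE s in LT T. sq_int M (f s)"
  using sq_int_space_slices[OF L2_adapted_sq_int] by fastforce

lemma NT_integrals:
  fixes f :: "real \<times> 'w => 'b::euclidean_space"
  assumes "integrable (NT T) f"
  shows "integrable (LT T) (\<lambda>s. \<integral>w. f (s, w) \<partial>M)"
    and "integrable M (\<lambda>w. \<integral>s. f (s, w) \<partial>(LT T))"
    and "(\<integral>s. (\<E> w. f (s, w)) \<partial>(LT T)) = (\<integral>z. f z \<partial>NT T)"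
    and "(\<E> w. (\<integral>s. f (s, w) \<partial>(LT T))) = (\<integral>z. f z \<partial>NT T)"
    and "AE w in M. integrable (LT T) (\<lambda>s. f (s, w))"
    and "AE s in LT T. integrable M (\<lambda>w. f (s, w))"
proof -
  interpret P: pair_sigma_finite "LT T" M by (rule pair_sigma_finite_time)
  have i: "integrable (NT T) (\<lambda>(s,w). f (s, w))" using assms by (simp add: case_prod_beta')
  show "integrable (LT T) (\<lambda>s. \<integral>w. f (s, w) \<partial>M)" by (rule P.integrable_fst'[OF assms])
  show "integrable M (\<lambda>w. \<integral>s. f (s, w) \<partial>(LT T))" by (rule P.integrable_snd[OF i])
  show 1: "(\<integral>s. (\<E> w. f (s, w)) \<partial>(LT T)) = (\<integral>z. f z \<partial>NT T)" by (rule P.integral_fst'[OF assms])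
  show "(\<E> w. (\<integral>s. f (s, w) \<partial>(LT T))) = (\<integral>z. f z \<partial>NT T)"
    using P.Fubini_integral[OF i] 1 by simp
  show "AE w in M. integrable (LT T) (\<lambda>s. f (s, w))" by (rule P.AE_integrable_snd[OF i])
  show "AE s in LT T. integrable M (\<lambda>w. f (s, w))" by (rule P.AE_integrable_fst'[OF assms])
qed

lemma msq_NT:
  fixes f :: "real \<times> 'w => 'b::euclidean_space"
  assumes "sq_int (NT T) f"
  shows "msq (NT T) f = (\<integral>s. msq M (\<lambda>w. f (s, w)) \<partial>(LT T))"
    "integrable (LT T) (\<lambda>s. msq M (\<lambda>w. f (s, w)))"
    "msq (NT T) f = (\<E> w. msq (LT T) (\<lambda>s. f (s, w)))"
    "integrable M (\<lambda>w. msq (LT T) (\<lambda>s. f (s, w)))"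
  unfolding msq_def using NT_integrals[OF sq_int_integrable[OF assms]] by simp_all

text \<open>
  The pathwise integral is defined for almost all scenarios only; on the exceptional set it is replaced so that all paths are continuous.
\<close>

theorem drift_process:
  fixes b :: "real => 'w => 'b::euclidean_space"
  assumes T: "T > 0" and b: "b \<in> L2p T"
  obtains D where "D \<in> Cp T"
    "AE w in M. \<forall>t. D t w = (\<integral>s. b s w \<partial>(LT t))"
    "(\<integral>\<^sup>+w. supsq T D w \<partial>M) <= ennreal (T * msq (NT T) (\<lambda>z. b @@ z))"
proof -
  let ?L = "LT T"
  interpret N: finite_measure "NT T" by (rule finite_NT)
  note sb = L2_adapted_sq_int[OF b]
  define G where "G w \<longleftrightarrow> sq_int ?L (\<lambda>s. b s w)" for w
  have G: "AE w in M. G w" using sq_int_slices[OF sb] by (simp add: G_def)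
  define D where "D t w = (if G w then \<integral>s. b s w \<partial>(LT t) else 0)" for t w
  have ae: "AE w in M. (\<integral>s. b s w \<partial>(LT t)) = D t w" for t
    using G by eventually_elim (simp add: D_def)
  have DF: "D t \<in> borel_measurable (F t)" if t: "t \<in> {0..T}" for t
  proof (rule F_measurable_AE'[OF _ ae])
    have eq: "(\<lambda>w. \<integral>s. b s w \<partial>(LT t)) = (\<lambda>w. \<integral>s. indicator {0..t} s *\<^sub>R b s w \<partial>?L)"
      using t by (subst integral_time_restrict[of t T]) auto
    have "sq_int (NT T) (\<lambda>z. (indicator {0..t} (fst z) * 1) *\<^sub>R b @@ z)"
      by (rule sq_int_indicator_time[OF sb]) simp
    from N.sq_int_imp_integrable[OF this]
    have i: "integrable (NT T) (\<lambda>(s, w). indicator {0..t} s *\<^sub>R b s w)" by (simp add: case_prod_beta')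
    show "(\<lambda>w. \<integral>s. b s w \<partial>(LT t)) \<in> borel_measurable (F t)"
      unfolding eq
    proof (rule time_integral_adapted[OF i])
      fix s assume s: "s \<in> {0..T}"
      show "(\<lambda>w. indicator {0..t} s *\<^sub>R b s w) \<in> borel_measurable (F t)"
      proof (cases "s <= t")
        case True
        from F_measurable_mono[OF this L2_adapted_adapted[OF b s]] show ?thesis by measurable
      qed simp
    qed
  qed
  have Dc: "continuous_on {0..T} (\<lambda>t. D t w)" for w
  proof (cases "G w")
    case True
    then show ?thesis
      unfolding D_def using integral_time_continuous[OF L.sq_int_imp_integrable[where f="\<lambda>s. b s w"]] by (simp add: G_def)
  qed (simp add: D_def)
  have "(\<integral>\<^sup>+w. supsq T D w \<partial>M) <= (\<integral>\<^sup>+w. ennreal (T * msq ?L (\<lambda>s. b s w)) \<partial>M)"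
  proof (rule nn_integral_mono)
    fix w
    show "supsq T D w <= ennreal (T * msq ?L (\<lambda>s. b s w))"
      unfolding supsq_def
    proof (rule SUP_least, rule ennreal_leI)
      fix t assume t: "t \<in> {0..T}"
      show "(norm (D t w))^2 <= T * msq ?L (\<lambda>s. b s w)"
      proof (cases "G w")
        case True
        then show ?thesis using integral_time_sq_bound[OF _ t, of "\<lambda>s. b s w"] by (simp add: D_def G_def)
      next
        case False
        have "0 <= T * msq ?L (\<lambda>s. b s w)" using T by (intro mult_nonneg_nonneg msq_nonneg) auto
        with False show ?thesis by (simp add: D_def)
      qed
    qed
  qed
  also have "... = ennreal (\<E> w. T * msq ?L (\<lambda>s. b s w))"
    by (rule nn_integral_eq_integral) (use msq_NT(4)[OF sb] T in \<open>auto simp: msq_nonneg\<close>)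
  also have "(\<E> w. T * msq ?L (\<lambda>s. b s w)) = T * msq (NT T) (\<lambda>z. b @@ z)"
    using msq_NT(3)[OF sb] by simp
  finally have S: "(\<integral>\<^sup>+w. supsq T D w \<partial>M) <= ennreal (T * msq (NT T) (\<lambda>z. b @@ z))" .
  have "D \<in> Cp T"
    unfolding cont_adapted_iff using DF Dc S by (auto intro: order.strict_trans1)
  moreover have "AE w in M. \<forall>t. D t w = (\<integral>s. b s w \<partial>(LT t))"
    using G by eventually_elim (simp add: D_def)
  ultimately show thesis using S that by blast
qed

text \<open>
  The equation is required at each time up to a null set depending on the time, as in the notion of a
state process; two such processes with continuous paths have the same supremum almost surely (\<open>modification_supsq\<close>).
\<close>

definition ito_process :: "real => 'b => (real => 'w => 'b) => (real => 'w => 'b) => (real => 'w => 'b::euclidean_space) => bool" where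
  "ito_process T x b \<sigma> Z \<longleftrightarrow> Z \<in> Cp T \<and> b \<in> L2p T \<and> \<sigma> \<in> L2p T \<and>
     (\<forall>t\<in>{0..T}. \<exists>Y. has_ito_integral M W t \<sigma> Y \<and>
        (AE w in M. Z t w = x + (\<integral>s. b s w \<partial>(LT t)) + Y w))"

lemma cont_adapted_const: "(\<lambda>s w. x) \<in> Cp T" for x :: "'b::euclidean_space"
proof -
  have "supsq T (\<lambda>s w. x) w <= ennreal ((norm x)^2)" for w :: 'w unfolding supsq_def by (rule SUP_least) simp
  then have "(\<integral>\<^sup>+w. supsq T (\<lambda>s w. x) w \<partial>M) <= (\<integral>\<^sup>+w. ennreal ((norm x)^2) \<partial>M)" by (intro nn_integral_mono)
  also have "... < \<infinity>" by (simp add: emeasure_space_1)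
  finally show ?thesis unfolding cont_adapted_iff by simp
qed

theorem ito_process_exists:
  fixes b \<sigma> :: "real => 'w => 'b::euclidean_space"
  assumes T: "T > 0" and b: "b \<in> L2p T" and \<sigma>: "\<sigma> \<in> L2p T"
  obtains D Y where "ito_process T x b \<sigma> (\<lambda>t w. x + D t w + Y t w)"
    "D \<in> Cp T" "AE w in M. \<forall>t. D t w = (\<integral>s. b s w \<partial>(LT t))"
    "(\<integral>\<^sup>+w. supsq T D w \<partial>M) <= ennreal (T * msq (NT T) (\<lambda>z. b @@ z))"
    "Y \<in> Cp T" "\<And>t. t \<in> {0..T} ==> has_ito_integral M W t \<sigma> (Y t)" "orth T Y"
proof -
  obtain D where D: "D \<in> Cp T"
    "AE w in M. \<forall>t. D t w = (\<integral>s. b s w \<partial>(LT t))"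
    "(\<integral>\<^sup>+w. supsq T D w \<partial>M) <= ennreal (T * msq (NT T) (\<lambda>z. b @@ z))"
    using that by (rule drift_process[OF T b])
  obtain Y where Y: "Y \<in> Cp T" "\<And>t. t \<in> {0..T} ==> has_ito_integral M W t \<sigma> (Y t)" "orth T Y"
    using that by (rule ito_integral_process[OF T \<sigma>])
  have "ito_process T x b \<sigma> (\<lambda>t w. x + D t w + Y t w)"
    unfolding ito_process_def
  proof (intro conjI b \<sigma> ballI)
    show "(\<lambda>t w. x + D t w + Y t w) \<in> Cp T"
      by (rule cont_adapted_add[OF T cont_adapted_add[OF T cont_adapted_const D(1)] Y(1)])
    fix t assume t: "t \<in> {0..T}"
    have "AE w in M. x + D t w + Y t w = x + (\<integral>s. b s w \<partial>(LT t)) + Y t w"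
      using D(2) by eventually_elim simp
    with Y(2)[OF t] show "\<exists>Ya. has_ito_integral M W t \<sigma> Ya \<and>
        (AE w in M. x + D t w + Y t w = x + (\<integral>s. b s w \<partial>(LT t)) + Ya w)" by blast
  qed
  from that[OF this D Y] show thesis .
qed

lemma ito_process_unique:
  fixes b \<sigma> :: "real => 'w => 'b::euclidean_space"
  assumes Z: "ito_process T x b \<sigma> Z" and Z': "ito_process T x b \<sigma> Z'" and t: "t \<in> {0..T}"
  shows "AE w in M. Z t w = Z' t w"
proof -
  obtain Y where Y: "has_ito_integral M W t \<sigma> Y" "AE w in M. Z t w = x + (\<integral>s. b s w \<partial>(LT t)) + Y w"
    using Z t unfolding ito_process_def by blast
  obtain Y' where Y': "has_ito_integral M W t \<sigma> Y'" "AE w in M. Z' t w = x + (\<integral>s. b s w \<partial>(LT t)) + Y' w"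
    using Z' t unfolding ito_process_def by blast
  have "AE w in M. Y w = Y' w" by (rule ito_unique_AE[OF Y(1) Y'(1), of t]) (use t in auto)
  with Y(2) Y'(2) show ?thesis by eventually_elim simp
qed

lemma modification_supsq:
  assumes T: "T > 0" and X: "X \<in> Cp T" and Y: "Y \<in> Cp T"
    and eq: "\<And>t. t \<in> {0..T} ==> AE w in M. X t w = Y t w"
  shows "AE w in M. supsq T X w = supsq T Y w"
proof -
  let ?P = "{(k,m). k <= Suc m}"
  have "AE w in M. \<forall>p\<in>?P. X (real (fst p) * T / real (Suc (snd p))) w = Y (real (fst p) * T / real (Suc (snd p))) w"
  proof (rule AE_ball_countable[THEN iffD2])
    show "countable ?P" by (rule countable_subset[of _ UNIV]) auto
    show "\<forall>p\<in>?P. AE w in M. X (real (fst p) * T / real (Suc (snd p))) w = Y (real (fst p) * T / real (Suc (snd p))) w"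
      by (auto simp del: of_nat_Suc intro!: eq[OF grid_in_interval[OF T]])
  qed
  then show ?thesis using AE_space[of M]
  proof eventually_elim
    case (elim w)
    then show ?case
      unfolding supsq_grid[where X=X, OF T cont_adaptedD(2)[OF X elim(2)]] supsq_grid[where X=Y, OF T cont_adaptedD(2)[OF Y elim(2)]]
      by (intro SUP_cong) auto
  qed
qed

theorem ito_process_sup_bound:
  fixes b \<sigma> :: "real => 'w => 'b::euclidean_space"
  assumes T: "T > 0" and Z: "ito_process T 0 b \<sigma> Z"
  shows "(\<integral>\<^sup>+w. supsq T Z w \<partial>M) <= ennreal (2 * T * msq (NT T) (\<lambda>z. b @@ z) + 8 * msq (NT T) (\<lambda>z. \<sigma> @@ z))"
proof -
  have b: "b \<in> L2p T" and \<sigma>: "\<sigma> \<in> L2p T" using Z by (auto simp: ito_process_def)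
  obtain D Y where DY: "ito_process T 0 b \<sigma> (\<lambda>t w. 0 + D t w + Y t w)"
    "D \<in> Cp T" "AE w in M. \<forall>t. D t w = (\<integral>s. b s w \<partial>(LT t))"
    "(\<integral>\<^sup>+w. supsq T D w \<partial>M) <= ennreal (T * msq (NT T) (\<lambda>z. b @@ z))"
    "Y \<in> Cp T" "\<And>t. t \<in> {0..T} ==> has_ito_integral M W t \<sigma> (Y t)" "orth T Y"
    using that by (rule ito_process_exists[OF T b \<sigma>])
  have TT: "0 <= T" "T \<in> {0..T}" using T by auto
  have [measurable]: "supsq T D \<in> borel_measurable M" "supsq T Y \<in> borel_measurable M"
    using cont_adaptedD[OF DY(2)] cont_adaptedD[OF DY(5)] by (auto intro!: supsq_measurable[OF T])
  have "(\<integral>\<^sup>+w. supsq T Z w \<partial>M) = (\<integral>\<^sup>+w. supsq T (\<lambda>t w. 0 + D t w + Y t w) w \<partial>M)"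
    by (intro nn_integral_cong_AE modification_supsq[OF T] ito_process_unique[OF Z DY(1)])
       (use Z DY(1) in \<open>auto simp: ito_process_def\<close>)
  also have "... <= (\<integral>\<^sup>+w. 2 * supsq T D w + 2 * supsq T Y w \<partial>M)"
    by (intro nn_integral_mono) (simp add: supsq_add_le)
  also have "... = 2 * (\<integral>\<^sup>+w. supsq T D w \<partial>M) + 2 * (\<integral>\<^sup>+w. supsq T Y w \<partial>M)"
    by (simp add: nn_integral_add nn_integral_cmult)
  also have "... <= 2 * ennreal (T * msq (NT T) (\<lambda>z. b @@ z)) + 2 * ennreal (4 * msq M (Y T))"
    by (intro add_mono mult_left_mono DY(4) doob_maximal T cont_adapted_sq_int[OF DY(5)] cont_adaptedD[OF DY(5)] DY(7)) auto
  also have "msq M (Y T) = msq (NT T) (cut T \<sigma>)" by (rule ito_isometry[OF DY(6)[OF TT(2)] TT(1) order_refl])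
  also have "... = msq (NT T) (\<lambda>z. \<sigma> @@ z)"
    by (rule msq_cong_AE[OF cut_self]) (use L2_adapted_cut[OF TT(1) order_refl \<sigma>] L2_adapted_sq_int[OF \<sigma>] in \<open>auto simp: sq_int_def\<close>)
  also have "2 * ennreal (T * msq (NT T) (\<lambda>z. b @@ z)) + 2 * ennreal (4 * msq (NT T) (\<lambda>z. \<sigma> @@ z))
      = ennreal (2 * T * msq (NT T) (\<lambda>z. b @@ z) + 8 * msq (NT T) (\<lambda>z. \<sigma> @@ z))"
    using T by (simp add: ennreal_plus[symmetric] ennreal_mult''[symmetric] msq_nonneg mult.assoc del: ennreal_plus
        flip: ennreal_numeral ennreal_mult)
  finally show ?thesis .
qed

lemma ito_lincomb:
  fixes f g :: "real => 'w => 'b::euclidean_space"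
  assumes T: "T > 0" and f: "f \<in> L2p T" and g: "g \<in> L2p T" and t: "t \<in> {0..T}"
    and Y: "has_ito_integral M W t f Y" and Z: "has_ito_integral M W t g Z"
  shows "has_ito_integral M W t (\<lambda>s w. a *\<^sub>R f s w + b *\<^sub>R g s w) (\<lambda>w. a *\<^sub>R Y w + b *\<^sub>R Z w)"
proof -
  let ?h = "\<lambda>s w. a *\<^sub>R f s w + b *\<^sub>R g s w"
  have t': "0 <= t" "t <= T" using t by auto
  obtain V where V0: "V \<in> Cp T" "\<And>t. t \<in> {0..T} ==> has_ito_integral M W t ?h (V t)" "orth T V"
    using that by (rule ito_integral_process[OF T L2_adapted_lincomb[OF f g]])
  note V = V0(2)[OF t]
  note sY = ito_sq_int[OF Y t'] and sZ = ito_sq_int[OF Z t'] and sV = ito_sq_int[OF V t']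
  have sU: "sq_int M (\<lambda>w. a *\<^sub>R Y w + b *\<^sub>R Z w)" by (intro sq_int_add sq_int_scaleR sY sZ)
  have sC: "sq_int (NT T) (\<lambda>z. a *\<^sub>R cut t f z + b *\<^sub>R cut t g z)" by (intro sq_int_add sq_int_scaleR sY sZ)
  have exp1: "(\<integral>x. v x \<bullet> (a *\<^sub>R y x + b *\<^sub>R z x) \<partial>N) = a * (\<integral>x. v x \<bullet> y x \<partial>N) + b * (\<integral>x. v x \<bullet> z x \<partial>N)"
    if "sq_int N v" "sq_int N y" "sq_int N z" for N and v y z :: "'q => 'b"
    using sq_int_inner[OF that(1,2)] sq_int_inner[OF that(1,3)] by (simp add: inner_add_right)
  have exp2: "(\<integral>x. (a *\<^sub>R y x + b *\<^sub>R z x) \<bullet> (a *\<^sub>R y x + b *\<^sub>R z x) \<partial>N)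
      = a * (a * (\<integral>x. y x \<bullet> y x \<partial>N) + b * (\<integral>x. y x \<bullet> z x \<partial>N)) + b * (a * (\<integral>x. y x \<bullet> z x \<partial>N) + b * (\<integral>x. z x \<bullet> z x \<partial>N))"
    if "sq_int N y" "sq_int N z" for N and y z :: "'q => 'b"
  proof -
    have s: "sq_int N (\<lambda>x. a *\<^sub>R y x + b *\<^sub>R z x)" by (intro sq_int_add sq_int_scaleR that)
    have "(\<integral>x. (a *\<^sub>R y x + b *\<^sub>R z x) \<bullet> (a *\<^sub>R y x + b *\<^sub>R z x) \<partial>N)
      = a * (\<integral>x. (a *\<^sub>R y x + b *\<^sub>R z x) \<bullet> y x \<partial>N) + b * (\<integral>x. (a *\<^sub>R y x + b *\<^sub>R z x) \<bullet> z x \<partial>N)"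
      by (rule exp1[OF s that])
    also have "(\<integral>x. (a *\<^sub>R y x + b *\<^sub>R z x) \<bullet> y x \<partial>N) = a * (\<integral>x. y x \<bullet> y x \<partial>N) + b * (\<integral>x. y x \<bullet> z x \<partial>N)"
      using exp1[OF that(1) that] by (simp add: inner_commute)
    also have "(\<integral>x. (a *\<^sub>R y x + b *\<^sub>R z x) \<bullet> z x \<partial>N) = a * (\<integral>x. y x \<bullet> z x \<partial>N) + b * (\<integral>x. z x \<bullet> z x \<partial>N)"
      using exp1[OF that(2) that] by (simp add: inner_commute)
    finally show ?thesis .
  qed
  note p = ito_polar[OF V t' V t'] ito_polar[OF V t' Y t'] ito_polar[OF V t' Z t'] ito_polar[OF Y t' Y t']
    ito_polar[OF Y t' Z t'] ito_polar[OF Z t' Z t']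
  have "msq M (\<lambda>w. V t w - (a *\<^sub>R Y w + b *\<^sub>R Z w)) = msq (NT T) (\<lambda>z. cut t ?h z - (a *\<^sub>R cut t f z + b *\<^sub>R cut t g z))"
    unfolding msq_diff_expand[OF sV(2) sU] msq_diff_expand[OF sV(1) sC] exp1[OF sV(2) sY(2) sZ(2)] exp1[OF sV(1) sY(1) sZ(1)]
    unfolding msq_def power2_norm_eq_inner exp2[OF sY(2) sZ(2)] exp2[OF sY(1) sZ(1)] p ..
  also have "... = msq (NT T) (\<lambda>z. 0 :: 'b)"
    by (intro arg_cong[where f="msq (NT T)"] ext) (simp add: cut_def scaleR_add_right mult.commute)
  also have "... = 0" by (simp add: msq_def)
  finally have "AE w in M. V t w - (a *\<^sub>R Y w + b *\<^sub>R Z w) = 0" by (rule msq_eq_0_AE[OF sq_int_diff[OF sV(2) sU]])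
  then have "AE w in M. V t w = a *\<^sub>R Y w + b *\<^sub>R Z w" by eventually_elim simp
  from has_ito_integral_AE[OF V this] show ?thesis .
qed

lemma drift_integrable_AE:
  assumes "b \<in> L2p T" "t \<in> {0..T}"
  shows "AE w in M. integrable (LT t) (\<lambda>s. b s w)"
proof -
  show ?thesis using sq_int_slices[OF L2_adapted_sq_int[OF assms(1)]]
    by eventually_elim (use assms(2) L.sq_int_imp_integrable integrable_time_subset[of t T] in auto)
qed

theorem ito_process_lincomb:
  fixes b \<sigma> b' \<sigma>' :: "real => 'w => 'b::euclidean_space"
  assumes T: "T > 0" and Z: "ito_process T x b \<sigma> Z" and Z': "ito_process T x' b' \<sigma>' Z'"
  shows "ito_process T (p *\<^sub>R x + q *\<^sub>R x') (\<lambda>s w. p *\<^sub>R b s w + q *\<^sub>R b' s w) (\<lambda>s w. p *\<^sub>R \<sigma> s w + q *\<^sub>R \<sigma>' s w)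
    (\<lambda>s w. p *\<^sub>R Z s w + q *\<^sub>R Z' s w)"
  unfolding ito_process_def
proof (intro conjI ballI)
  have b: "b \<in> L2p T" "\<sigma> \<in> L2p T" "b' \<in> L2p T" "\<sigma>' \<in> L2p T"
    "Z \<in> Cp T" "Z' \<in> Cp T"
    using Z Z' by (auto simp: ito_process_def)
  show "(\<lambda>s w. p *\<^sub>R Z s w + q *\<^sub>R Z' s w) \<in> Cp T"
    by (intro cont_adapted_add cont_adapted_scaleR T b)
  show "(\<lambda>s w. p *\<^sub>R b s w + q *\<^sub>R b' s w) \<in> L2p T" "(\<lambda>s w. p *\<^sub>R \<sigma> s w + q *\<^sub>R \<sigma>' s w) \<in> L2p T"
    by (intro L2_adapted_lincomb b)+
  fix t assume t: "t \<in> {0..T}"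
  obtain Y where Y: "has_ito_integral M W t \<sigma> Y" "AE w in M. Z t w = x + (\<integral>s. b s w \<partial>(LT t)) + Y w"
    using Z t unfolding ito_process_def by blast
  obtain Y' where Y': "has_ito_integral M W t \<sigma>' Y'" "AE w in M. Z' t w = x' + (\<integral>s. b' s w \<partial>(LT t)) + Y' w"
    using Z' t unfolding ito_process_def by blast
  have "AE w in M. p *\<^sub>R Z t w + q *\<^sub>R Z' t w = p *\<^sub>R x + q *\<^sub>R x' + (\<integral>s. p *\<^sub>R b s w + q *\<^sub>R b' s w \<partial>(LT t)) + (p *\<^sub>R Y w + q *\<^sub>R Y' w)"
    using Y(2) Y'(2) drift_integrable_AE[OF b(1) t] drift_integrable_AE[OF b(3) t]
  proof eventually_elim
    case (elim w)
    have "(\<integral>s. p *\<^sub>R b s w + q *\<^sub>R b' s w \<partial>(LT t)) = p *\<^sub>R (\<integral>s. b s w \<partial>(LT t)) + q *\<^sub>R (\<integral>s. b' s w \<partial>(LT t))"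
      by (subst bint_add) (use elim in auto)
    then show ?case using elim by (simp add: scaleR_add_right)
  qed
  with ito_lincomb[OF T b(2,4) t Y(1) Y'(1), of p q]
  show "\<exists>Y. has_ito_integral M W t (\<lambda>s w. p *\<^sub>R \<sigma> s w + q *\<^sub>R \<sigma>' s w) Y \<and>
        (AE w in M. p *\<^sub>R Z t w + q *\<^sub>R Z' t w = p *\<^sub>R x + q *\<^sub>R x' + (\<integral>s. p *\<^sub>R b s w + q *\<^sub>R b' s w \<partial>(LT t)) + Y w)"
    by blast
qed

corollary ito_process_diff:
  fixes b \<sigma> b' \<sigma>' :: "real => 'w => 'b::euclidean_space"
  assumes "T > 0" "ito_process T x b \<sigma> Z" "ito_process T x' b' \<sigma>' Z'"
  shows "ito_process T (x - x') (\<lambda>s w. b s w - b' s w) (\<lambda>s w. \<sigma> s w - \<sigma>' s w) (\<lambda>s w. Z s w - Z' s w)"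
  using ito_process_lincomb[OF assms, of 1 "-1"] by simp

lemma simple_ito_inner:
  assumes "simple_ito_integral M W t \<phi> S"
  shows "simple_ito_integral M W t (\<lambda>s w. \<phi> s w \<bullet> c) (\<lambda>w. S w \<bullet> c)"
proof -
  from assms[unfolded simple_ito_integral_def] obtain k \<tau> \<xi> where
    *: "0 <= \<tau> 0" "\<forall>i<(k::nat). \<tau> i <= \<tau> (Suc i)" "\<tau> k <= t"
      "\<forall>i<k. \<xi> i \<in> borel_measurable (F (\<tau> i)) \<and> integrable M (\<lambda>w. (norm (\<xi> i w))^2)"
      "\<phi> = (\<lambda>s w. \<Sum>i<k. indicator {\<tau> i<..\<tau> (Suc i)} s *\<^sub>R \<xi> i w)"
      "S = (\<lambda>w. \<Sum>i<k. (W (\<tau> (Suc i)) w - W (\<tau> i) w) *\<^sub>R \<xi> i w)"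
    by (elim exE conjE)
  show ?thesis
    unfolding simple_ito_integral_def
  proof (intro exI[of _ k] exI[of _ \<tau>] exI[of _ "\<lambda>i w. \<xi> i w \<bullet> c"] conjI allI impI)
    fix i assume i: "i < k"
    have [measurable]: "\<xi> i \<in> borel_measurable (F (\<tau> i))" using * i by blast
    show "(\<lambda>w. \<xi> i w \<bullet> c) \<in> borel_measurable (F (\<tau> i))" by measurable
    have "sq_int M (\<xi> i)" unfolding sq_int_def using *(4)[rule_format, OF i] F_measurable_M by blast
    from sq_int_integrable[OF sq_int_inner_const[OF this, of c]]
    show "integrable M (\<lambda>w. (norm (\<xi> i w \<bullet> c))^2)" .
  qed (use * in \<open>auto simp: inner_sum_left fun_eq_iff\<close>)
qed

lemma has_ito_inner:
  fixes f :: "real => 'w => 'a::euclidean_space"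
  assumes Y: "has_ito_integral M W t f Y" and t: "0 <= t" and f: "f \<in> L2p t"
  shows "has_ito_integral M W t (\<lambda>s w. f s w \<bullet> c) (\<lambda>w. Y w \<bullet> c)"
proof -
  obtain \<phi> S where a: "sq_int (NT t) (cut t f)" "sq_int M Y"
    "\<And>j::nat. simple_ito_integral M W t (\<phi> j) (S j)"
    "(\<lambda>j. msq (NT t) (\<lambda>z. \<phi> j @@ z - cut t f z)) \<longlonglongrightarrow> 0"
    "(\<lambda>j. msq M (\<lambda>w. S j w - Y w)) \<longlonglongrightarrow> 0"
    using that by (rule has_ito_limit[OF Y t order_refl])
  have contr: "(\<lambda>j. msq N (\<lambda>x. g j x \<bullet> c - h x \<bullet> c)) \<longlonglongrightarrow> 0"
    if g: "\<And>j. sq_int N (g j)" "sq_int N h" "(\<lambda>j. msq N (\<lambda>x. g j x - h x)) \<longlonglongrightarrow> 0" for N and g :: "nat => 'q => 'a" and h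
  proof (rule tendsto_sandwich[OF _ _ tendsto_const])
    have "msq N (\<lambda>x. g j x \<bullet> c - h x \<bullet> c) <= (norm c)^2 * msq N (\<lambda>x. g j x - h x)" for j
    proof (rule msq_mono_AE)
      show "AE x in N. norm (g j x \<bullet> c - h x \<bullet> c) <= norm c * norm (g j x - h x)"
        by (simp add: inner_diff_left[symmetric] mult.commute[of "norm c"] Cauchy_Schwarz_ineq2)
      show "sq_int N (\<lambda>x. g j x - h x)" by (intro sq_int_diff g)
      show "(\<lambda>x. g j x \<bullet> c - h x \<bullet> c) \<in> borel_measurable N"
        by (intro sq_int_measurable sq_int_diff sq_int_inner_const g)
    qed
    then show "\<forall>\<^sub>F j in sequentially. msq N (\<lambda>x. g j x \<bullet> c - h x \<bullet> c) <= (norm c)^2 * msq N (\<lambda>x. g j x - h x)" by simp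
    show "(\<lambda>j. (norm c)^2 * msq N (\<lambda>x. g j x - h x)) \<longlonglongrightarrow> 0" by (rule tendsto_mult_right_zero[OF g(3)])
  qed (simp add: msq_nonneg)
  note sf = L2_adapted_sq_int[OF f]
  have eq: "msq (NT t) (\<lambda>z. \<phi> j @@ z - cut t f z) = msq (NT t) (\<lambda>z. \<phi> j @@ z - f @@ z)" for j
  proof (rule msq_cong_AE)
    show "AE z in NT t. \<phi> j @@ z - cut t f z = \<phi> j @@ z - f @@ z"
      using cut_self[of t f] by eventually_elim simp
  qed (intro sq_int_measurable sq_int_diff simple_ito_sq_int(1)[OF a(3) order_refl] a(1) sf)+
  show ?thesis
  proof (rule has_ito_integralI[OF t L2_adapted_inner[OF f] sq_int_inner_const[OF a(2)] simple_ito_inner[OF a(3)]])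
    show "(\<lambda>j. msq (NT t) (\<lambda>z. \<phi> j @@ z \<bullet> c - f @@ z \<bullet> c)) \<longlonglongrightarrow> 0"
      by (rule contr[OF simple_ito_sq_int(1)[OF a(3) order_refl] sf]) (use a(4) in \<open>simp add: eq\<close>)
    show "(\<lambda>j. msq M (\<lambda>w. S j w \<bullet> c - Y w \<bullet> c)) \<longlonglongrightarrow> 0"
      by (rule contr[OF simple_ito_sq_int(2)[OF a(3) order_refl] a(2,5)])
  qed
qed

theorem ito_process_inner:
  assumes T: "T > 0" and Z: "ito_process T x b \<sigma> Z"
  shows "ito_process T (x \<bullet> c) (\<lambda>s w. b s w \<bullet> c) (\<lambda>s w. \<sigma> s w \<bullet> c) (\<lambda>s w. Z s w \<bullet> c)"
  unfolding ito_process_def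
proof (intro conjI ballI)
  have b: "b \<in> L2p T" "\<sigma> \<in> L2p T" and Zc: "Z \<in> Cp T"
    using Z by (auto simp: ito_process_def)
  show "(\<lambda>s w. b s w \<bullet> c) \<in> L2p T" "(\<lambda>s w. \<sigma> s w \<bullet> c) \<in> L2p T"
    by (intro L2_adapted_inner b)+
  show "(\<lambda>s w. Z s w \<bullet> c) \<in> Cp T"
    unfolding cont_adapted_iff
  proof (intro conjI ballI)
    have [measurable]: "supsq T Z \<in> borel_measurable M"
      by (rule supsq_measurable[OF T]) (use cont_adaptedD[OF Zc] in auto)
    have "(\<integral>\<^sup>+w. supsq T (\<lambda>s w. Z s w \<bullet> c) w \<partial>M) <= (\<integral>\<^sup>+w. ennreal ((norm c)^2) * supsq T Z w \<partial>M)"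
    proof (rule nn_integral_mono)
      fix w
      show "supsq T (\<lambda>s w. Z s w \<bullet> c) w <= ennreal ((norm c)^2) * supsq T Z w"
        unfolding supsq_def[of T "\<lambda>s w. Z s w \<bullet> c"]
      proof (rule SUP_least)
        fix s assume s: "s \<in> {0..T}"
        have "(norm (Z s w \<bullet> c))^2 <= (norm (Z s w) * norm c)^2" by (intro power_mono) (auto simp: Cauchy_Schwarz_ineq2)
        then have "ennreal ((norm (Z s w \<bullet> c))^2) <= ennreal ((norm c)^2) * ennreal ((norm (Z s w))^2)"
          by (simp add: power_mult_distrib mult.commute ennreal_leI flip: ennreal_mult)
        also have "... <= ennreal ((norm c)^2) * supsq T Z w" by (intro mult_left_mono supsq_upper s) auto
        finally show "ennreal ((norm (Z s w \<bullet> c))^2) <= ennreal ((norm c)^2) * supsq T Z w" .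
      qed
    qed
    also have "... = ennreal ((norm c)^2) * (\<integral>\<^sup>+w. supsq T Z w \<partial>M)" by (simp add: nn_integral_cmult)
    also have "... < \<infinity>" using cont_adaptedD(3)[OF Zc] by (simp add: ennreal_mult_less_top)
    finally show "(\<integral>\<^sup>+w. supsq T (\<lambda>s w. Z s w \<bullet> c) w \<partial>M) < \<infinity>" .
  qed (use cont_adaptedD[OF Zc] in \<open>auto intro!: continuous_intros borel_measurable_inner\<close>)
  fix t assume t: "t \<in> {0..T}"
  obtain Y where Y: "has_ito_integral M W t \<sigma> Y" "AE w in M. Z t w = x + (\<integral>s. b s w \<partial>(LT t)) + Y w"
    using Z t unfolding ito_process_def by blast
  have "has_ito_integral M W t (\<lambda>s w. \<sigma> s w \<bullet> c) (\<lambda>w. Y w \<bullet> c)"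
    by (rule has_ito_inner[OF Y(1)]) (use t L2_adapted_subset[OF _ _ b(2)] in auto)
  moreover have "AE w in M. Z t w \<bullet> c = x \<bullet> c + (\<integral>s. b s w \<bullet> c \<partial>(LT t)) + Y w \<bullet> c"
    using Y(2) drift_integrable_AE[OF b(1) t] by eventually_elim (simp add: inner_add_left)
  ultimately show "\<exists>Y. has_ito_integral M W t (\<lambda>s w. \<sigma> s w \<bullet> c) Y \<and>
        (AE w in M. Z t w \<bullet> c = x \<bullet> c + (\<integral>s. b s w \<bullet> c \<partial>(LT t)) + Y w)" by blast
qed


subsection \<open>First and second moments\<close>

lemma cut_self_msq:
  assumes "f \<in> L2p t" "0 <= t"
  shows "msq (NT t) (cut t f) = msq (NT t) (\<lambda>z. f @@ z)"
  by (rule msq_cong_AE[OF cut_self]) (use L2_adapted_cut[OF assms(2) order_refl assms(1)] L2_adapted_sq_int[OF assms(1)] in \<open>auto simp: sq_int_def\<close>)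

lemma sq_int_NT_snd: "sq_int M \<xi> ==> sq_int (NT T) (\<lambda>z. \<xi> (snd z))"
  using sq_int_NT_product[of UNIV \<xi> T] by simp

lemma orth_zero_mean:
  fixes Y :: "real => 'w => real"
  assumes Y: "\<And>t. t \<in> {0..T} ==> has_ito_integral M W t \<sigma> (Y t)" and o: "orth T Y" and t: "t \<in> {0..T}"
  shows "(\<E> w. Y t w) = 0"
proof -
  have 0: "0 \<in> {0..T}" using t by auto
  have sq: "sq_int M (Y t)" "sq_int M (Y 0)" using ito_sq_int(2)[OF Y] t 0 by auto
  have "msq M (Y 0) = msq (NT 0) (cut 0 \<sigma>)" by (rule ito_isometry[OF Y[OF 0]]) auto
  also have "... = (\<integral>z. (norm (cut 0 \<sigma> z))^2 \<partial>NT 0)" by (simp add: msq_def)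
  also have "... = 0"
  proof -
    interpret P: pair_sigma_finite "lebesgue_on {0..0::real}" M by (rule pair_sigma_finite_time)
    have "emeasure (NT 0) (space (NT 0)) = emeasure (lebesgue_on {0..0::real}) {0} * emeasure M (space M)"
      unfolding space_pair_measure by (subst emeasure_pair_measure_Times) auto
    also have "... = 0" by (simp add: emeasure_restrict_space)
    finally have "AE z in NT 0. cut 0 \<sigma> z = 0"
      by (intro AE_I[of _ _ "space (NT 0)"]) auto
    then show ?thesis by (intro integral_eq_zero_AE) auto
  qed
  finally have "AE w in M. Y 0 w = 0" by (rule msq_eq_0_AE[OF sq(2)])
  then have "(\<E> w. Y t w) = (\<E> w. (Y t w - Y 0 w) \<bullet> 1)"
    by (intro integral_cong_AE) (use sq in \<open>auto simp: sq_int_def\<close>)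
  also have "... = 0" using o[unfolded orth_def, rule_format, of 0 t "\<lambda>_. 1"] t sq_int_const[of "1::real"] by simp
  finally show ?thesis .
qed

lemma AE_NT_I:
  fixes f g :: "real => 'w => 'b::euclidean_space"
  assumes "(\<lambda>z. f @@ z) \<in> borel_measurable (NT T)" "(\<lambda>z. g @@ z) \<in> borel_measurable (NT T)"
    and "AE s in LT T. AE w in M. f s w = g s w"
  shows "AE z in NT T. f @@ z = g @@ z"
proof -
  interpret P: pair_sigma_finite "LT T" M by (rule pair_sigma_finite_time)
  note [measurable] = assms(1,2)
  show ?thesis by (rule P.AE_pair_measure) (measurable, use assms(3) in simp)
qed

lemma AE_NT_D:
  fixes f g :: "real => 'w => 'b::euclidean_space"
  assumes "(\<lambda>z. f @@ z) \<in> borel_measurable (NT T)" "(\<lambda>z. g @@ z) \<in> borel_measurable (NT T)"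
    and "AE z in NT T. f @@ z = g @@ z"
  shows "AE s in LT T. AE w in M. f s w = g s w" "AE w in M. AE s in LT T. f s w = g s w"
proof -
  interpret P: pair_sigma_finite "LT T" M by (rule pair_sigma_finite_time)
  show 1: "AE s in LT T. AE w in M. f s w = g s w" using P.AE_pair[OF assms(3)] by simp
  note [measurable] = assms(1,2)
  have "{z \<in> space (NT T). f @@ z = g @@ z} \<in> sets (NT T)" by measurable
  from P.AE_commute[OF this] 1 show "AE w in M. AE s in LT T. f s w = g s w" by simp
qed


lemma ito_process_mean_real:
  fixes b \<sigma> :: "real => 'w => real"
  assumes T: "T > 0" and Z: "ito_process T x b \<sigma> Z" and t: "t \<in> {0..T}"
  shows "(\<E> w. Z t w) = x + (\<integral>s. (\<E> w. b s w) \<partial>(LT t))"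
proof -
  have b: "b \<in> L2p T" and \<sigma>: "\<sigma> \<in> L2p T" and Zc: "Z \<in> Cp T"
    using Z by (auto simp: ito_process_def)
  have t': "0 <= t" "t <= T" using t by auto
  let ?L = "LT t"
  interpret N: finite_measure "NT t" by (rule finite_NT)
  obtain D Y where DY: "ito_process T x b \<sigma> (\<lambda>t w. x + D t w + Y t w)"
    "D \<in> Cp T" "AE w in M. \<forall>t. D t w = (\<integral>s. b s w \<partial>(LT t))"
    "(\<integral>\<^sup>+w. supsq T D w \<partial>M) <= ennreal (T * msq (NT T) (\<lambda>z. b @@ z))"
    "Y \<in> Cp T" "\<And>t. t \<in> {0..T} ==> has_ito_integral M W t \<sigma> (Y t)" "orth T Y"
    using that by (rule ito_process_exists[OF T b \<sigma>])
  note Dt = cont_adapted_sq_int(1)[OF DY(2) t] and Yt = cont_adapted_sq_int(1)[OF DY(5) t] and Zt = cont_adapted_sq_int(1)[OF Zc t]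
  have ib: "integrable (NT t) (\<lambda>z. b @@ z)"
    by (rule N.sq_int_imp_integrable[OF L2_adapted_sq_int[OF L2_adapted_subset[OF t' b]]])
  have "(\<E> w. Z t w) = (\<E> w. x + D t w + Y t w)"
    by (rule integral_cong_AE) (use ito_process_unique[OF Z DY(1) t] Dt Yt Zt in \<open>auto simp: sq_int_def\<close>)
  also have "... = x + (\<E> w. D t w)"
    using sq_int_imp_integrable[OF Dt] sq_int_imp_integrable[OF Yt] orth_zero_mean[OF DY(6,7) t] by (simp add: prob_space)
  also have "(\<E> w. D t w) = (\<E> w. (\<integral>s. b s w \<partial>?L))"
  proof (rule integral_cong_AE)
    show "AE w in M. D t w = (\<integral>s. b s w \<partial>?L)" using DY(3) by eventually_elim simp
  qed (use Dt NT_integrals(2)[OF ib] in \<open>auto simp: sq_int_def\<close>)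
  also have "... = (\<integral>s. (\<E> w. b s w) \<partial>?L)" using NT_integrals(3,4)[OF ib] by simp
  finally show ?thesis .
qed

text \<open>
  The increment of the martingale after \<open>s\<close> is orthogonal to the drift at \<open>s\<close>, so that under the time integral its terminal value may be replaced by its value at \<open>s\<close>.
\<close>

lemma drift_martingale_product:
  fixes b Y D :: "real => 'w => real"
  assumes T: "T > 0" and b: "b \<in> L2p T" and t: "t \<in> {0..T}"
    and D: "D \<in> Cp T" "AE w in M. \<forall>t. D t w = (\<integral>s. b s w \<partial>(LT t))"
    and Y: "Y \<in> Cp T" "orth T Y" "(\<E> w. Y t w) = 0"
  shows "(\<E> w. (x + D t w) * Y t w) = (\<integral>z. b @@ z * Y @@ z \<partial>NT t)"
proof -
  have t': "0 <= t" "t <= T" using t by auto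
  let ?L = "LT t"
  note bt = L2_adapted_subset[OF t' b]
  note sb = L2_adapted_sq_int[OF bt] and sY = L2_adapted_sq_int[OF L2_adapted_subset[OF t' cont_adapted_L2[OF T Y(1)]]]
  note Dt = cont_adapted_sq_int(1)[OF D(1) t] and Yt = cont_adapted_sq_int(1)[OF Y(1) t]
  have i2: "integrable (NT t) (\<lambda>z. b @@ z * Y @@ z)" using sq_int_inner[OF sb sY] by simp
  have i4: "integrable (NT t) (\<lambda>z. b @@ z * Y t (snd z))" using sq_int_inner[OF sb sq_int_NT_snd[OF Yt]] by simp
  have iD: "integrable M (\<lambda>w. D t w * Y t w)" using sq_int_inner[OF Dt Yt] by simp
  have "(\<E> w. (x + D t w) * Y t w) = (\<E> w. D t w * Y t w)"
    using iD sq_int_imp_integrable[OF Yt] Y(3) by (simp add: distrib_right)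
  also have "... = (\<E> w. (\<integral>s. b s w * Y t w \<partial>?L))"
  proof (rule integral_cong_AE)
    show "AE w in M. D t w * Y t w = (\<integral>s. b s w * Y t w \<partial>?L)" using D(2) by eventually_elim simp
  qed (use iD NT_integrals(2)[OF i4] in auto)
  also have "... = (\<integral>s. (\<E> w. b s w * Y t w) \<partial>?L)" using NT_integrals(3,4)[OF i4] by simp
  also have "... = (\<integral>s. (\<E> w. b s w * Y s w) \<partial>?L)"
  proof (rule integral_cong_AE)
    show "AE s in ?L. (\<E> w. b s w * Y t w) = (\<E> w. b s w * Y s w)"
      using L2_adapted_slices[OF bt] AE_space[of ?L]
    proof eventually_elim
      case (elim s)
      then have s: "0 <= s" "s <= t" "s \<in> {0..T}" using t' by auto
      note Ys = cont_adapted_sq_int(1)[OF Y(1) s(3)]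
      have bF: "b s \<in> borel_measurable (F s)" using L2_adapted_adapted[OF b s(3)] .
      have "0 = (\<E> w. (Y t w - Y s w) \<bullet> b s w)"
        using Y(2) s t' bF elim(1) unfolding orth_def by metis
      also have "... = (\<E> w. b s w * Y t w - b s w * Y s w)" by (simp add: algebra_simps)
      also have "... = (\<E> w. b s w * Y t w) - (\<E> w. b s w * Y s w)"
        using sq_int_inner[OF elim(1) Yt] sq_int_inner[OF elim(1) Ys] by simp
      finally show ?case by simp
    qed
  qed (use NT_integrals(1)[OF i4] NT_integrals(1)[OF i2] in auto)
  also have "... = (\<integral>z. b @@ z * Y @@ z \<partial>NT t)" using NT_integrals(3)[OF i2] by simp
  finally show ?thesis .
qed

text \<open>
  Ito's product rule in expectation. Only the mean is needed, so no pathwise Ito formula enters: drift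
times drift is integration by parts, drift times martingale is orthogonality, and martingale times
martingale is the polarised isometry.
\<close>

theorem ito_process_product:
  fixes b \<sigma> b' \<sigma>' :: "real => 'w => real"
  assumes T: "T > 0" and Z: "ito_process T x b \<sigma> Z" and Z': "ito_process T x' b' \<sigma>' Z'" and t: "t \<in> {0..T}"
  shows "(\<E> w. Z t w * Z' t w) = x * x' +
      (\<integral>s. (\<E> w. b s w * Z' s w + Z s w * b' s w + \<sigma> s w * \<sigma>' s w) \<partial>(LT t))"
    and "integrable (LT T) (\<lambda>s. \<integral>w. b s w * Z' s w + Z s w * b' s w + \<sigma> s w * \<sigma>' s w \<partial>M)"
proof -
  have a: "b \<in> L2p T" "\<sigma> \<in> L2p T" "Z \<in> Cp T"
    "b' \<in> L2p T" "\<sigma>' \<in> L2p T" "Z' \<in> Cp T"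
    using Z Z' by (auto simp: ito_process_def)
  let ?f = "\<lambda>z. b @@ z * Z' @@ z + Z @@ z * b' @@ z + \<sigma> @@ z * \<sigma>' @@ z"
  have sub: "sq_int (NT r) (\<lambda>z. f @@ z)" if "f \<in> L2p T" "r \<in> {0..T}" for f :: "real => 'w => real" and r
    using that by (intro L2_adapted_sq_int L2_adapted_subset[OF _ _ that(1)]) auto
  have pr: "integrable (NT r) (\<lambda>z. f @@ z * g @@ z)" if "f \<in> L2p T" "g \<in> L2p T" "r \<in> {0..T}" for f g :: "real => 'w => real" and r
    using sq_int_inner[OF sub[OF that(1,3)] sub[OF that(2,3)]] by simp
  note cL = cont_adapted_L2[OF T]
  have int: "integrable (NT r) ?f" if "r \<in> {0..T}" for r
    by (intro bint_add_int pr a cL that)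
  show "integrable (LT T) (\<lambda>s. \<integral>w. b s w * Z' s w + Z s w * b' s w + \<sigma> s w * \<sigma>' s w \<partial>M)"
    using NT_integrals(1)[OF int[of T]] T by simp
  let ?L = "LT t"
  have t': "0 <= t" "t <= T" using t by auto
  obtain D Y where DY: "ito_process T x b \<sigma> (\<lambda>t w. x + D t w + Y t w)"
    "D \<in> Cp T" "AE w in M. \<forall>t. D t w = (\<integral>s. b s w \<partial>(LT t))"
    "(\<integral>\<^sup>+w. supsq T D w \<partial>M) <= ennreal (T * msq (NT T) (\<lambda>z. b @@ z))"
    "Y \<in> Cp T" "\<And>t. t \<in> {0..T} ==> has_ito_integral M W t \<sigma> (Y t)" "orth T Y"
    using that by (rule ito_process_exists[OF T a(1,2)])
  obtain D' Y' where DY': "ito_process T x' b' \<sigma>' (\<lambda>t w. x' + D' t w + Y' t w)"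
    "D' \<in> Cp T" "AE w in M. \<forall>t. D' t w = (\<integral>s. b' s w \<partial>(LT t))"
    "(\<integral>\<^sup>+w. supsq T D' w \<partial>M) <= ennreal (T * msq (NT T) (\<lambda>z. b' @@ z))"
    "Y' \<in> Cp T" "\<And>t. t \<in> {0..T} ==> has_ito_integral M W t \<sigma>' (Y' t)" "orth T Y'"
    using that by (rule ito_process_exists[OF T a(4,5)])
  define U where "U s w = x + D s w" for s w
  define U' where "U' s w = x' + D' s w" for s w
  have U: "U \<in> Cp T" "U' \<in> Cp T"
    unfolding U_def[abs_def] U'_def[abs_def] by (intro cont_adapted_add T cont_adapted_const DY(2) DY'(2))+
  have eqZ: "AE w in M. Z s w = U s w + Y s w" "AE w in M. Z' s w = U' s w + Y' s w" if "s \<in> {0..T}" for s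
    using ito_process_unique[OF Z DY(1) that] ito_process_unique[OF Z' DY'(1) that] by (simp_all add: U_def U'_def)
  note sq = cont_adapted_sq_int(1)[OF _ t]
  have m: "(\<lambda>z. f @@ z) \<in> borel_measurable (NT t)" if "f \<in> Cp T" for f :: "real => 'w => real"
    by (rule sq_int_measurable[OF sub[OF cL[OF that] t]])
  have e1: "(\<E> w. U t w * U' t w) = x * x' + (\<integral>z. b @@ z * U' @@ z + U @@ z * b' @@ z \<partial>NT t)"
  proof -
    have i: "integrable (NT t) (\<lambda>z. b @@ z * U' @@ z + U @@ z * b' @@ z)"
      by (intro bint_add_int pr a cL U t)
    have "AE w in M. U t w * U' t w = x * x' + (\<integral>s. b s w * U' s w + U s w * b' s w \<partial>?L)"
      using DY(3) DY'(3) drift_integrable_AE[OF a(1) t] drift_integrable_AE[OF a(4) t]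
    proof eventually_elim
      case (elim w)
      have D: "D s w = (\<integral>s. b s w \<partial>(LT s))" "D' s w = (\<integral>s. b' s w \<partial>(LT s))" for s using elim by simp_all
      show ?case using time_product_rule(3)[OF elim(3,4) t'(1), of x x'] unfolding U_def U'_def D .
    qed
    then have "(\<E> w. U t w * U' t w) = (\<E> w. x * x' + (\<integral>s. b s w * U' s w + U s w * b' s w \<partial>?L))"
      by (rule integral_cong_AE[rotated 2]) (use sq[OF U(1)] sq[OF U(2)] NT_integrals(2)[OF i] in \<open>auto simp: sq_int_def\<close>)
    then show ?thesis using NT_integrals(2,4)[OF i] by (simp add: prob_space)
  qed
  have e2: "(\<E> w. U t w * Y' t w) = (\<integral>z. b @@ z * Y' @@ z \<partial>NT t)"
    unfolding U_def by (rule drift_martingale_product[OF T a(1) t DY(2,3) DY'(5,7) orth_zero_mean[OF DY'(6,7) t]])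
  have e3: "(\<E> w. U' t w * Y t w) = (\<integral>z. b' @@ z * Y @@ z \<partial>NT t)"
    unfolding U'_def by (rule drift_martingale_product[OF T a(4) t DY'(2,3) DY(5,7) orth_zero_mean[OF DY(6,7) t]])
  have e4: "(\<E> w. Y t w * Y' t w) = (\<integral>z. \<sigma> @@ z * \<sigma>' @@ z \<partial>NT t)"
  proof -
    have "(\<E> w. Y t w * Y' t w) = (\<integral>z. cut t \<sigma> z * cut t \<sigma>' z \<partial>NT t)"
      using ito_polar[OF DY(6)[OF t] t'(1) order_refl DY'(6)[OF t] t'(1) order_refl] by simp
    also have "... = (\<integral>z. \<sigma> @@ z * \<sigma>' @@ z \<partial>NT t)"
    proof (rule integral_cong_AE)
      show "AE z in NT t. cut t \<sigma> z * cut t \<sigma>' z = \<sigma> @@ z * \<sigma>' @@ z"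
        using cut_self[of t \<sigma>] cut_self[of t \<sigma>'] by eventually_elim simp
      show "(\<lambda>z. cut t \<sigma> z * cut t \<sigma>' z) \<in> borel_measurable (NT t)"
        by (intro borel_measurable_times sq_int_measurable ito_sq_int(1)[OF DY(6)[OF t] t'(1) order_refl] ito_sq_int(1)[OF DY'(6)[OF t] t'(1) order_refl])
    qed (use pr[OF a(2,5) t] in auto)
    finally show ?thesis .
  qed
  have p: "integrable M (\<lambda>w. f t w * g t w)" if "f \<in> Cp T" "g \<in> Cp T" for f g :: "real => 'w => real"
    using sq_int_inner[OF sq[OF that(1)] sq[OF that(2)]] by simp
  have "(\<E> w. Z t w * Z' t w) = (\<E> w. U t w * U' t w + U t w * Y' t w + U' t w * Y t w + Y t w * Y' t w)"
  proof (rule integral_cong_AE)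
    show "AE w in M. Z t w * Z' t w = U t w * U' t w + U t w * Y' t w + U' t w * Y t w + Y t w * Y' t w"
      using eqZ[OF t] by eventually_elim (simp add: algebra_simps)
  qed (use p[OF a(3,6)] p[OF U] p[OF U(1) DY'(5)] p[OF U(2) DY(5)] p[OF DY(5) DY'(5)] in auto)
  also have "... = x * x' + (\<integral>z. (b @@ z * U' @@ z + U @@ z * b' @@ z) + b @@ z * Y' @@ z
      + b' @@ z * Y @@ z + \<sigma> @@ z * \<sigma>' @@ z \<partial>NT t)"
    using p[OF U] p[OF U(1) DY'(5)] p[OF U(2) DY(5)] p[OF DY(5) DY'(5)] pr[OF a(1) cL[OF U(2)] t] pr[OF cL[OF U(1)] a(4) t]
      pr[OF a(1) cL[OF DY'(5)] t] pr[OF a(4) cL[OF DY(5)] t] pr[OF a(2,5) t]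
    by (simp add: e1 e2 e3 e4)
  also have "(\<integral>z. (b @@ z * U' @@ z + U @@ z * b' @@ z) + b @@ z * Y' @@ z
      + b' @@ z * Y @@ z + \<sigma> @@ z * \<sigma>' @@ z \<partial>NT t) = (\<integral>z. ?f z \<partial>NT t)"
  proof (rule integral_cong_AE)
    have "AE z in NT t. Z @@ z = U @@ z + Y @@ z"
      by (rule AE_NT_I[of Z t "\<lambda>s w. U s w + Y s w"], rule m[OF a(3)], rule borel_measurable_add[OF m[OF U(1)] m[OF DY(5)]], rule AE_I2, rule eqZ(1))
         (use t' in auto)
    moreover have "AE z in NT t. Z' @@ z = U' @@ z + Y' @@ z"
      by (rule AE_NT_I[of Z' t "\<lambda>s w. U' s w + Y' s w"], rule m[OF a(6)], rule borel_measurable_add[OF m[OF U(2)] m[OF DY'(5)]], rule AE_I2, rule eqZ(2))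
         (use t' in auto)
    ultimately show "AE z in NT t. (b @@ z * U' @@ z + U @@ z * b' @@ z) + b @@ z * Y' @@ z
      + b' @@ z * Y @@ z + \<sigma> @@ z * \<sigma>' @@ z = ?f z"
      by eventually_elim (simp add: algebra_simps)
  qed (use pr[OF a(1) cL[OF U(2)] t] pr[OF cL[OF U(1)] a(4) t] pr[OF a(1) cL[OF DY'(5)] t] pr[OF a(4) cL[OF DY(5)] t] pr[OF a(2,5) t] int[OF t] in auto)
  also have "... = (\<integral>s. (\<E> w. b s w * Z' s w + Z s w * b' s w + \<sigma> s w * \<sigma>' s w) \<partial>?L)"
    using NT_integrals(3)[OF int[OF t]] by simp
  finally show "(\<E> w. Z t w * Z' t w) = x * x' +
      (\<integral>s. (\<E> w. b s w * Z' s w + Z s w * b' s w + \<sigma> s w * \<sigma>' s w) \<partial>?L)" .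
qed

subsection \<open>Stability estimates\<close>

lemma ito_process_msq_bound:
  fixes b \<sigma> :: "real => 'w => 'b::euclidean_space"
  assumes T: "T > 0" and Z: "ito_process T 0 b \<sigma> Z" and t: "t \<in> {0..T}"
  shows "msq M (Z t) <= 2 * T * msq (NT t) (\<lambda>z. b @@ z) + 2 * msq (NT t) (\<lambda>z. \<sigma> @@ z)"
proof -
  have b: "b \<in> L2p T" "\<sigma> \<in> L2p T" and Zc: "Z \<in> Cp T"
    using Z by (auto simp: ito_process_def)
  have t': "0 <= t" "t <= T" using t by auto
  note bt = L2_adapted_subset[OF t' b(1)] and \<sigma>t = L2_adapted_subset[OF t' b(2)]
  note sb = L2_adapted_sq_int[OF bt]
  let ?L = "LT t"
  let ?D = "\<lambda>w. \<integral>s. b s w \<partial>?L"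
  obtain Y where Y: "has_ito_integral M W t \<sigma> Y" "AE w in M. Z t w = 0 + ?D w + Y w"
    using Z t unfolding ito_process_def by blast
  interpret N: finite_measure "NT t" by (rule finite_NT)
  have Dm: "?D \<in> borel_measurable M" using NT_integrals(2)[OF N.sq_int_imp_integrable[OF sb]] by simp
  have le: "AE w in M. (norm (?D w))^2 <= t * msq ?L (\<lambda>s. b s w)"
    using sq_int_slices[OF sb] by eventually_elim (use integral_time_sq_bound[of t _ t] t' in auto)
  have i: "integrable M (\<lambda>w. t * msq ?L (\<lambda>s. b s w))" using msq_NT(4)[OF sb] by simp
  have sD: "sq_int M ?D"
    unfolding sq_int_def
  proof (intro conjI Dm)
    show "integrable M (\<lambda>w. (norm (?D w))^2)"
      by (rule bint_bound[OF i]) (use Dm le in \<open>auto elim!: eventually_mono\<close>)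
  qed
  have mD: "msq M ?D <= t * msq (NT t) (\<lambda>z. b @@ z)"
  proof -
    have "msq M ?D <= (\<E> w. t * msq ?L (\<lambda>s. b s w))"
      unfolding msq_def[of M] by (rule integral_mono_AE[OF sq_int_integrable[OF sD] i le])
    then show ?thesis using msq_NT(3)[OF sb] by simp
  qed
  have sY: "sq_int M Y" by (rule ito_sq_int(2)[OF Y(1) t'])
  have "msq M (Z t) = msq M (\<lambda>w. ?D w + Y w)"
    by (rule msq_cong_AE) (use Y(2) cont_adaptedD(4)[OF Zc t] Dm sY in \<open>auto simp: sq_int_def\<close>)
  also have "... <= 2 * msq M ?D + 2 * msq M Y" by (rule msq_add_le[OF sD sY])
  also have "msq M Y = msq (NT t) (\<lambda>z. \<sigma> @@ z)"
    using ito_isometry[OF Y(1) t'(1) order_refl] cut_self_msq[OF \<sigma>t t'(1)] by simp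
  also have "2 * msq M ?D <= 2 * (T * msq (NT t) (\<lambda>z. b @@ z))"
    using mD mult_right_mono[OF t'(2) msq_nonneg[of "NT t" "\<lambda>z. b @@ z"]] by linarith
  finally show ?thesis by simp
qed

lemma ito_process_cong:
  fixes b \<sigma> :: "real => 'w => 'b::euclidean_space"
  assumes T: "T > 0" and Z: "ito_process T x b \<sigma> Z" and b': "b' \<in> L2p T" and \<sigma>': "\<sigma>' \<in> L2p T"
    and eq: "AE s in LT T. AE w in M. b s w = b' s w" "AE s in LT T. AE w in M. \<sigma> s w = \<sigma>' s w"
  shows "ito_process T x b' \<sigma>' Z"
  unfolding ito_process_def
proof (intro conjI b' \<sigma>' ballI)
  have b: "b \<in> L2p T" "\<sigma> \<in> L2p T" using Z by (auto simp: ito_process_def)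
  show "Z \<in> Cp T" using Z by (auto simp: ito_process_def)
  fix t assume t: "t \<in> {0..T}"
  note m = L2_adapted_sq_int[THEN sq_int_measurable]
  have bb: "AE z in NT T. b @@ z = b' @@ z" by (rule AE_NT_I[OF m[OF b(1)] m[OF b'] eq(1)])
  have ss: "AE z in NT T. \<sigma> @@ z = \<sigma>' @@ z" by (rule AE_NT_I[OF m[OF b(2)] m[OF \<sigma>'] eq(2)])
  obtain Y where Y: "has_ito_integral M W t \<sigma> Y" "AE w in M. Z t w = x + (\<integral>s. b s w \<partial>(LT t)) + Y w"
    using Z t unfolding ito_process_def by blast
  obtain V where V0: "V \<in> Cp T" "\<And>t. t \<in> {0..T} ==> has_ito_integral M W t \<sigma>' (V t)" "orth T V"
    using that by (rule ito_integral_process[OF T \<sigma>'])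
  have "AE w in M. V t w = Y w"
  proof (rule ito_unique_AE[OF V0(2)[OF t] Y(1)])
    show "AE z in NT T. cut t \<sigma>' z = cut t \<sigma> z" using cut_AE[OF _ ss, of t] t by (auto elim: eventually_mono)
  qed (use t in auto)
  from has_ito_integral_AE[OF V0(2)[OF t] this] have Y': "has_ito_integral M W t \<sigma>' Y" .
  have "AE w in M. (\<integral>s. b s w \<partial>(LT t)) = (\<integral>s. b' s w \<partial>(LT t))"
    using AE_NT_D(2)[OF m[OF b(1)] m[OF b'] bb] drift_integrable_AE[OF b(1) t] drift_integrable_AE[OF b' t]
  proof eventually_elim
    case (elim w)
    have "AE s in LT t. b s w = b' s w" by (rule AE_time_subset[OF _ elim(1)]) (use t in simp)
    then show ?case by (rule integral_cong_AE[rotated 2]) (use elim in auto)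
  qed
  with Y(2) have "AE w in M. Z t w = x + (\<integral>s. b' s w \<partial>(LT t)) + Y w" by eventually_elim simp
  with Y' show "\<exists>Y. has_ito_integral M W t \<sigma>' Y \<and> (AE w in M. Z t w = x + (\<integral>s. b' s w \<partial>(LT t)) + Y w)" by blast
qed

end

section \<open>Linear mean-field equations\<close>

lemma norm_matrix_vector_le: "norm (A *v x) <= norm A * norm (x :: real ^ 'n)" for A :: "real ^ 'n ^ 'm"
proof -
  have "(norm (A *v x))^2 = (\<Sum>i\<in>UNIV. ((A *v x) $ i)^2)"
    unfolding power2_norm_eq_inner inner_vec_def by (simp add: power2_eq_square)
  also have "... <= (\<Sum>i\<in>UNIV. (norm (A $ i))^2 * (norm x)^2)"
  proof (rule sum_mono)
    fix i
    have "((A *v x) $ i)^2 = (A $ i \<bullet> x)^2" by (simp add: matrix_vector_mul_component)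
    also have "... <= (A $ i \<bullet> A $ i) * (x \<bullet> x)" by (rule Cauchy_Schwarz_ineq)
    finally show "((A *v x) $ i)^2 <= (norm (A $ i))^2 * (norm x)^2" by (simp add: power2_norm_eq_inner)
  qed
  also have "... = (norm A * norm x)^2"
    unfolding power_mult_distrib power2_norm_eq_inner inner_vec_def[of A A] sum_distrib_right ..
  finally show ?thesis by (rule power2_le_imp_le) simp
qed

lemma measurable_matrix_vector:
  fixes f :: "'a => real ^ 'n ^ 'm" and g :: "'a => real ^ 'n"
  assumes "f \<in> borel_measurable N" "g \<in> borel_measurable N"
  shows "(\<lambda>x. f x *v g x) \<in> borel_measurable N"
proof -
  have "continuous_on UNIV (\<lambda>p :: (real ^ 'n ^ 'm) \<times> (real ^ 'n). fst p *v snd p)"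
    unfolding matrix_vector_mult_def by (intro continuous_intros)
  then show ?thesis by (rule borel_measurable_continuous_Pair[OF assms])
qed

lemma Linf_D:
  assumes "f \<in> Linf T V"
  shows "f \<in> borel_measurable (LT T)" "AE s in LT T. f s \<in> V"
    "\<exists>C\<ge>0. AE s in LT T. norm (f s) <= C"
proof -
  show "f \<in> borel_measurable (LT T)" "AE s in LT T. f s \<in> V"
    using assms by (auto simp: Linf_def)
  obtain C where "AE s in LT T. norm (f s) <= C" using assms by (auto simp: Linf_def)
  then have "AE s in LT T. norm (f s) <= max C 0" by eventually_elim auto
  then show "\<exists>C\<ge>0. AE s in LT T. norm (f s) <= C" by (intro exI[of _ "max C 0"]) auto
qed

context brownian
begin

lemma AE_time_NT: "AE s in LT T. Q s ==> AE z in NT T. Q (fst z)"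
proof -
  interpret P: pair_sigma_finite "LT T" M by (rule pair_sigma_finite_time)
  assume "AE s in LT T. Q s"
  then obtain Z where Z: "Z \<in> null_sets (LT T)" "{s\<in>space (LT T). \<not> Q s} \<subseteq> Z"
    by (auto simp: eventually_ae_filter)
  have [measurable]: "Z \<in> sets (LT T)" using Z by auto
  have "AE z in NT T. fst z \<notin> Z"
    by (rule P.AE_pair_measure) (measurable, use AE_not_in[OF Z(1)] in simp)
  then show "AE z in NT T. Q (fst z)"
    using AE_space[of "NT T"] by eventually_elim (use Z(2) in \<open>auto simp: space_pair_measure\<close>)
qed

lemma matrix_process_L2:
  fixes a :: "real => real ^ 'n ^ 'm" and X :: "real => 'w => real ^ 'n"
  assumes a: "a \<in> Linf T V" and X: "X \<in> L2p T"
  shows "(\<lambda>s w. a s *v X s w) \<in> L2p T"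
  unfolding L2_adapted_iff
proof (intro conjI ballI)
  obtain C where C: "C \<ge> 0" "AE s in LT T. norm (a s) <= C" using Linf_D(3)[OF a] by blast
  show "sq_int (NT T) (\<lambda>z. a (fst z) *v X @@ z)"
  proof (rule sq_int_dominated[OF _ L2_adapted_sq_int[OF X]])
    show "(\<lambda>z. a (fst z) *v X @@ z) \<in> borel_measurable (NT T)"
      by (intro measurable_matrix_vector time_measurable_NT Linf_D(1)[OF a] sq_int_measurable[OF L2_adapted_sq_int[OF X]])
    show "AE z in NT T. norm (a (fst z) *v X @@ z) <= C * norm (X @@ z)"
      using AE_time_NT[OF C(2)]
      by eventually_elim (meson mult_right_mono norm_ge_zero norm_matrix_vector_le order_trans)
  qed
  fix s assume s: "s \<in> {0..T}"
  show "(\<lambda>w. a s *v X s w) \<in> borel_measurable (F s)"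
    by (rule measurable_matrix_vector[OF _ L2_adapted_adapted[OF X s]]) simp
qed

lemma mean_sq_le:
  fixes Y :: "'w => 'b::euclidean_space"
  assumes "sq_int M Y" shows "(norm (\<E> w. Y w))^2 <= msq M Y"
proof -
  have s: "sq_int M (\<lambda>w. norm (Y w))" using assms by (auto simp: sq_int_def)
  have "norm (\<E> w. Y w) <= (\<E> w. norm (Y w))" by (rule integral_norm_bound)
  also have "... <= sqrt (msq M (\<lambda>w. norm (Y w))) * sqrt (msq M (\<lambda>_. 1::real))"
    using l2_Cauchy_Schwarz[OF s sq_int_const[of "1::real"]] by simp
  also have "... = sqrt (msq M Y)" by (simp add: msq_def prob_space)
  finally have "(norm (\<E> w. Y w))^2 <= (sqrt (msq M Y))^2" by (rule power_mono) simp
  then show ?thesis by (simp add: msq_nonneg)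
qed

lemma mean_measurable:
  fixes X :: "real => 'w => 'b::euclidean_space"
  assumes "(\<lambda>z. X @@ z) \<in> borel_measurable (NT T)"
  shows "(\<lambda>s. \<integral>w. X s w \<partial>M) \<in> borel_measurable (LT T)"
  by (rule borel_measurable_lebesgue_integral) (use assms in \<open>simp add: case_prod_beta'\<close>)

lemma mean_process_L2:
  fixes X :: "real => 'w => 'b::euclidean_space"
  assumes X: "X \<in> L2p T"
  shows "(\<lambda>s w. \<integral>w. X s w \<partial>M) \<in> L2p T"
  unfolding L2_adapted_iff
proof (intro conjI ballI)
  let ?L = "LT T"
  note s = L2_adapted_sq_int[OF X]
  have m: "(\<lambda>s. \<integral>w. X s w \<partial>M) \<in> borel_measurable ?L" by (rule mean_measurable[OF sq_int_measurable[OF s]])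
  note [measurable] = m
  have i: "integrable ?L (\<lambda>s. (norm (\<E> w. X s w))^2)"
  proof (rule bint_bound)
    show "integrable ?L (\<lambda>s. msq M (X s))" using msq_NT(2)[OF s] by simp
    show "AE s in ?L. norm ((norm (\<E> w. X s w))^2) <= norm (msq M (X s))"
      using L2_adapted_slices[OF X] by eventually_elim (simp add: mean_sq_le msq_nonneg)
  qed measurable
  from integral_NT_product(1)[OF i, of "\<lambda>_. 1"]
  show "sq_int (NT T) (\<lambda>z. \<integral>w. X (fst z) w \<partial>M)"
    unfolding sq_int_def using time_measurable_NT[OF m] by simp
qed simp

text \<open>
  The coefficients of a mean-field equation as an affine function of the state alone; a control enters through \<open>\<beta>\<close>.
\<close>

definition lin :: "(real => real ^ 'n ^ 'n) => (real => real ^ 'n ^ 'n) => (real => 'w => real ^ 'n) =>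
    (real => 'w => real ^ 'n) => real => 'w => real ^ 'n" where
  "lin a ah \<beta> X s w = a s *v X s w + ah s *v integral\<^sup>L M (X s) + \<beta> s w"

lemma L2_adapted_add:
  fixes f g :: "real => 'w => 'b::euclidean_space"
  shows "f \<in> L2p T ==> g \<in> L2p T ==> (\<lambda>s w. f s w + g s w) \<in> L2p T"
  and "f \<in> L2p T ==> g \<in> L2p T ==> (\<lambda>s w. f s w - g s w) \<in> L2p T"
  using L2_adapted_lincomb[of f T g 1 1] L2_adapted_lincomb[of f T g 1 "-1"] by simp_all

lemma lin_L2:
  assumes "a \<in> Linf T V" "ah \<in> Linf T V'" "\<beta> \<in> L2p T" "X \<in> L2p T"
  shows "lin a ah \<beta> X \<in> L2p T"
  unfolding lin_def[abs_def]
  by (intro L2_adapted_add matrix_process_L2[OF assms(1)] matrix_process_L2[OF assms(2), of "\<lambda>s w. integral\<^sup>L M (X s)"] mean_process_L2 assms)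

lemma lin_diff_bound:
  assumes a: "a \<in> Linf T V" and ah: "ah \<in> Linf T V'"
  obtains C where "C > 0" "\<And>X X'. X \<in> L2p T ==> X' \<in> L2p T ==>
    AE s in LT T. msq M (\<lambda>w. lin a ah \<beta> X s w - lin a ah \<beta> X' s w) <= C * msq M (\<lambda>w. X s w - X' s w)"
proof -
  obtain c1 where c1: "c1 \<ge> 0" "AE s in LT T. norm (a s) <= c1" using Linf_D(3)[OF a] by blast
  obtain c2 where c2: "c2 \<ge> 0" "AE s in LT T. norm (ah s) <= c2" using Linf_D(3)[OF ah] by blast
  let ?C = "2 * c1^2 + 2 * c2^2 + 1"
  show thesis
  proof (rule that[of ?C])
    have "0 <= c1^2" "0 <= c2^2" by auto
    then show "?C > 0" by linarith
    fix X X' :: "real => 'w => real ^ 'a" assume X: "X \<in> L2p T" "X' \<in> L2p T"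
    show "AE s in LT T. msq M (\<lambda>w. lin a ah \<beta> X s w - lin a ah \<beta> X' s w) <= ?C * msq M (\<lambda>w. X s w - X' s w)"
      using L2_adapted_slices[OF X(1)] L2_adapted_slices[OF X(2)] c1(2) c2(2)
    proof eventually_elim
      case (elim s)
      let ?D = "\<lambda>w. X s w - X' s w"
      have sD: "sq_int M ?D" by (intro sq_int_diff elim)
      have mean: "integral\<^sup>L M (X s) - integral\<^sup>L M (X' s) = (\<E> w. ?D w)"
        using elim by (intro bint_diff[symmetric] sq_int_imp_integrable)
      have s1: "sq_int M (\<lambda>w. a s *v ?D w)"
      proof (rule sq_int_dominated[OF _ sD, of _ "norm (a s)"])
        show "(\<lambda>w. a s *v ?D w) \<in> borel_measurable M" by (rule measurable_matrix_vector) (use sD in \<open>auto simp: sq_int_def\<close>)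
      qed (auto intro!: AE_I2 norm_matrix_vector_le)
      have s2: "sq_int M (\<lambda>w. ah s *v (\<E> w. ?D w))" by (rule sq_int_const)
      have "msq M (\<lambda>w. lin a ah \<beta> X s w - lin a ah \<beta> X' s w) = msq M (\<lambda>w. a s *v ?D w + ah s *v (\<E> w. ?D w))"
        unfolding mean[symmetric] lin_def by (intro arg_cong[where f="msq M"] ext) (simp add: matrix_vector_mult_diff_distrib)
      also have "... <= 2 * msq M (\<lambda>w. a s *v ?D w) + 2 * msq M (\<lambda>w. ah s *v (\<E> w. ?D w))"
        by (rule msq_add_le[OF s1 s2])
      also have "msq M (\<lambda>w. a s *v ?D w) <= c1^2 * msq M ?D"
      proof (rule msq_mono_AE[OF _ sq_int_measurable[OF s1] sD], rule AE_I2)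
        fix w
        show "norm (a s *v ?D w) <= c1 * norm (?D w)"
          using elim(3) by (meson mult_right_mono norm_ge_zero norm_matrix_vector_le order_trans)
      qed
      also have "msq M (\<lambda>w. ah s *v (\<E> w. ?D w)) <= c2^2 * msq M ?D"
      proof -
        have "msq M (\<lambda>w. ah s *v (\<E> w. ?D w)) = (norm (ah s *v (\<E> w. ?D w)))^2"
          by (simp add: msq_def prob_space)
        also have "... <= (c2 * norm (\<E> w. ?D w))^2"
          using elim(4) by (intro power_mono) (meson mult_right_mono norm_ge_zero norm_matrix_vector_le order_trans, simp)
        also have "... = c2^2 * (norm (\<E> w. ?D w))^2" by (rule power_mult_distrib)
        also have "... <= c2^2 * msq M ?D" by (intro mult_left_mono mean_sq_le sD) simp
        finally show ?thesis .
      qed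
      finally have "msq M (\<lambda>w. lin a ah \<beta> X s w - lin a ah \<beta> X' s w) <= 2 * (c1^2 * msq M ?D) + 2 * (c2^2 * msq M ?D)"
        by simp
      also have "... <= ?C * msq M ?D" using msq_nonneg[of M ?D] by (simp add: algebra_simps)
      finally show ?case .
    qed
  qed
qed

text \<open>
  One Picard step is bounded by the time integral of the previous squared difference, both pointwise in time and for the supremum; uniqueness uses the first bound, convergence both.
\<close>

lemma lin_process_bound:
  fixes a ah a1 ah1 :: "real => real ^ 'n ^ 'n"
  assumes T: "T > 0" and a: "a \<in> Linf T V1" "ah \<in> Linf T V2" "a1 \<in> Linf T V3" "ah1 \<in> Linf T V4"
  obtains C where "C > 0"
    "\<And>x X X' Z Z' t. X \<in> Cp T ==> X' \<in> Cp T ==>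
      ito_process T x (lin a ah \<beta> X) (lin a1 ah1 \<beta>1 X) Z ==> ito_process T x (lin a ah \<beta> X') (lin a1 ah1 \<beta>1 X') Z' ==>
      t \<in> {0..T} ==> msq M (\<lambda>w. Z t w - Z' t w) <= C * (\<integral>s. msq M (\<lambda>w. X s w - X' s w) \<partial>(LT t))"
    "\<And>x X X' Z Z'. X \<in> Cp T ==> X' \<in> Cp T ==>
      ito_process T x (lin a ah \<beta> X) (lin a1 ah1 \<beta>1 X) Z ==> ito_process T x (lin a ah \<beta> X') (lin a1 ah1 \<beta>1 X') Z' ==>
      (\<integral>\<^sup>+w. supsq T (\<lambda>s w. Z s w - Z' s w) w \<partial>M) <= ennreal (C * (\<integral>s. msq M (\<lambda>w. X s w - X' s w) \<partial>(LT T)))"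
proof -
  obtain C1 where C1: "C1 > 0" "\<And>X X'. X \<in> L2p T ==> X' \<in> L2p T ==>
    AE s in LT T. msq M (\<lambda>w. lin a ah \<beta> X s w - lin a ah \<beta> X' s w) <= C1 * msq M (\<lambda>w. X s w - X' s w)"
    using that by (rule lin_diff_bound[OF a(1,2)])
  obtain C2 where C2: "C2 > 0" "\<And>X X'. X \<in> L2p T ==> X' \<in> L2p T ==>
    AE s in LT T. msq M (\<lambda>w. lin a1 ah1 \<beta>1 X s w - lin a1 ah1 \<beta>1 X' s w) <= C2 * msq M (\<lambda>w. X s w - X' s w)"
    using that by (rule lin_diff_bound[OF a(3,4)])
  let ?C = "2 * T * C1 + 8 * C2"
  have C: "?C > 0" using T C1 C2 by (simp add: add_pos_pos)
  have step: "msq (NT t) (\<lambda>z. f @@ z) <= c * (\<integral>s. msq M (\<lambda>w. X s w - X' s w) \<partial>(LT t))"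
    if "X \<in> L2p T" "X' \<in> L2p T" and f: "f \<in> L2p T" and t: "t \<in> {0..T}"
      and le: "AE s in LT T. msq M (f s) <= c * msq M (\<lambda>w. X s w - X' s w)"
    for c t and X X' f :: "real => 'w => real ^ 'n"
  proof -
    have t': "0 <= t" "t <= T" using t by auto
    note sf = L2_adapted_sq_int[OF L2_adapted_subset[OF t' f]]
    note sX = L2_adapted_sq_int[OF L2_adapted_subset[OF t' L2_adapted_add(2)[OF that(1,2)]]]
    have "msq (NT t) (\<lambda>z. f @@ z) = (\<integral>s. msq M (f s) \<partial>(LT t))" using msq_NT(1)[OF sf] by simp
    also have "... <= (\<integral>s. c * msq M (\<lambda>w. X s w - X' s w) \<partial>(LT t))"
      by (rule integral_mono_AE) (use msq_NT(2)[OF sf] msq_NT(2)[OF sX] AE_time_subset[OF t'(2) le] in auto)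
    finally show ?thesis by simp
  qed
  show thesis
  proof (rule that[OF C])
    fix x :: "real ^ 'n" and X X' Z Z' t assume X: "X \<in> Cp T" "X' \<in> Cp T"
      and Z: "ito_process T x (lin a ah \<beta> X) (lin a1 ah1 \<beta>1 X) Z" "ito_process T x (lin a ah \<beta> X') (lin a1 ah1 \<beta>1 X') Z'"
      and t: "t \<in> {0..T}"
    note X2 = cont_adapted_L2[OF T X(1)] cont_adapted_L2[OF T X(2)]
    have D: "ito_process T 0 (\<lambda>s w. lin a ah \<beta> X s w - lin a ah \<beta> X' s w) (\<lambda>s w. lin a1 ah1 \<beta>1 X s w - lin a1 ah1 \<beta>1 X' s w) (\<lambda>s w. Z s w - Z' s w)"
      using ito_process_diff[OF T Z] by simp
    have bD: "(\<lambda>s w. lin a ah \<beta> X s w - lin a ah \<beta> X' s w) \<in> L2p T"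
      "(\<lambda>s w. lin a1 ah1 \<beta>1 X s w - lin a1 ah1 \<beta>1 X' s w) \<in> L2p T" using D by (auto simp: ito_process_def)
    let ?I = "\<integral>s. msq M (\<lambda>w. X s w - X' s w) \<partial>(LT t)"
    note s1 = step[OF X2 bD(1) t C1(2)[OF X2]] and s2 = step[OF X2 bD(2) t C2(2)[OF X2]]
    have "msq M (\<lambda>w. Z t w - Z' t w) <= 2 * T * (C1 * ?I) + 2 * (C2 * ?I)"
      using T by (intro order_trans[OF ito_process_msq_bound[OF T D t]] add_mono mult_left_mono s1 s2) auto
    also have "... <= ?C * ?I" using C2(1) by (simp add: distrib_right mult.assoc Bochner_Integration.integral_nonneg msq_nonneg)
    finally show "msq M (\<lambda>w. Z t w - Z' t w) <= ?C * ?I" .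
  next
    fix x :: "real ^ 'n" and X X' Z Z' assume X: "X \<in> Cp T" "X' \<in> Cp T"
      and Z: "ito_process T x (lin a ah \<beta> X) (lin a1 ah1 \<beta>1 X) Z" "ito_process T x (lin a ah \<beta> X') (lin a1 ah1 \<beta>1 X') Z'"
    note X2 = cont_adapted_L2[OF T X(1)] cont_adapted_L2[OF T X(2)]
    have t: "T \<in> {0..T}" using T by simp
    have D: "ito_process T 0 (\<lambda>s w. lin a ah \<beta> X s w - lin a ah \<beta> X' s w) (\<lambda>s w. lin a1 ah1 \<beta>1 X s w - lin a1 ah1 \<beta>1 X' s w) (\<lambda>s w. Z s w - Z' s w)"
      using ito_process_diff[OF T Z] by simp
    have bD: "(\<lambda>s w. lin a ah \<beta> X s w - lin a ah \<beta> X' s w) \<in> L2p T"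
      "(\<lambda>s w. lin a1 ah1 \<beta>1 X s w - lin a1 ah1 \<beta>1 X' s w) \<in> L2p T" using D by (auto simp: ito_process_def)
    let ?I = "\<integral>s. msq M (\<lambda>w. X s w - X' s w) \<partial>(LT T)"
    note s1 = step[OF X2 bD(1) t C1(2)[OF X2]] and s2 = step[OF X2 bD(2) t C2(2)[OF X2]]
    have "2 * T * msq (NT T) (\<lambda>z. lin a ah \<beta> X @@ z - lin a ah \<beta> X' @@ z)
        + 8 * msq (NT T) (\<lambda>z. lin a1 ah1 \<beta>1 X @@ z - lin a1 ah1 \<beta>1 X' @@ z) <= 2 * T * (C1 * ?I) + 8 * (C2 * ?I)"
      using T by (intro add_mono mult_left_mono s1 s2) auto
    also have "... = ?C * ?I" by (simp add: distrib_right mult.assoc)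
    finally show "(\<integral>\<^sup>+w. supsq T (\<lambda>s w. Z s w - Z' s w) w \<partial>M) <= ennreal (?C * ?I)"
      by (intro order_trans[OF ito_process_sup_bound[OF T D]] ennreal_leI)
  qed
qed

lemma msq_time_integrable:
  assumes T: "T > 0" and X: "X \<in> Cp T" "X' \<in> Cp T"
  shows "integrable (LT T) (\<lambda>s. msq M (\<lambda>w. X s w - X' s w))"
  using msq_NT(2)[OF L2_adapted_sq_int[OF L2_adapted_add(2)[OF cont_adapted_L2[OF T X(1)] cont_adapted_L2[OF T X(2)]]]] by simp

lemma cont_adapted_msq_bounded:
  assumes X: "X \<in> Cp T"
  obtains K where "K \<ge> 0" "\<And>t. t \<in> {0..T} ==> msq M (X t) <= K"
proof (rule that)
  show "enn2real (\<integral>\<^sup>+w. supsq T X w \<partial>M) \<ge> 0" by simp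
  fix t assume t: "t \<in> {0..T}"
  have "ennreal (msq M (X t)) <= ennreal (enn2real (\<integral>\<^sup>+w. supsq T X w \<partial>M))"
    using cont_adapted_sq_int(2)[OF X t] cont_adaptedD(3)[OF X] by (simp add: ennreal_enn2real)
  then show "msq M (X t) <= enn2real (\<integral>\<^sup>+w. supsq T X w \<partial>M)" by simp
qed

theorem mean_field_unique:
  fixes a ah a1 ah1 :: "real => real ^ 'n ^ 'n"
  assumes T: "T > 0" and a: "a \<in> Linf T V1" "ah \<in> Linf T V2" "a1 \<in> Linf T V3" "ah1 \<in> Linf T V4"
    and X: "ito_process T x (lin a ah \<beta> X) (lin a1 ah1 \<beta>1 X) X" and X': "ito_process T x (lin a ah \<beta> X') (lin a1 ah1 \<beta>1 X') X'"
    and t: "t \<in> {0..T}"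
  shows "AE w in M. X t w = X' t w"
proof -
  have c: "X \<in> Cp T" "X' \<in> Cp T" using X X' by (auto simp: ito_process_def)
  obtain C where C: "C > 0"
    "\<And>x X X' Z Z' t. X \<in> Cp T ==> X' \<in> Cp T ==>
      ito_process T x (lin a ah \<beta> X) (lin a1 ah1 \<beta>1 X) Z ==> ito_process T x (lin a ah \<beta> X') (lin a1 ah1 \<beta>1 X') Z' ==>
      t \<in> {0..T} ==> msq M (\<lambda>w. Z t w - Z' t w) <= C * (\<integral>s. msq M (\<lambda>w. X s w - X' s w) \<partial>(LT t))"
    by (rule lin_process_bound[OF T a]) blast
  obtain K where K: "K \<ge> 0" "\<And>t. t \<in> {0..T} ==> msq M (\<lambda>w. X t w - X' t w) <= K"
    using cont_adapted_msq_bounded[OF cont_adapted_diff[OF T c]] by blast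
  have "msq M (\<lambda>w. X t w - X' t w) <= 0"
    by (rule gronwall_zero[OF C(1) msq_time_integrable[OF T c] K(2,1) C(2)[OF c X X'] t])
  then have "msq M (\<lambda>w. X t w - X' t w) = 0" using msq_nonneg[of M "\<lambda>w. X t w - X' t w"] by linarith
  from msq_eq_0_AE[OF sq_int_diff[OF cont_adapted_sq_int(1)[OF c(1) t] cont_adapted_sq_int(1)[OF c(2) t]] this]
  show ?thesis by eventually_elim simp
qed

text \<open>
  Picard iteration. The iterates converge in the sense of \<open>cont_adapted_limit\<close> to some \<open>V\<close>; the process
with the coefficients evaluated at \<open>V\<close> is another limit of them, hence a version of \<open>V\<close>, and therefore solves the equation.
\<close>

theorem mean_field_exists:
  fixes a ah a1 ah1 :: "real => real ^ 'n ^ 'n"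
  assumes T: "T > 0" and a: "a \<in> Linf T V1" "ah \<in> Linf T V2" "a1 \<in> Linf T V3" "ah1 \<in> Linf T V4"
    and \<beta>: "\<beta> \<in> L2p T" "\<beta>1 \<in> L2p T"
  obtains X where "ito_process T x (lin a ah \<beta> X) (lin a1 ah1 \<beta>1 X) X"
proof -
  have ex: "\<exists>Y. ito_process T x (lin a ah \<beta> X) (lin a1 ah1 \<beta>1 X) Y" if "X \<in> Cp T" for X
    using ito_process_exists[OF T lin_L2[OF a(1,2) \<beta>(1) cont_adapted_L2[OF T that]] lin_L2[OF a(3,4) \<beta>(2) cont_adapted_L2[OF T that]], of x]
    by metis
  have "\<exists>X. \<forall>n. X n \<in> Cp T \<and> ito_process T x (lin a ah \<beta> (X n)) (lin a1 ah1 \<beta>1 (X n)) (X (Suc n))"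
  proof (rule dependent_nat_choice)
    show "\<exists>X. X \<in> Cp T" using cont_adapted_const by blast
    fix X :: "real => 'w => real ^ 'n" and n :: nat assume "X \<in> Cp T"
    from ex[OF this] show "\<exists>Y. Y \<in> Cp T \<and> ito_process T x (lin a ah \<beta> X) (lin a1 ah1 \<beta>1 X) Y"
      by (auto simp: ito_process_def)
  qed
  then obtain X where X: "\<And>n. X n \<in> Cp T" "\<And>n. ito_process T x (lin a ah \<beta> (X n)) (lin a1 ah1 \<beta>1 (X n)) (X (Suc n))"
    by blast
  obtain C where C: "C > 0"
    "\<And>x X X' Z Z' t. X \<in> Cp T ==> X' \<in> Cp T ==>
      ito_process T x (lin a ah \<beta> X) (lin a1 ah1 \<beta>1 X) Z ==> ito_process T x (lin a ah \<beta> X') (lin a1 ah1 \<beta>1 X') Z' ==>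
      t \<in> {0..T} ==> msq M (\<lambda>w. Z t w - Z' t w) <= C * (\<integral>s. msq M (\<lambda>w. X s w - X' s w) \<partial>(LT t))"
    "\<And>x X X' Z Z'. X \<in> Cp T ==> X' \<in> Cp T ==>
      ito_process T x (lin a ah \<beta> X) (lin a1 ah1 \<beta>1 X) Z ==> ito_process T x (lin a ah \<beta> X') (lin a1 ah1 \<beta>1 X') Z' ==>
      (\<integral>\<^sup>+w. supsq T (\<lambda>s w. Z s w - Z' s w) w \<partial>M) <= ennreal (C * (\<integral>s. msq M (\<lambda>w. X s w - X' s w) \<partial>(LT T)))"
    using that by (rule lin_process_bound[OF T a])
  define e where "e n t = msq M (\<lambda>w. X (Suc n) t w - X n t w)" for n t
  obtain K where K: "K \<ge> 0" "\<And>t. t \<in> {0..T} ==> e 0 t <= K"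
    unfolding e_def using cont_adapted_msq_bounded[OF cont_adapted_diff[OF T X(1) X(1)]] by blast
  have ei: "integrable (LT T) (e n)" for n unfolding e_def[abs_def] by (rule msq_time_integrable[OF T X(1) X(1)])
  have es: "e (Suc n) t <= C * (\<integral>s. e n s \<partial>(LT t))" if "t \<in> {0..T}" for n t
    unfolding e_def by (rule C(2)[OF X(1) X(1) X(2) X(2) that])
  have eb: "e n t <= K * exp (8 * C * t) / 8 ^ n" if "t \<in> {0..T}" for n t
    by (rule gronwall_iterate[OF C(1) _ K(2) ei es K(1) that]) simp
  let ?K = "C * (T * (K * exp (8 * C * T)))"
  have K': "?K \<ge> 0" using C T K by simp
  have sup: "(\<integral>\<^sup>+w. supsq T (\<lambda>s w. X (Suc (Suc n)) s w - X (Suc n) s w) w \<partial>M) <= ennreal (?K * (1/8) ^ n)" for n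
  proof -
    have "(\<integral>s. e n s \<partial>(LT T)) <= (\<integral>s. K * exp (8 * C * T) / 8 ^ n \<partial>(LT T))"
    proof (rule integral_mono[OF ei])
      fix s assume "s \<in> space (LT T)"
      then have s: "s \<in> {0..T}" by simp
      have "K * exp (8 * C * s) / 8 ^ n <= K * exp (8 * C * T) / 8 ^ n"
        using s C(1) K(1) by (intro divide_right_mono mult_left_mono) auto
      with eb[OF s, of n] show "e n s <= K * exp (8 * C * T) / 8 ^ n" by linarith
    qed auto
    also have "... = T * (K * exp (8 * C * T)) * (1/8) ^ n" using T by (simp add: measure_restrict_space power_divide)
    finally have "C * (\<integral>s. e n s \<partial>(LT T)) <= C * (T * (K * exp (8 * C * T)) * (1/8) ^ n)"
      using C(1) by (intro mult_left_mono) auto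
    then have "ennreal (C * (\<integral>s. e n s \<partial>(LT T))) <= ennreal (?K * (1/8) ^ n)"
      by (intro ennreal_leI) (simp add: mult.assoc)
    moreover have "(\<integral>\<^sup>+w. supsq T (\<lambda>s w. X (Suc (Suc n)) s w - X (Suc n) s w) w \<partial>M) <= ennreal (C * (\<integral>s. e n s \<partial>(LT T)))"
      unfolding e_def by (rule C(3)[OF X(1) X(1) X(2) X(2)])
    ultimately show ?thesis by (rule order_trans[rotated])
  qed
  obtain V C' where V: "V \<in> Cp T" "\<And>n t. t \<in> {0..T} ==> msq M (\<lambda>w. X (Suc n) t w - V t w) <= C' * (1/4) ^ n"
    "\<And>t. t \<in> {0..T} ==> (\<lambda>n. msq M (\<lambda>w. X (Suc n) t w - V t w)) \<longlonglongrightarrow> 0"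
    by (rule cont_adapted_limit[OF T X(1) sup K']) blast
  obtain Z where Z: "ito_process T x (lin a ah \<beta> V) (lin a1 ah1 \<beta>1 V) Z" using ex[OF V(1)] by blast
  have Zc: "Z \<in> Cp T" using Z by (simp add: ito_process_def)
  have VZ: "AE w in M. V t w = Z t w" if t: "t \<in> {0..T}" for t
  proof (rule l2_null_unique[of _ _ _ "\<lambda>n. X (Suc (Suc n)) t"])
    show "sq_int M (V t)" "sq_int M (Z t)" "sq_int M (X (Suc (Suc n)) t)" for n
      by (intro cont_adapted_sq_int(1)[OF _ t] V Zc X)+
    show "(\<lambda>n. msq M (\<lambda>w. X (Suc (Suc n)) t w - V t w)) \<longlonglongrightarrow> 0" using LIMSEQ_Suc[OF V(3)[OF t]] .
    have le: "msq M (\<lambda>w. X (Suc (Suc n)) t w - Z t w) <= C * (t * C') * (1/4) ^ n" for n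
    proof -
      have "msq M (\<lambda>w. X (Suc (Suc n)) t w - Z t w) <= C * (\<integral>s. msq M (\<lambda>w. X (Suc n) s w - V s w) \<partial>(LT t))"
        by (rule C(2)[OF X(1) V(1) X(2) Z t])
      also have "... <= C * (\<integral>s. C' * (1/4) ^ n \<partial>(LT t))"
        using C(1) t V(2) by (intro mult_left_mono integral_mono integrable_time_subset[OF _ msq_time_integrable[OF T X(1) V(1)]]) auto
      also have "... = C * (t * C') * (1/4) ^ n" using t by (simp add: measure_restrict_space)
      finally show ?thesis .
    qed
    have "(\<lambda>n. C * (t * C') * (1/4) ^ n) \<longlonglongrightarrow> C * (t * C') * 0" by (intro tendsto_mult tendsto_const LIMSEQ_power_zero) auto
    then show "(\<lambda>n. msq M (\<lambda>w. X (Suc (Suc n)) t w - Z t w)) \<longlonglongrightarrow> 0"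
      by (rule tendsto_sandwich[OF _ _ tendsto_const, rotated 2, OF tendsto_eq_rhs]) (use le in \<open>auto simp: msq_nonneg\<close>)
  qed
  have lin_eq: "AE s in LT T. AE w in M. lin p q \<gamma> V s w = lin p q \<gamma> Z s w" for p q :: "real => real ^ 'n ^ 'n" and \<gamma>
  proof (rule AE_I2)
    fix s assume "s \<in> space (LT T)"
    then have s: "s \<in> {0..T}" by simp
    have m: "integral\<^sup>L M (V s) = integral\<^sup>L M (Z s)"
      by (rule integral_cong_AE) (use VZ[OF s] cont_adaptedD(4)[OF V(1) s] cont_adaptedD(4)[OF Zc s] in auto)
    show "AE w in M. lin p q \<gamma> V s w = lin p q \<gamma> Z s w" using VZ[OF s] by eventually_elim (simp add: lin_def m)
  qed
  have "ito_process T x (lin a ah \<beta> Z) (lin a1 ah1 \<beta>1 Z) Z"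
    by (rule ito_process_cong[OF T Z lin_L2[OF a(1,2) \<beta>(1) cont_adapted_L2[OF T Zc]] lin_L2[OF a(3,4) \<beta>(2) cont_adapted_L2[OF T Zc]] lin_eq lin_eq])
  then show thesis by (rule that)
qed

end

section \<open>Bounded measurable matrix functions\<close>

lemma Linf_components_I:
  fixes f :: "real => real ^ 'm ^ 'n"
  assumes "\<And>i j. (\<lambda>s. f s $ i $ j) \<in> Linf T UNIV"
  shows "f \<in> Linf T UNIV"
proof -
  have m: "f \<in> borel_measurable (LT T)"
    by (subst borel_measurable_euclidean_space) (use assms in \<open>auto simp: Linf_def Basis_vec_def inner_axis\<close>)
  obtain C where C: "\<And>i j. AE s in LT T. norm (f s $ i $ j) <= C i j"
    using assms unfolding Linf_def by (simp add: choice_iff) metis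
  have "AE s in LT T. \<forall>i\<in>UNIV. \<forall>j\<in>UNIV. norm (f s $ i $ j) <= C i j"
    by (intro AE_finite_allI C) simp_all
  then have "AE s in LT T. norm (f s) <= (\<Sum>i\<in>UNIV. \<Sum>j\<in>UNIV. C i j)"
  proof eventually_elim
    case (elim s)
    have "norm (f s) <= (\<Sum>i\<in>UNIV. norm (f s $ i))" unfolding norm_vec_def by (rule L2_set_le_sum) simp
    also have "... <= (\<Sum>i\<in>UNIV. \<Sum>j\<in>UNIV. C i j)"
      by (intro sum_mono order_trans[OF norm_le_l1_cart]) (use elim in auto)
    finally show ?case .
  qed
  with m show ?thesis by (auto simp: Linf_def)
qed

lemma Linf_component:
  fixes f :: "real => real ^ 'm ^ 'n"
  assumes "f \<in> Linf T V" shows "(\<lambda>s. f s $ i $ j) \<in> Linf T UNIV"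
proof -
  obtain C where C: "AE s in LT T. norm (f s) <= C" using assms by (auto simp: Linf_def)
  have "AE s in LT T. norm (f s $ i $ j) <= C"
    using C by eventually_elim (metis Finite_Cartesian_Product.norm_nth_le order_trans)
  moreover have "(\<lambda>s. f s $ i $ j) \<in> borel_measurable (LT T)"
    by (rule measurable_compose[OF Linf_D(1)[OF assms]]) (intro borel_measurable_continuous_onI continuous_intros)
  ultimately show ?thesis by (auto simp: Linf_def)
qed

lemma Linf_real_mult:
  fixes f g :: "real => real" assumes "f \<in> Linf T V" "g \<in> Linf T V'" shows "(\<lambda>s. f s * g s) \<in> Linf T UNIV"
proof -
  obtain C where C: "C \<ge> 0" "AE s in LT T. norm (f s) <= C" using Linf_D(3)[OF assms(1)] by blast
  obtain D where D: "D \<ge> 0" "AE s in LT T. norm (g s) <= D" using Linf_D(3)[OF assms(2)] by blast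
  have "AE s in LT T. norm (f s * g s) <= C * D"
    using C(2) D(2) by eventually_elim (simp add: abs_mult mult_mono C)
  then show ?thesis using Linf_D(1)[OF assms(1)] Linf_D(1)[OF assms(2)] by (auto simp: Linf_def)
qed

lemma Linf_lincomb:
  fixes f g :: "real => 'b::euclidean_space"
  assumes "f \<in> Linf T V" "g \<in> Linf T V'" shows "(\<lambda>s. a *\<^sub>R f s + b *\<^sub>R g s) \<in> Linf T UNIV"
proof -
  obtain C where C: "AE s in LT T. norm (f s) <= C" using Linf_D(3)[OF assms(1)] by blast
  obtain D where D: "AE s in LT T. norm (g s) <= D" using Linf_D(3)[OF assms(2)] by blast
  have "AE s in LT T. norm (a *\<^sub>R f s + b *\<^sub>R g s) <= \<bar>a\<bar> * C + \<bar>b\<bar> * D"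
    using C D
  proof eventually_elim
    case (elim s)
    have "norm (a *\<^sub>R f s + b *\<^sub>R g s) <= \<bar>a\<bar> * norm (f s) + \<bar>b\<bar> * norm (g s)" using norm_triangle_ineq[of "a *\<^sub>R f s" "b *\<^sub>R g s"] by simp
    also have "... <= \<bar>a\<bar> * C + \<bar>b\<bar> * D" using elim by (intro add_mono mult_left_mono) auto
    finally show ?case .
  qed
  then show ?thesis using Linf_D(1)[OF assms(1)] Linf_D(1)[OF assms(2)] by (auto simp: Linf_def)
qed

lemma Linf_add: "f \<in> Linf T V ==> g \<in> Linf T V' ==> (\<lambda>s. f s + g s) \<in> Linf T UNIV"
  and Linf_diff: "f \<in> Linf T V ==> g \<in> Linf T V' ==> (\<lambda>s. f s - g s) \<in> Linf T UNIV"
  using Linf_lincomb[of f T V g V' 1 1] Linf_lincomb[of f T V g V' 1 "-1"] by simp_all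

lemma Linf_minus: "f \<in> Linf T V ==> (\<lambda>s. - f s) \<in> Linf T UNIV"
  using Linf_lincomb[of f T V f V 0 "-1"] by simp

lemma Linf_const: "(\<lambda>s. c) \<in> Linf T UNIV"
  by (auto simp: Linf_def)

lemma Linf_sum:
  fixes f :: "'i => real => 'b::euclidean_space"
  assumes "\<And>i. i \<in> I ==> f i \<in> Linf T UNIV" shows "(\<lambda>s. \<Sum>i\<in>I. f i s) \<in> Linf T UNIV"
  using assms by (induction I rule: infinite_finite_induct) (auto simp: Linf_const intro!: Linf_add)

lemma Linf_matrix_mult:
  fixes f :: "real => real ^ 'm ^ 'n" and g :: "real => real ^ 'k ^ 'm"
  assumes "f \<in> Linf T V" "g \<in> Linf T V'" shows "(\<lambda>s. f s ** g s) \<in> Linf T UNIV"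
  by (rule Linf_components_I) (auto simp: matrix_matrix_mult_def intro!: Linf_sum Linf_real_mult[OF Linf_component[OF assms(1)] Linf_component[OF assms(2)]])

lemma Linf_transpose:
  fixes f :: "real => real ^ 'm ^ 'n"
  assumes "f \<in> Linf T V" shows "(\<lambda>s. transpose (f s)) \<in> Linf T UNIV"
  by (rule Linf_components_I) (simp add: transpose_def Linf_component[OF assms])

lemma Linf_continuous:
  fixes f :: "real => 'b::euclidean_space"
  assumes "continuous_on {0..T} f" shows "f \<in> Linf T UNIV"
proof -
  have "bounded (f ` {0..T})" by (intro compact_imp_bounded compact_continuous_image assms) simp
  then obtain C where "\<forall>s\<in>{0..T}. norm (f s) <= C" by (auto simp: bounded_iff)
  then have "AE s in LT T. norm (f s) <= C" by (intro AE_I2) auto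
  moreover have "f \<in> borel_measurable (LT T)"
    by (rule continuous_imp_measurable_on_sets_lebesgue[OF assms]) simp
  ultimately show ?thesis by (auto simp: Linf_def)
qed

lemma matrix_inv_right: "invertible A ==> A ** matrix_inv A = mat 1"
  and matrix_inv_left: "invertible A ==> matrix_inv A ** A = mat 1" for A :: "real ^ 'n ^ 'n"
  unfolding invertible_def matrix_inv_def by (metis (mono_tags, lifting) someI_ex)+

text \<open>
  For symmetric \<open>K\<close> this is \<open>c I <= K\<close>; as a bound on the form alone it already gives invertibility and the bound \<open>1 / c\<close> on the inverse.
\<close>

definition coercive :: "real => real ^ 'n ^ 'n => bool" where
  "coercive c K \<longleftrightarrow> (\<forall>y. c * (norm y)^2 <= (K *v y) \<bullet> y)"

lemma coercive_inverse:
  fixes K :: "real ^ 'n ^ 'n"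
  assumes c: "c > 0" and K: "coercive c K"
  shows "invertible K" "norm (matrix_inv K *v y) <= norm y / c"
proof -
  have "K *v y = 0 ==> y = 0" for y
    using K[unfolded coercive_def, THEN spec, of y] c by (simp add: mult_le_0_iff)
  then have "inj ((*v) K)" by (subst linear_injective_0) auto
  then show inv: "invertible K" by (simp add: invertible_left_inverse matrix_left_invertible_injective)
  let ?z = "matrix_inv K *v y"
  have Kz: "K *v ?z = y" using inv by (simp add: matrix_vector_mul_assoc matrix_inv_right)
  have "c * (norm ?z)^2 <= y \<bullet> ?z" using K[unfolded coercive_def, THEN spec, of ?z] Kz by simp
  also have "... <= norm y * norm ?z" by (rule norm_cauchy_schwarz)
  finally have "(c * norm ?z) * norm ?z <= norm y * norm ?z" by (simp add: power2_eq_square)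
  then have "c * norm ?z <= norm y" by (cases "norm ?z = 0") (auto dest: mult_right_le_imp_le)
  then show "norm ?z <= norm y / c" using c by (simp add: field_simps)
qed

lemma measurable_det:
  fixes f :: "'a => real ^ 'n ^ 'n"
  assumes [measurable]: "\<And>i j. (\<lambda>s. f s $ i $ j) \<in> borel_measurable N" shows "(\<lambda>s. det (f s)) \<in> borel_measurable N"
  unfolding det_def by measurable

lemma lebesgue_on_measurable_AE:
  fixes f g :: "real => real"
  assumes "f \<in> borel_measurable (lebesgue_on {a..b})" "AE s in lebesgue_on {a..b}. f s = g s"
  shows "g \<in> borel_measurable (lebesgue_on {a..b})"
proof -
  have "AE s in lebesgue. (if s \<in> {a..b} then f s else 0) = (if s \<in> {a..b} then g s else 0)"
    using assms(2) by (subst (asm) AE_restrict_space_iff) (auto elim!: eventually_mono)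
  from borel_measurable_AE[OF _ this] show ?thesis using assms(1)
    by (simp only: borel_measurable_if[of "{a..b}", OF lmeasurable_interval(1)[THEN fmeasurableD], symmetric])
qed

text \<open>
  Measurability of the inverse is read off from Cramer's rule, boundedness from coercivity; both hold only where the matrix is coercive, that is almost everywhere.
\<close>

lemma Linf_matrix_inv:
  fixes K :: "real => real ^ 'n ^ 'n"
  assumes c: "c > 0" and K: "K \<in> Linf T V" and co: "AE s in LT T. coercive c (K s)"
  shows "(\<lambda>s. matrix_inv (K s)) \<in> Linf T UNIV"
proof (rule Linf_components_I)
  fix i j
  let ?L = "LT T"
  let ?D = "\<lambda>s. \<chi> k l. if l = i then axis j 1 $ k else K s $ k $ l"
  have eq: "AE s in ?L. matrix_inv (K s) $ i $ j = det (?D s) / det (K s)" "AE s in ?L. norm (matrix_inv (K s) $ i $ j) <= 1 / c"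
  proof -
    show "AE s in ?L. matrix_inv (K s) $ i $ j = det (?D s) / det (K s)" using co
    proof eventually_elim
      case (elim s)
      have inv: "invertible (K s)" by (rule coercive_inverse[OF c elim])
      have "K s *v (matrix_inv (K s) *v axis j 1) = axis j 1" using inv by (simp add: matrix_vector_mul_assoc matrix_inv_right)
      then have "matrix_inv (K s) *v axis j 1 = (\<chi> k. det (\<chi> i l. if l = k then axis j 1 $ i else K s $ i $ l) / det (K s))"
        using cramer[of "K s"] inv invertible_det_nz by blast
      from arg_cong[OF this, of "\<lambda>v. v $ i"] show ?case by (simp add: matrix_vector_mult_basis column_def)
    qed
    show "AE s in ?L. norm (matrix_inv (K s) $ i $ j) <= 1 / c" using co
    proof eventually_elim
      case (elim s)
      have "norm (matrix_inv (K s) $ i $ j) = norm ((matrix_inv (K s) *v axis j 1) $ i)"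
        by (simp add: matrix_vector_mult_basis column_def)
      also have "... <= norm (matrix_inv (K s) *v axis j 1)" by (rule Finite_Cartesian_Product.norm_nth_le)
      also have "... <= norm (axis j (1::real)) / c" by (rule coercive_inverse[OF c elim])
      finally show ?case by simp
    qed
  qed
  have [measurable]: "(\<lambda>s. K s $ k $ l) \<in> borel_measurable ?L" for k l using Linf_D(1)[OF Linf_component[OF K]] .
  have "(\<lambda>s. det (?D s) / det (K s)) \<in> borel_measurable ?L"
    by (intro borel_measurable_divide measurable_det) auto
  then have "(\<lambda>s. matrix_inv (K s) $ i $ j) \<in> borel_measurable ?L"
    by (rule lebesgue_on_measurable_AE) (use eq(1) in \<open>auto elim: eventually_mono\<close>)
  with eq(2) show "(\<lambda>s. matrix_inv (K s) $ i $ j) \<in> Linf T UNIV" by (auto simp: Linf_def)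
qed

section \<open>Completion of squares for the Riccati equations\<close>

lemma transpose_inner: "(transpose A *v x) \<bullet> y = x \<bullet> (A *v y)" for A :: "real ^ 'n ^ 'm"
  by (simp add: dot_lmul_matrix)

lemma inner_vector_matrix: "x \<bullet> (y v* A) = (A *v x) \<bullet> y" for A :: "real ^ 'n ^ 'm"
  by (metis dot_lmul_matrix inner_commute)

lemma symmetric_inner: "transpose S = S ==> (S *v x) \<bullet> y = (S *v y) \<bullet> x" for S :: "real ^ 'n ^ 'n"
  using transpose_inner[of S x y] by (simp add: inner_commute)

lemma matrix_vector_mult_minus_right: "A *v (- x) = - (A *v x)" for A :: "real ^ 'n ^ 'm"
  using matrix_vector_mult_diff_distrib[of A 0 x] by simp

lemma matrix_vector_mult_minus: "(- A) *v x = - (A *v x)" for A :: "real ^ 'n ^ 'm"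
  using matrix_vector_mult_diff_rdistrib[of 0 A x] by simp

lemmas matrix_simps = matrix_vector_mul_assoc[symmetric] matrix_vector_mult_add_rdistrib matrix_vector_mult_diff_rdistrib
  matrix_vector_right_distrib matrix_vector_mult_diff_distrib inner_add_left inner_add_right inner_diff_left inner_diff_right dot_lmul_matrix inner_vector_matrix

text \<open>
  What a Riccati equation says at one time, as quadratic forms: \<open>\<Theta>\<close> is the gain and \<open>D\<close> the derivative of
\<open>S\<close>. The first equation is the case \<open>S = P\<close>; in the second one \<open>S\<close> is \<open>\<Pi>\<close>, while the diffusion is still
weighted by \<open>P\<close>.
\<close>

definition riccati_form :: "real ^ 'n ^ 'n => real ^ 'm ^ 'n => real ^ 'n ^ 'n => real ^ 'm ^ 'n => real ^ 'n ^ 'n =>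
    real ^ 'm ^ 'm => real ^ 'n ^ 'm => real ^ 'n ^ 'n => real ^ 'n ^ 'n => real ^ 'n ^ 'n => bool" where
  "riccati_form A B A1 B1 Q K \<Theta> P S D \<longleftrightarrow> (\<forall>z. K *v (\<Theta> *v z) = transpose B *v (S *v z) + transpose B1 *v (P *v (A1 *v z)) \<and>
     (D *v z) \<bullet> z + 2 * ((S *v z) \<bullet> (A *v z)) + (P *v (A1 *v z)) \<bullet> (A1 *v z) + (Q *v z) \<bullet> z = (K *v (\<Theta> *v z)) \<bullet> (\<Theta> *v z))"

text \<open>
  The left-hand side is the running cost plus the rate of change of the form of \<open>S\<close> along the state; what the Riccati equation leaves is a square that vanishes exactly for the feedback control.
\<close>

lemma completion_of_squares:
  fixes B1 :: "real ^ 'm ^ 'n"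
  assumes rf: "riccati_form A B A1 B1 Q K \<Theta> P S D" and K: "K = R + transpose B1 ** P ** B1"
    and sym: "transpose P = P" "transpose S = S" "transpose R = R"
  shows "(Q *v z) \<bullet> z + (R *v u) \<bullet> u + (D *v z) \<bullet> z + 2 * ((S *v z) \<bullet> (A *v z + B *v u))
      + (P *v (A1 *v z + B1 *v u)) \<bullet> (A1 *v z + B1 *v u) = (K *v (u + \<Theta> *v z)) \<bullet> (u + \<Theta> *v z)"
proof -
  have Ks: "(K *v x) \<bullet> y = (K *v y) \<bullet> x" for x y
    using symmetric_inner[OF sym(3), of x y] symmetric_inner[OF sym(1), of "B1 *v x" "B1 *v y"] by (simp add: K matrix_simps)
  have L: "(K *v (\<Theta> *v z)) \<bullet> u = (S *v z) \<bullet> (B *v u) + (P *v (A1 *v z)) \<bullet> (B1 *v u)"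
    using rf[unfolded riccati_form_def, THEN spec, of z] by (simp add: matrix_simps)
  have Ku: "(K *v u) \<bullet> u = (R *v u) \<bullet> u + (P *v (B1 *v u)) \<bullet> (B1 *v u)" by (simp add: K matrix_simps)
  show ?thesis
    using rf[unfolded riccati_form_def, THEN spec, of z] L Ku Ks[of u "\<Theta> *v z"] symmetric_inner[OF sym(1), of "A1 *v z" "B1 *v u"]
    by (simp add: matrix_simps algebra_simps)
qed

lemma symmetric_inverse:
  fixes K :: "real ^ 'n ^ 'n"
  assumes "transpose K = K" "invertible K" shows "transpose (matrix_inv K) = matrix_inv K"
  by (metis assms matrix_inv_left matrix_inv_right matrix_mul_assoc matrix_mul_lid matrix_mul_rid matrix_transpose_mul transpose_mat)

text \<open>
  Expanding the products shows that the two equations have the same shape, so that everything below is proved for the second one.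
\<close>

lemma riccati_P_Pi:
  assumes "riccati_P T A B A1 B1 Q R G P" shows "riccati_Pi T A B A1 B1 Q R G P P"
proof -
  have eq: "P' + P s ** (A s - B s ** J ** transpose (B1 s) ** P s ** A1 s)
           + (transpose (A s) - transpose (A1 s) ** P s ** B1 s ** J ** transpose (B s)) ** P s
           - P s ** B s ** J ** transpose (B s) ** P s
           + transpose (A1 s) ** (P s - P s ** B1 s ** J ** transpose (B1 s) ** P s) ** A1 s + Q s
    = P' + P s ** A s + transpose (A s) ** P s + transpose (A1 s) ** P s ** A1 s + Q s
           - (P s ** B s + transpose (A1 s) ** P s ** B1 s) ** J ** (transpose (B s) ** P s + transpose (B1 s) ** P s ** A1 s)" for P' s J
    by (simp add: matrix_eq matrix_vector_mul_assoc[symmetric] algebra_simps del: transpose_matrix_vector)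
  show ?thesis using assms unfolding riccati_P_def riccati_Pi_def eq .
qed

text \<open>
  The derivative of \<open>S\<close> solved from the equation, with \<open>J\<close> in place of the inverse of \<open>K\<close>. Being an explicit expression, it is visibly bounded and measurable.
\<close>

definition riccati_drift :: "real ^ 'n ^ 'n => real ^ 'm ^ 'n => real ^ 'n ^ 'n => real ^ 'm ^ 'n => real ^ 'n ^ 'n =>
    real ^ 'm ^ 'm => real ^ 'n ^ 'n => real ^ 'n ^ 'n => real ^ 'n ^ 'n" where
  "riccati_drift A B A1 B1 Q J P S = - (S ** (A - B ** J ** transpose B1 ** P ** A1)
           + (transpose A - transpose A1 ** P ** B1 ** J ** transpose B) ** S
           - S ** B ** J ** transpose B ** S
           + transpose A1 ** (P - P ** B1 ** J ** transpose B1 ** P) ** A1 + Q)"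

lemma riccati_form_Pi:
  fixes A :: "real ^ 'n ^ 'n" and B B1 :: "real ^ 'm ^ 'n"
  assumes K: "invertible K" "transpose K = K" and P: "transpose P = P" and S: "transpose S = S"
  shows "riccati_form A B A1 B1 Q K (matrix_inv K ** (transpose B ** S + transpose B1 ** P ** A1)) P S
    (riccati_drift A B A1 B1 Q (matrix_inv K) P S)"
  unfolding riccati_form_def
proof (intro allI conjI)
  fix z
  let ?D = "riccati_drift A B A1 B1 Q (matrix_inv K) P S"
  let ?L = "transpose B ** S + transpose B1 ** P ** A1"
  show 1: "K *v ((matrix_inv K ** ?L) *v z) = transpose B *v (S *v z) + transpose B1 *v (P *v (A1 *v z))"
    using K(1) by (simp add: matrix_vector_mul_assoc matrix_mul_assoc[symmetric] matrix_vector_mult_add_rdistrib)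
       (simp add: matrix_mul_assoc matrix_inv_right matrix_vector_mult_add_rdistrib)
  define a where "a = (S *v z) v* B"
  define b where "b = (P *v (A1 *v z)) v* B1"
  let ?J = "matrix_inv K"
  have J: "(?J *v x) \<bullet> y = (?J *v y) \<bullet> x" for x y by (rule symmetric_inner[OF symmetric_inverse[OF K(2,1)]])
  have s: "(S *v x) \<bullet> y = (S *v y) \<bullet> x" "(P *v x) \<bullet> y = (P *v y) \<bullet> x" for x y by (rule symmetric_inner, fact)+
  have ab: "a \<bullet> y = (S *v z) \<bullet> (B *v y)" "b \<bullet> y = (P *v (A1 *v z)) \<bullet> (B1 *v y)" for y by (simp_all add: a_def b_def dot_lmul_matrix)
  have "(?D *v z) \<bullet> z + ((S *v (A *v z)) \<bullet> z - a \<bullet> (?J *v b)) + ((S *v z) \<bullet> (A *v z) - b \<bullet> (?J *v a))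
     - a \<bullet> (?J *v a) + ((P *v (A1 *v z)) \<bullet> (A1 *v z) - b \<bullet> (?J *v b)) + (Q *v z) \<bullet> z = 0"
    using s(1)[of "B *v (?J *v b)" z] s(1)[of "B *v (?J *v a)" z] s(2)[of "B1 *v (?J *v b)" "A1 *v z"] s(2)[of "B1 *v (?J *v a)" "A1 *v z"]
    unfolding ab riccati_drift_def by (simp add: matrix_simps a_def[symmetric] b_def[symmetric] inner_commute matrix_vector_mult_minus)
  then show "(?D *v z) \<bullet> z + 2 * ((S *v z) \<bullet> (A *v z)) + (P *v (A1 *v z)) \<bullet> (A1 *v z) + (Q *v z) \<bullet> z
      = (K *v ((matrix_inv K ** ?L) *v z)) \<bullet> ((matrix_inv K ** ?L) *v z)"
    unfolding 1 using s(1)[of z "A *v z"] J[of a b]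
    by (simp add: matrix_simps a_def[symmetric] b_def[symmetric] inner_commute)
qed

lemma AE_lebesgue_on_negligible:
  assumes "AE s in lebesgue_on {a..b::real}. Q s" shows "negligible {s \<in> {a..b}. \<not> Q s}"
proof -
  have "AE s in lebesgue. s \<in> {a..b} \<longrightarrow> Q s" using assms by (subst (asm) AE_restrict_space_iff) auto
  then have "{s. \<not> (s \<in> {a..b} \<longrightarrow> Q s)} \<in> null_sets lebesgue" unfolding completion.AE_iff_null_sets by simp
  then show ?thesis unfolding negligible_iff_null_sets by (simp add: set_eq_iff Collect_conj_eq)
qed

lemma transpose_add: "transpose (X + Y) = transpose X + transpose Y" for X Y :: "real ^ 'n ^ 'm"
  by (simp add: transpose_def vec_eq_iff)

lemma transpose_riccati_K: "transpose (R s) = R s ==> transpose (P s) = P s ==> transpose (riccati_K R B1 P s) = riccati_K R B1 P s"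
  by (simp add: riccati_K_def matrix_transpose_mul matrix_mul_assoc transpose_add)

abbreviation "riccati_gain A B A1 B1 R P S s \<equiv>
  matrix_inv (riccati_K R B1 P s) ** (transpose (B s) ** S s + transpose (B1 s) ** P s ** A1 s)"

lemma riccati_Pi_AE:
  assumes "riccati_Pi T A B A1 B1 Q R G P S" and R: "R \<in> Linf T symmetric_matrices" and P: "\<forall>s\<in>{0..T}. P s \<in> symmetric_matrices"
  shows "AE s in LT T. (S has_vector_derivative
      riccati_drift (A s) (B s) (A1 s) (B1 s) (Q s) (matrix_inv (riccati_K R B1 P s)) (P s) (S s)) (at s within {0..T})"
    and "AE s in LT T. riccati_form (A s) (B s) (A1 s) (B1 s) (Q s) (riccati_K R B1 P s) (riccati_gain A B A1 B1 R P S s) (P s) (S s)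
      (riccati_drift (A s) (B s) (A1 s) (B1 s) (Q s) (matrix_inv (riccati_K R B1 P s)) (P s) (S s))"
proof -
  let ?L = "LT T"
  have S: "\<forall>s\<in>{0..T}. S s \<in> symmetric_matrices" and eq: "AE s in ?L. invertible (riccati_K R B1 P s) \<and>
    (\<exists>D. (S has_vector_derivative D) (at s within {0..T}) \<and> D - riccati_drift (A s) (B s) (A1 s) (B1 s) (Q s) (matrix_inv (riccati_K R B1 P s)) (P s) (S s) = 0)"
    using assms(1) unfolding riccati_Pi_def riccati_drift_def by (simp_all add: algebra_simps)
  show "AE s in ?L. (S has_vector_derivative
      riccati_drift (A s) (B s) (A1 s) (B1 s) (Q s) (matrix_inv (riccati_K R B1 P s)) (P s) (S s)) (at s within {0..T})"
    using eq by eventually_elim auto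
  show "AE s in ?L. riccati_form (A s) (B s) (A1 s) (B1 s) (Q s) (riccati_K R B1 P s) (riccati_gain A B A1 B1 R P S s) (P s) (S s)
      (riccati_drift (A s) (B s) (A1 s) (B1 s) (Q s) (matrix_inv (riccati_K R B1 P s)) (P s) (S s))"
    using eq Linf_D(2)[OF R] AE_space[of ?L]
  proof eventually_elim
    case (elim s)
    then show ?case using S P by (intro riccati_form_Pi transpose_riccati_K) (auto simp: symmetric_matrices_def)
  qed
qed

lemma psd_kernel:
  fixes S :: "real ^ 'n ^ 'n"
  assumes sym: "transpose S = S" and psd: "\<And>v. 0 <= (S *v v) \<bullet> v" and y: "(S *v y) \<bullet> y = 0"
  shows "S *v y = 0"
proof -
  let ?w = "S *v y"
  let ?a = "?w \<bullet> ?w" and ?b = "(S *v ?w) \<bullet> ?w"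
  define r where "r = - ?a / (?b + 1)"
  have b: "?b \<ge> 0" by (rule psd)
  have "0 <= (S *v (y + r *\<^sub>R ?w)) \<bullet> (y + r *\<^sub>R ?w)" by (rule psd)
  also have "... = 2 * r * ?a + r^2 * ?b"
    using symmetric_inner[OF sym, of ?w y] y
    by (simp add: matrix_vector_right_distrib matrix_vector_mult_scaleR inner_add_left inner_add_right power2_eq_square algebra_simps)
  also have "... = - (?a^2 * (?b + 2)) / (?b + 1)^2"
    using b by (simp add: r_def divide_simps power2_eq_square) (simp add: algebra_simps)
  finally have "?a^2 * (?b + 2) <= 0" using b by (simp add: divide_le_0_iff zero_le_divide_iff) 
  then have "?a = 0" using b by (simp add: mult_le_0_iff)
  then show ?thesis by simp
qed

text \<open>
  At a time when \<open>P \<ge> - e I\<close> and \<open>P y\<close> is of order \<open>e\<close>, the derivative of the form in the direction \<open>y\<close> is at most a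
multiple of \<open>e\<close>: by completion of squares with the feedback control, only terms of order \<open>e\<close> can be
positive. The multiple depends only on bounds of the data, because \<open>K \<ge> \<delta>/2\<close> bounds the gain along \<open>y\<close>.
\<close>

lemma touching_bound:
  fixes B1 :: "real ^ 'm ^ 'n"
  defines "\<theta> \<equiv> \<lambda>C \<delta>. 2 * (C^2 + C ^ 3) / \<delta>"
  assumes rf: "riccati_form A B A1 B1 Q K \<Theta> P P D" and K: "K = R + transpose B1 ** P ** B1"
    and sym: "transpose P = P" "transpose R = R" and Q: "\<And>v. 0 <= (Q *v v) \<bullet> v" and R: "coercive \<delta> R" "\<delta> > 0"
    and C: "norm A <= C" "norm B <= C" "norm A1 <= C" "norm B1 <= C" "norm P <= C"
    and e: "e \<ge> 0" "\<And>v. - e * (norm v)^2 <= (P *v v) \<bullet> v" "e * C^2 <= \<delta> / 2" and y: "norm y = 1" "norm (P *v y) <= 2 * e"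
  shows "(D *v y) \<bullet> y <= (4 * (C + C * \<theta> C \<delta>) + (C + C * \<theta> C \<delta>)^2) * e"
proof -
  let ?x = "\<Theta> *v y"
  have C0: "C \<ge> 0" using C(1) norm_ge_zero order_trans by blast
  have b: "norm (M *v v) <= C * norm v" if "norm M <= C" for M :: "real ^ 'k ^ 'l" and v
    using norm_matrix_vector_le[of M v] mult_right_mono[OF that norm_ge_zero[of v]] by linarith
  have "\<delta> * (norm ?x)^2 <= (R *v ?x) \<bullet> ?x" using R by (simp add: coercive_def)
  moreover have "- e * (norm (B1 *v ?x))^2 <= (P *v (B1 *v ?x)) \<bullet> (B1 *v ?x)" by (rule e)
  moreover have "e * (norm (B1 *v ?x))^2 <= \<delta> / 2 * (norm ?x)^2"
  proof -
    have "e * (norm (B1 *v ?x))^2 <= e * (C * norm ?x)^2" by (intro mult_left_mono power_mono b C e) auto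
    also have "... = e * C^2 * (norm ?x)^2" by (simp add: power_mult_distrib)
    also have "... <= \<delta> / 2 * (norm ?x)^2" by (intro mult_right_mono e) simp
    finally show ?thesis .
  qed
  moreover have "(K *v ?x) \<bullet> ?x = (R *v ?x) \<bullet> ?x + (P *v (B1 *v ?x)) \<bullet> (B1 *v ?x)" by (simp add: K matrix_simps)
  moreover have "(K *v ?x) \<bullet> ?x = (P *v y) \<bullet> (B *v ?x) + (P *v (A1 *v y)) \<bullet> (B1 *v ?x)"
    using rf[unfolded riccati_form_def, THEN spec, of y] by (simp add: matrix_simps)
  moreover have "(P *v y) \<bullet> (B *v ?x) <= C * (C * norm ?x)"
    by (rule order_trans[OF norm_cauchy_schwarz mult_mono]) (use b[OF C(5), of y] b[OF C(2)] y C0 in auto)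
  moreover have "(P *v (A1 *v y)) \<bullet> (B1 *v ?x) <= (C * C) * (C * norm ?x)"
    by (rule order_trans[OF norm_cauchy_schwarz mult_mono])
       (use order_trans[OF b[OF C(5), of "A1 *v y"] mult_left_mono[OF b[OF C(3), of y] C0]] b[OF C(4)] y C0 in auto)
  ultimately have "(\<delta> / 2 * norm ?x) * norm ?x <= (C^2 + C ^ 3) * norm ?x"
    by (simp add: power2_eq_square power3_eq_cube algebra_simps)
  then have "\<delta> / 2 * norm ?x <= C^2 + C ^ 3" using C0 by (cases "norm ?x = 0") (auto dest: mult_right_le_imp_le)
  then have x: "norm ?x <= \<theta> C \<delta>" using R(2) by (simp add: \<theta>_def field_simps)
  have ab: "norm (M *v y - N *v ?x) <= C + C * \<theta> C \<delta>" if "norm M <= C" "norm N <= C" for M :: "real ^ 'n ^ 'n" and N :: "real ^ 'm ^ 'n"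
    using norm_triangle_ineq4[of "M *v y" "N *v ?x"] b[OF that(1), of y] b[OF that(2), of ?x] mult_left_mono[OF x C0] by (simp add: y(1))
  let ?c = "C + C * \<theta> C \<delta>" and ?v = "A *v y - B *v ?x" and ?w = "A1 *v y - B1 *v ?x"
  have "(Q *v y) \<bullet> y + (R *v ?x) \<bullet> ?x + (D *v y) \<bullet> y + 2 * ((P *v y) \<bullet> ?v) + (P *v ?w) \<bullet> ?w = 0"
    using completion_of_squares[OF rf K sym(1,1,2), of y "- ?x"] by (simp add: matrix_vector_mult_minus_right)
  moreover have "0 <= (R *v ?x) \<bullet> ?x" using R unfolding coercive_def by (meson order_trans mult_nonneg_nonneg less_imp_le zero_le_power2)
  moreover have "- ((P *v y) \<bullet> ?v) <= (2 * e) * ?c"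
    by (rule order_trans[OF _ mult_mono[OF y(2) ab[OF C(1,2)]]]) (use norm_cauchy_schwarz[of "- (P *v y)" ?v] e in auto)
  moreover have "- ((P *v ?w) \<bullet> ?w) <= e * ?c^2"
    using e(2)[of ?w] mult_left_mono[OF power_mono[OF ab[OF C(3,4)] norm_ge_zero, of 2] e(1)] by linarith
  ultimately show ?thesis using Q[of y] by (simp add: algebra_simps)
qed

section \<open>Positivity and regularity of Riccati solutions\<close>

text \<open>
  Add \<open>\<epsilon> exp (c (T - t)) I\<close> to \<open>P\<close>, with \<open>c\<close> the constant of \<open>touching_bound\<close>, and suppose that the sum is not
strictly positive everywhere. At the last time \<open>t0\<close> where this happens it has a kernel vector \<open>y\<close>. Just after \<open>t0\<close> the derivative of
the form at \<open>y\<close> is at most zero, since the exponential decreases faster than \<open>P\<close> can increase; so the sum fails to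
be positive later as well. The bound holds for all small \<open>\<epsilon>\<close>, and \<open>\<epsilon>\<close> tends to zero.
\<close>

theorem riccati_P_psd:
  fixes A :: "real => real ^ 'n ^ 'n" and B :: "real => real ^ 'm ^ 'n"
  assumes T: "T > 0" and L: "A \<in> Linf T UNIV" "B \<in> Linf T UNIV" "A1 \<in> Linf T UNIV" "B1 \<in> Linf T UNIV" "R \<in> Linf T symmetric_matrices"
    and Q: "AE s in LT T. \<forall>v. 0 <= (Q s *v v) \<bullet> v" and R: "AE s in LT T. coercive \<delta> (R s)" and \<delta>: "\<delta> > 0"
    and G: "\<And>v. 0 <= (G *v v) \<bullet> v" and P: "riccati_P T A B A1 B1 Q R G P" and t: "t \<in> {0..T}"
  shows "0 <= (P t *v v) \<bullet> v"
proof -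
  let ?L = "LT T"
  have Pi: "riccati_Pi T A B A1 B1 Q R G P P" by (rule riccati_P_Pi[OF P])
  have ac: "abs_continuous_on 0 T P" and sP: "\<forall>s\<in>{0..T}. P s \<in> symmetric_matrices" and PT: "P T = G" using P by (simp_all add: riccati_P_def)
  have Pc: "continuous_on {0..T} P" by (rule abs_continuous_on_imp_continuous_on[OF ac])
  define D where "D s = riccati_drift (A s) (B s) (A1 s) (B1 s) (Q s) (matrix_inv (riccati_K R B1 P s)) (P s) (P s)" for s
  note PD = riccati_Pi_AE[OF Pi L(5) sP, folded D_def]
  obtain C where C: "C \<ge> 0" "AE s in ?L. norm (A s) <= C \<and> norm (B s) <= C \<and> norm (A1 s) <= C \<and> norm (B1 s) <= C \<and> norm (P s) <= C"
  proof -
    obtain c1 c2 c3 c4 c5 where c: "c1 \<ge> 0" "AE s in ?L. norm (A s) <= c1" "AE s in ?L. norm (B s) <= c2" "AE s in ?L. norm (A1 s) <= c3"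
      "AE s in ?L. norm (B1 s) <= c4" "AE s in ?L. norm (P s) <= c5"
      using Linf_D(3)[OF L(1)] Linf_D(3)[OF L(2)] Linf_D(3)[OF L(3)] Linf_D(3)[OF L(4)] Linf_D(3)[OF Linf_continuous[OF Pc]] by blast
    show thesis
    proof (rule that[of "max c1 (max c2 (max c3 (max c4 c5)))"])
      show "AE s in ?L. norm (A s) <= max c1 (max c2 (max c3 (max c4 c5))) \<and> norm (B s) <= max c1 (max c2 (max c3 (max c4 c5))) \<and>
        norm (A1 s) <= max c1 (max c2 (max c3 (max c4 c5))) \<and> norm (B1 s) <= max c1 (max c2 (max c3 (max c4 c5))) \<and> norm (P s) <= max c1 (max c2 (max c3 (max c4 c5)))"
        using c(2-) by eventually_elim auto
    qed (use c(1) in simp)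
  qed
  let ?\<theta> = "2 * (C^2 + C ^ 3) / \<delta>"
  define c where "c = 4 * (C + C * ?\<theta>) + (C + C * ?\<theta>)^2"
  have c0: "c \<ge> 0" using C(1) \<delta> by (simp add: c_def)
  have main: "0 <= (P t *v v) \<bullet> v + \<epsilon> * exp (c * (T - t)) * (norm v)^2" if t: "t \<in> {0..T}" and \<epsilon>: "0 < \<epsilon>" "\<epsilon> * exp (c * T) * C^2 <= \<delta> / 2" for t v \<epsilon>
  proof -
    define e where "e s = \<epsilon> * exp (c * (T - s))" for s
    have e: "\<epsilon> <= e s" "e s <= \<epsilon> * exp (c * T)" "e s > 0" if "s \<in> {0..T}" for s
      using that \<epsilon>(1) c0 by (auto simp: e_def mult_left_mono mult_le_cancel_left1)
    let ?q = "\<lambda>s v. (P s *v v) \<bullet> v + e s * (norm v)^2"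
    have ec: "continuous_on S e" for S unfolding e_def[abs_def] by (intro continuous_intros)
    have "?q s w > 0" if s: "s \<in> {0..T}" and w: "norm w = 1" for s w
    proof (rule ccontr)
      assume neg: "\<not> ?q s w > 0"
      let ?K = "{p \<in> {0..T} \<times> sphere 0 1. ?q (fst p) (snd p) <= 0}"
      have "continuous_on ({0..T} \<times> sphere 0 1) (\<lambda>p :: real \<times> (real ^ 'n). ?q (fst p) (snd p))"
        unfolding matrix_vector_mult_def
        by (intro continuous_intros continuous_on_compose2[OF Pc] continuous_on_compose2[OF ec[of UNIV]]) auto
      from continuous_closedin_preimage[OF this, of "{..0}"]
      have "closedin (top_of_set ({0..T} \<times> sphere 0 1)) ?K" by (simp add: vimage_def Int_def) 
      then have "compact ?K" by (rule closedin_compact[rotated]) (intro compact_Times; simp)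
      then have cK: "compact (fst ` ?K)" by (intro compact_continuous_image continuous_intros)
      have "fst ` ?K \<noteq> {}" using s w neg by (force simp: image_iff)
      from compact_attains_sup[OF cK this] obtain t0 where t0: "t0 \<in> fst ` ?K" "\<And>r. r \<in> fst ` ?K ==> r <= t0" by (elim bexE) (blast intro: that)
      then obtain y where y: "t0 \<in> {0..T}" "norm y = 1" "?q t0 y <= 0" by auto
      have pos: "?q r v \<ge> 0" if r: "r \<in> {0..T}" "t0 < r" for r v
      proof (cases "v = 0")
        case False
        have "?q r (v /\<^sub>R norm v) > 0"
        proof (rule ccontr)
          assume "\<not> ?thesis"
          then have "r \<in> fst ` ?K" using r False by (intro image_eqI[of _ _ "(r, v /\<^sub>R norm v)"]) auto
          then show False using t0(2)[of r] r by simp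
        qed
        moreover have "?q r v = (norm v)^2 * ?q r (v /\<^sub>R norm v)"
          using False by (simp add: matrix_vector_mult_scaleR power2_eq_square field_simps)
        ultimately show ?thesis by simp
      qed simp
      have t0T: "t0 < T"
      proof (rule ccontr)
        assume "\<not> t0 < T"
        then have "t0 = T" using y by simp
        then show False using y(2,3) G[of y] \<epsilon>(1) by (simp add: PT e_def)
      qed
      have pos0: "?q t0 v \<ge> 0" for v
      proof -
        \<comment> \<open>Positivity on the right of t0 passes to t0 itself.\<close>
        have "continuous_on {0..T} (\<lambda>r. ?q r v)" unfolding matrix_vector_mult_def by (intro continuous_intros Pc ec)
        then have "((\<lambda>r. ?q r v) \<longlongrightarrow> ?q t0 v) (at t0 within {0..T})" using y(1) by (simp add: continuous_on)
        then have "((\<lambda>r. ?q r v) \<longlongrightarrow> ?q t0 v) (at_right t0)"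
          by (rule tendsto_mono[rotated]) (use y(1) t0T in \<open>simp add: at_within_Icc_at_right[symmetric] at_le\<close>)
        then show ?thesis
          by (rule tendsto_lowerbound) (use pos t0T y(1) in \<open>auto simp: eventually_at_right[OF t0T] intro!: exI[of _ T]\<close>)
      qed
      define S where "S r = P r + e r *\<^sub>R mat 1" for r
      have S: "S r *v v = P r *v v + e r *\<^sub>R v" for r v by (simp add: S_def matrix_vector_mult_add_rdistrib scaleR_matrix_vector_assoc[symmetric])
      have Sq: "(S r *v v) \<bullet> v = ?q r v" for r v by (simp add: S inner_add_left power2_norm_eq_inner)
      have "S t0 *v y = 0"
      proof (rule psd_kernel)
        show "transpose (S t0) = S t0" using sP y(1) by (auto simp: S_def symmetric_matrices_def transpose_def vec_eq_iff mat_def)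
        show "0 <= (S t0 *v v) \<bullet> v" "(S t0 *v y) \<bullet> y = 0" for v using pos0[of v] pos0[of y] y(3) unfolding Sq by linarith+
      qed
      moreover have "continuous_on {0..T} (\<lambda>r. S r *v y)" unfolding S_def matrix_vector_mult_def by (intro continuous_intros Pc ec)
      ultimately obtain \<eta> where \<eta>: "\<eta> > 0" "\<And>r. r \<in> {0..T} ==> \<bar>r - t0\<bar> < \<eta> ==> norm (S r *v y) < \<epsilon>"
        using y(1) \<epsilon>(1) unfolding continuous_on_iff dist_norm by (metis diff_zero real_norm_def)
      define t1 where "t1 = min T (t0 + \<eta> / 2)"
      have t1: "t0 < t1" "t1 <= T" "t1 < t0 + \<eta>" using t0T \<eta>(1) by (auto simp: t1_def)
      let ?ok = "\<lambda>s. (P has_vector_derivative D s) (at s within {0..T}) \<and> (D s *v y) \<bullet> y <= c * max 0 (e s) \<or> \<not> (t0 <= s \<and> s <= t1)"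
      have "AE s in ?L. ?ok s"
        using PD Q R C(2) Linf_D(2)[OF L(5)] AE_space[of ?L]
      proof eventually_elim
        case (elim s)
        show ?case
        proof (cases "t0 <= s \<and> s <= t1")
          case True
          have s: "s \<in> {0..T}" using elim by simp
          have "norm (P s *v y) = norm (S s *v y - e s *\<^sub>R y)" by (simp add: S)
          also have "... <= norm (S s *v y) + e s" using norm_triangle_ineq4[of "S s *v y" "e s *\<^sub>R y"] e(3)[OF s] y(2) by simp
          also have "... <= 2 * e s" using \<eta>(2)[OF s] True t1 e(1)[OF s] by force
          finally have Py: "norm (P s *v y) <= 2 * e s" .
          have "(D s *v y) \<bullet> y <= c * e s" unfolding c_def
          proof (rule touching_bound[OF elim(2) _ _ _ _ elim(4) \<delta> _ _ _ _ _ _ _ _ y(2) Py])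
            show "riccati_K R B1 P s = R s + transpose (B1 s) ** P s ** B1 s" by (rule riccati_K_def)
            show "transpose (P s) = P s" "transpose (R s) = R s" using sP s elim by (auto simp: symmetric_matrices_def)
            show "- e s * (norm v)^2 <= (P s *v v) \<bullet> v" for v using pos[OF s, of v] pos0[of v] True by (cases "s = t0") auto
            have "e s * C^2 <= \<epsilon> * exp (c * T) * C^2" by (intro mult_right_mono e s) simp
            with \<epsilon>(2) show "e s * C^2 <= \<delta> / 2" by simp
          qed (use elim e(3)[OF s] in auto)
          with elim(1) e(3)[OF s] show ?thesis by (simp add: max_def)
        qed simp
      qed
      then have "negligible {s \<in> {0..T}. \<not> ?ok s}" (is "negligible ?N") by (rule AE_lebesgue_on_negligible)
      then have hi: "((\<lambda>s. if s \<in> ?N then 0 else D s) has_integral (P t1 - P t0)) {t0..t1}"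
      proof (rule abs_continuous_has_integral[OF t1(1) abs_continuous_on_subset[OF ac], rotated 2])
        fix s assume "s \<in> {t0..t1} - ?N"
        then have "(P has_vector_derivative D s) (at s within {0..T})" using y(1) t1 by auto
        then show "(P has_vector_derivative D s) (at s within {t0..t1})"
          by (rule has_vector_derivative_within_subset) (use y(1) t1 in auto)
      qed (use y(1) t1 in auto)
      have "linear (\<lambda>X :: real ^ 'n ^ 'n. (X *v y) \<bullet> y)"
        by (rule linearI) (simp_all add: matrix_vector_mult_add_rdistrib inner_add_left scaleR_matrix_vector_assoc[symmetric])
      from has_integral_linear[OF hi linear_conv_bounded_linear[THEN iffD1, OF this]]
      have "((\<lambda>s. ((if s \<in> ?N then 0 else D s) *v y) \<bullet> y) has_integral ((P t1 - P t0) *v y) \<bullet> y) {t0..t1}" by (simp add: o_def)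
      moreover have "((\<lambda>s. - c * e s) has_integral (e t1 - e t0)) {t0..t1}"
        by (rule fundamental_theorem_of_calculus)
           (use t1 in \<open>auto simp: e_def[abs_def] has_real_derivative_iff_has_vector_derivative[symmetric] intro!: derivative_eq_intros\<close>)
      ultimately have "((\<lambda>s. ((if s \<in> ?N then 0 else D s) *v y) \<bullet> y + - c * e s) has_integral ((P t1 - P t0) *v y) \<bullet> y + (e t1 - e t0)) {t0..t1}"
        by (rule has_integral_add)
      then have "((P t1 - P t0) *v y) \<bullet> y + (e t1 - e t0) <= 0"
      proof (rule has_integral_le[OF _ has_integral_0])
        fix s assume s: "s \<in> {t0..t1}"
        then have e0: "e s > 0" using y(1) t1 by (intro e) auto
        then show "((if s \<in> ?N then 0 else D s) *v y) \<bullet> y + - c * e s <= 0" using s c0 y(1) t1 by auto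
      qed
      then have "?q t1 y <= 0" using y(3) by (simp add: matrix_vector_mult_diff_rdistrib inner_diff_left y(2))
      then have "t1 \<in> fst ` ?K" using y t1 by (intro image_eqI[of _ _ "(t1, y)"]) auto
      then show False using t0(2)[of t1] t1 by simp
    qed
    note pos = this
    show ?thesis
    proof (cases "v = 0")
      case False
      have "?q t (v /\<^sub>R norm v) > 0" using False by (intro pos t) simp
      moreover have "?q t v = (norm v)^2 * ?q t (v /\<^sub>R norm v)"
        using False by (simp add: matrix_vector_mult_scaleR power2_eq_square field_simps)
      ultimately show ?thesis by (simp add: e_def)
    qed simp
  qed
  \<comment> \<open>Below this threshold K stays above one half of delta as long as P is at least the negative perturbation.\<close>
  define \<epsilon>0 where "\<epsilon>0 = \<delta> / (2 * (exp (c * T) * C^2 + 1))"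
  have \<epsilon>0: "\<epsilon>0 > 0" unfolding \<epsilon>0_def using \<delta> by (intro divide_pos_pos mult_pos_pos add_nonneg_pos) auto
  have "eventually (\<lambda>\<epsilon>. 0 <= (P t *v v) \<bullet> v + \<epsilon> * exp (c * (T - t)) * (norm v)^2) (at_right 0)"
    unfolding eventually_at_right[OF \<epsilon>0]
  proof (intro exI[of _ \<epsilon>0] conjI \<epsilon>0 allI impI main t)
    fix \<epsilon> assume e: "0 < \<epsilon>" "\<epsilon> < \<epsilon>0"
    have "\<epsilon> * (exp (c * T) * C^2 + 1) <= \<epsilon>0 * (exp (c * T) * C^2 + 1)" using e by (intro mult_right_mono) auto
    also have "... = \<delta> / 2" unfolding \<epsilon>0_def by (simp add: divide_simps add_nonneg_eq_0_iff)
    finally show "\<epsilon> * exp (c * T) * C^2 <= \<delta> / 2" using e by (simp add: distrib_left mult.assoc)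
  qed auto
  moreover have "((\<lambda>\<epsilon>. (P t *v v) \<bullet> v + \<epsilon> * exp (c * (T - t)) * (norm v)^2) \<longlongrightarrow> (P t *v v) \<bullet> v + 0 * exp (c * (T - t)) * (norm v)^2) (at_right 0)"
    by (intro tendsto_intros)
  ultimately show ?thesis using tendsto_lowerbound by fastforce
qed

lemma Linf_integrable: "g \<in> Linf T V ==> integrable (LT T) g"
proof -
  assume g: "g \<in> Linf T V"
  then obtain C where "AE s in LT T. norm (g s) <= C" using Linf_D(3) by blast
  then show ?thesis using finite_measure.integrable_const_bound[OF finite_measure_lebesgue_interval] Linf_D(1)[OF g] by blast
qed

lemma abs_continuous_integral:
  fixes f :: "real => 'b::euclidean_space"
  assumes ac: "abs_continuous_on 0 T f" and g: "g \<in> Linf T V"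
    and d: "AE s in LT T. (f has_vector_derivative g s) (at s within {0..T})" and t: "t \<in> {0..T}"
  shows "f t = f 0 + (\<integral>s. g s \<partial>(LT t))"
proof (cases "t = 0")
  case True
  have "AE s in lebesgue_on {0..0::real}. g s = 0" using AE_lebesgue_on_neq[of 0 0 0] AE_space by eventually_elim auto
  then have "(\<integral>s. g s \<partial>(LT 0)) = 0" by (rule integral_eq_zero_AE)
  then show ?thesis using True by simp
next
  case False
  then have t0: "0 < t" "t <= T" using t by auto
  let ?ok = "\<lambda>s. (f has_vector_derivative g s) (at s within {0..T})"
  let ?N = "{s \<in> {0..T}. \<not> ?ok s}"
  have N: "negligible ?N" by (rule AE_lebesgue_on_negligible[OF d])
  have "((\<lambda>s. if s \<in> ?N then 0 else g s) has_integral (f t - f 0)) {0..t}"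
  proof (rule abs_continuous_has_integral[OF t0(1) abs_continuous_on_subset[OF ac] N])
    fix s assume "s \<in> {0..t} - ?N"
    then have "?ok s" using t by auto
    then show "(f has_vector_derivative g s) (at s within {0..t})"
      by (rule has_vector_derivative_within_subset) (use t in auto)
  qed (use t in auto)
  then have "(g has_integral (f t - f 0)) {0..t}" by (rule has_integral_spike[OF N, rotated]) auto
  moreover have "(\<integral>s. g s \<partial>(LT t)) = integral {0..t} g"
    by (rule lebesgue_integral_eq_integral[OF integrable_time_subset[OF t0(2) Linf_integrable[OF g]]]) simp
  ultimately show ?thesis by (simp add: integral_unique)
qed

text \<open>
  With \<open>K\<close> coercive, gain and derivative are bounded and measurable, and the solution is the integral of its derivative.
\<close>

theorem riccati_regular:
  fixes A :: "real => real ^ 'n ^ 'n" and B :: "real => real ^ 'm ^ 'n"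
  assumes L: "A \<in> Linf T UNIV" "B \<in> Linf T UNIV" "A1 \<in> Linf T UNIV" "B1 \<in> Linf T UNIV" "Q \<in> Linf T V" and R: "R \<in> Linf T symmetric_matrices"
    and co: "AE s in LT T. coercive \<delta> (R s)" and \<delta>: "\<delta> > 0"
    and P: "continuous_on {0..T} P" "\<forall>s\<in>{0..T}. P s \<in> symmetric_matrices" "\<forall>t\<in>{0..T}. \<forall>v. 0 <= (P t *v v) \<bullet> v"
    and S: "riccati_Pi T A B A1 B1 Q R G P S"
  obtains D where "D \<in> Linf T UNIV" "riccati_gain A B A1 B1 R P S \<in> Linf T UNIV"
    "\<And>t. t \<in> {0..T} ==> S t = S 0 + (\<integral>s. D s \<partial>(LT t))"
    "AE s in LT T. coercive \<delta> (riccati_K R B1 P s)"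
    "AE s in LT T. riccati_form (A s) (B s) (A1 s) (B1 s) (Q s) (riccati_K R B1 P s) (riccati_gain A B A1 B1 R P S s) (P s) (S s) (D s)"
proof -
  let ?L = "LT T"
  define D where "D s = riccati_drift (A s) (B s) (A1 s) (B1 s) (Q s) (matrix_inv (riccati_K R B1 P s)) (P s) (S s)" for s
  note SD = riccati_Pi_AE[OF S R P(2), folded D_def]
  have ac: "abs_continuous_on 0 T S" using S by (simp add: riccati_Pi_def)
  have K: "AE s in ?L. coercive \<delta> (riccati_K R B1 P s)"
    using co AE_space
  proof eventually_elim
    case (elim s)
    then show ?case using P(3) by (auto simp: coercive_def riccati_K_def matrix_simps intro: order_trans)
  qed
  have UL: "f \<in> Linf T V ==> f \<in> Linf T UNIV" for f :: "real => real ^ 'k ^ 'l" and V by (simp add: Linf_def)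
  have R': "R \<in> Linf T UNIV" and Q': "Q \<in> Linf T UNIV" using R L(5) by (auto simp: Linf_def)
  note I = Linf_add[of _ T UNIV _ UNIV] Linf_diff[of _ T UNIV _ UNIV] Linf_minus[of _ T UNIV] Linf_transpose[of _ T UNIV] Linf_matrix_mult[of _ T UNIV _ UNIV]
  note lS = Linf_continuous[OF abs_continuous_on_imp_continuous_on[OF ac]] and lP = Linf_continuous[OF P(1)]
  have lK: "riccati_K R B1 P \<in> Linf T UNIV" unfolding riccati_K_def[abs_def] by (intro I L lP R')
  note lJ = Linf_matrix_inv[OF \<delta> lK K]
  have D: "D \<in> Linf T UNIV" unfolding D_def[abs_def] riccati_drift_def by (intro I L lP lS lJ Q')
  show thesis
  proof (rule that[OF D _ _ K SD(2)])
    show "riccati_gain A B A1 B1 R P S \<in> Linf T UNIV" by (intro I L lP lS lJ)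
    show "S t = S 0 + (\<integral>s. D s \<partial>(LT t))" if "t \<in> {0..T}" for t
      by (rule abs_continuous_integral[OF ac D SD(1) that])
  qed
qed

section \<open>Quadratic forms along Ito processes\<close>

context brownian
begin

text \<open>
  The mean is itself an Ito process, deterministic and without diffusion, so that the quadratic formula below covers the mean and, after subtraction, the fluctuation.
\<close>

lemma ito_process_mean:
  fixes b \<sigma> :: "real => 'w => 'b::euclidean_space"
  assumes T: "T > 0" and Z: "ito_process T x b \<sigma> Z"
  shows "\<And>t. t \<in> {0..T} ==> (\<E> w. Z t w) = x + (\<integral>s. (\<E> w. b s w) \<partial>(LT t))"
    and "ito_process T x (\<lambda>s w. \<integral>w. b s w \<partial>M) (\<lambda>s w. 0) (\<lambda>s w. \<integral>w. Z s w \<partial>M)"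
proof -
  let ?L = "LT T" and ?m = "\<lambda>s. \<integral>w. Z s w \<partial>M" and ?b = "\<lambda>s. \<integral>w. b s w \<partial>M"
  have b: "b \<in> L2p T" and Zc: "Z \<in> Cp T" using Z by (auto simp: ito_process_def)
  interpret N: finite_measure "NT T" by (rule finite_NT)
  have bi: "integrable ?L ?b" using NT_integrals(1)[OF N.sq_int_imp_integrable[OF L2_adapted_sq_int[OF b]]] by simp
  show m: "?m t = x + (\<integral>s. ?b s \<partial>(LT t))" if t: "t \<in> {0..T}" for t
  proof (rule euclidean_eqI)
    fix c :: 'b
    have bit: "integrable (LT t) ?b" using integrable_time_subset[OF _ bi] t by auto
    have "?m t \<bullet> c = (\<E> w. Z t w \<bullet> c)"
      using sq_int_imp_integrable[OF cont_adapted_sq_int(1)[OF Zc t]] by simp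
    also have "... = x \<bullet> c + (\<integral>s. (\<E> w. b s w \<bullet> c) \<partial>(LT t))"
      by (rule ito_process_mean_real[OF T ito_process_inner[OF T Z] t])
    also have "(\<integral>s. (\<E> w. b s w \<bullet> c) \<partial>(LT t)) = (\<integral>s. ?b s \<bullet> c \<partial>(LT t))"
    proof (rule integral_cong_AE)
      have "AE s in LT t. sq_int M (b s)" using AE_time_subset[OF _ L2_adapted_slices[OF b]] t by auto
      then show "AE s in LT t. (\<E> w. b s w \<bullet> c) = ?b s \<bullet> c"
        by eventually_elim (simp add: sq_int_imp_integrable)
      have "(\<lambda>s. \<integral>w. b s w \<bullet> c \<partial>M) \<in> borel_measurable ?L"
        by (rule mean_measurable[OF sq_int_measurable[OF L2_adapted_sq_int[OF L2_adapted_inner[OF b]]]])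
      then show "(\<lambda>s. \<integral>w. b s w \<bullet> c \<partial>M) \<in> borel_measurable (LT t)"
        using t by (auto simp: restrict_lebesgue_on[of t T] intro: measurable_restrict_space1)
    qed (use bit in auto)
    also have "... = (\<integral>s. ?b s \<partial>(LT t)) \<bullet> c" using bit by simp
    finally show "?m t \<bullet> c = (x + (\<integral>s. ?b s \<partial>(LT t))) \<bullet> c" by (simp add: inner_add_left)
  qed
  have mc: "continuous_on {0..T} ?m"
    by (rule iffD2[OF continuous_on_cong[OF refl m]]) (auto intro!: continuous_intros integral_time_continuous[OF bi])
  have "bounded (?m ` {0..T})" by (intro compact_imp_bounded compact_continuous_image mc) simp
  then obtain K where K: "\<And>s. s \<in> {0..T} ==> norm (?m s) <= K" unfolding bounded_iff by blast
  have "supsq T (\<lambda>s w. ?m s) w <= ennreal (K^2)" for w :: 'w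
    unfolding supsq_def by (rule SUP_least) (use K in \<open>auto intro!: ennreal_leI power_mono\<close>)
  then have "(\<integral>\<^sup>+w. supsq T (\<lambda>s w. ?m s) w \<partial>M) <= (\<integral>\<^sup>+w. ennreal (K^2) \<partial>M)" by (intro nn_integral_mono)
  also have "... < \<infinity>" by (simp add: emeasure_space_1)
  finally have ca: "(\<lambda>s w. ?m s) \<in> Cp T" unfolding cont_adapted_iff using mc by simp
  have z: "(\<lambda>s w. 0 :: 'b) \<in> L2p T" by (rule cont_adapted_L2[OF T cont_adapted_const])
  obtain V :: "real => 'w => 'b" where V: "\<And>t. t \<in> {0..T} ==> has_ito_integral M W t (\<lambda>s w. 0) (V t)"
    by (rule ito_integral_process[OF T z]) blast
  show "ito_process T x (\<lambda>s w. ?b s) (\<lambda>s w. 0) (\<lambda>s w. ?m s)"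
    unfolding ito_process_def
  proof (intro conjI ca mean_process_L2 b z ballI exI)
    fix t assume t: "t \<in> {0..T}"
    show "has_ito_integral M W t (\<lambda>s w. 0) (V t)" by (rule V[OF t])
    have "msq M (V t) = 0" using ito_isometry[OF V[OF t], of t] t by (simp add: cut_def msq_def)
    from msq_eq_0_AE[OF ito_sq_int(2)[OF V[OF t], of t] this] t
    have "AE w in M. V t w = 0" by simp
    then show "AE w in M. ?m t = x + (\<integral>s. ?b s \<partial>(LT t)) + V t w" by eventually_elim (simp add: m[OF t])
  qed
qed

lemma mean_bilinear:
  fixes S :: "real ^ 'n ^ 'n"
  assumes "sq_int M f" "sq_int M g"
  shows "integrable M (\<lambda>w. (S *v f w) \<bullet> g w)"
    and "(\<E> w. (S *v f w) \<bullet> g w) = (\<Sum>i\<in>UNIV. \<Sum>j\<in>UNIV. S $ i $ j * (\<E> w. f w $ j * g w $ i))"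
proof -
  have i: "integrable M (\<lambda>w. f w $ j * g w $ i)" for i j
    using sq_int_inner[OF sq_int_inner_const[OF assms(1), of "axis j 1"] sq_int_inner_const[OF assms(2), of "axis i 1"]] by (simp add: inner_axis)
  have eq: "(S *v f w) \<bullet> g w = (\<Sum>i\<in>UNIV. \<Sum>j\<in>UNIV. S $ i $ j * (f w $ j * g w $ i))" for w
    by (simp add: inner_vec_def matrix_vector_mult_def sum_distrib_right mult.assoc)
  show "integrable M (\<lambda>w. (S *v f w) \<bullet> g w)" unfolding eq by (intro bint_sum_int integrable_mult_right i)
  show "(\<E> w. (S *v f w) \<bullet> g w) = (\<Sum>i\<in>UNIV. \<Sum>j\<in>UNIV. S $ i $ j * (\<E> w. f w $ j * g w $ i))"
    unfolding eq by (simp add: i)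
qed

text \<open>
  The componentwise product rules, combined with integration by parts in time against the entries of \<open>S\<close>.
\<close>

theorem ito_process_quadratic:
  fixes Z b \<sigma> :: "real => 'w => real ^ 'n"
  assumes T: "T > 0" and Z: "ito_process T x b \<sigma> Z" and D: "D \<in> Linf T V"
    and S: "\<And>t. t \<in> {0..T} ==> S t = S 0 + (\<integral>s. D s \<partial>(LT t))"
  defines "I \<equiv> \<lambda>s. (\<E> w. (D s *v Z s w) \<bullet> Z s w) + (\<E> w. (S s *v b s w) \<bullet> Z s w)
      + (\<E> w. (S s *v Z s w) \<bullet> b s w) + (\<E> w. (S s *v \<sigma> s w) \<bullet> \<sigma> s w)"
  shows "integrable (LT T) I"
    and "(\<E> w. (S T *v Z T w) \<bullet> Z T w) = (S 0 *v x) \<bullet> x + (\<integral>s. I s \<partial>(LT T))"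
proof -
  let ?L = "LT T"
  have a: "b \<in> L2p T" "\<sigma> \<in> L2p T" "Z \<in> Cp T" using Z by (auto simp: ito_process_def)
  have sZ: "sq_int M (Z s)" if "s \<in> {0..T}" for s using cont_adapted_sq_int(1)[OF a(3) that] .
  define h where "h i j s = (\<E> w. b s w $ i * Z s w $ j + Z s w $ i * b s w $ j + \<sigma> s w $ i * \<sigma> s w $ j)" for i j s
  define \<phi> where "\<phi> i j t = (\<E> w. Z t w $ i * Z t w $ j)" for i j t
  note C = ito_process_inner[OF T Z, of "axis _ 1", simplified inner_axis]
  have \<phi>: "\<phi> i j t = x $ i * x $ j + (\<integral>s. h i j s \<partial>(LT t))" if "t \<in> {0..T}" for i j t
    unfolding \<phi>_def h_def using ito_process_product(1)[OF T C[of i] C[of j] that] by simp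
  have TT: "T \<in> {0..T}" using T by simp
  have hi: "integrable ?L (h i j)" for i j unfolding h_def[abs_def] using ito_process_product(2)[OF T C[of i] C[of j] TT] by simp
  have Di: "integrable ?L (\<lambda>s. D s $ i $ j)" for i j by (rule Linf_integrable[OF Linf_component[OF D]])
  have Sij: "S t $ i $ j = S 0 $ i $ j + (\<integral>s. D s $ i $ j \<partial>(LT t))" if t: "t \<in> {0..T}" for i j t
  proof -
    have "integrable (LT t) D" by (rule integrable_time_subset[OF _ Linf_integrable[OF D]]) (use t in simp)
    then have "(\<integral>s. D s \<partial>(LT t)) \<bullet> axis i (axis j 1) = (\<integral>s. D s \<bullet> axis i (axis j 1) \<partial>(LT t))" by simp
    then show ?thesis unfolding S[OF t] by (simp add: inner_axis)
  qed
  define f where "f i j s = D s $ i $ j * \<phi> j i s + S s $ i $ j * h j i s" for i j s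
  have fi: "integrable ?L (f i j)" and fe: "S T $ i $ j * \<phi> j i T = S 0 $ i $ j * (x $ j * x $ i) + (\<integral>s. f i j s \<partial>?L)" for i j
  proof -
    note pr = time_product_rule[OF Di[of i j] hi[of j i] less_imp_le[OF T]]
    have i: "integrable ?L (\<lambda>s. D s $ i $ j * (x $ j * x $ i + (\<integral>s. h j i s \<partial>(LT s))) +
        (S 0 $ i $ j + (\<integral>s. D s $ i $ j \<partial>(LT s))) * h j i s)"
      by (rule bint_add_int[OF pr(1,2)])
    have eq: "D s $ i $ j * (x $ j * x $ i + (\<integral>s. h j i s \<partial>(LT s))) +
        (S 0 $ i $ j + (\<integral>s. D s $ i $ j \<partial>(LT s))) * h j i s = f i j s" if "s \<in> space ?L" for s
    proof -
      have s: "s \<in> {0..T}" using that by simp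
      show ?thesis unfolding f_def \<phi>[OF s] Sij[OF s] by simp
    qed
    show "integrable ?L (f i j)" by (rule iffD1[OF Bochner_Integration.integrable_cong[OF refl eq] i])
    have "S T $ i $ j * \<phi> j i T = S 0 $ i $ j * (x $ j * x $ i) + (\<integral>s. D s $ i $ j * (x $ j * x $ i + (\<integral>s. h j i s \<partial>(LT s))) +
        (S 0 $ i $ j + (\<integral>s. D s $ i $ j \<partial>(LT s))) * h j i s \<partial>?L)"
      using pr(3)[of "S 0 $ i $ j" "x $ j * x $ i"] unfolding \<phi>[OF TT] Sij[OF TT] by simp
    also have "(\<integral>s. D s $ i $ j * (x $ j * x $ i + (\<integral>s. h j i s \<partial>(LT s))) +
        (S 0 $ i $ j + (\<integral>s. D s $ i $ j \<partial>(LT s))) * h j i s \<partial>?L) = (\<integral>s. f i j s \<partial>?L)"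
      by (rule bint_cong[OF refl eq])
    finally show "S T $ i $ j * \<phi> j i T = S 0 $ i $ j * (x $ j * x $ i) + (\<integral>s. f i j s \<partial>?L)" .
  qed
  have If: "AE s in ?L. (\<Sum>i\<in>UNIV. \<Sum>j\<in>UNIV. f i j s) = I s"
    using L2_adapted_slices[OF a(1)] L2_adapted_slices[OF a(2)] AE_space[of ?L]
  proof eventually_elim
    case (elim s)
    then have z: "sq_int M (Z s)" using sZ by simp
    have pi: "integrable M (\<lambda>w. p w $ j * q w $ i)" if "sq_int M p" "sq_int M q" for p q :: "'w => real ^ 'n" and i j
      using sq_int_inner[OF sq_int_inner_const[OF that(1), of "axis j 1"] sq_int_inner_const[OF that(2), of "axis i 1"]] by (simp add: inner_axis)
    have "h j i s = (\<E> w. b s w $ j * Z s w $ i) + (\<E> w. Z s w $ j * b s w $ i) + (\<E> w. \<sigma> s w $ j * \<sigma> s w $ i)" for i j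
      unfolding h_def using pi[OF elim(1) z] pi[OF z elim(1)] pi[OF elim(2,2)] by simp
    then show ?case
      unfolding I_def mean_bilinear(2)[OF z z] mean_bilinear(2)[OF elim(1) z] mean_bilinear(2)[OF z elim(1)] mean_bilinear(2)[OF elim(2,2)]
      by (simp add: f_def \<phi>_def sum.distrib[symmetric] algebra_simps)
  qed
  have fi': "integrable ?L (\<lambda>s. \<Sum>i\<in>UNIV. \<Sum>j\<in>UNIV. f i j s)" by (intro bint_sum_int fi)
  have Im: "I \<in> borel_measurable ?L" by (rule lebesgue_on_measurable_AE[OF borel_measurable_integrable[OF fi'] If])
  show "integrable ?L I"
    by (rule integrable_cong_AE_imp[OF fi' Im]) (use If in \<open>auto elim: eventually_mono\<close>)
  have "(\<E> w. (S T *v Z T w) \<bullet> Z T w) = (\<Sum>i\<in>UNIV. \<Sum>j\<in>UNIV. S T $ i $ j * \<phi> j i T)"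
    unfolding \<phi>_def using T by (intro mean_bilinear sZ) auto
  also have "... = (\<Sum>i\<in>UNIV. \<Sum>j\<in>UNIV. S 0 $ i $ j * (x $ j * x $ i)) + (\<integral>s. (\<Sum>i\<in>UNIV. \<Sum>j\<in>UNIV. f i j s) \<partial>?L)"
    unfolding fe by (simp add: sum.distrib fi)
  also have "(\<Sum>i\<in>UNIV. \<Sum>j\<in>UNIV. S 0 $ i $ j * (x $ j * x $ i)) = (S 0 *v x) \<bullet> x"
    by (simp add: inner_vec_def matrix_vector_mult_def sum_distrib_right mult.assoc)
  finally have *: "(\<E> w. (S T *v Z T w) \<bullet> Z T w) = (S 0 *v x) \<bullet> x + (\<integral>s. (\<Sum>i\<in>UNIV. \<Sum>j\<in>UNIV. f i j s) \<partial>?L)" .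
  show "(\<E> w. (S T *v Z T w) \<bullet> Z T w) = (S 0 *v x) \<bullet> x + (\<integral>s. I s \<partial>?L)"
    unfolding * using integral_cong_AE[OF borel_measurable_integrable[OF fi'] Im If] by simp
qed


lemma mean_matrix_vector: "integrable M f ==> (\<E> w. S *v f w) = S *v (\<E> w. f w)"
  and integrable_matrix_vector: "integrable M f ==> integrable M (\<lambda>w. S *v f w)" for S :: "real ^ 'n ^ 'm"
  by (rule integral_bounded_linear[OF matrix_vector_mul_bounded_linear], assumption)
     (rule integrable_bounded_linear[OF matrix_vector_mul_bounded_linear])

lemma sq_int_matrix:
  fixes S :: "real ^ 'n ^ 'm"
  assumes "sq_int M f" shows "sq_int M (\<lambda>w. S *v f w)"
  by (rule sq_int_dominated[OF _ assms]) (auto intro!: measurable_matrix_vector sq_int_measurable[OF assms] AE_I2 norm_matrix_vector_le)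

lemma mean_decomposition:
  fixes S :: "real ^ 'n ^ 'n"
  assumes f: "sq_int M f"
  shows "(\<E> w. (S *v f w) \<bullet> f w) = (\<E> w. (S *v (f w - integral\<^sup>L M f)) \<bullet> (f w - integral\<^sup>L M f))
    + (S *v integral\<^sup>L M f) \<bullet> integral\<^sup>L M f"
proof -
  let ?c = "integral\<^sup>L M f"
  note i = sq_int_imp_integrable[OF f]
  have 1: "integrable M (\<lambda>w. (S *v f w) \<bullet> ?c)" "integrable M (\<lambda>w. (S *v ?c) \<bullet> f w)"
    by (intro integrable_inner_left integrable_inner_right integrable_matrix_vector i)+
  have 2: "(\<E> w. (S *v f w) \<bullet> ?c) = (S *v ?c) \<bullet> ?c" "(\<E> w. (S *v ?c) \<bullet> f w) = (S *v ?c) \<bullet> ?c"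
    by (subst integral_inner_left[OF integrable_matrix_vector[OF i]], simp add: mean_matrix_vector[OF i])
       (simp add: integral_inner_right[OF i])
  have "(\<E> w. (S *v (f w - ?c)) \<bullet> (f w - ?c))
      = (\<E> w. ((S *v f w) \<bullet> f w - (S *v f w) \<bullet> ?c) - ((S *v ?c) \<bullet> f w - (S *v ?c) \<bullet> ?c))"
    by (rule bint_cong) (simp_all add: matrix_vector_mult_diff_distrib inner_diff_left inner_diff_right)
  also have "... = (\<E> w. (S *v f w) \<bullet> f w) - (S *v ?c) \<bullet> ?c"
    using mean_bilinear(1)[OF f f, of S] 1 2 by (simp add: prob_space)
  finally show ?thesis by simp
qed

end

section \<open>The controlled mean-field equation\<close>

definition mf_input :: "'w measure => (real => real ^ 'm ^ 'n) => (real => real ^ 'm ^ 'n) => (real => 'w => real ^ 'm) => real => 'w => real ^ 'n" where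
  "mf_input M B Bh u s w = B s *v u s w + Bh s *v integral\<^sup>L M (u s)"

lemma mf_coeff_lin: "mf_coeff M A Ah B Bh X u = brownian.lin M A Ah (mf_input M B Bh u) X" if "brownian M W"
  using that by (auto simp: mf_coeff_def brownian.lin_def mf_input_def fun_eq_iff)

locale mean_field_lq = brownian M W for M :: "'w measure" and W :: "real => 'w => real" +
  fixes T \<delta> :: real and A Ah A1 A1h :: "real => real ^ 'n ^ 'n" and B Bh B1 B1h :: "real => real ^ 'm ^ 'n"
    and Q Qh :: "real => real ^ 'n ^ 'n" and R Rh :: "real => real ^ 'm ^ 'm" and G Gh :: "real ^ 'n ^ 'n"
    and P Pii :: "real => real ^ 'n ^ 'n"
  assumes T: "T > 0"
    and coeffs: "A \<in> Linf T UNIV" "Ah \<in> Linf T UNIV" "A1 \<in> Linf T UNIV" "A1h \<in> Linf T UNIV"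
      "B \<in> Linf T UNIV" "Bh \<in> Linf T UNIV" "B1 \<in> Linf T UNIV" "B1h \<in> Linf T UNIV"
    and weights: "Q \<in> Linf T symmetric_matrices" "Qh \<in> Linf T symmetric_matrices"
      "R \<in> Linf T symmetric_matrices" "Rh \<in> Linf T symmetric_matrices"
    and \<delta>: "\<delta> > 0"
    and Q_psd: "AE s in LT T. 0 \<preceq> Q s"
    and R_pos: "AE s in LT T. \<delta> *\<^sub>R mat 1 \<preceq> R s" "AE s in LT T. \<delta> *\<^sub>R mat 1 \<preceq> R s + Rh s"
    and G_psd: "0 \<preceq> G"
    and P: "riccati_P T A B A1 B1 Q R G P"
    and Pii: "riccati_Pi T (\<lambda>s. A s + Ah s) (\<lambda>s. B s + Bh s) (\<lambda>s. A1 s + A1h s) (\<lambda>s. B1 s + B1h s)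
           (\<lambda>s. Q s + Qh s) (\<lambda>s. R s + Rh s) (G + Gh) P Pii"
begin

abbreviation "K0 \<equiv> riccati_K R B1 P"
abbreviation "K1 \<equiv> riccati_K (\<lambda>s. R s + Rh s) (\<lambda>s. B1 s + B1h s) P"
abbreviation "\<Theta>0 \<equiv> riccati_gain A B A1 B1 R P P"
abbreviation "\<Theta>1 \<equiv> riccati_gain (\<lambda>s. A s + Ah s) (\<lambda>s. B s + Bh s) (\<lambda>s. A1 s + A1h s) (\<lambda>s. B1 s + B1h s) (\<lambda>s. R s + Rh s) P Pii"
abbreviation "fb \<equiv> mf_feedback M A1 A1h B Bh B1 B1h R Rh P Pii"
abbreviation "sol \<equiv> mf_state_solution M W T A Ah B Bh A1 A1h B1 B1h"

text \<open>
  The excess of the cost rate over the optimal one when the control deviates from the feedback by \<open>d\<close>.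
\<close>

definition gap :: "(real => 'w => real ^ 'm) => real => real" where
  "gap d s = (\<E> w. (K0 s *v (d s w - integral\<^sup>L M (d s))) \<bullet> (d s w - integral\<^sup>L M (d s)))
     + (K1 s *v integral\<^sup>L M (d s)) \<bullet> integral\<^sup>L M (d s)"

lemma P_sym: "\<forall>s\<in>{0..T}. P s \<in> symmetric_matrices" and Pii_sym: "\<forall>s\<in>{0..T}. Pii s \<in> symmetric_matrices"
  and P_end: "P T = G" and Pii_end: "Pii T = G + Gh"
  using P Pii by (simp_all add: riccati_P_def riccati_Pi_def)

lemma R_coercive: "AE s in LT T. coercive \<delta> (R s)" "AE s in LT T. coercive \<delta> (R s + Rh s)"
  using R_pos by (auto elim!: eventually_mono simp: psd_le_def coercive_def matrix_vector_mult_diff_rdistrib inner_diff_left scaleR_matrix_vector_assoc[symmetric] power2_norm_eq_inner)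

lemma R_Rh_sym: "(\<lambda>s. R s + Rh s) \<in> Linf T symmetric_matrices"
proof -
  have "AE s in LT T. R s + Rh s \<in> symmetric_matrices"
    using Linf_D(2)[OF weights(3)] Linf_D(2)[OF weights(4)] by eventually_elim (simp add: symmetric_matrices_def transpose_add)
  then show ?thesis using Linf_add[OF weights(3,4)] by (simp add: Linf_def)
qed

lemma P_psd: "\<forall>t\<in>{0..T}. \<forall>v. 0 <= (P t *v v) \<bullet> v"
  by (intro ballI allI riccati_P_psd[OF T coeffs(1,5,3,7) weights(3) _ R_coercive(1) \<delta> _ P])
     (use Q_psd G_psd in \<open>auto elim!: eventually_mono simp: psd_le_def\<close>)

lemma P_continuous: "continuous_on {0..T} P"
  using P by (auto simp: riccati_P_def intro: abs_continuous_on_imp_continuous_on)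

lemmas regular_P = riccati_regular[OF coeffs(1,5,3,7) weights(1,3) R_coercive(1) \<delta> P_continuous P_sym P_psd riccati_P_Pi[OF P]]
lemmas regular_Pii = riccati_regular[OF Linf_add[OF coeffs(1,2)] Linf_add[OF coeffs(5,6)] Linf_add[OF coeffs(3,4)] Linf_add[OF coeffs(7,8)]
  Linf_add[OF weights(1,2)] R_Rh_sym R_coercive(2) \<delta> P_continuous P_sym P_psd Pii]

lemma gains: "\<Theta>0 \<in> Linf T UNIV" "\<Theta>1 \<in> Linf T UNIV"
  by (rule regular_P, assumption) (rule regular_Pii, assumption)

lemma K_coercive: "AE s in LT T. coercive \<delta> (K0 s)" "AE s in LT T. coercive \<delta> (K1 s)"
  by (rule regular_P, assumption) (rule regular_Pii, assumption)

lemma fb_alt: "fb X s w = - (\<Theta>0 s *v (X s w - integral\<^sup>L M (X s))) - \<Theta>1 s *v integral\<^sup>L M (X s)"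
  by (simp add: mf_feedback_def)

lemma fb_L2: assumes "X \<in> L2p T" shows "fb X \<in> L2p T"
proof -
  have m: "(\<lambda>s w. integral\<^sup>L M (X s)) \<in> L2p T" by (rule mean_process_L2[OF assms])
  have "(\<lambda>s w. (-1) *\<^sub>R (\<Theta>0 s *v (X s w - integral\<^sup>L M (X s))) + (-1) *\<^sub>R (\<Theta>1 s *v integral\<^sup>L M (X s))) \<in> L2p T"
    by (intro L2_adapted_lincomb matrix_process_L2[OF gains(1)] matrix_process_L2[OF gains(2) m] L2_adapted_add m assms)
  then show ?thesis by (simp add: fb_alt[abs_def])
qed

lemma integrable_fb: "sq_int M (X s) ==> integrable M (fb X s)"
  unfolding fb_alt[abs_def] diff_conv_add_uminus
  by (intro sq_int_imp_integrable sq_int_add sq_int_minus sq_int_matrix sq_int_const)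

lemma fb_mean:
  assumes "integrable M (X s)" shows "integral\<^sup>L M (fb X s) = - (\<Theta>1 s *v integral\<^sup>L M (X s))"
proof -
  have "integral\<^sup>L M (fb X s) = (\<E> w. - (\<Theta>0 s *v (X s w - integral\<^sup>L M (X s))) - \<Theta>1 s *v integral\<^sup>L M (X s))"
    by (simp add: fb_alt[abs_def])
  also have "... = - (\<Theta>0 s *v (\<E> w. X s w - integral\<^sup>L M (X s))) - \<Theta>1 s *v integral\<^sup>L M (X s)"
    using assms by (subst mean_matrix_vector[symmetric]) (auto simp: prob_space integrable_matrix_vector)
  finally show ?thesis using assms by (simp add: prob_space)
qed

lemma input_L2: "b \<in> Linf T V ==> bh \<in> Linf T V' ==> u \<in> L2p T ==> mf_input M b bh u \<in> L2p T"
  unfolding mf_input_def[abs_def] by (intro L2_adapted_add matrix_process_L2 mean_process_L2[of u]) 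

lemma sol_iff:
  assumes u: "u \<in> L2p T"
  shows "sol x u X \<longleftrightarrow> ito_process T x (lin A Ah (mf_input M B Bh u) X) (lin A1 A1h (mf_input M B1 B1h u) X) X"
proof -
  have eq: "mf_coeff M a ah b bh X u = lin a ah (mf_input M b bh u) X" for a ah b bh by (rule mf_coeff_lin[OF brownian_axioms])
  show ?thesis
    unfolding mf_state_solution_def ito_process_def eq
    using lin_L2[OF coeffs(1,2) input_L2[OF coeffs(5,6) u]] lin_L2[OF coeffs(3,4) input_L2[OF coeffs(7,8) u]] cont_adapted_L2[OF T] by blast
qed

lemma sol_exists: "u \<in> L2p T ==> \<exists>X. sol x u X"
  by (rule mean_field_exists[OF T coeffs(1-4) input_L2[OF coeffs(5,6)] input_L2[OF coeffs(7,8)]]) (auto simp: sol_iff)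

lemma sol_unique: "u \<in> L2p T ==> sol x u X ==> sol x u X' ==> t \<in> {0..T} ==> AE w in M. X t w = X' t w"
  by (rule mean_field_unique[OF T coeffs(1-4)]) (auto simp: sol_iff)

lemma sol_state: "u \<in> L2p T ==> sol x u (mf_state M W T A Ah B Bh A1 A1h B1 B1h x u)"
  unfolding mf_state_def by (rule someI_ex[OF sol_exists])

abbreviation "closed_a a b s \<equiv> a s - b s ** \<Theta>0 s"
abbreviation "closed_ah ah b bh s \<equiv> ah s + b s ** \<Theta>0 s - (b s + bh s) ** \<Theta>1 s"
abbreviation "closed_loop x X \<equiv> ito_process T x (lin (closed_a A B) (closed_ah Ah B Bh) (\<lambda>s w. 0) X)
  (lin (closed_a A1 B1) (closed_ah A1h B1 B1h) (\<lambda>s w. 0) X) X"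

lemma closed_Linf: "a \<in> Linf T UNIV ==> b \<in> Linf T UNIV ==> closed_a a b \<in> Linf T UNIV"
  "ah \<in> Linf T UNIV ==> b \<in> Linf T UNIV ==> bh \<in> Linf T UNIV ==> closed_ah ah b bh \<in> Linf T UNIV"
  by (intro Linf_add[of _ T UNIV _ UNIV] Linf_diff[of _ T UNIV _ UNIV] Linf_matrix_mult[of _ T UNIV _ UNIV] gains; assumption)+

lemmas closed_coeffs = closed_Linf(1)[OF coeffs(1,5)] closed_Linf(2)[OF coeffs(2,5,6)] closed_Linf(1)[OF coeffs(3,7)] closed_Linf(2)[OF coeffs(4,7,8)]

lemma zero_L2: "(\<lambda>s w. 0 :: real ^ 'n) \<in> L2p T" by (rule cont_adapted_L2[OF T cont_adapted_const])

text \<open>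
  Taking expectations in the feedback gives \<open>E[u] = - \<Theta>1 E[X]\<close>, so that the equation closed by it is again a linear mean-field
equation. It suffices that the control agrees with the feedback almost everywhere, which is what optimality provides.
\<close>

lemma sol_closed_loop:
  assumes X: "X \<in> Cp T" and v: "v \<in> L2p T" "AE s in LT T. AE w in M. v s w = fb X s w"
  shows "sol x v X \<longleftrightarrow> closed_loop x X"
proof -
  note X2 = cont_adapted_L2[OF T X]
  have eq: "AE s in LT T. AE w in M. lin a ah (mf_input M b bh v) X s w = lin (closed_a a b) (closed_ah ah b bh) (\<lambda>s w. 0) X s w" for a ah b bh
    using v(2) L2_adapted_slices[OF v(1)] L2_adapted_slices[OF fb_L2[OF X2]] AE_space[of "LT T"]
  proof eventually_elim
    case (elim s)
    then have s: "s \<in> {0..T}" by simp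
    have "integral\<^sup>L M (v s) = integral\<^sup>L M (fb X s)"
      by (rule integral_cong_AE) (use elim in \<open>auto simp: sq_int_def\<close>)
    also have "... = - (\<Theta>1 s *v integral\<^sup>L M (X s))"
      by (rule fb_mean, rule sq_int_imp_integrable[OF cont_adapted_sq_int(1)[OF X s]])
    finally have m: "integral\<^sup>L M (v s) = - (\<Theta>1 s *v integral\<^sup>L M (X s))" .
    define t0 where "t0 = \<Theta>0 s"
    define t1 where "t1 = \<Theta>1 s"
    show ?case using elim(1)
    proof eventually_elim
      case (elim w)
      then have e: "v s w = - (t0 *v (X s w - integral\<^sup>L M (X s))) - t1 *v integral\<^sup>L M (X s)" by (simp only: fb_alt t0_def t1_def)
      show ?case unfolding lin_def mf_input_def m e t0_def[symmetric] t1_def[symmetric]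
        by (simp add: matrix_vector_mult_minus_right matrix_vector_mul_assoc[symmetric] algebra_simps)
    qed
  qed
  note L = lin_L2[OF coeffs(1,2) input_L2[OF coeffs(5,6) v(1)] X2] lin_L2[OF coeffs(3,4) input_L2[OF coeffs(7,8) v(1)] X2]
    lin_L2[OF closed_coeffs(1,2) zero_L2 X2] lin_L2[OF closed_coeffs(3,4) zero_L2 X2]
  have sym: "AE s in LT T. AE w in M. g s w = f s w" if "AE s in LT T. AE w in M. f s w = g s w" for f g :: "real => 'w => real ^ 'n"
    using that by (auto elim!: eventually_mono)
  show ?thesis unfolding sol_iff[OF v(1)]
    using ito_process_cong[OF T _ L(3,4) eq eq] ito_process_cong[OF T _ L(1,2) sym[OF eq] sym[OF eq]] by blast
qed

lemma closed_loop_exists: "\<exists>X. closed_loop x X"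
  by (rule mean_field_exists[OF T closed_coeffs zero_L2 zero_L2]) blast

lemma closed_loop_unique: "closed_loop x X ==> closed_loop x X' ==> t \<in> {0..T} ==> AE w in M. X t w = X' t w"
  by (rule mean_field_unique[OF T closed_coeffs])


section \<open>Cost identity and optimality\<close>

lemma bilinear_integrable:
  fixes S :: "real => real ^ 'k ^ 'k" and f g :: "real => 'w => real ^ 'k"
  assumes "S \<in> Linf T V" "f \<in> L2p T" "g \<in> L2p T"
  shows "integrable (NT T) (\<lambda>z. (S (fst z) *v f @@ z) \<bullet> g @@ z)"
  by (rule sq_int_inner[OF L2_adapted_sq_int[OF matrix_process_L2[OF assms(1,2)]] L2_adapted_sq_int[OF assms(3)]])

text \<open>
  The product rules for \<open>\<langle>P Z, Z\<rangle>\<close> and \<open>\<langle>\<Pi> m, m\<rangle>\<close> express the terminal cost by time integrals \<open>IP\<close> and \<open>IQ\<close>. Cross terms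
between fluctuation and mean vanish in expectation, except that the diffusion of \<open>Z\<close> contributes the form of \<open>P\<close> at its mean; this
term is moved to the mean part, where the second Riccati equation accounts for it.
\<close>

lemma cost_identity:
  assumes u: "u \<in> L2p T" and X: "sol x u X"
  shows "integrable (LT T) (gap (\<lambda>s w. u s w - fb X s w))"
    and "mf_cost M T Q Qh R Rh G Gh X u = (Pii 0 *v x) \<bullet> x + (\<integral>s. gap (\<lambda>s w. u s w - fb X s w) s \<partial>(LT T))"
proof -
  let ?L = "LT T"
  define b where "b = lin A Ah (mf_input M B Bh u) X"
  define \<sigma> where "\<sigma> = lin A1 A1h (mf_input M B1 B1h u) X"
  define m where "m s = integral\<^sup>L M (X s)" for s
  define v where "v s = integral\<^sup>L M (u s)" for s
  define Z where "Z s w = X s w - m s" for s w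
  define d where "d s w = u s w - fb X s w" for s w
  have IX: "ito_process T x b \<sigma> X" using X unfolding sol_iff[OF u] b_def \<sigma>_def .
  then have Xc: "X \<in> Cp T" by (simp add: ito_process_def)
  note X2 = cont_adapted_L2[OF T Xc]
  note Im = ito_process_mean(2)[OF T IX, folded m_def]
  have IZ: "ito_process T 0 (\<lambda>s w. b s w - integral\<^sup>L M (b s)) \<sigma> Z"
    using ito_process_diff[OF T IX Im] by (simp add: Z_def[abs_def])
  obtain D where D: "D \<in> Linf T UNIV" "\<And>t. t \<in> {0..T} ==> P t = P 0 + (\<integral>s. D s \<partial>(LT t))"
    "AE s in ?L. riccati_form (A s) (B s) (A1 s) (B1 s) (Q s) (K0 s) (\<Theta>0 s) (P s) (P s) (D s)"
    by (rule regular_P) blast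
  obtain E where E: "E \<in> Linf T UNIV" "\<And>t. t \<in> {0..T} ==> Pii t = Pii 0 + (\<integral>s. E s \<partial>(LT t))"
    "AE s in ?L. riccati_form (A s + Ah s) (B s + Bh s) (A1 s + A1h s) (B1 s + B1h s) (Q s + Qh s) (K1 s) (\<Theta>1 s) (P s) (Pii s) (E s)"
    by (rule regular_Pii) blast
  note qZ = ito_process_quadratic[OF T IZ D(1,2)] and qm = ito_process_quadratic[OF T Im E(1,2)]
  define IP where "IP s = (\<E> w. (D s *v Z s w) \<bullet> Z s w) + (\<E> w. (P s *v (b s w - integral\<^sup>L M (b s))) \<bullet> Z s w)
      + (\<E> w. (P s *v Z s w) \<bullet> (b s w - integral\<^sup>L M (b s))) + (\<E> w. (P s *v \<sigma> s w) \<bullet> \<sigma> s w)" for s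
  define IQ where "IQ s = (E s *v m s) \<bullet> m s + (Pii s *v integral\<^sup>L M (b s)) \<bullet> m s + (Pii s *v m s) \<bullet> integral\<^sup>L M (b s)" for s
  have P1: "integrable ?L IP" "(\<E> w. (G *v Z T w) \<bullet> Z T w) = (\<integral>s. IP s \<partial>?L)"
    using qZ by (simp_all add: IP_def[abs_def] P_end)
  have Q1: "integrable ?L IQ" "((G + Gh) *v m T) \<bullet> m T = (Pii 0 *v x) \<bullet> x + (\<integral>s. IQ s \<partial>?L)"
    using qm by (simp_all add: IQ_def[abs_def] Pii_end prob_space)
  define c where "c s w = (Q s *v X s w) \<bullet> X s w + (Qh s *v m s) \<bullet> m s + (R s *v u s w) \<bullet> u s w + (Rh s *v v s) \<bullet> v s" for s w
  have ci: "integrable (NT T) (\<lambda>z. c @@ z)"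
    unfolding c_def m_def v_def
    by (intro bint_add_int bilinear_integrable[OF weights(1) X2 X2] bilinear_integrable[OF weights(3) u u]
        bilinear_integrable[OF weights(2) mean_process_L2[OF X2] mean_process_L2[OF X2]] bilinear_integrable[OF weights(4) mean_process_L2[OF u] mean_process_L2[OF u]])
  have sXT: "sq_int M (X T)" using cont_adapted_sq_int(1)[OF Xc, of T] T by simp
  have J: "mf_cost M T Q Qh R Rh G Gh X u = (\<integral>s. (\<E> w. c s w) \<partial>?L) + (\<E> w. (G *v X T w) \<bullet> X T w) + (Gh *v m T) \<bullet> m T"
  proof -
    have "mf_cost M T Q Qh R Rh G Gh X u = (\<E> w. (\<integral>s. c s w \<partial>?L) + (G *v X T w) \<bullet> X T w + (Gh *v m T) \<bullet> m T)"
      by (simp add: mf_cost_def c_def m_def v_def)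
    also have "... = (\<E> w. (\<integral>s. c s w \<partial>?L)) + (\<E> w. (G *v X T w) \<bullet> X T w) + (Gh *v m T) \<bullet> m T"
      using NT_integrals(2)[OF ci] mean_bilinear(1)[OF sXT sXT, of G] by (simp add: prob_space)
    also have "(\<E> w. (\<integral>s. c s w \<partial>?L)) = (\<integral>s. (\<E> w. c s w) \<partial>?L)"
      using NT_integrals(3,4)[OF ci] by simp
    finally show ?thesis .
  qed
  have Ci: "integrable ?L (\<lambda>s. \<integral>w. c s w \<partial>M)" using NT_integrals(1)[OF ci] by simp
  have key: "AE s in ?L. (\<E> w. c s w) + IP s + IQ s = gap d s"
    using L2_adapted_slices[OF u] D(3) E(3) Linf_D(2)[OF weights(3)] Linf_D(2)[OF R_Rh_sym] AE_space[of ?L]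
  proof eventually_elim
    case (elim s)
    then have s: "s \<in> {0..T}" by simp
    have sX: "sq_int M (X s)" by (rule cont_adapted_sq_int(1)[OF Xc s])
    have su: "sq_int M (u s)" by (rule elim)
    note iX = sq_int_imp_integrable[OF sX] and iu = sq_int_imp_integrable[OF su]
    have Ps: "transpose (P s) = P s" and Pis: "transpose (Pii s) = Pii s" and Rs: "transpose (R s) = R s" and Rhs: "transpose (R s + Rh s) = R s + Rh s"
      using P_sym Pii_sym s elim(4,5) by (auto simp: symmetric_matrices_def)
    define U where "U w = u s w - v s" for w
    let ?z = "Z s"
    have sz: "sq_int M ?z" and sU: "sq_int M U" unfolding Z_def U_def by (intro sq_int_diff sX su sq_int_const)+
    have lmean: "integral\<^sup>L M (lin a ah (mf_input M p ph u) X s) = (a s + ah s) *v m s + (p s + ph s) *v v s" for a ah p ph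
      using iX iu by (simp add: lin_def[abs_def] mf_input_def mean_matrix_vector integrable_matrix_vector prob_space m_def v_def matrix_vector_mult_add_rdistrib)
    have lsq: "sq_int M (lin a ah (mf_input M p ph u) X s)" for a ah p ph
      unfolding lin_def[abs_def] mf_input_def by (intro sq_int_add sq_int_const sq_int_matrix sX su)
    have lcent: "lin a ah (mf_input M p ph u) X s w - ((a s + ah s) *v m s + (p s + ph s) *v v s) = a s *v ?z w + p s *v U w" for a ah p ph w
      by (simp add: lin_def mf_input_def m_def[symmetric] v_def[symmetric] Z_def U_def algebra_simps)
    have dm: "integral\<^sup>L M (d s) = v s + \<Theta>1 s *v m s"
      using fb_mean[where X=X and s=s, OF iX] iX iu integrable_fb[where X=X and s=s, OF sX] by (simp add: d_def[abs_def] v_def m_def)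
    \<comment> \<open>The deviation splits into the arguments of the two squares: its centred part and its mean.\<close>
    have dd: "d s w - integral\<^sup>L M (d s) = U w + \<Theta>0 s *v ?z w" for w
      unfolding dm d_def fb_alt U_def Z_def m_def by simp
    have cs: "(\<E> w. c s w) = (\<E> w. (Q s *v ?z w) \<bullet> ?z w) + ((Q s + Qh s) *v m s) \<bullet> m s + (\<E> w. (R s *v U w) \<bullet> U w) + ((R s + Rh s) *v v s) \<bullet> v s"
      using mean_decomposition[OF sX, of "Q s"] mean_decomposition[OF su, of "R s"] mean_bilinear(1)[OF sX sX, of "Q s"] mean_bilinear(1)[OF su su, of "R s"]
      by (simp add: c_def[abs_def] m_def[symmetric] v_def[symmetric] Z_def U_def prob_space matrix_vector_mult_add_rdistrib inner_add_left)
    let ?y = "v s + \<Theta>1 s *v m s" and ?b = "(A s + Ah s) *v m s + (B s + Bh s) *v v s" and ?\<sigma> = "(A1 s + A1h s) *v m s + (B1 s + B1h s) *v v s"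
    let ?bz = "\<lambda>w. A s *v ?z w + B s *v U w" and ?\<sigma>z = "\<lambda>w. A1 s *v ?z w + B1 s *v U w"
    have sb: "sq_int M ?bz" "sq_int M ?\<sigma>z" by (intro sq_int_add sq_int_matrix sz sU)+
    have bs: "b s w - integral\<^sup>L M (b s) = ?bz w" "integral\<^sup>L M (b s) = ?b" for w unfolding b_def lmean lcent by simp_all
    have \<sigma>s: "(\<E> w. (P s *v \<sigma> s w) \<bullet> \<sigma> s w) = (\<E> w. (P s *v ?\<sigma>z w) \<bullet> ?\<sigma>z w) + (P s *v ?\<sigma>) \<bullet> ?\<sigma>"
      using mean_decomposition[OF lsq, of "P s" A1 A1h B1 B1h] unfolding \<sigma>_def lmean lcent by simp
    have IPs: "IP s = (\<E> w. (D s *v ?z w) \<bullet> ?z w) + 2 * (\<E> w. (P s *v ?z w) \<bullet> ?bz w) + (\<E> w. (P s *v ?\<sigma>z w) \<bullet> ?\<sigma>z w) + (P s *v ?\<sigma>) \<bullet> ?\<sigma>"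
      unfolding IP_def bs(1) \<sigma>s symmetric_inner[OF Ps, of "?bz _"] by simp
    have IQs: "IQ s = (E s *v m s) \<bullet> m s + 2 * ((Pii s *v m s) \<bullet> ?b)"
      unfolding IQ_def bs(2) symmetric_inner[OF Pis, of ?b] by simp
    have "(\<E> w. (Q s *v ?z w) \<bullet> ?z w) + (\<E> w. (R s *v U w) \<bullet> U w) + (\<E> w. (D s *v ?z w) \<bullet> ?z w)
        + 2 * (\<E> w. (P s *v ?z w) \<bullet> ?bz w) + (\<E> w. (P s *v ?\<sigma>z w) \<bullet> ?\<sigma>z w)
      = (\<E> w. (Q s *v ?z w) \<bullet> ?z w + (R s *v U w) \<bullet> U w + (D s *v ?z w) \<bullet> ?z w + 2 * ((P s *v ?z w) \<bullet> ?bz w) + (P s *v ?\<sigma>z w) \<bullet> ?\<sigma>z w)"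
      using mean_bilinear(1)[OF sz sz, of "Q s"] mean_bilinear(1)[OF sU sU, of "R s"] mean_bilinear(1)[OF sz sz, of "D s"]
        mean_bilinear(1)[OF sz sb(1), of "P s"] mean_bilinear(1)[OF sb(2) sb(2), of "P s"] by simp
    also have "... = (\<E> w. (K0 s *v (U w + \<Theta>0 s *v ?z w)) \<bullet> (U w + \<Theta>0 s *v ?z w))"
      unfolding completion_of_squares[OF elim(2) riccati_K_def Ps Ps Rs] ..
    finally have e1: "(\<E> w. (Q s *v ?z w) \<bullet> ?z w) + (\<E> w. (R s *v U w) \<bullet> U w) + (\<E> w. (D s *v ?z w) \<bullet> ?z w)
        + 2 * (\<E> w. (P s *v ?z w) \<bullet> ?bz w) + (\<E> w. (P s *v ?\<sigma>z w) \<bullet> ?\<sigma>z w)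
      = (\<E> w. (K0 s *v (U w + \<Theta>0 s *v ?z w)) \<bullet> (U w + \<Theta>0 s *v ?z w))" .
    have e2: "((Q s + Qh s) *v m s) \<bullet> m s + ((R s + Rh s) *v v s) \<bullet> v s + (E s *v m s) \<bullet> m s + 2 * ((Pii s *v m s) \<bullet> ?b) + (P s *v ?\<sigma>) \<bullet> ?\<sigma> = (K1 s *v ?y) \<bullet> ?y"
      by (rule completion_of_squares[OF elim(3) riccati_K_def Ps Pis Rhs])
    show ?case unfolding cs IPs IQs gap_def dm dd[unfolded dm] using e1 e2 by linarith
  qed
  have sum: "integrable ?L (\<lambda>s. (\<E> w. c s w) + IP s + IQ s)" using Ci P1(1) Q1(1) by simp
  have gm: "gap d \<in> borel_measurable ?L" by (rule lebesgue_on_measurable_AE[OF borel_measurable_integrable[OF sum] key])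
  have gi: "integrable ?L (gap d)"
    by (rule integrable_cong_AE_imp[OF sum gm]) (use key in \<open>auto elim: eventually_mono\<close>)
  then show "integrable ?L (gap (\<lambda>s w. u s w - fb X s w))" by (simp add: d_def[abs_def])
  have "(\<integral>s. gap d s \<partial>?L) = (\<integral>s. (\<E> w. c s w) + IP s + IQ s \<partial>?L)"
    by (rule integral_cong_AE[OF gm borel_measurable_integrable[OF sum]]) (use key in \<open>auto elim: eventually_mono\<close>)
  also have "... = (\<integral>s. (\<E> w. c s w) \<partial>?L) + (\<integral>s. IP s \<partial>?L) + (\<integral>s. IQ s \<partial>?L)" using Ci P1(1) Q1(1) by simp
  finally have "(\<integral>s. gap d s \<partial>?L) = (\<integral>s. (\<E> w. c s w) \<partial>?L) + (\<integral>s. IP s \<partial>?L) + (\<integral>s. IQ s \<partial>?L)" .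
  moreover have "(\<E> w. (G *v X T w) \<bullet> X T w) = (\<E> w. (G *v Z T w) \<bullet> Z T w) + (G *v m T) \<bullet> m T"
    using mean_decomposition[OF sXT, of G] by (simp add: Z_def m_def)
  ultimately show "mf_cost M T Q Qh R Rh G Gh X u = (Pii 0 *v x) \<bullet> x + (\<integral>s. gap (\<lambda>s w. u s w - fb X s w) s \<partial>?L)"
    using J P1(2) Q1(2) by (simp add: d_def[abs_def] matrix_vector_mult_add_rdistrib inner_add_left)
qed

lemma gap_coercive:
  assumes d: "d \<in> L2p T" shows "AE s in LT T. \<delta> * msq M (d s) <= gap d s"
  using L2_adapted_slices[OF d] K_coercive
proof eventually_elim
  case (elim s)
  let ?e = "integral\<^sup>L M (d s)"
  have sw: "sq_int M (\<lambda>w. d s w - ?e)" by (intro sq_int_diff elim sq_int_const)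
  have "msq M (d s) = msq M (\<lambda>w. d s w - ?e) + (norm ?e)^2"
    using mean_decomposition[OF elim(1), of "mat 1"] by (simp add: msq_def power2_norm_eq_inner)
  moreover have "\<delta> * msq M (\<lambda>w. d s w - ?e) <= (\<E> w. (K0 s *v (d s w - ?e)) \<bullet> (d s w - ?e))"
    unfolding msq_def integral_mult_right_zero[symmetric]
    by (intro integral_mono integrable_mult_right sq_int_integrable[OF sw] mean_bilinear(1)[OF sw sw]) (use elim(2) in \<open>simp add: coercive_def\<close>)
  moreover have "\<delta> * (norm ?e)^2 <= (K1 s *v ?e) \<bullet> ?e" using elim(3) by (simp add: coercive_def)
  ultimately show ?case unfolding gap_def by (simp add: distrib_left)
qed

lemma gap_zero: "d s \<in> borel_measurable M ==> AE w in M. d s w = 0 ==> gap d s = 0"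
proof -
  assume d: "d s \<in> borel_measurable M" "AE w in M. d s w = 0"
  then have m: "integral\<^sup>L M (d s) = 0" by (intro integral_eq_zero_AE)
  have "AE w in M. (K0 s *v d s w) \<bullet> d s w = 0" using d(2) by eventually_elim simp
  then have "(\<E> w. (K0 s *v d s w) \<bullet> d s w) = 0" by (rule integral_eq_zero_AE)
  then show "gap d s = 0" by (simp add: gap_def m)
qed

abbreviation controls :: "(real => 'w => real ^ 'm) set" where "controls \<equiv> L2p T"

abbreviation J :: "real ^ 'n => (real => 'w => real ^ 'm) => real" where
  "J x u \<equiv> mf_cost M T Q Qh R Rh G Gh (mf_state M W T A Ah B Bh A1 A1h B1 B1h x u) u"

lemma sol_cont: "sol x u X ==> X \<in> Cp T" by (simp add: mf_state_solution_def)

theorem cost_lower_bound: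
  assumes u: "u \<in> L2p T"
  shows "(Pii 0 *v x) \<bullet> x + \<delta> * msq (NT T) (\<lambda>z. u @@ z - fb (mf_state M W T A Ah B Bh A1 A1h B1 B1h x u) @@ z) <= J x u"
proof -
  let ?X = "mf_state M W T A Ah B Bh A1 A1h B1 B1h x u"
  let ?d = "\<lambda>s w. u s w - fb ?X s w"
  note X = sol_state[OF u, of x]
  have d: "?d \<in> L2p T" by (rule L2_adapted_add(2)[OF u fb_L2[OF cont_adapted_L2[OF T sol_cont[OF X]]]])
  note n = msq_NT[OF L2_adapted_sq_int[OF d], simplified]
  have "\<delta> * msq (NT T) (\<lambda>z. ?d @@ z) = (\<integral>s. \<delta> * msq M (?d s) \<partial>(LT T))" unfolding n(1) by simp
  also have "... <= (\<integral>s. gap ?d s \<partial>(LT T))"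
    by (rule integral_mono_AE) (use n(2) cost_identity(1)[OF u X] gap_coercive[OF d] in auto)
  finally show ?thesis unfolding cost_identity(2)[OF u X] by simp
qed

text \<open>
  The state process of a control is chosen arbitrarily among its versions; the feedback does not see the choice.
\<close>

lemma fb_cong:
  assumes "X \<in> Cp T" "X' \<in> Cp T" "AE w in M. X s w = X' s w" "s \<in> {0..T}"
  shows "AE w in M. fb X s w = fb X' s w"
proof -
  have "integral\<^sup>L M (X s) = integral\<^sup>L M (X' s)"
    by (rule integral_cong_AE) (use assms cont_adaptedD(4) in auto)
  then show ?thesis using assms(3) unfolding fb_alt by (auto elim!: eventually_mono)
qed

theorem feedback_cost:
  assumes X: "sol x (fb X) X" shows "fb X \<in> L2p T" "J x (fb X) = (Pii 0 *v x) \<bullet> x"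
proof -
  let ?u = "fb X" and ?X = "mf_state M W T A Ah B Bh A1 A1h B1 B1h x (fb X)"
  show u: "?u \<in> L2p T" by (rule fb_L2[OF cont_adapted_L2[OF T sol_cont[OF X]]])
  note X' = sol_state[OF u, of x]
  note c = sol_cont[OF X] sol_cont[OF X']
  note u' = fb_L2[OF cont_adapted_L2[OF T c(2)]]
  have "gap (\<lambda>s w. ?u s w - fb ?X s w) s = 0" if s: "s \<in> {0..T}" for s
  proof (rule gap_zero)
    show "(\<lambda>w. ?u s w - fb ?X s w) \<in> borel_measurable M"
      by (rule borel_measurable_diff[OF F_measurable_M[OF L2_adapted_adapted[OF u s]] F_measurable_M[OF L2_adapted_adapted[OF u' s]]])
    have "AE w in M. fb X s w = fb ?X s w" by (rule fb_cong[OF c sol_unique[OF u X X' s] s])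
    then show "AE w in M. ?u s w - fb ?X s w = 0" by eventually_elim (simp only: diff_self)
  qed
  then have "(\<integral>s. gap (\<lambda>s w. ?u s w - fb ?X s w) s \<partial>(LT T)) = 0"
    by (intro integral_eq_zero_AE AE_I2) simp
  then show "J x (fb X) = (Pii 0 *v x) \<bullet> x" using cost_identity(2)[OF u X'] by simp
qed

lemma feedback_exists: "\<exists>X. sol x (fb X) X"
proof -
  obtain X where X: "closed_loop x X" using closed_loop_exists by blast
  then have c: "X \<in> Cp T" by (simp add: ito_process_def)
  have "sol x (fb X) X" unfolding sol_closed_loop[OF c fb_L2[OF cont_adapted_L2[OF T c]] AE_I2[OF AE_I2[OF refl]]] by (rule X)
  then show ?thesis by blast
qed

theorem optimal_unique:
  assumes X: "sol x (fb X) X" and v: "v \<in> L2p T" and opt: "J x v = (Pii 0 *v x) \<bullet> x"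
  shows "AE (s, w) in LT T \<Otimes>\<^sub>M M. v s w = fb X s w"
proof -
  let ?Y = "mf_state M W T A Ah B Bh A1 A1h B1 B1h x v"
  note Y = sol_state[OF v, of x]
  note c = sol_cont[OF X] sol_cont[OF Y]
  note f = fb_L2[OF cont_adapted_L2[OF T c(1)]] fb_L2[OF cont_adapted_L2[OF T c(2)]]
  note mb = L2_adapted_sq_int[THEN sq_int_measurable]
  let ?d = "\<lambda>z. v @@ z - fb ?Y @@ z"
  have d: "sq_int (NT T) ?d" by (rule L2_adapted_sq_int[OF L2_adapted_add(2)[OF v f(2)]])
  have "\<delta> * msq (NT T) ?d <= 0" using cost_lower_bound[OF v, of x] opt by linarith
  then have "msq (NT T) ?d = 0" using \<delta> msq_nonneg[of "NT T" ?d] by (simp add: mult_le_0_iff)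
  from msq_eq_0_AE[OF d this] have "AE z in NT T. v @@ z = fb ?Y @@ z" by eventually_elim simp
  from AE_NT_D(1)[OF mb[OF v] mb[OF f(2)] this]
  have vY: "AE s in LT T. AE w in M. v s w = fb ?Y s w" .
  have "closed_loop x ?Y" using Y sol_closed_loop[OF c(2) v vY] by blast
  moreover have "closed_loop x X" using X sol_closed_loop[OF c(1) f(1) AE_I2[OF AE_I2[OF refl]]] by blast
  ultimately have XY: "AE w in M. ?Y s w = X s w" if "s \<in> {0..T}" for s using closed_loop_unique that by blast
  have "AE s in LT T. AE w in M. v s w = fb X s w"
    using vY AE_space[of "LT T"]
  proof eventually_elim
    case (elim s)
    then have s: "s \<in> {0..T}" by simp
    have "AE w in M. fb ?Y s w = fb X s w" by (rule fb_cong[OF c(2,1) XY[OF s] s])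
    with elim(1) show ?case by eventually_elim (simp only:)
  qed
  from AE_NT_I[OF mb[OF v] mb[OF f(1)] this] show ?thesis by (simp add: case_prod_beta')
qed

theorem value_function: "(INF u\<in>controls. ereal (J x u)) = ereal ((Pii 0 *v x) \<bullet> x)"
proof (rule antisym)
  obtain X where X: "sol x (fb X) X" using feedback_exists by blast
  show "(INF u\<in>controls. ereal (J x u)) <= ereal ((Pii 0 *v x) \<bullet> x)"
    by (rule INF_lower2[OF feedback_cost(1)[OF X]]) (simp add: feedback_cost(2)[OF X])
  show "ereal ((Pii 0 *v x) \<bullet> x) <= (INF u\<in>controls. ereal (J x u))"
  proof (rule INF_greatest)
    fix u assume u: "u \<in> controls"
    have "0 <= \<delta> * msq (NT T) (\<lambda>z. u @@ z - fb (mf_state M W T A Ah B Bh A1 A1h B1 B1h x u) @@ z)"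
      using \<delta> by (simp add: msq_nonneg)
    with cost_lower_bound[OF u, of x] show "ereal ((Pii 0 *v x) \<bullet> x) <= ereal (J x u)" by simp
  qed
qed

end

theorem theorem4p2:
  fixes M :: "'w measure" and W :: "real \<Rightarrow> 'w \<Rightarrow> real" and T \<delta> :: real
    and A Ah A1 A1h :: "real \<Rightarrow> real ^ 'n ^ 'n"
    and B Bh B1 B1h :: "real \<Rightarrow> real ^ 'm ^ 'n"
    and Q Qh :: "real \<Rightarrow> real ^ 'n ^ 'n"
    and R Rh :: "real \<Rightarrow> real ^ 'm ^ 'm"
    and G Gh :: "real ^ 'n ^ 'n"
    and P Pii :: "real \<Rightarrow> real ^ 'n ^ 'n"
  defines "\<U> \<equiv> L2_adapted M W T"
    and "J \<equiv> \<lambda>x u. mf_cost M T Q Qh R Rh G Gh (mf_state M W T A Ah B Bh A1 A1h B1 B1h x u) u"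
    and "fb \<equiv> mf_feedback M A1 A1h B Bh B1 B1h R Rh P Pii"
  assumes "T > 0"
    and "prob_space M" and "complete_measure M" and "brownian_motion M W"
    and "A \<in> Linf T UNIV" "Ah \<in> Linf T UNIV" "A1 \<in> Linf T UNIV" "A1h \<in> Linf T UNIV"
    and "B \<in> Linf T UNIV" "Bh \<in> Linf T UNIV" "B1 \<in> Linf T UNIV" "B1h \<in> Linf T UNIV"
    and "Q \<in> Linf T symmetric_matrices" "Qh \<in> Linf T symmetric_matrices"
    and "R \<in> Linf T symmetric_matrices" "Rh \<in> Linf T symmetric_matrices"
    and "G \<in> symmetric_matrices" "Gh \<in> symmetric_matrices"
    and "\<delta> > 0"
    and "AE s in lebesgue_on {0..T}. 0 \<preceq> Q s"
    and "AE s in lebesgue_on {0..T}. 0 \<preceq> Q s + Qh s"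
    and "AE s in lebesgue_on {0..T}. \<delta> *\<^sub>R mat 1 \<preceq> R s"
    and "AE s in lebesgue_on {0..T}. \<delta> *\<^sub>R mat 1 \<preceq> R s + Rh s"
    and "0 \<preceq> G" and "0 \<preceq> G + Gh"
    and "riccati_P T A B A1 B1 Q R G P"
    and "riccati_Pi T (\<lambda>s. A s + Ah s) (\<lambda>s. B s + Bh s) (\<lambda>s. A1 s + A1h s) (\<lambda>s. B1 s + B1h s)
           (\<lambda>s. Q s + Qh s) (\<lambda>s. R s + Rh s) (G + Gh) P Pii"
  shows "\<forall>x.
     (\<exists>X. mf_state_solution M W T A Ah B Bh A1 A1h B1 B1h x (fb X) X) \<and>
     (\<forall>X. mf_state_solution M W T A Ah B Bh A1 A1h B1 B1h x (fb X) X \<longrightarrow>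
        fb X \<in> \<U> \<and>
        ereal (J x (fb X)) = (INF u\<in>\<U>. ereal (J x u)) \<and>
        (\<forall>v\<in>\<U>. ereal (J x v) = (INF u\<in>\<U>. ereal (J x u)) \<longrightarrow>
           (AE (s, \<omega>) in lebesgue_on {0..T} \<Otimes>\<^sub>M M. v s \<omega> = fb X s \<omega>))) \<and>
     (INF u\<in>\<U>. ereal (J x u)) = ereal ((Pii 0 *v x) \<bullet> x)"
proof -
  interpret mean_field_lq M W T \<delta> A Ah A1 A1h B Bh B1 B1h Q Qh R Rh G Gh P Pii
    using assms(4-) by (simp add: mean_field_lq_def brownian_def brownian_axioms_def mean_field_lq_axioms_def)
  show ?thesis
    unfolding \<U>_def J_def fb_def value_function
    using feedback_exists feedback_cost optimal_unique by simp
qed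

end
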